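(* Consider the target and source linear models, the parameter space $\Theta(\bm s,h)$, the profiled transfer learning (PTL) estimator $\widehat{\bm\beta}_{\mathrm{ptl}}$ with tuning parameter $\lambda_\delta$, and the rate $r_n$ defined in the context. Assume the following. (a) For $k=1,\dots,K$ there exist constants $C_k$ and $C_k'$ such that $\|\widehat{\bm\beta}^{(k)}-\bm\beta^{(k)}\|^2\le C_k s_{\max}\log p/n_k$ with probability at least $1-2\exp(-C_k'\log p)$. (b) $\sum_{k=1}^K s_{\max}\log p/n_k=o(1)$, $s_\delta\log p/n=o(1)$, $K=o(n\wedge p)$, and $h=O(1)$. (c) $X_i$ and $\varepsilon_i$ are sub-Gaussian and there is a constant $C_{\psi_2}>0$ such that $\|X_i\|_{\psi_2}\le C_{\psi_2}$ and $\|\varepsilon_i\|_{\psi_2}\le C_{\psi_2}$. (d) There are absolute constants $0<C_{\min}<C_{\max}<\infty$ such that $C_{\min}\le\lambda_{\min}(\Sigma)\le\lambda_{\max}(\Sigma)\le C_{\max}$ and $C_{\min}\le\lambda_{\min}(B^\top B)\le\lambda_{\max}(B^\top B)\le C_{\max}$. Further assume that $\lambda_\delta\ge C_\lambda r_n$ for some sufficiently large constant $C_\lambda>0$. Then for some constant $C_1>0$, $$\inf_{\theta\in\Theta(\bm s,h)}P\Big(\|\widehat{\bm\beta}_{\mathrm{ptl}}-\bm\beta\|^2\lesssim\sum_{k=1}^K\frac{s_{\max}\log p}{n_k}+\frac{K+\log(p\wedge n)}{n}+\big(s_\delta r_n^2\wedge h r_n\wedge h^2\big)\Big)\ge 1-\exp\{-C_1\log(p\wedge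 n)\}.$$
   Context: Notation: $\|\cdot\|_1,\|\cdot\|$ are the $\ell_1$ and $\ell_2$ norms, $\|\cdot\|_0$ is the number of nonzero entries; $a\wedge b=\min\{a,b\}$; $a\lesssim b$ means $a\le Cb$ for some constant $C>0$; $\lambda_{\min},\lambda_{\max}$ are the smallest and largest eigenvalues of a symmetric matrix. For a real random variable $U$, $\|U\|_{\psi_2}=\inf\{t>0:E\exp(U^2/t^2)\le 2\}$; for a random vector $V$, $\|V\|_{\psi_2}=\sup_{\|u\|=1}\|u^\top V\|_{\psi_2}$. The quantities $p,K,n_k,s_{\max},s_\delta,h$ may vary with $n$, and $o(\cdot),O(\cdot)$ refer to $n\to\infty$. Target model: i.i.d. observations $(X_i,Y_i)$, $i=1,\dots,n$, with $Y_i=X_i^\top\bm\beta+\varepsilon_i$, $X_i\in\mathbb R^p$, $E(X_i)=0$, $\mathrm{cov}(X_i)=\Sigma$, $\varepsilon_i$ independent of $X_i$, $E(\varepsilon_i)=0$, $E(\varepsilon_i^2)=\sigma^2$. Source models, $k=1,\dots,K$: i.i.d. observations $(X_i^{(k)},Y_i^{(k)})$, $i=1,\dots,n_k$, with $Y_i^{(k)}=X_i^{(k)\top}\bm\beta^{(k)}+\varepsilon_i^{(k)}$, $E(X_i^{(k)})=0$, $\mathrm{cov}(X_i^{(k)})=\Sigma_k$, $\varepsilon_i^{(k)}$ independent of $X_i^{(k)}$, $E(\varepsilon_i^{(k)})=0$, $E(\varepsilon_i^{(k)2})=\sigma_k^2$. The source samples are independent of the target sample. The vectors $\bm\beta^{(1)},\dots,\bm\beta^{(K)}\in\mathbb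 R^p$ are linearly independent, and $B=(\bm\beta^{(1)},\dots,\bm\beta^{(K)})\in\mathbb R^{p\times K}$. Parameter space: with $\bm s=(s_{\max},s_\delta)^\top$ and a fixed constant $C_w>0$, $\Theta(\bm s,h)$ is the set of $\theta=(B,\bm\beta)$ such that $\bm\beta=B\bm w+\bm\delta$ for some $\bm w\in\mathbb R^K$, $\bm\delta\in\mathbb R^p$ with $\|\bm\beta^{(k)}\|_0\le s_{\max}$ and $\bm\beta^{(k)\top}\Sigma\bm\delta=0$ for $k=1,\dots,K$, $\|\bm w\|\le C_w$, $\|\bm\delta\|_1\le h$, $\|\bm\delta\|_0\le s_\delta$. PTL estimator: let $\widehat{\bm\beta}^{(k)}$ be an estimator of $\bm\beta^{(k)}$ computed from the data of source $k$ (e.g. LASSO), $\widehat B=(\widehat{\bm\beta}^{(1)},\dots,\widehat{\bm\beta}^{(K)})$ and $\widehat Z_i=\widehat B^\top X_i$. Put $\widehat{\bm w}_{\mathrm{ptl}}=(\sum_{i=1}^n\widehat Z_i\widehat Z_i^\top)^{-1}\sum_{i=1}^n\widehat Z_iY_i$, $\widehat e_i=Y_i-\widehat Z_i^\top\widehat{\bm w}_{\mathrm{ptl}}$, $\widehat{\bm\delta}_{\mathrm{ptl}}\in\arg\min_{\bm\delta\in\mathbb R^p}\{(2n)^{-1}\sum_{i=1}^n(\widehat e_i-X_i^\top\bm\delta)^2+\lambda_\delta\|\bm\delta\|_1\}$, and $\widehat{\bm\beta}_{\mathrm{ptl}}=\widehat B\widehat{\bm w}_{\mathrm{ptl}}+\widehat{\bm\delta}_{\mathrm{ptl}}$.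 Rate: $r_n=\big(\sum_{k=1}^K s_{\max}\log p/n_k\big)^{1/2}+(K/n)^{1/2}+(\log p/n)^{1/2}$.
   Formalization: Added, as the claim fails otherwise: λ_δ is also O(r_n); the C_k are bounded over k; the sum over k of 2exp(-C_k' log p) is eventually at most exp(-c log(p∧n)) for some c>0 (the last two automatic for bounded K). The infimum is over θ in Θ(s,h) satisfying (d). *)

theory Defs
  imports
    "HOL-Probability.Probability"
    "HOL-Library.Landau_Symbols"
    "Jordan_Normal_Form.Char_Poly"
    "Jordan_Normal_Form.Gauss_Jordan_Elimination"
begin

text \<open>
  The dimensions vary with the sample size, so vectors and matrices are those of
  \<^theory>\<open>Jordan_Normal_Form.Matrix\<close>, with explicit carriers. All indices start at \<open>0\<close>.
\<close>

no_notation Finite_Cartesian_Product.vec_nth (infixl "$" 90)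
no_notation inner (infix "\<bullet>" 70)

type_synonym rvec = "real Matrix.vec"
type_synonym rmat = "real Matrix.mat"

text \<open>One observation is a pair of covariate vector and response; a sample is an indexed family of them.\<close>

type_synonym dataset = "nat \<Rightarrow> rvec \<times> real"


section \<open>Norms and eigenvalues\<close>

definition norm_l0 :: "rvec \<Rightarrow> nat" where
  "norm_l0 v = card {j. j < dim_vec v \<and> v $ j \<noteq> 0}"

definition norm_l1 :: "rvec \<Rightarrow> real" where
  "norm_l1 v = (\<Sum>j<dim_vec v. \<bar>v $ j\<bar>)"

definition norm_l2 :: "rvec \<Rightarrow> real" where
  "norm_l2 v = sqrt (v \<bullet> v)"

definition lambda_min :: "rmat \<Rightarrow> real" where
  "lambda_min A = Min {x. eigenvalue A x}"

definition lambda_max :: "rmat \<Rightarrow> real" where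
  "lambda_max A = Max {x. eigenvalue A x}"

text \<open>The zero matrix is a junk value for singular matrices.\<close>

definition mat_inv :: "rmat \<Rightarrow> rmat" where
  "mat_inv A = (case mat_inverse A of Some C \<Rightarrow> C | None \<Rightarrow> 0\<^sub>m (dim_row A) (dim_row A))"

definition lin_indep_cols :: "rmat \<Rightarrow> bool" where
  "lin_indep_cols B \<longleftrightarrow>
    (\<forall>c \<in> carrier_vec (dim_col B). B *\<^sub>v c = 0\<^sub>v (dim_row B) \<longrightarrow> c = 0\<^sub>v (dim_col B))"


section \<open>Random vectors\<close>

definition borel_vec :: "nat \<Rightarrow> rvec measure" where
  "borel_vec p =
    vimage_algebra (carrier_vec p) (\<lambda>v. \<lambda>j\<in>{..<p}. v $ j) (Pi\<^sub>M {..<p} (\<lambda>_. borel))"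

lemma space_borel_vec [simp]: "space (borel_vec p) = carrier_vec p"
  by (simp add: borel_vec_def)

lemma measurable_borel_vec_iff:
  "f \<in> measurable N (borel_vec p) \<longleftrightarrow>
    f \<in> space N \<rightarrow> carrier_vec p \<and> (\<forall>j<p. (\<lambda>x. f x $ j) \<in> borel_measurable N)"
proof
  assume f: "f \<in> measurable N (borel_vec p)"
  have 1: "f \<in> space N \<rightarrow> carrier_vec p"
    using measurable_space[OF f] by auto
  have "(\<lambda>v. \<lambda>j\<in>{..<p}. v $ j) \<in> measurable (borel_vec p) (Pi\<^sub>M {..<p} (\<lambda>_. borel :: real measure))"
    unfolding borel_vec_def by (rule measurable_vimage_algebra1) (auto simp: space_PiM)
  from measurable_compose[OF f this]
  have g: "(\<lambda>x. \<lambda>j\<in>{..<p}. f x $ j) \<in> measurable N (Pi\<^sub>M {..<p} (\<lambda>_. borel :: real measure))" .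
  have "(\<lambda>x. f x $ j) \<in> borel_measurable N" if "j < p" for j
    using measurable_compose[OF g measurable_component_singleton[of j]] that by simp
  with 1 show "f \<in> space N \<rightarrow> carrier_vec p \<and> (\<forall>j<p. (\<lambda>x. f x $ j) \<in> borel_measurable N)"
    by blast
next
  assume "f \<in> space N \<rightarrow> carrier_vec p \<and> (\<forall>j<p. (\<lambda>x. f x $ j) \<in> borel_measurable N)"
  then show "f \<in> measurable N (borel_vec p)"
    unfolding borel_vec_def
    by (intro measurable_vimage_algebra2 measurable_restrict) auto
qed

abbreviation obs_space :: "nat \<Rightarrow> (rvec \<times> real) measure" where
  "obs_space p \<equiv> borel_vec p \<Otimes>\<^sub>M borel"

abbreviation data_space :: "nat \<Rightarrow> nat \<Rightarrow> dataset measure" where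
  "data_space p n \<equiv> Pi\<^sub>M {..<n} (\<lambda>_. obs_space p)"

text \<open>
  \<^const>\<open>prob_space.indep_var\<close> needs both variables to have values in the same type.
\<close>

definition indep_rv ::
    "'a measure \<Rightarrow> 'b measure \<Rightarrow> ('a \<Rightarrow> 'b) \<Rightarrow> 'c measure \<Rightarrow> ('a \<Rightarrow> 'c) \<Rightarrow> bool" where
  "indep_rv M N U L V \<longleftrightarrow>
    U \<in> measurable M N \<and> V \<in> measurable M L \<and>
    prob_space.indep_set M {U -` A \<inter> space M | A. A \<in> sets N} {V -` A \<inter> space M | A. A \<in> sets L}"

definition iid :: "'a measure \<Rightarrow> 'b measure \<Rightarrow> (nat \<Rightarrow> 'a \<Rightarrow> 'b) \<Rightarrow> nat \<Rightarrow> bool" where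
  "iid M N Z n \<longleftrightarrow>
    prob_space.indep_vars M (\<lambda>_. N) Z {..<n} \<and>
    (\<forall>i<n. distr M N (Z i) = distr M N (Z 0))"

definition mean_vec :: "'a measure \<Rightarrow> nat \<Rightarrow> ('a \<Rightarrow> rvec) \<Rightarrow> rvec" where
  "mean_vec M p V = Matrix.vec p (\<lambda>j. \<integral>\<omega>. V \<omega> $ j \<partial>M)"

definition cov_mat :: "'a measure \<Rightarrow> nat \<Rightarrow> ('a \<Rightarrow> rvec) \<Rightarrow> rmat" where
  "cov_mat M p V = Matrix.mat p p (\<lambda>(j, l).
    \<integral>\<omega>. (V \<omega> $ j - mean_vec M p V $ j) * (V \<omega> $ l - mean_vec M p V $ l) \<partial>M)"

text \<open>
  The Orlicz norms take values in \<^typ>\<open>ennreal\<close>, so that they are \<open>\<infinity>\<close> for variables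
  that are not sub-Gaussian.
\<close>

definition psi2_norm :: "'a measure \<Rightarrow> ('a \<Rightarrow> real) \<Rightarrow> ennreal" where
  "psi2_norm M U =
    (INF t \<in> {t. 0 < t \<and> (\<integral>\<^sup>+\<omega>. ennreal (exp ((U \<omega>)\<^sup>2 / t\<^sup>2)) \<partial>M) \<le> 2}. ennreal t)"

definition psi2_norm_vec :: "'a measure \<Rightarrow> nat \<Rightarrow> ('a \<Rightarrow> rvec) \<Rightarrow> ennreal" where
  "psi2_norm_vec M p V =
    (SUP u \<in> {u \<in> carrier_vec p. norm_l2 u = 1}. psi2_norm M (\<lambda>\<omega>. u \<bullet> V \<omega>))"


section \<open>The linear models and the parameter space\<close>

text \<open>
  Design and noise of \<open>n\<close> observations. Their law does not involve the regression
  coefficient \<open>b\<close>, which enters only through the sample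
  \<open>(X\<^sub>i, X\<^sub>i\<^sup>T b + \<epsilon>\<^sub>i)\<close>; for fixed \<open>b\<close>, the pairs \<open>(X\<^sub>i, Y\<^sub>i)\<close> are i.i.d. iff the pairs
  \<open>(X\<^sub>i, \<epsilon>\<^sub>i)\<close> are.
\<close>

definition design_noise ::
    "'a measure \<Rightarrow> nat \<Rightarrow> nat \<Rightarrow> (nat \<Rightarrow> 'a \<Rightarrow> rvec) \<Rightarrow> (nat \<Rightarrow> 'a \<Rightarrow> real) \<Rightarrow> rmat \<Rightarrow> real \<Rightarrow> bool" where
  "design_noise M p n X e S sd \<longleftrightarrow>
    iid M (obs_space p) (\<lambda>i \<omega>. (X i \<omega>, e i \<omega>)) n \<and>
    (\<forall>i<n.
      (\<forall>j<p. integrable M (\<lambda>\<omega>. (X i \<omega> $ j)\<^sup>2)) \<and>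
      mean_vec M p (X i) = 0\<^sub>v p \<and> cov_mat M p (X i) = S \<and>
      indep_rv M (borel_vec p) (X i) borel (e i) \<and>
      integrable M (\<lambda>\<omega>. (e i \<omega>)\<^sup>2) \<and>
      (\<integral>\<omega>. e i \<omega> \<partial>M) = 0 \<and> (\<integral>\<omega>. (e i \<omega>)\<^sup>2 \<partial>M) = sd\<^sup>2)"

definition sample ::
    "nat \<Rightarrow> (nat \<Rightarrow> 'a \<Rightarrow> rvec) \<Rightarrow> (nat \<Rightarrow> 'a \<Rightarrow> real) \<Rightarrow> rvec \<Rightarrow> 'a \<Rightarrow> dataset" where
  "sample n X e b \<omega> = (\<lambda>i\<in>{..<n}. (X i \<omega>, X i \<omega> \<bullet> b + e i \<omega>))"

definition sources_indep_target ::
    "'a measure \<Rightarrow> nat \<Rightarrow> nat \<Rightarrow> (nat \<Rightarrow> nat) \<Rightarrow> nat \<Rightarrow>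
     (nat \<Rightarrow> nat \<Rightarrow> 'a \<Rightarrow> rvec) \<Rightarrow> (nat \<Rightarrow> nat \<Rightarrow> 'a \<Rightarrow> real) \<Rightarrow>
     (nat \<Rightarrow> 'a \<Rightarrow> rvec) \<Rightarrow> (nat \<Rightarrow> 'a \<Rightarrow> real) \<Rightarrow> bool" where
  "sources_indep_target M p K nk n Xs es X e \<longleftrightarrow>
    indep_rv M
      (Pi\<^sub>M (SIGMA k:{..<K}. {..<nk k}) (\<lambda>_. obs_space p))
      (\<lambda>\<omega>. restrict (\<lambda>(k, i). (Xs k i \<omega>, es k i \<omega>)) (SIGMA k:{..<K}. {..<nk k}))
      (data_space p n)
      (\<lambda>\<omega>. restrict (\<lambda>i. (X i \<omega>, e i \<omega>)) {..<n})"

definition Theta ::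
    "nat \<Rightarrow> nat \<Rightarrow> rmat \<Rightarrow> real \<Rightarrow> nat \<Rightarrow> nat \<Rightarrow> real \<Rightarrow> (rmat \<times> rvec) set" where
  "Theta p K S Cw smax sdelta h =
    {(B, b). B \<in> carrier_mat p K \<and> b \<in> carrier_vec p \<and> lin_indep_cols B \<and>
      (\<exists>w \<in> carrier_vec K. \<exists>d \<in> carrier_vec p.
        b = B *\<^sub>v w + d \<and>
        (\<forall>k<K. norm_l0 (col B k) \<le> smax \<and> col B k \<bullet> (S *\<^sub>v d) = 0) \<and>
        norm_l2 w \<le> Cw \<and> norm_l1 d \<le> h \<and> norm_l0 d \<le> sdelta)}"

definition eigen_bounded :: "real \<Rightarrow> real \<Rightarrow> rmat \<Rightarrow> bool" where
  "eigen_bounded Cmin Cmax A \<longleftrightarrow>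
    Cmin \<le> lambda_min A \<and> lambda_min A \<le> lambda_max A \<and> lambda_max A \<le> Cmax"

text \<open>
  \<^const>\<open>Theta\<close> alone does not bound \<open>B\<close>: a bound on the eigenvalues of \<open>B\<^sup>T B\<close>
  restricts the parameter.
\<close>

definition Theta_reg ::
    "nat \<Rightarrow> nat \<Rightarrow> rmat \<Rightarrow> real \<Rightarrow> real \<Rightarrow> real \<Rightarrow> nat \<Rightarrow> nat \<Rightarrow> real \<Rightarrow> (rmat \<times> rvec) set" where
  "Theta_reg p K S Cw Cmin Cmax smax sdelta h =
    {(B, b) \<in> Theta p K S Cw smax sdelta h. eigen_bounded Cmin Cmax (transpose_mat B * B)}"


section \<open>The profiled transfer learning estimator\<close>

definition B_hat ::
    "nat \<Rightarrow> nat \<Rightarrow> (nat \<Rightarrow> dataset \<Rightarrow> rvec) \<Rightarrow> (nat \<Rightarrow> dataset) \<Rightarrow> rmat" where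
  "B_hat p K est Ds = mat_of_cols p (map (\<lambda>k. est k (Ds k)) [0..<K])"

definition Z_hat :: "rmat \<Rightarrow> dataset \<Rightarrow> nat \<Rightarrow> rvec" where
  "Z_hat Bh D i = transpose_mat Bh *\<^sub>v fst (D i)"

definition w_ptl :: "nat \<Rightarrow> nat \<Rightarrow> rmat \<Rightarrow> dataset \<Rightarrow> rvec" where
  "w_ptl n K Bh D =
    mat_inv (Matrix.mat K K (\<lambda>(a, b). \<Sum>i<n. Z_hat Bh D i $ a * Z_hat Bh D i $ b)) *\<^sub>v
    Matrix.vec K (\<lambda>a. \<Sum>i<n. Z_hat Bh D i $ a * snd (D i))"

text \<open>The data \<open>(X\<^sub>i, e\<^sub>i)\<close> of the second stage, with \<open>e\<^sub>i\<close> the residuals of the first.\<close>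

definition resid_data :: "nat \<Rightarrow> nat \<Rightarrow> rmat \<Rightarrow> dataset \<Rightarrow> dataset" where
  "resid_data n K Bh D =
    (\<lambda>i\<in>{..<n}. (fst (D i), snd (D i) - Z_hat Bh D i \<bullet> w_ptl n K Bh D))"

definition lasso_obj :: "nat \<Rightarrow> real \<Rightarrow> dataset \<Rightarrow> rvec \<Rightarrow> real" where
  "lasso_obj n lam D d =
    (\<Sum>i<n. (snd (D i) - fst (D i) \<bullet> d)\<^sup>2) / (2 * real n) + lam * norm_l1 d"

text \<open>A measurable selection of a minimiser, which need not be unique.\<close>

definition is_lasso :: "nat \<Rightarrow> nat \<Rightarrow> real \<Rightarrow> (dataset \<Rightarrow> rvec) \<Rightarrow> bool" where
  "is_lasso p n lam L \<longleftrightarrow>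
    L \<in> measurable (data_space p n) (borel_vec p) \<and>
    (\<forall>D \<in> space (data_space p n).
      is_arg_min (lasso_obj n lam D) (\<lambda>d. d \<in> carrier_vec p) (L D))"

definition beta_ptl ::
    "nat \<Rightarrow> nat \<Rightarrow> (dataset \<Rightarrow> rvec) \<Rightarrow> rmat \<Rightarrow> dataset \<Rightarrow> rvec" where
  "beta_ptl n K L Bh D = Bh *\<^sub>v w_ptl n K Bh D + L (resid_data n K Bh D)"


section \<open>Rates\<close>

definition source_rate :: "nat \<Rightarrow> nat \<Rightarrow> (nat \<Rightarrow> nat) \<Rightarrow> nat \<Rightarrow> real" where
  "source_rate p K nk smax = (\<Sum>k<K. real smax * ln (real p) / real (nk k))"

definition r_rate :: "nat \<Rightarrow> nat \<Rightarrow> nat \<Rightarrow> (nat \<Rightarrow> nat) \<Rightarrow> nat \<Rightarrow> real" where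
  "r_rate p n K nk smax =
    sqrt (source_rate p K nk smax) + sqrt (real K / real n) + sqrt (ln (real p) / real n)"

definition ptl_rate ::
    "nat \<Rightarrow> nat \<Rightarrow> nat \<Rightarrow> (nat \<Rightarrow> nat) \<Rightarrow> nat \<Rightarrow> nat \<Rightarrow> real \<Rightarrow> real" where
  "ptl_rate p n K nk smax sdelta h =
    source_rate p K nk smax + (real K + ln (real (min p n))) / real n +
    min (real sdelta * (r_rate p n K nk smax)\<^sup>2) (min (h * r_rate p n K nk smax) (h\<^sup>2))"

end

theory Submission
  imports Defs
begin

text \<open>
  Write \<open>b = B w + \<delta>\<close>, let \<open>v\<close> be the error of the first (profiled) stage as an estimate of \<open>B w\<close>, and put
  \<open>\<mu> = min p n\<close>. The normal equations of the first stage express the prediction error through the score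
  \<open>\<Sum>\<^sub>i Z\<^sub>i (X\<^sub>i\<^sup>T \<delta> + \<epsilon>\<^sub>i)\<close> of dimension \<open>K\<close>, whose mean is small because \<open>\<Sigma> \<delta>\<close> is orthogonal to the columns
  of \<open>B\<close> and these are well estimated; this gives \<open>\<parallel>v\<parallel>\<^sup>2\<close> of the order of the source rate plus
  \<open>(K + ln \<mu>) / n\<close>. In the second stage the LASSO has noise \<open>\<epsilon>\<^sub>i - X\<^sub>i\<^sup>T v\<close>, whose correlations with the
  covariates are at most of the order of \<open>r\<^sub>n\<close>, and the three bounds in the minimum come from the cone condition, from the
  basic inequality, and from \<open>\<parallel>\<delta>\<parallel>\<^sub>1 \<le> h\<close>.

  Uniformity over vectors is obtained without epsilon-nets. If a quadratic form is nonnegative at all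
  integer points of \<open>\<ell>\<^sub>1\<close> norm at most \<open>m\<close>, then averaging it over a random walk with \<open>m\<close> signed unit steps in
  a prescribed mean direction bounds it below at that direction, up to a multiple of \<open>\<parallel>x\<parallel>\<^sub>1\<^sup>2 / m\<close>. There are
  at most \<open>min ((2 d + 1)\<^sup>m) (2\<^sup>m 3\<^sup>d)\<close> such points, so one lemma yields the restricted eigenvalue condition
  (\<open>d = p\<close>, \<open>m\<close> of order \<open>n / ln p\<close>), the Gram bound and the score bound (\<open>d = K\<close>, \<open>m\<close> of order \<open>K\<close>).
\<close>

section \<open>Quadratic forms on lattice points\<close>

text \<open>All tail bounds are for one fixed vector, but the vectors that matter are random. The
  fitted matrix depends on the sources only, which are independent of the target sample, so
  conditioning freezes it. The first-stage error \<open>v\<close> and the LASSO solution depend on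
  the target sample itself; for them only statements uniform in the vector or Cauchy-Schwarz help.
  The lattice argument loses D / (m - 1) times the squared l1 norm. In dimension \<open>K\<close>
  that norm costs a factor K, repaid by m of order K; in dimension \<open>p\<close> the cone
  condition costs the sparsity of \<delta>, repaid by m of order n / ln p because sparsity times ln
  p / n tends to zero. The ratio ln p / n alone may diverge when the sparsity bound is zero. Hence
  ln p stays inside the thresholds, the noise is compensated inside its exponential moment, and the
  bound by h^2 is obtained without a restricted eigenvalue. The failure probability collects 2 / p
  from the noise coordinates, terms exponential in -n, and the sources. As K \<ge> 1, K = o(min p n)
  makes \<mu> tend to infinity, so numerical factors are absorbed by lowering the exponent.\<close>

definition lattice_pts :: "nat \<Rightarrow> nat \<Rightarrow> (nat \<Rightarrow> real) set" where
  "lattice_pts d m = {z. (\<forall>j. z j \<in> \<int>) \<and> (\<forall>j\<ge>d. z j = 0) \<and> (\<Sum>j<d. \<bar>z j\<bar>) \<le> real m}"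

text \<open>The box alone would give finiteness; the l1 constraint stays in the index set because
  \<open>card_lattice_pts_le_exp\<close> weighs integer points by their l1 norm.\<close>

lemma lattice_pts_subset:
  "lattice_pts d m \<subseteq> (\<lambda>g j. if j < d then real_of_int (g j) else 0) `
     {g \<in> PiE {..<d} (\<lambda>_. {- int m..int m}). (\<Sum>j<d. \<bar>real_of_int (g j)\<bar>) \<le> real m}"
proof
  fix z assume z: "z \<in> lattice_pts d m"
  define g where "g = (\<lambda>j\<in>{..<d}. \<lfloor>z j\<rfloor>)"
  have fl: "real_of_int \<lfloor>z j\<rfloor> = z j" for j
    using z by (auto simp: lattice_pts_def floor_of_int elim!: Ints_cases)
  have zg: "z = (\<lambda>j. if j < d then real_of_int (g j) else 0)"
    using z by (auto simp: g_def fl lattice_pts_def fun_eq_iff)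
  have bd: "\<bar>z j\<bar> \<le> real m" if "j < d" for j
    using z member_le_sum[of j "{..<d}" "\<lambda>j. \<bar>z j\<bar>"] that by (auto simp: lattice_pts_def)
  have "g j \<in> {- int m..int m}" if "j < d" for j
  proof -
    have "\<bar>real_of_int (g j)\<bar> \<le> real m" using bd[OF that] that by (simp add: g_def fl)
    then show ?thesis by auto
  qed
  then have "g \<in> PiE {..<d} (\<lambda>_. {- int m..int m})"
    unfolding g_def by (intro restrict_PiE_iff[THEN iffD2]) (auto simp: g_def)
  moreover have "(\<Sum>j<d. \<bar>real_of_int (g j)\<bar>) \<le> real m"
    using z by (simp add: g_def fl lattice_pts_def)
  ultimately have "g \<in> {g \<in> PiE {..<d} (\<lambda>_. {- int m..int m}). (\<Sum>j<d. \<bar>real_of_int (g j)\<bar>) \<le> real m}"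
    by blast
  with zg show "z \<in> (\<lambda>g j. if j < d then real_of_int (g j) else 0) `
     {g \<in> PiE {..<d} (\<lambda>_. {- int m..int m}). (\<Sum>j<d. \<bar>real_of_int (g j)\<bar>) \<le> real m}"
    by (rule image_eqI)
qed

lemma finite_lattice_pts: "finite (lattice_pts d m)"
proof -
  have "finite (PiE {..<d} (\<lambda>_. {- int m..int m}))" by (intro finite_PiE) simp_all
  then show ?thesis
    by (intro finite_subset[OF lattice_pts_subset] finite_imageI finite_Collect_conjI disjI1) simp
qed

text \<open>Two-sided geometric series: one coordinate carries total weight at most 1 + 2 (1/2 + 1/4
  + ...) = 3, the origin of the factor \<open>3 ^ d\<close> in the count.\<close>

lemma sum_half_powers: "(\<Sum>k\<in>{- int m..int m}. (1/2::real) ^ nat \<bar>k\<bar>) \<le> 3"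
proof -
  have "(\<Sum>k\<in>{- int m..int m}. (1/2::real) ^ nat \<bar>k\<bar>) = 3 - 2 * (1/2) ^ m"
  proof (induction m)
    case (Suc m)
    have "{- int (Suc m)..int (Suc m)} = insert (int (Suc m)) (insert (- int (Suc m)) {- int m..int m})"
      by auto
    then have "(\<Sum>k\<in>{- int (Suc m)..int (Suc m)}. (1/2::real) ^ nat \<bar>k\<bar>)
        = 2 * (1/2) ^ Suc m + (\<Sum>k\<in>{- int m..int m}. (1/2::real) ^ nat \<bar>k\<bar>)"
      by (simp add: nat_add_distrib del: of_nat_Suc)
    then show ?case using Suc by simp
  qed simp
  then show ?thesis by simp
qed

text \<open>Chernoff bound for counting: the weight 2^m times 1/2 to the l1 norm is at least 1 on
  the lattice points, and its total over the box factorises over the coordinates. Suited to a radius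
  of order \<open>d\<close>.\<close>

lemma card_lattice_pts_le_exp: "real (card (lattice_pts d m)) \<le> 2 ^ m * 3 ^ d"
proof -
  let ?P = "PiE {..<d} (\<lambda>_. {- int m..int m})"
  let ?G = "{g \<in> ?P. (\<Sum>j<d. \<bar>real_of_int (g j)\<bar>) \<le> real m}"
  have finP: "finite ?P" by (intro finite_PiE) simp_all
  have "card (lattice_pts d m) \<le> card ?G"
    using finP by (intro surj_card_le[OF _ lattice_pts_subset]) auto
  then have "real (card (lattice_pts d m)) \<le> (\<Sum>g\<in>?G. 1)" by simp
  also have "\<dots> \<le> (\<Sum>g\<in>?G. 2 ^ m * (\<Prod>j<d. (1/2) ^ nat \<bar>g j\<bar>))"
  proof (rule sum_mono)
    fix g assume g: "g \<in> ?G"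
    have "real (\<Sum>j<d. nat \<bar>g j\<bar>) = (\<Sum>j<d. \<bar>real_of_int (g j)\<bar>)" by simp
    also have "\<dots> \<le> real m" using g by simp
    finally have "(\<Sum>j<d. nat \<bar>g j\<bar>) \<le> m" by linarith
    then have "(1/2::real) ^ m \<le> (1/2) ^ (\<Sum>j<d. nat \<bar>g j\<bar>)"
      by (intro power_decreasing) auto
    also have "\<dots> = (\<Prod>j<d. (1/2) ^ nat \<bar>g j\<bar>)" by (simp add: power_sum)
    finally have "2 ^ m * (1/2::real) ^ m \<le> 2 ^ m * (\<Prod>j<d. (1/2) ^ nat \<bar>g j\<bar>)"
      by (intro mult_left_mono) auto
    then show "1 \<le> 2 ^ m * (\<Prod>j<d. (1/2::real) ^ nat \<bar>g j\<bar>)"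
      by (simp add: power_mult_distrib[symmetric])
  qed
  also have "\<dots> \<le> (\<Sum>g\<in>?P. 2 ^ m * (\<Prod>j<d. (1/2) ^ nat \<bar>g j\<bar>))"
    by (rule sum_mono2[OF finP]) (blast, simp add: prod_nonneg)
  also have "\<dots> = 2 ^ m * (\<Prod>j<d. \<Sum>k\<in>{- int m..int m}. (1/2) ^ nat \<bar>k\<bar>)"
    by (simp only: prod_sum_PiE finite_lessThan finite_atLeastAtMost_int sum_distrib_left)
  also have "\<dots> \<le> 2 ^ m * (\<Prod>j<d. 3)"
    by (intro mult_left_mono prod_mono conjI sum_half_powers sum_nonneg) simp_all
  finally show ?thesis by simp
qed

text \<open>A nonzero point loses exactly one unit of l1 norm when a nonzero coordinate moves one
  step toward zero. So radius \<open>Suc m\<close> is reached from radius \<open>m\<close> by one of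
  \<open>2 * d\<close> signed unit steps or by none. Suited to a dimension that may far exceed the
  radius, since the exponent is \<open>m\<close>.\<close>

lemma card_lattice_pts_le_poly: "real (card (lattice_pts d m)) \<le> (2 * real d + 1) ^ m"
proof (induction m)
  case 0
  have "lattice_pts d 0 \<subseteq> {\<lambda>_. 0}"
  proof
    fix z assume z: "z \<in> lattice_pts d 0"
    then have "(\<Sum>j<d. \<bar>z j\<bar>) = 0" by (simp add: lattice_pts_def order_antisym sum_nonneg)
    then have "\<forall>j<d. z j = 0" by (simp add: sum_nonneg_eq_0_iff)
    then show "z \<in> {\<lambda>_. 0}" using z by (auto simp: lattice_pts_def fun_eq_iff) (meson not_less)
  qed
  then have "card (lattice_pts d 0) \<le> card {\<lambda>_::nat. 0::real}" by (intro card_mono) auto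
  then show ?case by simp
next
  case (Suc m)
  let ?N = "lattice_pts d m"
  let ?F = "\<lambda>(z, j, s). z(j := z j + s)"
  have "lattice_pts d (Suc m) \<subseteq> ?N \<union> ?F ` (?N \<times> {..<d} \<times> {1, -1})"
  proof
    fix z assume z: "z \<in> lattice_pts d (Suc m)"
    show "z \<in> ?N \<union> ?F ` (?N \<times> {..<d} \<times> {1, -1})"
    proof (cases "\<exists>j<d. z j \<noteq> 0")
      case False
      then have "z \<in> ?N" using z by (simp add: lattice_pts_def)
      then show ?thesis by simp
    next
      case True
      then obtain j where j: "j < d" "z j \<noteq> 0" by auto
      define y where "y = z(j := z j - sgn (z j))"
      have zj: "z j \<in> \<int>" using z by (simp add: lattice_pts_def)
      then have "1 \<le> \<bar>z j\<bar>" using j by (metis Ints_nonzero_abs_ge1)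
      then have yj: "\<bar>y j\<bar> = \<bar>z j\<bar> - 1" by (auto simp: y_def sgn_if)
      have "(\<Sum>i<d. \<bar>y i\<bar>) = \<bar>y j\<bar> + (\<Sum>i\<in>{..<d}-{j}. \<bar>y i\<bar>)"
        using j by (intro sum.remove) auto
      also have "\<dots> = \<bar>z j\<bar> - 1 + (\<Sum>i\<in>{..<d}-{j}. \<bar>z i\<bar>)"
        using yj by (simp add: y_def)
      also have "\<dots> = (\<Sum>i<d. \<bar>z i\<bar>) - 1"
        using j by (subst sum.remove[of "{..<d}" j "\<lambda>i. \<bar>z i\<bar>"]) auto
      finally have "(\<Sum>i<d. \<bar>y i\<bar>) \<le> real m" using z by (simp add: lattice_pts_def)
      moreover have "y i \<in> \<int>" for i
        using z by (auto simp: y_def lattice_pts_def sgn_if)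
      moreover have "y i = 0" if "i \<ge> d" for i
        using z j that by (auto simp: y_def lattice_pts_def)
      ultimately have "y \<in> ?N" by (simp add: lattice_pts_def)
      moreover have "z = ?F (y, j, sgn (z j))" by (auto simp: y_def)
      moreover have "sgn (z j) \<in> {1, -1}" using j by (auto simp: sgn_if)
      ultimately show ?thesis using j by blast
    qed
  qed
  then have "card (lattice_pts d (Suc m)) \<le> card (?N \<union> ?F ` (?N \<times> {..<d} \<times> {1, -1}))"
    by (intro card_mono) (auto simp: finite_lattice_pts)
  also have "\<dots> \<le> card ?N + card (?F ` (?N \<times> {..<d} \<times> {1, -1::real}))" by (rule card_Un_le)
  also have "\<dots> \<le> card ?N + card (?N \<times> {..<d} \<times> {1, -1::real})"
    by (intro add_left_mono card_image_le) (auto simp: finite_lattice_pts)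
  also have "\<dots> = card ?N * (2 * d + 1)" by (simp add: card_cartesian_product algebra_simps)
  finally have "real (card (lattice_pts d (Suc m))) \<le> real (card ?N * (2 * d + 1))"
    by (simp only: of_nat_le_iff)
  also have "\<dots> = real (card ?N) * (2 * real d + 1)" by (simp add: algebra_simps)
  also have "\<dots> \<le> (2 * real d + 1) ^ m * (2 * real d + 1)"
    by (intro mult_right_mono Suc) auto
  finally show ?case by (simp add: mult.commute)
qed

section \<open>Bilinear forms and their means along walks with signed unit steps\<close>

definition bform :: "nat \<Rightarrow> (nat \<Rightarrow> nat \<Rightarrow> real) \<Rightarrow> (nat \<Rightarrow> real) \<Rightarrow> (nat \<Rightarrow> real) \<Rightarrow> real" where
  "bform d A u v = (\<Sum>j<d. \<Sum>l<d. A j l * u j * v l)"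

lemma bform_add_left: "bform d A (\<lambda>i. u i + s * v i) w = bform d A u w + s * bform d A v w"
  by (simp add: bform_def algebra_simps sum.distrib sum_distrib_left)

lemma bform_add_right: "bform d A w (\<lambda>i. u i + s * v i) = bform d A w u + s * bform d A w v"
  by (simp add: bform_def algebra_simps sum.distrib sum_distrib_left)

lemma bform_sum_left:
  "(\<Sum>i\<in>I. c i * bform d A (u i) w) = bform d A (\<lambda>j. \<Sum>i\<in>I. c i * u i j) w"
proof (induction I rule: infinite_finite_induct)
  case (insert i I)
  then show ?case using bform_add_left[of d A "\<lambda>j. \<Sum>i\<in>I. c i * u i j" "c i" "u i" w]
    by (simp add: add.commute)
qed (auto simp: bform_def)

lemma bform_sum_right:
  "(\<Sum>i\<in>I. c i * bform d A w (u i)) = bform d A w (\<lambda>j. \<Sum>i\<in>I. c i * u i j)"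
proof (induction I rule: infinite_finite_induct)
  case (insert i I)
  then show ?case using bform_add_right[of d A w "\<lambda>j. \<Sum>i\<in>I. c i * u i j" "c i" "u i"]
    by (simp add: add.commute)
qed (auto simp: bform_def)

abbreviation ind_vec :: "nat \<Rightarrow> nat \<Rightarrow> real" where
  "ind_vec j \<equiv> \<lambda>i. if i = j then 1 else 0"

lemma bform_ind: "j < d \<Longrightarrow> bform d A (ind_vec j) (ind_vec j) = A j j"
proof -
  assume j: "j < d"
  have "bform d A (ind_vec j) (ind_vec j) = (\<Sum>i<d. \<Sum>l<d. if l = j then if i = j then A j j else 0 else 0)"
    unfolding bform_def by (intro sum.cong refl) simp
  also have "\<dots> = A j j" using j by simp
  finally show ?thesis .
qed

lemma bform_diag:
  fixes u :: "nat \<Rightarrow> real"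
  shows "(\<Sum>j<d. \<Sum>l<d. (if j = l then c else 0) * u j * u l) = c * (\<Sum>j<d. (u j)\<^sup>2)"
  unfolding sum_distrib_left
proof (rule sum.cong[OF refl])
  fix j assume j: "j \<in> {..<d}"
  have "(\<Sum>l<d. (if j = l then c else 0) * u j * u l) = (\<Sum>l<d. if l = j then c * (u j)\<^sup>2 else 0)"
    by (intro sum.cong refl) (simp add: power2_eq_square)
  also have "\<dots> = c * (u j)\<^sup>2" using j by (subst sum.delta) simp_all
  finally show "(\<Sum>l<d. (if j = l then c else 0) * u j * u l) = c * (u j)\<^sup>2" .
qed

text \<open>
  The left-hand side of the conclusion is the mean of the quadratic form at \<open>y + s\<^sub>1 + \<dots> + s\<^sub>k\<close>
  for independent steps \<open>s\<^sub>i\<close> that equal \<open>\<sigma>\<^sub>j e\<^sub>j\<close> with probability \<open>\<pi>\<^sub>j\<close>.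
\<close>

lemma bform_random_walk_nonneg:
  fixes \<pi> \<sigma> :: "nat \<Rightarrow> real"
  assumes pi: "\<And>j. \<pi> j \<ge> 0" "(\<Sum>j<d. \<pi> j) = 1" and sg: "\<And>j. \<sigma> j \<in> {1, -1}"
  defines "x \<equiv> (\<lambda>i. \<Sum>j<d. (\<pi> j * \<sigma> j) * ind_vec j i)"
  shows "(\<And>z. z \<in> lattice_pts d k \<Longrightarrow> bform d A (\<lambda>i. y i + z i) (\<lambda>i. y i + z i) \<ge> 0) \<Longrightarrow>
    bform d A y y + real k * (bform d A y x + bform d A x y)
      + real k * (real k - 1) * bform d A x x + real k * (\<Sum>j<d. \<pi> j * A j j) \<ge> 0"
proof (induction k arbitrary: y)
  case 0
  from 0[of "\<lambda>_. 0"] show ?case by (simp add: lattice_pts_def)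
next
  case (Suc k)
  let ?f = "bform d A"
  let ?D = "\<Sum>j<d. \<pi> j * A j j"
  \<comment> \<open>The claimed mean after \<open>k\<close> further steps from \<open>y\<close>. The
    induction peels off the first step, so \<open>y\<close> is arbitrary and the hypothesis at
    radius \<open>Suc k\<close> is used at points shifted by one unit vector.\<close>
  define P where "P y = ?f y y + real k * (?f y x + ?f x y)
      + real k * (real k - 1) * ?f x x + real k * ?D" for y
  define y' where "y' j = (\<lambda>i. y i + \<sigma> j * ind_vec j i)" for j
  have P0: "P (y' j) \<ge> 0" if j: "j < d" for j
    unfolding P_def
  proof (rule Suc.IH)
    fix z assume z: "z \<in> lattice_pts d k"
    define z' where "z' = (\<lambda>i. \<sigma> j * ind_vec j i + z i)"
    have "(\<Sum>i<d. \<bar>z' i\<bar>) \<le> (\<Sum>i<d. ind_vec j i + \<bar>z i\<bar>)"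
      using sg[of j] by (intro sum_mono) (auto simp: z'_def)
    also have "\<dots> = 1 + (\<Sum>i<d. \<bar>z i\<bar>)" using j by (simp add: sum.distrib)
    also have "\<dots> \<le> real (Suc k)" using z by (simp add: lattice_pts_def)
    finally have "(\<Sum>i<d. \<bar>z' i\<bar>) \<le> real (Suc k)" .
    moreover have "z' i \<in> \<int>" for i using z sg[of j] by (auto simp: z'_def lattice_pts_def)
    moreover have "z' i = 0" if "i \<ge> d" for i using z j that by (auto simp: z'_def lattice_pts_def)
    ultimately have "z' \<in> lattice_pts d (Suc k)" by (simp add: lattice_pts_def)
    from Suc.prems[OF this] show "0 \<le> ?f (\<lambda>i. y' j i + z i) (\<lambda>i. y' j i + z i)"
      by (simp add: z'_def y'_def add.assoc)
  qed
  have s2: "\<sigma> j * \<sigma> j = 1" for j using sg[of j] by auto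
  have Pj: "P (y' j) = P y + \<sigma> j * (?f y (ind_vec j) + ?f (ind_vec j) y) + A j j
      + real k * \<sigma> j * (?f (ind_vec j) x + ?f x (ind_vec j))" if j: "j < d" for j
  proof -
    have 1: "?f (y' j) (y' j) = ?f y y + \<sigma> j * ?f y (ind_vec j) + \<sigma> j * ?f (ind_vec j) y
        + (\<sigma> j * \<sigma> j) * ?f (ind_vec j) (ind_vec j)"
      unfolding y'_def bform_add_left bform_add_right by (simp add: algebra_simps)
    have 2: "?f (y' j) x = ?f y x + \<sigma> j * ?f (ind_vec j) x" "?f x (y' j) = ?f x y + \<sigma> j * ?f x (ind_vec j)"
      unfolding y'_def bform_add_left bform_add_right by simp_all
    show ?thesis unfolding P_def 1 2 s2 bform_ind[OF j] by (simp add: algebra_simps)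
  qed
  have L: "(\<Sum>j<d. \<pi> j * \<sigma> j * ?f (ind_vec j) w) = ?f x w" for w
    unfolding x_def by (rule bform_sum_left)
  have R: "(\<Sum>j<d. \<pi> j * \<sigma> j * ?f w (ind_vec j)) = ?f w x" for w
    unfolding x_def by (rule bform_sum_right)
  \<comment> \<open>Averaging over the first step turns the signed unit vectors into
    \<open>x\<close> and, as squared signs are one, their own forms into the diagonal mean; the
    coefficient of \<open>?f x x\<close> becomes k (k - 1) + 2 k = (k + 1) k.\<close>
  have "0 \<le> (\<Sum>j<d. \<pi> j * P (y' j))"
    by (intro sum_nonneg mult_nonneg_nonneg pi P0) auto
  also have "\<dots> = (\<Sum>j<d. \<pi> j * P y + (\<pi> j * \<sigma> j * ?f y (ind_vec j) + \<pi> j * \<sigma> j * ?f (ind_vec j) y)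
      + \<pi> j * A j j + real k * (\<pi> j * \<sigma> j * ?f (ind_vec j) x + \<pi> j * \<sigma> j * ?f x (ind_vec j)))"
    by (intro sum.cong refl) (simp add: Pj algebra_simps)
  also have "\<dots> = P y + (?f y x + ?f x y) + ?D + real k * (?f x x + ?f x x)"
    unfolding sum.distrib sum_distrib_left[symmetric] sum_distrib_right[symmetric] L R pi by simp
  also have "\<dots> = ?f y y + real (Suc k) * (?f y x + ?f x y)
      + real (Suc k) * (real (Suc k) - 1) * ?f x x + real (Suc k) * ?D"
    by (simp add: P_def algebra_simps)
  finally show ?case .
qed

lemma bform_scale: "bform d A (\<lambda>i. s * u i) (\<lambda>i. s * u i) = s\<^sup>2 * bform d A u u"
  by (simp add: bform_def sum_distrib_left power2_eq_square algebra_simps)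

text \<open>Scale \<open>x\<close> to l1 norm one; its absolute entries become step probabilities
  and its signs step signs. The walk of \<open>m\<close> steps from the origin has mean m (m - 1)
  f(y, y) plus m times a convex combination of diagonal entries. Dividing by m (m - 1) leaves only
  the diagonal as loss; this is where \<open>m \<ge> 2\<close> and the bound \<open>D\<close>
  enter.\<close>

lemma bform_lattice_transfer:
  assumes m: "m \<ge> 2"
    and pts: "\<And>z. z \<in> lattice_pts d m \<Longrightarrow> bform d A z z \<ge> 0"
    and diag: "\<And>j. j < d \<Longrightarrow> A j j \<le> D"
  shows "bform d A x x \<ge> - D / (real m - 1) * (\<Sum>j<d. \<bar>x j\<bar>)\<^sup>2"
proof -
  define N where "N = (\<Sum>j<d. \<bar>x j\<bar>)"
  have N0: "N \<ge> 0" by (simp add: N_def sum_nonneg)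
  show ?thesis
  proof (cases "N = 0")
    case True
    then have "\<forall>j<d. x j = 0" by (simp add: N_def sum_nonneg_eq_0_iff)
    then have "bform d A x x = 0" by (simp add: bform_def)
    then show ?thesis using True by (simp add: N_def)
  next
    case False
    with N0 have Np: "N > 0" by simp
    define \<pi> where "\<pi> j = \<bar>x j\<bar> / N" for j
    define \<sigma> where "\<sigma> j = (if x j \<ge> 0 then 1 else -1 :: real)" for j
    define y where "y = (\<lambda>i. \<Sum>j<d. (\<pi> j * \<sigma> j) * ind_vec j i)"
    have pi1: "(\<Sum>j<d. \<pi> j) = 1"
      using Np by (simp add: \<pi>_def sum_divide_distrib[symmetric] N_def)
    have "bform d A (\<lambda>_. 0) (\<lambda>_. 0) + real m * (bform d A (\<lambda>_. 0) y + bform d A y (\<lambda>_. 0))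
      + real m * (real m - 1) * bform d A y y + real m * (\<Sum>j<d. \<pi> j * A j j) \<ge> 0"
      unfolding y_def
      by (rule bform_random_walk_nonneg) (use pts pi1 Np in \<open>auto simp: \<pi>_def \<sigma>_def\<close>)
    then have "real m * ((real m - 1) * bform d A y y + (\<Sum>j<d. \<pi> j * A j j)) \<ge> 0"
      by (simp add: bform_def algebra_simps)
    then have "(real m - 1) * bform d A y y + (\<Sum>j<d. \<pi> j * A j j) \<ge> 0"
      using m by (simp add: zero_le_mult_iff)
    moreover have "(\<Sum>j<d. \<pi> j * A j j) \<le> (\<Sum>j<d. \<pi> j * D)"
      using Np by (intro sum_mono mult_left_mono diag) (auto simp: \<pi>_def)
    moreover have "(\<Sum>j<d. \<pi> j * D) = D" by (simp add: sum_distrib_right[symmetric] pi1)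
    ultimately have "(real m - 1) * bform d A y y \<ge> - D" by linarith
    then have fy: "bform d A y y \<ge> - D / (real m - 1)" using m by (simp add: field_simps)
    have "N * y i = x i" if "i < d" for i
    proof -
      have "y i = (\<Sum>j<d. if j = i then \<pi> i * \<sigma> i else 0)"
        unfolding y_def by (intro sum.cong refl) simp
      also have "\<dots> = \<pi> i * \<sigma> i" using that by simp
      finally show ?thesis using Np by (simp add: \<pi>_def \<sigma>_def)
    qed
    then have "bform d A x x = bform d A (\<lambda>i. N * y i) (\<lambda>i. N * y i)"
      by (simp add: bform_def)
    also have "\<dots> = N\<^sup>2 * bform d A y y" by (rule bform_scale)
    also have "\<dots> \<ge> N\<^sup>2 * (- D / (real m - 1))" by (intro mult_left_mono fy) auto
    finally show ?thesis by (simp add: N_def mult.commute)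
  qed
qed

text \<open>The transfer is applied to the Gram matrix minus \<open>c\<close> times the identity;
  \<open>c \<ge> 0\<close> keeps the diagonal below that of the Gram matrix.\<close>

lemma gram_lower_bound:
  assumes m: "m \<ge> 2" and n: "n > 0" and c: "c \<ge> 0"
    and pts: "\<And>z. z \<in> lattice_pts d m \<Longrightarrow>
      c * (\<Sum>j<d. (z j)\<^sup>2) \<le> (\<Sum>i<n. (\<Sum>j<d. z j * Z i j)\<^sup>2) / real n"
    and diag: "\<And>j. j < d \<Longrightarrow> (\<Sum>i<n. (Z i j)\<^sup>2) / real n \<le> D"
  shows "(\<Sum>i<n. (\<Sum>j<d. x j * Z i j)\<^sup>2) / real n
    \<ge> c * (\<Sum>j<d. (x j)\<^sup>2) - D / (real m - 1) * (\<Sum>j<d. \<bar>x j\<bar>)\<^sup>2"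
proof -
  define A where "A j l = (\<Sum>i<n. Z i j * Z i l) / real n - (if j = l then c else 0)" for j l
  have f: "bform d A u u = (\<Sum>i<n. (\<Sum>j<d. u j * Z i j)\<^sup>2) / real n - c * (\<Sum>j<d. (u j)\<^sup>2)" for u
  proof -
    have "(\<Sum>j<d. \<Sum>l<d. (\<Sum>i<n. Z i j * Z i l) * u j * u l)
        = (\<Sum>i<n. (\<Sum>j<d. u j * Z i j)\<^sup>2)"
    proof -
      have "(\<Sum>j<d. \<Sum>l<d. (\<Sum>i<n. Z i j * Z i l) * u j * u l)
        = (\<Sum>j<d. \<Sum>l<d. \<Sum>i<n. (u j * Z i j) * (u l * Z i l))"
        by (simp add: sum_distrib_left sum_distrib_right algebra_simps)
      also have "\<dots> = (\<Sum>j<d. \<Sum>i<n. \<Sum>l<d. (u j * Z i j) * (u l * Z i l))"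
        by (intro sum.cong refl sum.swap)
      also have "\<dots> = (\<Sum>i<n. \<Sum>j<d. \<Sum>l<d. (u j * Z i j) * (u l * Z i l))"
        by (rule sum.swap)
      also have "\<dots> = (\<Sum>i<n. (\<Sum>j<d. u j * Z i j)\<^sup>2)"
        by (simp add: power2_eq_square sum_product)
      finally show ?thesis .
    qed
    moreover have "(\<Sum>j<d. \<Sum>l<d. (if j = l then c else 0) * u j * u l) = c * (\<Sum>j<d. (u j)\<^sup>2)"
      by (rule bform_diag)
    ultimately show ?thesis
      by (simp add: bform_def A_def left_diff_distrib sum_subtractf sum_divide_distrib[symmetric])
  qed
  have "bform d A x x \<ge> - D / (real m - 1) * (\<Sum>j<d. \<bar>x j\<bar>)\<^sup>2"
  proof (rule bform_lattice_transfer[OF m])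
    show "bform d A z z \<ge> 0" if "z \<in> lattice_pts d m" for z using pts[OF that] by (simp add: f)
    show "A j j \<le> D" if "j < d" for j using diag[OF that] c by (simp add: A_def power2_eq_square)
  qed
  then show ?thesis by (simp add: f)
qed

lemma sum_abs_sq_le:
  fixes x :: "nat \<Rightarrow> real"
  shows "(\<Sum>j<d. \<bar>x j\<bar>)\<^sup>2 \<le> real d * (\<Sum>j<d. (x j)\<^sup>2)"
  using Cauchy_Schwarz_ineq_sum[of "\<lambda>_. 1" "\<lambda>j. \<bar>x j\<bar>" "{..<d}"] by simp

text \<open>Turns finitely many directional bounds into a bound on a Euclidean norm: the transfer is
  applied to t I - T T^T and evaluated at T itself. With radius \<open>d + 1\<close> the loss is t /
  d times the squared l1 norm of T, by Cauchy-Schwarz at most t times the squared norm S, so S^2 is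
  at most 2 t S.\<close>

lemma dual_lattice_bound:
  fixes T :: "nat \<Rightarrow> real"
  assumes d: "d \<ge> 1"
    and pts: "\<And>z. z \<in> lattice_pts d (d + 1) \<Longrightarrow> (\<Sum>j<d. z j * T j)\<^sup>2 \<le> t * (\<Sum>j<d. (z j)\<^sup>2)"
    and t: "t \<ge> 0"
  shows "(\<Sum>j<d. (T j)\<^sup>2) \<le> 2 * t"
proof -
  define A where "A j l = (if j = l then t else 0) - T j * T l" for j l
  have f: "bform d A u u = t * (\<Sum>j<d. (u j)\<^sup>2) - (\<Sum>j<d. u j * T j)\<^sup>2" for u
  proof -
    have "(\<Sum>j<d. \<Sum>l<d. T j * T l * u j * u l) = (\<Sum>j<d. u j * T j)\<^sup>2"
      by (simp add: power2_eq_square sum_product algebra_simps)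
    moreover have "(\<Sum>j<d. \<Sum>l<d. (if j = l then t else 0) * u j * u l) = t * (\<Sum>j<d. (u j)\<^sup>2)"
      by (rule bform_diag)
    ultimately show ?thesis
      by (simp add: bform_def A_def left_diff_distrib sum_subtractf)
  qed
  define S where "S = (\<Sum>j<d. (T j)\<^sup>2)"
  have S0: "S \<ge> 0" by (simp add: S_def sum_nonneg)
  have "bform d A T T \<ge> - t / (real (d + 1) - 1) * (\<Sum>j<d. \<bar>T j\<bar>)\<^sup>2"
  proof (rule bform_lattice_transfer)
    show "2 \<le> d + 1" using d by simp
    show "bform d A z z \<ge> 0" if "z \<in> lattice_pts d (d + 1)" for z using pts[OF that] by (simp add: f)
    show "A j j \<le> t" for j by (simp add: A_def)
  qed
  moreover have "bform d A T T = t * S - S\<^sup>2" by (simp add: f S_def power2_eq_square)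
  moreover have "t / real d * (\<Sum>j<d. \<bar>T j\<bar>)\<^sup>2 \<le> t / real d * (real d * S)"
    unfolding S_def using t by (intro mult_left_mono sum_abs_sq_le) auto
  ultimately have "S\<^sup>2 \<le> 2 * t * S" using d by simp
  then have "S \<le> 2 * t \<or> S = 0" using S0 by (auto simp: power2_eq_square)
  then show ?thesis using t by (auto simp: S_def)
qed

section \<open>Eigenvalues of symmetric matrices\<close>

lemma scalar_prod_lessThan: "v \<in> carrier_vec d \<Longrightarrow> u \<bullet> v = (\<Sum>j<d. u $ j * (v $ j :: real))"
  by (simp add: scalar_prod_def lessThan_atLeast0)

lemma quad_form_eq_bform:
  assumes "A \<in> carrier_mat d d" "u \<in> carrier_vec d" "v \<in> carrier_vec d"
  shows "u \<bullet> (A *\<^sub>v v) = bform d (\<lambda>j l. A $$ (j, l)) (\<lambda>j. u $ j) (\<lambda>j. v $ j)"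
  using assms
  by (auto simp: scalar_prod_lessThan[of _ d] bform_def sum_distrib_left algebra_simps
      intro!: sum.cong)

text \<open>The dimension is a term, so the sphere is modelled among functions that vanish from
  \<open>d\<close> on. In the product topology it is a closed subset of a product of compact sets,
  hence compact by Tychonoff.\<close>

lemma compact_fun_sphere:
  "compact {x :: nat \<Rightarrow> real. (\<forall>i\<ge>d. x i = 0) \<and> (\<Sum>i<d. (x i)\<^sup>2) = 1}"
proof -
  let ?S = "\<lambda>i. if i < d then {-1..1::real} else {0}"
  have "compactin (product_topology (\<lambda>_. euclidean) UNIV) (PiE UNIV ?S)"
    by (subst compactin_PiE) (simp add: compactin_euclidean_iff)
  then have comp: "compact (PiE UNIV ?S)"
    by (simp only: euclidean_product_topology compactin_euclidean_iff)
  have cl: "closed {x :: nat \<Rightarrow> real. (\<Sum>i<d. (x i)\<^sup>2) = 1}"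
    by (intro closed_Collect_eq continuous_intros continuous_on_product_coordinates)
  have "{x :: nat \<Rightarrow> real. (\<forall>i\<ge>d. x i = 0) \<and> (\<Sum>i<d. (x i)\<^sup>2) = 1}
     = PiE UNIV ?S \<inter> {x. (\<Sum>i<d. (x i)\<^sup>2) = 1}"
  proof (rule Set.set_eqI, rule iffI)
    fix x :: "nat \<Rightarrow> real"
    assume x: "x \<in> {x. (\<forall>i\<ge>d. x i = 0) \<and> (\<Sum>i<d. (x i)\<^sup>2) = 1}"
    have "\<bar>x i\<bar> \<le> 1" if "i < d" for i
    proof -
      have "(x i)\<^sup>2 \<le> 1"
        using member_le_sum[of i "{..<d}" "\<lambda>i. (x i)\<^sup>2"] x that by auto
      then show ?thesis by (simp add: abs_square_le_1)
    qed
    then show "x \<in> PiE UNIV ?S \<inter> {x. (\<Sum>i<d. (x i)\<^sup>2) = 1}"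
      using x by (auto simp: abs_le_iff)
  next
    fix x :: "nat \<Rightarrow> real"
    assume x: "x \<in> PiE UNIV ?S \<inter> {x. (\<Sum>i<d. (x i)\<^sup>2) = 1}"
    then have "x i \<in> ?S i" for i by (rule PiE_mem[OF IntD1 UNIV_I])
    then have "x i = 0" if "i \<ge> d" for i
      using that by (metis leD singletonD)
    with x show "x \<in> {x. (\<forall>i\<ge>d. x i = 0) \<and> (\<Sum>i<d. (x i)\<^sup>2) = 1}" by simp
  qed
  then show ?thesis using compact_Int_closed[OF comp cl] by simp
qed

lemma bform_minus_diag:
  "bform d (\<lambda>j l. A j l - (if j = l then c else 0)) u u = bform d A u u - c * (\<Sum>j<d. (u j)\<^sup>2)"
  by (simp add: bform_def left_diff_distrib sum_subtractf bform_diag)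

text \<open>Links the set of eigenvalues, on which \<open>lambda_min\<close> is based, to quadratic
  forms. The form attains its minimum \<mu> on the sphere at some \<open>x\<close>; A - \<mu> I is
  then positive semidefinite and its form vanishes at \<open>x\<close>, which forces
  \<open>x\<close> into its kernel.\<close>

lemma rayleigh_min:
  assumes A: "A \<in> carrier_mat d d" and d: "d \<ge> 1"
    and sym: "\<And>i j. i < d \<Longrightarrow> j < d \<Longrightarrow> A $$ (i, j) = A $$ (j, i)"
  shows "\<exists>\<mu>::real. eigenvalue A \<mu> \<and> (\<forall>v\<in>carrier_vec d. \<mu> * (v \<bullet> v) \<le> v \<bullet> (A *\<^sub>v v))"
proof -
  let ?f = "bform d (\<lambda>j l. A $$ (j, l))"
  let ?S = "{x :: nat \<Rightarrow> real. (\<forall>i\<ge>d. x i = 0) \<and> (\<Sum>i<d. (x i)\<^sup>2) = 1}"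
  have "(\<Sum>i<d. (ind_vec 0 i)\<^sup>2) = (1::real)"
  proof -
    have "(\<Sum>i<d. (ind_vec 0 i)\<^sup>2) = (\<Sum>i<d. if i = 0 then 1 else 0 :: real)"
      by (intro sum.cong) auto
    then show ?thesis using d by simp
  qed
  moreover have "\<forall>i\<ge>d. ind_vec 0 i = (0::real)" using d by simp
  ultimately have mem: "ind_vec 0 \<in> ?S" by (simp only: mem_Collect_eq simp_thms)
  have ne: "?S \<noteq> {}" using equals0D[of ?S "ind_vec 0"] mem by (rule contrapos_pn[rotated])
  have "continuous_on ?S (\<lambda>x. ?f x x)"
    unfolding bform_def
    by (intro continuous_intros continuous_on_subset[OF continuous_on_product_coordinates]) auto
  from continuous_attains_inf[OF compact_fun_sphere ne this]
  obtain x where x: "x \<in> ?S" and xmin: "\<And>y. y \<in> ?S \<Longrightarrow> ?f x x \<le> ?f y y" by blast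
  define \<mu> where "\<mu> = ?f x x"
  define a where "a j l = A $$ (j, l) - (if j = l then \<mu> else 0)" for j l
  let ?g = "bform d a"
  have g: "?g u u = ?f u u - \<mu> * (\<Sum>j<d. (u j)\<^sup>2)" for u
    unfolding a_def by (rule bform_minus_diag)
  have g0: "?g u u \<ge> 0" for u
  proof (cases "(\<Sum>j<d. (u j)\<^sup>2) = 0")
    case True
    then have "\<forall>j<d. u j = 0" by (simp add: sum_nonneg_eq_0_iff)
    then show ?thesis by (simp add: bform_def)
  next
    case False
    define N where "N = (\<Sum>j<d. (u j)\<^sup>2)"
    have N: "N > 0" using False by (simp add: N_def less_le sum_nonneg)
    define y where "y i = (if i < d then u i / sqrt N else 0)" for i
    have "(\<Sum>i<d. (y i)\<^sup>2) = (\<Sum>i<d. (u i)\<^sup>2 / N)"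
      using N by (intro sum.cong) (auto simp: y_def power_divide)
    also have "\<dots> = 1" using N by (simp add: sum_divide_distrib[symmetric] N_def)
    finally have "y \<in> ?S" by (simp add: y_def)
    then have le: "\<mu> \<le> ?f y y" unfolding \<mu>_def by (rule xmin)
    have "?f u u = ?f (\<lambda>i. sqrt N * y i) (\<lambda>i. sqrt N * y i)"
      using N by (simp add: bform_def y_def)
    also have "\<dots> = N * ?f y y" using N by (simp add: bform_scale)
    finally have "\<mu> * N \<le> ?f u u" using le N by (simp add: mult.commute)
    then show ?thesis by (simp add: g N_def)
  qed
  have gx: "?g x x = 0" using x by (simp add: g \<mu>_def)
  have asym: "a i j = a j i" if "i < d" "j < d" for i j using sym[OF that] by (simp add: a_def)
  have comm: "?g u w = ?g w u" for u w
    unfolding bform_def by (subst sum.swap) (intro sum.cong refl, simp add: asym mult_ac)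
  have orth: "?g x y = 0" for y
  proof (rule ccontr)
    assume h: "?g x y \<noteq> 0"
    \<comment> \<open>The perturbation of \<open>x\<close> along \<open>y\<close> by this amount
      would make the form negative; the added 1 keeps the denominator positive when
      \<open>?g y y = 0\<close>.\<close>
    define s where "s = - ?g x y / (?g y y + 1)"
    have pos: "?g y y + 1 > 0" using g0[of y] by simp
    have "0 \<le> ?g (\<lambda>i. x i + s * y i) (\<lambda>i. x i + s * y i)" by (rule g0)
    also have "\<dots> = 2 * s * ?g x y + s\<^sup>2 * ?g y y"
      unfolding bform_add_left bform_add_right comm[of y x] gx by (simp add: power2_eq_square algebra_simps)
    also have "\<dots> = s * (2 * ?g x y + s * ?g y y)" by (simp add: power2_eq_square algebra_simps)
    also have "s * ?g y y = - ?g x y - s"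
      using pos by (simp add: s_def field_simps)
    also have "s * (2 * ?g x y + (- ?g x y - s)) = s * ?g x y - s\<^sup>2"
      by (simp add: power2_eq_square algebra_simps)
    finally have "s\<^sup>2 \<le> s * ?g x y" by simp
    moreover have "s * ?g x y = - (?g x y)\<^sup>2 / (?g y y + 1)" by (simp add: s_def power2_eq_square)
    moreover have "(?g x y)\<^sup>2 / (?g y y + 1) > 0" using h pos by simp
    moreover have "s\<^sup>2 \<ge> 0" by simp
    ultimately show False by simp
  qed
  define v where "v = Matrix.vec d x"
  have v: "v \<in> carrier_vec d" by (simp add: v_def)
  have "A *\<^sub>v v = \<mu> \<cdot>\<^sub>v v"
  proof (rule eq_vecI)
    fix i assume "i < dim_vec (\<mu> \<cdot>\<^sub>v v)"
    then have i: "i < d" by (simp add: v_def)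
    \<comment> \<open>Orthogonality tested on a unit vector reads off coordinate \<open>i\<close> of
      (A - \<mu> I) x.\<close>
    have "0 = ?g (ind_vec i) x" using orth[of "ind_vec i"] by (simp add: comm)
    also have "\<dots> = (\<Sum>j<d. if j = i then (\<Sum>l<d. a i l * x l) else 0)"
      unfolding bform_def by (intro sum.cong refl) simp
    also have "\<dots> = (\<Sum>l<d. a i l * x l)" using i by simp
    also have "\<dots> = (\<Sum>l<d. A $$ (i, l) * x l) - (\<Sum>l<d. if l = i then \<mu> * x i else 0)"
      unfolding sum_subtractf[symmetric] by (intro sum.cong refl) (simp add: a_def left_diff_distrib)
    also have "(\<Sum>l<d. if l = i then \<mu> * x i else 0) = \<mu> * x i" using i by simp
    finally have "(\<Sum>l<d. A $$ (i, l) * x l) = \<mu> * x i" by simp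
    then show "(A *\<^sub>v v) $ i = (\<mu> \<cdot>\<^sub>v v) $ i"
      using A i by (simp add: v_def scalar_prod_lessThan[of _ d])
  qed (use A in \<open>simp add: v_def\<close>)
  moreover have "v \<noteq> 0\<^sub>v d"
  proof
    assume "v = 0\<^sub>v d"
    then have "x i = 0" if "i < d" for i using that by (metis v_def index_vec index_zero_vec(1))
    then show False using x by simp
  qed
  ultimately have "eigenvalue A \<mu>"
    using A v unfolding eigenvalue_def eigenvector_def by auto
  moreover have "\<mu> * (w \<bullet> w) \<le> w \<bullet> (A *\<^sub>v w)" if w: "w \<in> carrier_vec d" for w
    using g0[of "\<lambda>j. w $ j"] unfolding g quad_form_eq_bform[OF A w w]
    by (simp add: scalar_prod_lessThan[OF w] power2_eq_square)
  ultimately show ?thesis by blast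
qed

lemma finite_eigenvalues:
  assumes "(A :: rmat) \<in> carrier_mat d d"
  shows "finite {x. eigenvalue A x}"
proof -
  have "char_poly A \<noteq> 0" using degree_monic_char_poly[OF assms] by auto
  then show ?thesis by (simp add: eigenvalue_root_char_poly[OF assms] poly_roots_finite)
qed

text \<open>The Rayleigh minimum is an eigenvalue, so it is at least \<open>lambda_min\<close>. The
  upper bound is the same argument for \<open>- A\<close>, whose eigenvalues are the negatives of
  those of \<open>A\<close>.\<close>

lemma eigen_bounded_quad_form:
  assumes A: "A \<in> carrier_mat d d" and d: "d \<ge> 1"
    and sym: "\<And>i j. i < d \<Longrightarrow> j < d \<Longrightarrow> A $$ (i, j) = A $$ (j, i)"
    and bd: "eigen_bounded Cmin Cmax A" and v: "v \<in> carrier_vec d"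
  shows "Cmin * (v \<bullet> v) \<le> v \<bullet> (A *\<^sub>v v)" and "v \<bullet> (A *\<^sub>v v) \<le> Cmax * (v \<bullet> v)"
proof -
  have vv: "v \<bullet> v \<ge> 0" by (simp add: scalar_prod_lessThan[OF v] sum_nonneg)
  obtain \<mu> where \<mu>: "eigenvalue A \<mu>" "\<mu> * (v \<bullet> v) \<le> v \<bullet> (A *\<^sub>v v)"
    using rayleigh_min[OF A d sym] v by blast
  have "Cmin \<le> lambda_min A" using bd by (simp add: eigen_bounded_def)
  also have "\<dots> \<le> \<mu>" unfolding lambda_min_def
    by (intro Min_le finite_eigenvalues[OF A]) (use \<mu> in simp)
  finally show "Cmin * (v \<bullet> v) \<le> v \<bullet> (A *\<^sub>v v)" using \<mu>(2) vv
    by (meson mult_right_mono order_trans)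
  have A': "- A \<in> carrier_mat d d" using A by simp
  obtain \<nu> where \<nu>: "eigenvalue (- A) \<nu>" "\<nu> * (v \<bullet> v) \<le> v \<bullet> (- A *\<^sub>v v)"
    using rayleigh_min[OF A' d] sym A v by fastforce
  obtain w where w: "w \<in> carrier_vec d" "w \<noteq> 0\<^sub>v d" "- A *\<^sub>v w = \<nu> \<cdot>\<^sub>v w"
    using \<nu>(1) A unfolding eigenvalue_def eigenvector_def by auto
  have "A *\<^sub>v w = (- \<nu>) \<cdot>\<^sub>v w"
  proof (rule eq_vecI)
    fix i assume "i < dim_vec ((- \<nu>) \<cdot>\<^sub>v w)"
    then have i: "i < d" using w by simp
    have "(- A *\<^sub>v w) $ i = (\<nu> \<cdot>\<^sub>v w) $ i" using w by simp
    then show "(A *\<^sub>v w) $ i = ((- \<nu>) \<cdot>\<^sub>v w) $ i"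
      using A i w(1) by (simp add: scalar_prod_lessThan[of _ d] sum_negf)
  qed (use A w in simp)
  then have "eigenvalue A (- \<nu>)" using A w unfolding eigenvalue_def eigenvector_def by auto
  then have "- \<nu> \<le> lambda_max A" unfolding lambda_max_def
    by (intro Max_ge finite_eigenvalues[OF A]) simp
  also have "\<dots> \<le> Cmax" using bd by (simp add: eigen_bounded_def)
  finally have "- \<nu> * (v \<bullet> v) \<le> Cmax * (v \<bullet> v)" using vv by (intro mult_right_mono)
  moreover have "v \<bullet> (- A *\<^sub>v v) = - (v \<bullet> (A *\<^sub>v v))"
    using A v by (simp add: quad_form_eq_bform[of _ d] bform_def sum_negf)
  ultimately show "v \<bullet> (A *\<^sub>v v) \<le> Cmax * (v \<bullet> v)" using \<nu>(2) by linarith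
qed

section \<open>Sub-Gaussian variables and independence\<close>

lemma exp_le_quadratic: "exp x \<le> 1 + x + x\<^sup>2 / 2 * exp \<bar>x :: real\<bar>"
proof -
  obtain t where t: "\<bar>t\<bar> \<le> \<bar>x\<bar>" "exp x = (\<Sum>m<2. x ^ m / fact m) + exp t / fact 2 * x ^ 2"
    using Maclaurin_exp_le[of x 2] by blast
  have "exp x = 1 + x + x\<^sup>2 / 2 * exp t"
    using t(2) by (simp add: numeral_2_eq_2)
  moreover have "exp t \<le> exp \<bar>x\<bar>" using t(1) by simp
  then have "x\<^sup>2 / 2 * exp t \<le> x\<^sup>2 / 2 * exp \<bar>x\<bar>" by (rule mult_left_mono) simp
  ultimately show ?thesis by linarith
qed

lemma sq_le_exp_half: "x \<ge> 0 \<Longrightarrow> x\<^sup>2 \<le> 8 * exp (x / 2)" for x :: real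
  using exp_lower_Taylor_quadratic[of "x / 2"] by (simp add: power2_eq_square)

text \<open>The condition on \<open>s\<close> keeps the exponential in the Taylor remainder below
  exp (R / 2), and the other half of exp R absorbs the square of \<open>R\<close>; the constant 4 is
  half of the 8 in \<open>sq_le_exp_half\<close>.\<close>

lemma exp_mult_le:
  fixes x y s R :: real
  assumes R: "R \<ge> 0" and w: "\<bar>w\<bar> \<le> c * R" and s: "\<bar>s\<bar> * c \<le> 1 / 2"
  shows "exp (s * w) \<le> 1 + s * w + 4 * s\<^sup>2 * c\<^sup>2 * exp R"
proof -
  have a: "\<bar>s * w\<bar> \<le> R / 2"
  proof -
    have "\<bar>s * w\<bar> \<le> \<bar>s\<bar> * (c * R)" unfolding abs_mult by (intro mult_left_mono w) simp
    also have "\<dots> = (\<bar>s\<bar> * c) * R" by simp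
    also have "\<dots> \<le> 1 / 2 * R" by (intro mult_right_mono s R)
    finally show ?thesis by simp
  qed
  have "w\<^sup>2 \<le> (c * R)\<^sup>2" using w by (metis abs_ge_zero power2_abs power_mono)
  then have "(s * w)\<^sup>2 \<le> s\<^sup>2 * (c * R)\<^sup>2" unfolding power_mult_distrib by (rule mult_left_mono) simp
  also have "\<dots> = s\<^sup>2 * c\<^sup>2 * R\<^sup>2" by (simp add: power_mult_distrib)
  also have "\<dots> \<le> s\<^sup>2 * c\<^sup>2 * (8 * exp (R / 2))" by (intro mult_left_mono sq_le_exp_half R) simp
  finally have b: "(s * w)\<^sup>2 / 2 \<le> 4 * s\<^sup>2 * c\<^sup>2 * exp (R / 2)" by simp
  have "exp \<bar>s * w\<bar> \<le> exp (R / 2)" using a by simp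
  then have "(s * w)\<^sup>2 / 2 * exp \<bar>s * w\<bar> \<le> 4 * s\<^sup>2 * c\<^sup>2 * exp (R / 2) * exp (R / 2)"
    using b by (intro mult_mono) auto
  also have "\<dots> = 4 * s\<^sup>2 * c\<^sup>2 * exp R" by (simp add: mult.assoc flip: exp_add)
  finally show ?thesis using exp_le_quadratic[of "s * w"] by linarith
qed

lemma exp_mean_le: "exp ((x + y) / 2) \<le> (exp x + exp y) / (2 :: real)"
proof -
  have "exp ((x + y) / 2) = exp (x / 2) * exp (y / 2)" by (simp add: add_divide_distrib flip: exp_add)
  also have "\<dots> \<le> ((exp (x / 2))\<^sup>2 + (exp (y / 2))\<^sup>2) / 2"
    using sum_squares_bound[of "exp (x / 2)" "exp (y / 2)"] by simp
  also have "\<dots> = (exp x + exp y) / 2" by (simp add: power2_eq_square flip: exp_add)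
  finally show ?thesis .
qed

lemma (in prob_space) integral_le_of_nn_integral:
  fixes f :: "'a \<Rightarrow> real"
  assumes [measurable]: "f \<in> borel_measurable M" and "\<And>x. f x \<ge> 0" "(\<integral>\<^sup>+x. f x \<partial>M) \<le> ennreal c" "c \<ge> 0"
  shows "integrable M f" "(\<integral>x. f x \<partial>M) \<le> c"
proof -
  show i: "integrable M f"
  proof (rule integrableI_nonneg)
    show "(\<integral>\<^sup>+x. ennreal (f x) \<partial>M) < \<infinity>"
      using assms(3) by (rule order.strict_trans1) simp
  qed (use assms in auto)
  have "ennreal (\<integral>x. f x \<partial>M) = (\<integral>\<^sup>+x. f x \<partial>M)"
    using i assms(2) by (intro nn_integral_eq_integral[symmetric]) auto
  with assms(3) have "ennreal (\<integral>x. f x \<partial>M) \<le> ennreal c" by simp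
  then show "(\<integral>x. f x \<partial>M) \<le> c" using assms(4) by (rule ennreal_le_iff[THEN iffD1, rotated])
qed

text \<open>A product of sub-Gaussian variables is only sub-exponential, hence the restriction on
  \<open>s\<close>. The mean \<open>R\<close> of the two normalised squares bounds |U V| / (a b) by
  the arithmetic-geometric inequality, and convexity of exp bounds its exponential moment by 2.
  \<open>U\<close> and \<open>V\<close> may depend on each other, as two linear forms of one
  covariate do.\<close>

lemma (in prob_space) subgaussian_product_mgf:
  fixes U V :: "'a \<Rightarrow> real"
  assumes [measurable]: "U \<in> borel_measurable M" "V \<in> borel_measurable M"
    and a: "a > 0" and b: "b > 0"
    and U: "(\<integral>\<^sup>+x. exp ((U x)\<^sup>2 / a\<^sup>2) \<partial>M) \<le> ennreal 2"
    and V: "(\<integral>\<^sup>+x. exp ((V x)\<^sup>2 / b\<^sup>2) \<partial>M) \<le> ennreal 2"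
  shows "integrable M (\<lambda>x. U x * V x)"
    and "\<bar>s\<bar> * (a * b) \<le> 1 / 2 \<Longrightarrow>
      (\<integral>\<^sup>+x. exp (s * (U x * V x - (\<integral>y. U y * V y \<partial>M))) \<partial>M) \<le> ennreal (exp (8 * s\<^sup>2 * (a * b)\<^sup>2))"
proof -
  define R where "R x = ((U x)\<^sup>2 / a\<^sup>2 + (V x)\<^sup>2 / b\<^sup>2) / 2" for x
  have R0: "R x \<ge> 0" for x by (simp add: R_def)
  have [measurable]: "R \<in> borel_measurable M" unfolding R_def by measurable
  have W: "\<bar>U x * V x\<bar> \<le> (a * b) * R x" for x
  proof -
    have "2 * (\<bar>U x\<bar> / a) * (\<bar>V x\<bar> / b) \<le> (\<bar>U x\<bar> / a)\<^sup>2 + (\<bar>V x\<bar> / b)\<^sup>2" by (rule sum_squares_bound)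
    then have "(\<bar>U x\<bar> / a) * (\<bar>V x\<bar> / b) \<le> R x" by (simp add: R_def power_divide mult_ac)
    then show ?thesis using a b by (simp add: field_simps abs_mult)
  qed
  have iU: "integrable M (\<lambda>x. exp ((U x)\<^sup>2 / a\<^sup>2))" "(\<integral>x. exp ((U x)\<^sup>2 / a\<^sup>2) \<partial>M) \<le> 2"
    using integral_le_of_nn_integral[OF _ _ U] by auto
  have iV: "integrable M (\<lambda>x. exp ((V x)\<^sup>2 / b\<^sup>2))" "(\<integral>x. exp ((V x)\<^sup>2 / b\<^sup>2) \<partial>M) \<le> 2"
    using integral_le_of_nn_integral[OF _ _ V] by auto
  have Rle: "exp (R x) \<le> (exp ((U x)\<^sup>2 / a\<^sup>2) + exp ((V x)\<^sup>2 / b\<^sup>2)) / 2" for x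
    unfolding R_def by (rule exp_mean_le)
  have iR: "integrable M (\<lambda>x. exp (R x))"
    by (rule Bochner_Integration.integrable_bound[where f = "\<lambda>x. (exp ((U x)\<^sup>2 / a\<^sup>2) + exp ((V x)\<^sup>2 / b\<^sup>2)) / 2"])
       (use iU iV Rle in \<open>auto intro!: AE_I2 simp: abs_of_nonneg add_nonneg_nonneg\<close>)
  have iR2: "(\<integral>x. exp (R x) \<partial>M) \<le> 2"
  proof -
    have "(\<integral>x. exp (R x) \<partial>M) \<le> (\<integral>x. (exp ((U x)\<^sup>2 / a\<^sup>2) + exp ((V x)\<^sup>2 / b\<^sup>2)) / 2 \<partial>M)"
      by (intro integral_mono iR Rle) (use iU iV in auto)
    also have "\<dots> \<le> 2" using iU iV by simp
    finally show ?thesis .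
  qed
  have Wexp: "\<bar>U x * V x\<bar> \<le> (a * b) * exp (R x)" for x
  proof -
    have "R x \<le> exp (R x)" using exp_ge_add_one_self[of "R x"] by linarith
    then have "(a * b) * R x \<le> (a * b) * exp (R x)" using a b by (intro mult_left_mono) auto
    then show ?thesis using W[of x] by linarith
  qed
  show iW: "integrable M (\<lambda>x. U x * V x)"
    by (rule Bochner_Integration.integrable_bound[where f = "\<lambda>x. (a * b) * exp (R x)"])
       (use iR Wexp a b in \<open>auto intro!: AE_I2 simp: abs_mult\<close>)
  assume s: "\<bar>s\<bar> * (a * b) \<le> 1 / 2"
  define m where "m = (\<integral>y. U y * V y \<partial>M)"
  define c where "c = 4 * s\<^sup>2 * (a * b)\<^sup>2"
  have c0: "c \<ge> 0" by (simp add: c_def)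
  have le: "exp (s * (U x * V x)) \<le> 1 + s * (U x * V x) + c * exp (R x)" for x
    unfolding c_def by (rule exp_mult_le[OF R0 W s])
  have int: "integrable M (\<lambda>x. 1 + s * (U x * V x) + c * exp (R x))"
    using iW iR by simp
  have "(\<integral>\<^sup>+x. exp (s * (U x * V x - m)) \<partial>M) = (\<integral>\<^sup>+x. ennreal (exp (- s * m)) * ennreal (exp (s * (U x * V x))) \<partial>M)"
    by (intro nn_integral_cong) (simp add: algebra_simps flip: ennreal_mult exp_add)
  also have "\<dots> = exp (- s * m) * (\<integral>\<^sup>+x. exp (s * (U x * V x)) \<partial>M)"
    by (rule nn_integral_cmult) measurable
  also have "(\<integral>\<^sup>+x. exp (s * (U x * V x)) \<partial>M) \<le> (\<integral>\<^sup>+x. 1 + s * (U x * V x) + c * exp (R x) \<partial>M)"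
    by (intro nn_integral_mono ennreal_leI le)
  also have "\<dots> = ennreal (\<integral>x. 1 + s * (U x * V x) + c * exp (R x) \<partial>M)"
    by (intro nn_integral_eq_integral int AE_I2 order_trans[OF _ le]) auto
  also have "(\<integral>x. 1 + s * (U x * V x) + c * exp (R x) \<partial>M) = 1 + s * m + c * (\<integral>x. exp (R x) \<partial>M)"
    using iW iR by (simp add: m_def prob_space)
  also have "ennreal \<dots> \<le> ennreal (exp (s * m + 2 * c))"
  proof (rule ennreal_leI)
    have "c * (\<integral>x. exp (R x) \<partial>M) \<le> c * 2" by (intro mult_left_mono iR2 c0)
    then show "1 + s * m + c * (\<integral>x. exp (R x) \<partial>M) \<le> exp (s * m + 2 * c)"
      using exp_ge_add_one_self[of "s * m + 2 * c"] by linarith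
  qed
  also have "ennreal (exp (- s * m)) * ennreal (exp (s * m + 2 * c)) = ennreal (exp (2 * c))"
    by (simp flip: ennreal_mult exp_add)
  finally show "(\<integral>\<^sup>+x. exp (s * (U x * V x - (\<integral>y. U y * V y \<partial>M))) \<partial>M)
      \<le> ennreal (exp (8 * s\<^sup>2 * (a * b)\<^sup>2))"
    by (simp add: m_def c_def mult_left_mono mult.assoc)
qed

text \<open>With r = |u| / a, the condition on \<open>s\<close> gives |s u| \<le> r \<le> 1/2 + r^2
  / 2. One factor exp (r^2 / 2) bounds the exponential in the Taylor remainder, a second one bounds
  the square, and the 2 bounds exp (1/2).\<close>

lemma exp_le_subgaussian_aux:
  fixes s u a :: real
  assumes a: "a > 0" and s: "\<bar>s\<bar> * a \<le> 1"
  shows "exp (s * u) \<le> 1 + s * u + 2 * s\<^sup>2 * a\<^sup>2 * exp (u\<^sup>2 / a\<^sup>2)"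
proof -
  define r where "r = \<bar>u\<bar> / a"
  have r0: "r \<ge> 0" using a by (simp add: r_def)
  have r2: "r\<^sup>2 = u\<^sup>2 / a\<^sup>2" by (simp add: r_def power_divide)
  have u: "\<bar>u\<bar> = a * r" using a by (simp add: r_def)
  have su: "\<bar>s * u\<bar> \<le> r"
    using mult_right_mono[OF s r0] by (simp add: abs_mult u mult.assoc)
  have "2 * r * 1 \<le> r\<^sup>2 + 1\<^sup>2" by (rule sum_squares_bound)
  then have "exp \<bar>s * u\<bar> \<le> exp (1 / 2 + r\<^sup>2 / 2)" using su by simp
  also have "\<dots> = exp (1 / 2) * exp (r\<^sup>2 / 2)" by (rule exp_add)
  also have "exp (1 / 2 :: real) \<le> 2" using exp_half_le2 by simp
  finally have 1: "exp \<bar>s * u\<bar> \<le> 2 * exp (r\<^sup>2 / 2)" by simp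
  have "r\<^sup>2 / 2 \<le> exp (r\<^sup>2 / 2)" using exp_ge_add_one_self[of "r\<^sup>2 / 2"] by linarith
  then have 2: "(s * u)\<^sup>2 / 2 \<le> s\<^sup>2 * a\<^sup>2 * exp (r\<^sup>2 / 2)"
  proof -
    assume h: "r\<^sup>2 / 2 \<le> exp (r\<^sup>2 / 2)"
    have "(s * u)\<^sup>2 / 2 = s\<^sup>2 * \<bar>u\<bar>\<^sup>2 / 2" by (simp add: power_mult_distrib)
    also have "\<dots> = s\<^sup>2 * a\<^sup>2 * (r\<^sup>2 / 2)" unfolding u by (simp add: power_mult_distrib)
    also have "\<dots> \<le> s\<^sup>2 * a\<^sup>2 * exp (r\<^sup>2 / 2)" by (intro mult_left_mono h) simp
    finally show ?thesis .
  qed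
  have "(s * u)\<^sup>2 / 2 * exp \<bar>s * u\<bar> \<le> s\<^sup>2 * a\<^sup>2 * exp (r\<^sup>2 / 2) * (2 * exp (r\<^sup>2 / 2))"
    by (intro mult_mono 1 2) auto
  also have "\<dots> = 2 * s\<^sup>2 * a\<^sup>2 * exp (r\<^sup>2)" by (simp flip: exp_add)
  finally show ?thesis using exp_le_quadratic[of "s * u"] by (simp add: r2)
qed

text \<open>For |s| a \<le> 1 the zero mean removes the linear Taylor term. For larger
  \<open>s\<close> Young's inequality s u \<le> s^2 a^2 / 2 + u^2 / (2 a^2) suffices, because the
  bound then no longer has to be close to 1.\<close>

lemma (in prob_space) subgaussian_mgf:
  fixes U :: "'a \<Rightarrow> real"
  assumes [measurable]: "U \<in> borel_measurable M" and a: "a > 0"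
    and U: "(\<integral>\<^sup>+x. exp ((U x)\<^sup>2 / a\<^sup>2) \<partial>M) \<le> ennreal 2"
    and mean: "integrable M U" "(\<integral>x. U x \<partial>M) = 0"
  shows "(\<integral>\<^sup>+x. exp (s * U x) \<partial>M) \<le> ennreal (exp (4 * s\<^sup>2 * a\<^sup>2))"
proof -
  have iU: "integrable M (\<lambda>x. exp ((U x)\<^sup>2 / a\<^sup>2))" "(\<integral>x. exp ((U x)\<^sup>2 / a\<^sup>2) \<partial>M) \<le> 2"
    using integral_le_of_nn_integral[OF _ _ U] by auto
  show ?thesis
  proof (cases "\<bar>s\<bar> * a \<le> 1")
    case True
    define c where "c = 2 * s\<^sup>2 * a\<^sup>2"
    have c0: "c \<ge> 0" by (simp add: c_def)
    have le: "exp (s * U x) \<le> 1 + s * U x + c * exp ((U x)\<^sup>2 / a\<^sup>2)" for x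
      unfolding c_def by (rule exp_le_subgaussian_aux[OF a True])
    have int: "integrable M (\<lambda>x. 1 + s * U x + c * exp ((U x)\<^sup>2 / a\<^sup>2))"
      using iU mean by simp
    have "(\<integral>\<^sup>+x. exp (s * U x) \<partial>M) \<le> (\<integral>\<^sup>+x. 1 + s * U x + c * exp ((U x)\<^sup>2 / a\<^sup>2) \<partial>M)"
      by (intro nn_integral_mono ennreal_leI le)
    also have "\<dots> = ennreal (\<integral>x. 1 + s * U x + c * exp ((U x)\<^sup>2 / a\<^sup>2) \<partial>M)"
      by (intro nn_integral_eq_integral int AE_I2 order_trans[OF _ le]) auto
    also have "(\<integral>x. 1 + s * U x + c * exp ((U x)\<^sup>2 / a\<^sup>2) \<partial>M) = 1 + c * (\<integral>x. exp ((U x)\<^sup>2 / a\<^sup>2) \<partial>M)"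
      using iU mean by (simp add: prob_space)
    also have "ennreal \<dots> \<le> ennreal (exp (2 * c))"
    proof (rule ennreal_leI)
      have "c * (\<integral>x. exp ((U x)\<^sup>2 / a\<^sup>2) \<partial>M) \<le> c * 2" by (intro mult_left_mono iU c0)
      then show "1 + c * (\<integral>x. exp ((U x)\<^sup>2 / a\<^sup>2) \<partial>M) \<le> exp (2 * c)"
        using exp_ge_add_one_self[of "2 * c"] by linarith
    qed
    finally show ?thesis by (simp add: c_def mult.assoc)
  next
    case False
    have le: "exp (s * U x) \<le> exp (s\<^sup>2 * a\<^sup>2 / 2) * exp ((U x)\<^sup>2 / a\<^sup>2)" for x
    proof -
      have "2 * (s * a) * (U x / a) \<le> (s * a)\<^sup>2 + (U x / a)\<^sup>2" by (rule sum_squares_bound)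
      then have le: "s * U x \<le> s\<^sup>2 * a\<^sup>2 / 2 + (U x)\<^sup>2 / a\<^sup>2 / 2"
        using a by (simp add: power_mult_distrib power_divide)
      have half: "y / 2 \<le> y" if "y \<ge> 0" for y :: real using that by simp
      have "s * U x \<le> s\<^sup>2 * a\<^sup>2 / 2 + (U x)\<^sup>2 / a\<^sup>2"
        by (rule order_trans[OF le add_left_mono[OF half]]) simp
      then show ?thesis by (simp flip: exp_add)
    qed
    have "(\<integral>\<^sup>+x. exp (s * U x) \<partial>M) \<le> (\<integral>\<^sup>+x. ennreal (exp (s\<^sup>2 * a\<^sup>2 / 2)) * ennreal (exp ((U x)\<^sup>2 / a\<^sup>2)) \<partial>M)"
      by (intro nn_integral_mono) (simp add: le flip: ennreal_mult)
    also have "\<dots> = exp (s\<^sup>2 * a\<^sup>2 / 2) * (\<integral>\<^sup>+x. exp ((U x)\<^sup>2 / a\<^sup>2) \<partial>M)"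
      by (rule nn_integral_cmult) measurable
    also have "\<dots> \<le> ennreal (exp (s\<^sup>2 * a\<^sup>2 / 2)) * ennreal 2" by (intro mult_left_mono U) simp
    also have "\<dots> = ennreal (exp (s\<^sup>2 * a\<^sup>2 / 2) * 2)" by (rule ennreal_mult[symmetric]) simp_all
    \<comment> \<open>Here s^2 a^2 \<ge> 1, so the factor 2 from the exponential moment is at most
      exp (s^2 a^2) and disappears into the exponent.\<close>
    also have "\<dots> \<le> ennreal (exp (4 * s\<^sup>2 * a\<^sup>2))"
    proof (rule ennreal_leI)
      have "1 < \<bar>s\<bar> * a" using False by simp
      then have "1\<^sup>2 \<le> (\<bar>s\<bar> * a)\<^sup>2" by (intro power_mono) auto
      then have *: "1 \<le> s\<^sup>2 * a\<^sup>2" by (simp add: power_mult_distrib)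
      have "(2::real) \<le> exp 1" using exp_ge_add_one_self[of 1] by simp
      also have "\<dots> \<le> exp (s\<^sup>2 * a\<^sup>2)" using * by simp
      finally have "exp (s\<^sup>2 * a\<^sup>2 / 2) * 2 \<le> exp (s\<^sup>2 * a\<^sup>2 / 2) * exp (s\<^sup>2 * a\<^sup>2)"
        by (intro mult_left_mono) auto
      also have "\<dots> \<le> exp (4 * s\<^sup>2 * a\<^sup>2)" using * by (simp flip: exp_add)
      finally show "exp (s\<^sup>2 * a\<^sup>2 / 2) * 2 \<le> exp (4 * s\<^sup>2 * a\<^sup>2)" .
    qed
    finally show ?thesis .
  qed
qed

text \<open>Markov's inequality for the exponential of the sum, whose mean factorises by
  independence. With nonnegative integrals the moment bound also carries the integrability.
  \<open>b\<close> bounds the log moment generating function of one observation.\<close>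

lemma (in prob_space) indep_vars_chernoff:
  assumes ind: "indep_vars (\<lambda>_. N) Z {..<n::nat}"
    and f: "\<And>i. i < n \<Longrightarrow> f i \<in> borel_measurable N"
    and mgf: "\<And>i. i < n \<Longrightarrow> (\<integral>\<^sup>+\<omega>. exp (f i (Z i \<omega>) :: real) \<partial>M) \<le> ennreal (exp b)"
  shows "measure M {\<omega> \<in> space M. (\<Sum>i<n. f i (Z i \<omega>)) \<ge> real n * b + t} \<le> exp (- t)"
proof -
  have Z: "Z i \<in> measurable M N" if "i < n" for i
    using ind that by (auto simp: indep_vars_def)
  have fZ [measurable]: "(\<lambda>\<omega>. f i (Z i \<omega>)) \<in> borel_measurable M" if "i < n" for i
    using measurable_compose[OF Z f] that by blast
  have S [measurable]: "(\<lambda>\<omega>. \<Sum>i<n. f i (Z i \<omega>)) \<in> borel_measurable M"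
    by (intro borel_measurable_sum fZ) simp
  have ind': "indep_vars (\<lambda>_. borel) (\<lambda>i \<omega>. ennreal (exp (f i (Z i \<omega>)))) {..<n}"
    by (rule indep_vars_compose2[OF ind, of "\<lambda>i z. ennreal (exp (f i z))"])
       (use f in \<open>auto intro!: measurable_compose[OF _ measurable_ennreal] borel_measurable_exp\<close>)
  have "(\<integral>\<^sup>+\<omega>. exp (\<Sum>i<n. f i (Z i \<omega>)) \<partial>M) = (\<integral>\<^sup>+\<omega>. (\<Prod>i<n. ennreal (exp (f i (Z i \<omega>)))) \<partial>M)"
    by (intro nn_integral_cong) (simp add: exp_sum prod_ennreal)
  also have "\<dots> = (\<Prod>i<n. \<integral>\<^sup>+\<omega>. ennreal (exp (f i (Z i \<omega>))) \<partial>M)"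
    by (rule indep_vars_nn_integral[OF _ ind']) auto
  also have "\<dots> \<le> (\<Prod>i<n. ennreal (exp b))"
    by (intro prod_mono_ennreal mgf) auto
  also have "\<dots> = ennreal (exp (real n * b))"
    by (simp add: ennreal_power exp_of_nat_mult)
  finally have E: "(\<integral>\<^sup>+\<omega>. exp (\<Sum>i<n. f i (Z i \<omega>)) \<partial>M) \<le> ennreal (exp (real n * b))" .
  let ?A = "{\<omega> \<in> space M. (\<Sum>i<n. f i (Z i \<omega>)) \<ge> real n * b + t}"
  let ?u = "\<lambda>\<omega>. ennreal (exp (\<Sum>i<n. f i (Z i \<omega>)))"
  have "?A = {\<omega> \<in> space M. 1 \<le> ennreal (exp (- (real n * b + t))) * ?u \<omega>}"
    by (auto simp flip: ennreal_mult exp_add)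
  then have "emeasure M ?A = emeasure M ({\<omega> \<in> space M. 1 \<le> ennreal (exp (- (real n * b + t))) * ?u \<omega>})"
    by simp
  also have "\<dots> \<le> ennreal (exp (- (real n * b + t))) * (\<integral>\<^sup>+\<omega>. ?u \<omega> * indicator (space M) \<omega> \<partial>M)"
    by (rule nn_integral_Markov_inequality) auto
  also have "(\<integral>\<^sup>+\<omega>. ?u \<omega> * indicator (space M) \<omega> \<partial>M) = (\<integral>\<^sup>+\<omega>. ?u \<omega> \<partial>M)"
    by (intro nn_integral_cong) simp
  also have "ennreal (exp (- (real n * b + t))) * (\<integral>\<^sup>+\<omega>. ?u \<omega> \<partial>M)
      \<le> ennreal (exp (- (real n * b + t))) * ennreal (exp (real n * b))"
    by (intro mult_left_mono E) simp
  also have "\<dots> = ennreal (exp (- t))" by (simp flip: ennreal_mult exp_add)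
  finally show ?thesis by (simp add: emeasure_eq_measure)
qed

section \<open>Independent pairs: product law, Fubini, conditioning\<close>

lemma indep_rv_distr:
  assumes M: "prob_space M" and ind: "indep_rv M N U L V"
  shows "distr M (N \<Otimes>\<^sub>M L) (\<lambda>\<omega>. (U \<omega>, V \<omega>)) = distr M N U \<Otimes>\<^sub>M distr M L V"
proof -
  interpret prob_space M by fact
  have U [measurable]: "U \<in> measurable M N" and V [measurable]: "V \<in> measurable M L"
    using ind by (auto simp: indep_rv_def)
  interpret DU: prob_space "distr M N U" by (rule prob_space_distr) measurable
  interpret DV: prob_space "distr M L V" by (rule prob_space_distr) measurable
  show ?thesis
  proof (rule pair_measure_eqI[symmetric])
    show "sigma_finite_measure (distr M N U)" "sigma_finite_measure (distr M L V)" by unfold_locales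
    show "sets (distr M N U \<Otimes>\<^sub>M distr M L V) = sets (distr M (N \<Otimes>\<^sub>M L) (\<lambda>\<omega>. (U \<omega>, V \<omega>)))"
      by (simp cong: sets_pair_measure_cong)
    fix A B assume "A \<in> sets (distr M N U)" "B \<in> sets (distr M L V)"
    then have A: "A \<in> sets N" and B: "B \<in> sets L" by simp_all
    have eq: "(\<lambda>\<omega>. (U \<omega>, V \<omega>)) -` (A \<times> B) \<inter> space M = (U -` A \<inter> space M) \<inter> (V -` B \<inter> space M)"
      by auto
    have "prob ((U -` A \<inter> space M) \<inter> (V -` B \<inter> space M)) = prob (U -` A \<inter> space M) * prob (V -` B \<inter> space M)"
      using ind A B unfolding indep_rv_def by (intro indep_setD[where A = "{U -` A \<inter> space M | A. A \<in> sets N}" and B = "{V -` B \<inter> space M | B. B \<in> sets L}"]) auto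
    then show "emeasure (distr M N U) A * emeasure (distr M L V) B
        = emeasure (distr M (N \<Otimes>\<^sub>M L) (\<lambda>\<omega>. (U \<omega>, V \<omega>))) (A \<times> B)"
      using A B by (simp add: emeasure_distr eq emeasure_eq_measure ennreal_mult)
  qed
qed

text \<open>Fubini for the product law in both orders: \<open>noise_mgf\<close> integrates the first
  variable for fixed second one, \<open>indep_rv_prob_le\<close> the second for fixed first.\<close>

lemma indep_rv_nn_integral:
  assumes M: "prob_space M" and ind: "indep_rv M N U L V"
    and f [measurable]: "f \<in> borel_measurable (N \<Otimes>\<^sub>M L)"
  shows "(\<integral>\<^sup>+\<omega>. f (U \<omega>, V \<omega>) \<partial>M) = (\<integral>\<^sup>+\<omega>. (\<integral>\<^sup>+\<omega>'. f (U \<omega>', V \<omega>) \<partial>M) \<partial>M)"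
    and "(\<integral>\<^sup>+\<omega>. f (U \<omega>, V \<omega>) \<partial>M) = (\<integral>\<^sup>+\<omega>. (\<integral>\<^sup>+\<omega>'. f (U \<omega>, V \<omega>') \<partial>M) \<partial>M)"
proof -
  interpret prob_space M by fact
  have U [measurable]: "U \<in> measurable M N" and V [measurable]: "V \<in> measurable M L"
    using ind by (auto simp: indep_rv_def)
  interpret DU: prob_space "distr M N U" by (rule prob_space_distr) measurable
  interpret DV: prob_space "distr M L V" by (rule prob_space_distr) measurable
  interpret P: pair_sigma_finite "distr M N U" "distr M L V" by unfold_locales
  have f' [measurable]: "f \<in> borel_measurable (distr M N U \<Otimes>\<^sub>M distr M L V)"
    by measurable
  have "(\<integral>\<^sup>+\<omega>. f (U \<omega>, V \<omega>) \<partial>M) = integral\<^sup>N (distr M (N \<Otimes>\<^sub>M L) (\<lambda>\<omega>. (U \<omega>, V \<omega>))) f"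
    by (subst nn_integral_distr) auto
  also have "\<dots> = integral\<^sup>N (distr M N U \<Otimes>\<^sub>M distr M L V) f"
    by (simp only: indep_rv_distr[OF M ind])
  finally have *: "(\<integral>\<^sup>+\<omega>. f (U \<omega>, V \<omega>) \<partial>M) = integral\<^sup>N (distr M N U \<Otimes>\<^sub>M distr M L V) f" .
  also have "\<dots> = (\<integral>\<^sup>+y. (\<integral>\<^sup>+x. f (x, y) \<partial>distr M N U) \<partial>distr M L V)"
    by (rule P.nn_integral_snd[symmetric]) measurable
  also have "\<dots> = (\<integral>\<^sup>+\<omega>. (\<integral>\<^sup>+x. f (x, V \<omega>) \<partial>distr M N U) \<partial>M)"
    by (subst nn_integral_distr) (auto intro!: DU.borel_measurable_nn_integral)
  also have "\<dots> = (\<integral>\<^sup>+\<omega>. (\<integral>\<^sup>+\<omega>'. f (U \<omega>', V \<omega>) \<partial>M) \<partial>M)"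
  proof (intro nn_integral_cong)
    fix \<omega> assume "\<omega> \<in> space M"
    then have "V \<omega> \<in> space L" using measurable_space[OF V] by blast
    then show "(\<integral>\<^sup>+x. f (x, V \<omega>) \<partial>distr M N U) = (\<integral>\<^sup>+\<omega>'. f (U \<omega>', V \<omega>) \<partial>M)"
      by (intro nn_integral_distr) auto
  qed
  finally show "(\<integral>\<^sup>+\<omega>. f (U \<omega>, V \<omega>) \<partial>M) = (\<integral>\<^sup>+\<omega>. (\<integral>\<^sup>+\<omega>'. f (U \<omega>', V \<omega>) \<partial>M) \<partial>M)" .
  note *
  also have "integral\<^sup>N (distr M N U \<Otimes>\<^sub>M distr M L V) f = (\<integral>\<^sup>+x. (\<integral>\<^sup>+y. f (x, y) \<partial>distr M L V) \<partial>distr M N U)"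
    by (rule DV.nn_integral_fst[symmetric]) measurable
  also have "\<dots> = (\<integral>\<^sup>+\<omega>. (\<integral>\<^sup>+y. f (U \<omega>, y) \<partial>distr M L V) \<partial>M)"
    by (subst nn_integral_distr) (auto intro!: DV.borel_measurable_nn_integral)
  also have "\<dots> = (\<integral>\<^sup>+\<omega>. (\<integral>\<^sup>+\<omega>'. f (U \<omega>, V \<omega>') \<partial>M) \<partial>M)"
  proof (intro nn_integral_cong)
    fix \<omega> assume "\<omega> \<in> space M"
    then have "U \<omega> \<in> space N" using measurable_space[OF U] by blast
    then show "(\<integral>\<^sup>+y. f (U \<omega>, y) \<partial>distr M L V) = (\<integral>\<^sup>+\<omega>'. f (U \<omega>, V \<omega>') \<partial>M)"
      by (intro nn_integral_distr) auto
  qed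
  finally show "(\<integral>\<^sup>+\<omega>. f (U \<omega>, V \<omega>) \<partial>M) = (\<integral>\<^sup>+\<omega>. (\<integral>\<^sup>+\<omega>'. f (U \<omega>, V \<omega>') \<partial>M) \<partial>M)" .
qed

text \<open>Conditioning without conditional expectations: a bound that holds for every frozen value
  of \<open>U\<close> integrates to the same bound.\<close>

lemma indep_rv_prob_le:
  assumes M: "prob_space M" and ind: "indep_rv M N U L V"
    and B: "Measurable.pred (N \<Otimes>\<^sub>M L) (\<lambda>z. P (fst z) (snd z))"
    and le: "\<And>x. x \<in> space N \<Longrightarrow> measure M {\<omega> \<in> space M. P x (V \<omega>)} \<le> q"
  shows "measure M {\<omega> \<in> space M. P (U \<omega>) (V \<omega>)} \<le> q"
proof -
  interpret prob_space M by fact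
  have U [measurable]: "U \<in> measurable M N" and V [measurable]: "V \<in> measurable M L"
    using ind by (auto simp: indep_rv_def)
  \<comment> \<open>Needed to return from the extended reals; a probability space is nonempty, so
    some frozen value exists and \<open>q\<close> dominates a probability.\<close>
  have q: "q \<ge> 0"
  proof -
    obtain \<omega> where "\<omega> \<in> space M" using not_empty by blast
    then have "U \<omega> \<in> space N" using measurable_space[OF U] by blast
    from order_trans[OF measure_nonneg le[OF this]] show ?thesis .
  qed
  let ?E = "{z \<in> space (N \<Otimes>\<^sub>M L). P (fst z) (snd z)}"
  have E [measurable]: "?E \<in> sets (N \<Otimes>\<^sub>M L)" using B by (simp add: pred_def)
  have f: "(indicator ?E :: _ \<Rightarrow> ennreal) \<in> borel_measurable (N \<Otimes>\<^sub>M L)" by measurable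
  have UV: "(\<lambda>\<omega>. (U \<omega>, V \<omega>)) \<in> measurable M (N \<Otimes>\<^sub>M L)" by measurable
  have sp: "(U \<omega>, V \<omega>') \<in> space (N \<Otimes>\<^sub>M L)" if "\<omega> \<in> space M" "\<omega>' \<in> space M" for \<omega> \<omega>'
    using measurable_space[OF U] measurable_space[OF V] that by (simp add: space_pair_measure)
  have S1: "{\<omega> \<in> space M. P (U \<omega>) (V \<omega>)} = (\<lambda>\<omega>. (U \<omega>, V \<omega>)) -` ?E \<inter> space M"
    using sp by auto
  have S1m: "{\<omega> \<in> space M. P (U \<omega>) (V \<omega>)} \<in> events"
    unfolding S1 by (rule measurable_sets[OF UV E])
  have "emeasure M {\<omega> \<in> space M. P (U \<omega>) (V \<omega>)} = (\<integral>\<^sup>+\<omega>. indicator {\<omega> \<in> space M. P (U \<omega>) (V \<omega>)} \<omega> \<partial>M)"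
    using S1m by simp
  also have "\<dots> = (\<integral>\<^sup>+\<omega>. indicator ?E (U \<omega>, V \<omega>) \<partial>M)"
    by (intro nn_integral_cong) (auto simp: indicator_def sp)
  also have "\<dots> = (\<integral>\<^sup>+\<omega>. (\<integral>\<^sup>+\<omega>'. indicator ?E (U \<omega>, V \<omega>') \<partial>M) \<partial>M)"
    by (rule indep_rv_nn_integral(2)[OF M ind f])
  also have "\<dots> \<le> (\<integral>\<^sup>+\<omega>. ennreal q \<partial>M)"
  proof (intro nn_integral_mono)
    fix \<omega> assume w: "\<omega> \<in> space M"
    then have Uw: "U \<omega> \<in> space N" using measurable_space[OF U] by blast
    have "(\<lambda>\<omega>'. (U \<omega>, V \<omega>')) \<in> measurable M (N \<Otimes>\<^sub>M L)" using Uw by measurable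
    from measurable_sets[OF this E]
    have m: "{\<omega>' \<in> space M. P (U \<omega>) (V \<omega>')} \<in> events"
    proof -
      have "(\<lambda>\<omega>'. (U \<omega>, V \<omega>')) -` ?E \<inter> space M = {\<omega>' \<in> space M. P (U \<omega>) (V \<omega>')}"
        using sp w by auto
      then show ?thesis using \<open>(\<lambda>\<omega>'. (U \<omega>, V \<omega>')) -` ?E \<inter> space M \<in> events\<close> by simp
    qed
    have "(\<integral>\<^sup>+\<omega>'. indicator ?E (U \<omega>, V \<omega>') \<partial>M) = (\<integral>\<^sup>+\<omega>'. indicator {\<omega>' \<in> space M. P (U \<omega>) (V \<omega>')} \<omega>' \<partial>M)"
      using w by (intro nn_integral_cong) (auto simp: indicator_def sp)
    also have "\<dots> = ennreal (prob {\<omega>' \<in> space M. P (U \<omega>) (V \<omega>')})"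
      using m by (simp add: emeasure_eq_measure)
    also have "\<dots> \<le> ennreal q" by (intro ennreal_leI le Uw)
    finally show "(\<integral>\<^sup>+\<omega>'. indicator ?E (U \<omega>, V \<omega>') \<partial>M) \<le> ennreal q" .
  qed
  also have "\<dots> = ennreal q" by (simp add: emeasure_space_1)
  finally show ?thesis using q by (simp add: emeasure_eq_measure)
qed

text \<open>An infimum of at most \<open>C\<close> need not provide \<open>C\<close> itself as an
  admissible value. Doubling yields an admissible \<open>t\<close> below \<open>2 * C\<close>, and
  the exponential moment decreases in \<open>t\<close>.\<close>

lemma psi2_norm_le_imp:
  assumes "psi2_norm M U \<le> ennreal C" "C > 0"
  shows "(\<integral>\<^sup>+\<omega>. exp ((U \<omega>)\<^sup>2 / (2 * C)\<^sup>2) \<partial>M) \<le> ennreal 2"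
proof -
  have "psi2_norm M U < ennreal (2 * C)"
    using assms(1) by (rule order.strict_trans1) (use assms(2) in \<open>simp add: ennreal_less_iff\<close>)
  then obtain t where t: "0 < t" "(\<integral>\<^sup>+\<omega>. exp ((U \<omega>)\<^sup>2 / t\<^sup>2) \<partial>M) \<le> 2" "ennreal t < ennreal (2 * C)"
    unfolding psi2_norm_def by (auto simp: INF_less_iff)
  have tC: "t < 2 * C" using t by (simp add: ennreal_less_iff)
  have "(\<integral>\<^sup>+\<omega>. exp ((U \<omega>)\<^sup>2 / (2 * C)\<^sup>2) \<partial>M) \<le> (\<integral>\<^sup>+\<omega>. exp ((U \<omega>)\<^sup>2 / t\<^sup>2) \<partial>M)"
  proof (intro nn_integral_mono ennreal_leI)
    fix \<omega>
    have "t\<^sup>2 \<le> (2 * C)\<^sup>2" using t(1) tC by (intro power_mono) auto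
    then have "(U \<omega>)\<^sup>2 / (2 * C)\<^sup>2 \<le> (U \<omega>)\<^sup>2 / t\<^sup>2"
      using t(1) assms(2) by (intro divide_left_mono) auto
    then show "exp ((U \<omega>)\<^sup>2 / (2 * C)\<^sup>2) \<le> exp ((U \<omega>)\<^sup>2 / t\<^sup>2)" by simp
  qed
  also have "\<dots> \<le> ennreal 2" using t by simp
  finally show ?thesis .
qed

lemma norm_l2_sq: "v \<in> carrier_vec d \<Longrightarrow> (norm_l2 v)\<^sup>2 = v \<bullet> v"
  by (simp add: norm_l2_def scalar_prod_lessThan sum_nonneg)

lemma norm_l2_nonneg: "v \<in> carrier_vec d \<Longrightarrow> norm_l2 v \<ge> 0"
  by (simp add: norm_l2_def scalar_prod_lessThan sum_nonneg)

lemma psi2_norm_vec_le_imp: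
  assumes psi: "psi2_norm_vec M p V \<le> ennreal C" and C: "C > 0" and u: "u \<in> carrier_vec p"
    and u0: "norm_l2 u \<noteq> 0"
    and V: "\<And>\<omega>. \<omega> \<in> space M \<Longrightarrow> V \<omega> \<in> carrier_vec p"
  shows "(\<integral>\<^sup>+\<omega>. exp ((u \<bullet> V \<omega>)\<^sup>2 / (2 * C * norm_l2 u)\<^sup>2) \<partial>M) \<le> ennreal 2"
proof -
  define r where "r = norm_l2 u"
  define u' where "u' = (1 / r) \<cdot>\<^sub>v u"
  have u': "u' \<in> carrier_vec p" using u by (simp add: u'_def)
  have r: "r > 0" using u0 norm_l2_nonneg[OF u] by (simp add: r_def)
  have "u' \<bullet> u' = (u \<bullet> u) / r\<^sup>2"
    using u by (simp add: u'_def scalar_prod_lessThan[of _ p] sum_divide_distrib power2_eq_square)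
  also have "\<dots> = 1" using r norm_l2_sq[OF u, symmetric] by (simp add: r_def)
  finally have "norm_l2 u' = 1" by (simp add: norm_l2_def)
  then have "psi2_norm M (\<lambda>\<omega>. u' \<bullet> V \<omega>) \<le> psi2_norm_vec M p V"
    unfolding psi2_norm_vec_def using u' by (intro SUP_upper) simp
  also note psi
  finally have "(\<integral>\<^sup>+\<omega>. exp ((u' \<bullet> V \<omega>)\<^sup>2 / (2 * C)\<^sup>2) \<partial>M) \<le> ennreal 2"
    by (rule psi2_norm_le_imp[OF _ C])
  moreover have "(\<integral>\<^sup>+\<omega>. exp ((u' \<bullet> V \<omega>)\<^sup>2 / (2 * C)\<^sup>2) \<partial>M)
      = (\<integral>\<^sup>+\<omega>. exp ((u \<bullet> V \<omega>)\<^sup>2 / (2 * C * r)\<^sup>2) \<partial>M)"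
  proof (intro nn_integral_cong)
    fix \<omega> assume "\<omega> \<in> space M"
    then have "u' \<bullet> V \<omega> = (u \<bullet> V \<omega>) / r"
      using u V by (simp add: u'_def)
    then show "ennreal (exp ((u' \<bullet> V \<omega>)\<^sup>2 / (2 * C)\<^sup>2)) = ennreal (exp ((u \<bullet> V \<omega>)\<^sup>2 / (2 * C * r)\<^sup>2))"
      by (simp add: power_divide power_mult_distrib mult_ac)
  qed
  ultimately show ?thesis by (simp add: r_def)
qed

section \<open>Deviation inequalities for the target sample\<close>

lemma borel_measurable_scalar_prod:
  assumes f: "f \<in> measurable N (borel_vec p)" and g: "g \<in> measurable N (borel_vec p)"
  shows "(\<lambda>x. f x \<bullet> g x) \<in> borel_measurable N"
proof -
  have "(\<lambda>x. \<Sum>j<p. f x $ j * g x $ j) \<in> borel_measurable N"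
    using f g by (intro borel_measurable_sum borel_measurable_times) (auto simp: measurable_borel_vec_iff)
  moreover have "f x \<bullet> g x = (\<Sum>j<p. f x $ j * g x $ j)" if "x \<in> space N" for x
    using measurable_space[OF g that] by (simp add: scalar_prod_lessThan)
  ultimately show ?thesis by (simp cong: measurable_cong)
qed

lemma borel_measurable_scalar_prod_const:
  "u \<in> carrier_vec p \<Longrightarrow> g \<in> measurable N (borel_vec p) \<Longrightarrow> (\<lambda>x. u \<bullet> g x) \<in> borel_measurable N"
  by (intro borel_measurable_scalar_prod[of _ _ p]) auto

locale target_sample = prob_space M for M :: "'a measure" +
  fixes p n :: nat and X :: "nat \<Rightarrow> 'a \<Rightarrow> rvec" and e :: "nat \<Rightarrow> 'a \<Rightarrow> real"
    and S :: rmat and sd \<tau> :: real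
  assumes model: "design_noise M p n X e S sd" and tau: "\<tau> > 0"
    and subX: "\<And>i u. i < n \<Longrightarrow> u \<in> carrier_vec p \<Longrightarrow> norm_l2 u \<noteq> 0 \<Longrightarrow>
      (\<integral>\<^sup>+\<omega>. exp ((u \<bullet> X i \<omega>)\<^sup>2 / (\<tau> * norm_l2 u)\<^sup>2) \<partial>M) \<le> ennreal 2"
    and sube: "\<And>i. i < n \<Longrightarrow> (\<integral>\<^sup>+\<omega>. exp ((e i \<omega>)\<^sup>2 / \<tau>\<^sup>2) \<partial>M) \<le> ennreal 2"
begin

lemma indep_Xe: "indep_vars (\<lambda>_. obs_space p) (\<lambda>i \<omega>. (X i \<omega>, e i \<omega>)) {..<n}"
  using model by (simp add: design_noise_def iid_def)

lemma X_measurable: "i < n \<Longrightarrow> X i \<in> measurable M (borel_vec p)"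
  and e_measurable: "i < n \<Longrightarrow> e i \<in> borel_measurable M"
  using model by (auto simp: design_noise_def indep_rv_def)

lemma X_carrier: "i < n \<Longrightarrow> \<omega> \<in> space M \<Longrightarrow> X i \<omega> \<in> carrier_vec p"
  using measurable_space[OF X_measurable] by simp

lemma uX_measurable: "i < n \<Longrightarrow> u \<in> carrier_vec p \<Longrightarrow> (\<lambda>\<omega>. u \<bullet> X i \<omega>) \<in> borel_measurable M"
  by (rule borel_measurable_scalar_prod_const[OF _ X_measurable])

lemma Xj_measurable: "i < n \<Longrightarrow> j < p \<Longrightarrow> (\<lambda>\<omega>. X i \<omega> $ j) \<in> borel_measurable M"
  using X_measurable by (auto simp: measurable_borel_vec_iff)

lemma integrable_Xj_sq: "i < n \<Longrightarrow> j < p \<Longrightarrow> integrable M (\<lambda>\<omega>. (X i \<omega> $ j)\<^sup>2)"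
  using model by (simp add: design_noise_def)

lemma integrable_Xj: "i < n \<Longrightarrow> j < p \<Longrightarrow> integrable M (\<lambda>\<omega>. X i \<omega> $ j)"
  by (rule square_integrable_imp_integrable[OF Xj_measurable integrable_Xj_sq])

lemma integrable_Xjl:
  assumes "i < n" "j < p" "l < p"
  shows "integrable M (\<lambda>\<omega>. X i \<omega> $ j * X i \<omega> $ l)"
proof (rule Bochner_Integration.integrable_bound)
  show "integrable M (\<lambda>\<omega>. (X i \<omega> $ j)\<^sup>2 + (X i \<omega> $ l)\<^sup>2)"
    using integrable_Xj_sq assms by simp
  show "(\<lambda>\<omega>. X i \<omega> $ j * X i \<omega> $ l) \<in> borel_measurable M"
    using Xj_measurable assms by simp
  have "\<bar>x * y\<bar> \<le> x\<^sup>2 + y\<^sup>2" for x y :: real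
  proof -
    have "2 * \<bar>x\<bar> * \<bar>y\<bar> \<le> \<bar>x\<bar>\<^sup>2 + \<bar>y\<bar>\<^sup>2" by (rule sum_squares_bound)
    moreover have "0 \<le> \<bar>x\<bar> * \<bar>y\<bar>" by simp
    ultimately show ?thesis unfolding abs_mult power2_abs by linarith
  qed
  then show "AE \<omega> in M. norm (X i \<omega> $ j * X i \<omega> $ l) \<le> norm ((X i \<omega> $ j)\<^sup>2 + (X i \<omega> $ l)\<^sup>2)"
    by (intro AE_I2) simp
qed

lemma mean_Xj: "i < n \<Longrightarrow> j < p \<Longrightarrow> (\<integral>\<omega>. X i \<omega> $ j \<partial>M) = 0"
proof -
  assume ij: "i < n" "j < p"
  then have "mean_vec M p (X i) $ j = 0" using model by (simp add: design_noise_def)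
  then show ?thesis using ij by (simp add: mean_vec_def)
qed

lemma cov_Xj: "i < n \<Longrightarrow> j < p \<Longrightarrow> l < p \<Longrightarrow> (\<integral>\<omega>. X i \<omega> $ j * X i \<omega> $ l \<partial>M) = S $$ (j, l)"
proof -
  assume ij: "i < n" "j < p" "l < p"
  have S: "S = cov_mat M p (X i)" "mean_vec M p (X i) = 0\<^sub>v p" using model ij by (auto simp: design_noise_def)
  show ?thesis unfolding S(1) cov_mat_def S(2) using ij by simp
qed

lemma S_carrier: "n > 0 \<Longrightarrow> S \<in> carrier_mat p p"
  using model by (auto simp: design_noise_def cov_mat_def)

lemma S_sym: "n > 0 \<Longrightarrow> j < p \<Longrightarrow> l < p \<Longrightarrow> S $$ (j, l) = S $$ (l, j)"
  using cov_Xj[of 0 j l] cov_Xj[of 0 l j] by (simp add: mult.commute)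

lemma uX_sum: "i < n \<Longrightarrow> \<omega> \<in> space M \<Longrightarrow> u \<bullet> X i \<omega> = (\<Sum>j<p. u $ j * X i \<omega> $ j)"
  by (rule scalar_prod_lessThan[OF X_carrier])

lemma mean_uX:
  assumes "i < n"
  shows "integrable M (\<lambda>\<omega>. u \<bullet> X i \<omega>)" "(\<integral>\<omega>. u \<bullet> X i \<omega> \<partial>M) = 0"
proof -
  have 1: "integrable M (\<lambda>\<omega>. \<Sum>j<p. u $ j * X i \<omega> $ j)"
    by (intro Bochner_Integration.integrable_sum integrable_mult_right integrable_Xj assms) simp
  then show "integrable M (\<lambda>\<omega>. u \<bullet> X i \<omega>)"
    using uX_sum[OF assms] by (simp cong: Bochner_Integration.integrable_cong)
  have "(\<integral>\<omega>. u \<bullet> X i \<omega> \<partial>M) = (\<integral>\<omega>. (\<Sum>j<p. u $ j * X i \<omega> $ j) \<partial>M)"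
    using uX_sum[OF assms] by (intro Bochner_Integration.integral_cong) auto
  also have "\<dots> = (\<Sum>j<p. \<integral>\<omega>. u $ j * X i \<omega> $ j \<partial>M)"
    by (intro Bochner_Integration.integral_sum integrable_mult_right integrable_Xj assms) simp
  also have "\<dots> = 0" using assms by (simp add: mean_Xj)
  finally show "(\<integral>\<omega>. u \<bullet> X i \<omega> \<partial>M) = 0" .
qed

lemma cov_uX:
  assumes i: "i < n" and v: "v \<in> carrier_vec p" and u: "u \<in> carrier_vec p"
  shows "(\<integral>\<omega>. (u \<bullet> X i \<omega>) * (v \<bullet> X i \<omega>) \<partial>M) = u \<bullet> (S *\<^sub>v v)"
proof -
  have "(\<integral>\<omega>. (u \<bullet> X i \<omega>) * (v \<bullet> X i \<omega>) \<partial>M)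
      = (\<integral>\<omega>. (\<Sum>j<p. \<Sum>l<p. (u $ j * v $ l) * (X i \<omega> $ j * X i \<omega> $ l)) \<partial>M)"
    using uX_sum[OF i] by (intro Bochner_Integration.integral_cong) (auto simp: sum_product mult_ac)
  also have "\<dots> = (\<Sum>j<p. \<integral>\<omega>. (\<Sum>l<p. (u $ j * v $ l) * (X i \<omega> $ j * X i \<omega> $ l)) \<partial>M)"
    by (rule Bochner_Integration.integral_sum) (use integrable_Xjl i in \<open>auto intro!: Bochner_Integration.integrable_sum integrable_mult_right\<close>)
  also have "\<dots> = (\<Sum>j<p. \<Sum>l<p. \<integral>\<omega>. (u $ j * v $ l) * (X i \<omega> $ j * X i \<omega> $ l) \<partial>M)"
    by (intro sum.cong refl Bochner_Integration.integral_sum) (use integrable_Xjl i in \<open>auto intro!: integrable_mult_right\<close>)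
  also have "\<dots> = (\<Sum>j<p. \<Sum>l<p. (u $ j * v $ l) * S $$ (j, l))"
    using cov_Xj[OF i] by simp
  also have "\<dots> = bform p (\<lambda>j l. S $$ (j, l)) (\<lambda>j. u $ j) (\<lambda>j. v $ j)"
    by (simp add: bform_def mult_ac)
  also have "\<dots> = u \<bullet> (S *\<^sub>v v)"
    using i by (subst quad_form_eq_bform[OF S_carrier u v]) auto
  finally show ?thesis .
qed

lemma chernoff_Xe:
  assumes f: "\<And>i. i < n \<Longrightarrow> f i \<in> borel_measurable (obs_space p)"
    and mgf: "\<And>i. i < n \<Longrightarrow> (\<integral>\<^sup>+\<omega>. exp (f i (X i \<omega>, e i \<omega>) :: real) \<partial>M) \<le> ennreal (exp b)"
  shows "prob {\<omega> \<in> space M. (\<Sum>i<n. f i (X i \<omega>, e i \<omega>)) \<ge> real n * b + t} \<le> exp (- t)"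
  by (rule indep_vars_chernoff[OF indep_Xe f mgf])

lemma ufst_measurable: "u \<in> carrier_vec p \<Longrightarrow> (\<lambda>z. u \<bullet> fst z) \<in> borel_measurable (obs_space p)"
  by (rule borel_measurable_scalar_prod_const[OF _ measurable_fst])

lemma sum_uX_measurable:
  "u \<in> carrier_vec p \<Longrightarrow> v \<in> carrier_vec p \<Longrightarrow>
    (\<lambda>\<omega>. \<Sum>i<n. (u \<bullet> X i \<omega>) * (v \<bullet> X i \<omega>)) \<in> borel_measurable M"
  "u \<in> carrier_vec p \<Longrightarrow> (\<lambda>\<omega>. \<Sum>i<n. (u \<bullet> X i \<omega>)\<^sup>2) \<in> borel_measurable M"
  "u \<in> carrier_vec p \<Longrightarrow> (\<lambda>\<omega>. \<Sum>i<n. (u \<bullet> X i \<omega>) * e i \<omega>) \<in> borel_measurable M"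
  "(\<lambda>\<omega>. \<Sum>i<n. (e i \<omega>)\<^sup>2) \<in> borel_measurable M"
  by (intro borel_measurable_sum borel_measurable_times borel_measurable_power uX_measurable e_measurable; simp)+

lemma exp_1_ge_2: "ennreal 2 \<le> ennreal (exp 1)"
  using exp_ge_add_one_self[of 1] by (intro ennreal_leI) simp

lemma norm_l2_eq_0: "u \<in> carrier_vec p \<Longrightarrow> norm_l2 u = 0 \<Longrightarrow> i < n \<Longrightarrow> \<omega> \<in> space M \<Longrightarrow> u \<bullet> X i \<omega> = 0"
proof -
  assume u: "u \<in> carrier_vec p" "norm_l2 u = 0" and i: "i < n" "\<omega> \<in> space M"
  have "(\<Sum>j<p. u $ j * u $ j) = 0"
    using norm_l2_sq[OF u(1)] u by (simp add: scalar_prod_lessThan)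
  then have "\<forall>j<p. u $ j = 0" by (simp add: sum_nonneg_eq_0_iff)
  then show ?thesis by (simp add: uX_sum[OF i])
qed

text \<open>At scale \<tau> times the norm of \<open>u\<close>, the exponential moment of a squared
  term is at most 2, hence at most e, and Chernoff runs with log moment 1 per observation. The zero
  direction is separate because of the normalisation.\<close>

lemma prob_sum_uX_sq:
  assumes u: "u \<in> carrier_vec p"
  shows "prob {\<omega> \<in> space M. (\<Sum>i<n. (u \<bullet> X i \<omega>)\<^sup>2) > \<tau>\<^sup>2 * (u \<bullet> u) * (real n + t)} \<le> exp (- t)"
proof (cases "norm_l2 u = 0")
  case True
  then have "u \<bullet> u = 0" using norm_l2_sq[OF u] by simp
  moreover have "(\<Sum>i<n. (u \<bullet> X i \<omega>)\<^sup>2) = 0" if "\<omega> \<in> space M" for \<omega>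
    using norm_l2_eq_0[OF u True _ that] by simp
  ultimately have "{\<omega> \<in> space M. (\<Sum>i<n. (u \<bullet> X i \<omega>)\<^sup>2) > \<tau>\<^sup>2 * (u \<bullet> u) * (real n + t)} = {}" by auto
  then show ?thesis by (simp only: measure_empty exp_ge_zero)
next
  case False
  then have r: "norm_l2 u > 0" using norm_l2_nonneg[OF u] by simp
  let ?f = "\<lambda>z :: rvec \<times> real. (u \<bullet> fst z)\<^sup>2 / (\<tau> * norm_l2 u)\<^sup>2"
  have "prob {\<omega> \<in> space M. (\<Sum>i<n. ?f (X i \<omega>, e i \<omega>)) \<ge> real n * 1 + t} \<le> exp (- t)"
  proof (rule chernoff_Xe)
    show "?f \<in> borel_measurable (obs_space p)"
      using ufst_measurable[OF u] by simp
    show "(\<integral>\<^sup>+\<omega>. exp (?f (X i \<omega>, e i \<omega>)) \<partial>M) \<le> ennreal (exp 1)" if "i < n" for i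
      unfolding fst_conv by (rule order_trans[OF subX[OF that u False] exp_1_ge_2])
  qed
  moreover have "prob {\<omega> \<in> space M. (\<Sum>i<n. (u \<bullet> X i \<omega>)\<^sup>2) > \<tau>\<^sup>2 * (u \<bullet> u) * (real n + t)}
      \<le> prob {\<omega> \<in> space M. (\<Sum>i<n. ?f (X i \<omega>, e i \<omega>)) \<ge> real n * 1 + t}"
  proof (rule finite_measure_mono)
    have "(\<Sum>i<n. ?f (X i \<omega>, e i \<omega>)) = (\<Sum>i<n. (u \<bullet> X i \<omega>)\<^sup>2) / (\<tau>\<^sup>2 * (u \<bullet> u))" for \<omega>
      by (simp add: sum_divide_distrib power_mult_distrib norm_l2_sq[OF u])
    moreover have "\<tau>\<^sup>2 * (u \<bullet> u) > 0" using tau r norm_l2_sq[OF u, symmetric] by simp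
    ultimately show "{\<omega> \<in> space M. (\<Sum>i<n. (u \<bullet> X i \<omega>)\<^sup>2) > \<tau>\<^sup>2 * (u \<bullet> u) * (real n + t)}
      \<subseteq> {\<omega> \<in> space M. (\<Sum>i<n. ?f (X i \<omega>, e i \<omega>)) \<ge> real n * 1 + t}"
      by (auto simp: pos_le_divide_eq mult_ac)
    have "(\<lambda>\<omega>. \<Sum>i<n. ?f (X i \<omega>, e i \<omega>)) \<in> borel_measurable M"
      unfolding fst_conv by (intro borel_measurable_sum borel_measurable_divide borel_measurable_power uX_measurable u) auto
    then show "{\<omega> \<in> space M. (\<Sum>i<n. ?f (X i \<omega>, e i \<omega>)) \<ge> real n * 1 + t} \<in> events"
      by measurable
  qed
  ultimately show ?thesis by linarith
qed

lemma prob_sum_e_sq: "prob {\<omega> \<in> space M. (\<Sum>i<n. (e i \<omega>)\<^sup>2) > \<tau>\<^sup>2 * (real n + t)} \<le> exp (- t)"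
proof -
  let ?f = "\<lambda>z :: rvec \<times> real. (snd z)\<^sup>2 / \<tau>\<^sup>2"
  have "prob {\<omega> \<in> space M. (\<Sum>i<n. ?f (X i \<omega>, e i \<omega>)) \<ge> real n * 1 + t} \<le> exp (- t)"
  proof (rule chernoff_Xe)
    show "?f \<in> borel_measurable (obs_space p)" by measurable
    show "(\<integral>\<^sup>+\<omega>. exp (?f (X i \<omega>, e i \<omega>)) \<partial>M) \<le> ennreal (exp 1)" if "i < n" for i
      unfolding snd_conv by (rule order_trans[OF sube[OF that] exp_1_ge_2])
  qed
  moreover have "prob {\<omega> \<in> space M. (\<Sum>i<n. (e i \<omega>)\<^sup>2) > \<tau>\<^sup>2 * (real n + t)}
      \<le> prob {\<omega> \<in> space M. (\<Sum>i<n. ?f (X i \<omega>, e i \<omega>)) \<ge> real n * 1 + t}"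
  proof (rule finite_measure_mono)
    have "(\<Sum>i<n. ?f (X i \<omega>, e i \<omega>)) = (\<Sum>i<n. (e i \<omega>)\<^sup>2) / \<tau>\<^sup>2" for \<omega>
      by (simp add: sum_divide_distrib)
    moreover have "\<tau>\<^sup>2 > 0" using tau by simp
    ultimately show "{\<omega> \<in> space M. (\<Sum>i<n. (e i \<omega>)\<^sup>2) > \<tau>\<^sup>2 * (real n + t)}
      \<subseteq> {\<omega> \<in> space M. (\<Sum>i<n. ?f (X i \<omega>, e i \<omega>)) \<ge> real n * 1 + t}"
      by (auto simp: pos_le_divide_eq mult_ac)
    have "(\<lambda>\<omega>. \<Sum>i<n. ?f (X i \<omega>, e i \<omega>)) \<in> borel_measurable M"
      unfolding snd_conv by (intro borel_measurable_sum borel_measurable_divide borel_measurable_power e_measurable) auto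
    then show "{\<omega> \<in> space M. (\<Sum>i<n. ?f (X i \<omega>, e i \<omega>)) \<ge> real n * 1 + t} \<in> events"
      by measurable
  qed
  ultimately show ?thesis by linarith
qed

text \<open>Bernstein's inequality for products of two linear forms. The range of \<open>t\<close>
  is exactly the one in which the optimal exponential parameter satisfies |s| a b \<le> 1/2.\<close>

lemma prob_cross_dev_one_sided:
  assumes u: "u \<in> carrier_vec p" "norm_l2 u > 0" and v: "v \<in> carrier_vec p" "norm_l2 v > 0"
    and t: "0 \<le> t" "t \<le> 8 * \<tau>\<^sup>2" and sg: "\<sigma> \<in> {1, -1 :: real}"
  shows "prob {\<omega> \<in> space M. \<sigma> * ((\<Sum>i<n. (u \<bullet> X i \<omega>) * (v \<bullet> X i \<omega>)) - real n * (u \<bullet> (S *\<^sub>v v)))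
      > real n * t * norm_l2 u * norm_l2 v} \<le> exp (- real n * t\<^sup>2 / (32 * \<tau>^4))"
proof -
  define a where "a = \<tau> * norm_l2 u"
  define b where "b = \<tau> * norm_l2 v"
  have ab: "a > 0" "b > 0" using u v tau by (simp_all add: a_def b_def)
  \<comment> \<open>Optimal choice: with y = |s| a b the exponent per observation is y t / \<tau>^2
    - 8 y^2, largest at y = t / (16 \<tau>^2) with value t^2 / (32 \<tau>^4).\<close>
  define s where "s = \<sigma> * t / (16 * \<tau>\<^sup>2 * (a * b))"
  define s' where "s' = t / (16 * \<tau>\<^sup>2 * (a * b))"
  have s's: "s = \<sigma> * s'" by (simp add: s_def s'_def)
  have s'0: "s' \<ge> 0" using t ab tau by (simp add: s'_def)
  have abs_s: "\<bar>s\<bar> = s'" using sg s'0 by (auto simp: s's)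
  have sab: "s' * (a * b) = t / (16 * \<tau>\<^sup>2)" using ab by (simp add: s'_def)
  have s2: "s\<^sup>2 * (a * b)\<^sup>2 = (t / (16 * \<tau>\<^sup>2))\<^sup>2"
    using sg by (auto simp: s's power_mult_distrib sab[symmetric])
  define m where "m = u \<bullet> (S *\<^sub>v v)"
  define \<beta> where "\<beta> = 8 * s\<^sup>2 * (a * b)\<^sup>2"
  have \<beta>: "\<beta> = t\<^sup>2 / (32 * \<tau>^4)"
    unfolding \<beta>_def mult.assoc s2 by (simp add: power_divide power_mult_distrib flip: power_mult)
  let ?f = "\<lambda>z :: rvec \<times> real. s * ((u \<bullet> fst z) * (v \<bullet> fst z) - m)"
  \<comment> \<open>The threshold contains \<open>\<beta>\<close> twice per observation: one copy
    pays for the log moment, the other is the exponent of the tail.\<close>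
  have "prob {\<omega> \<in> space M. (\<Sum>i<n. ?f (X i \<omega>, e i \<omega>)) \<ge> real n * \<beta> + real n * \<beta>} \<le> exp (- (real n * \<beta>))"
  proof (rule chernoff_Xe)
    show "?f \<in> borel_measurable (obs_space p)"
      using ufst_measurable[OF u(1)] ufst_measurable[OF v(1)] by simp
    fix i assume i: "i < n"
    have "\<bar>s\<bar> * (a * b) \<le> 1 / 2" unfolding abs_s sab using t tau by (simp add: field_simps)
    from subgaussian_product_mgf(2)[OF uX_measurable[OF i u(1)] uX_measurable[OF i v(1)] ab _ _ this]
    show "(\<integral>\<^sup>+\<omega>. exp (?f (X i \<omega>, e i \<omega>)) \<partial>M) \<le> ennreal (exp \<beta>)"
      using subX[OF i u(1)] subX[OF i v(1)] u(2) v(2)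
      by (simp add: a_def b_def cov_uX[OF i v(1) u(1)] m_def \<beta>_def)
  qed
  moreover have "prob {\<omega> \<in> space M. \<sigma> * ((\<Sum>i<n. (u \<bullet> X i \<omega>) * (v \<bullet> X i \<omega>)) - real n * m)
      > real n * t * norm_l2 u * norm_l2 v}
    \<le> prob {\<omega> \<in> space M. (\<Sum>i<n. ?f (X i \<omega>, e i \<omega>)) \<ge> real n * \<beta> + real n * \<beta>}"
  proof (rule finite_measure_mono)
    have sumf: "(\<Sum>i<n. ?f (X i \<omega>, e i \<omega>)) = s * ((\<Sum>i<n. (u \<bullet> X i \<omega>) * (v \<bullet> X i \<omega>)) - real n * m)" for \<omega>
      by (simp add: sum_subtractf flip: sum_distrib_left)
    have key: "s' * (real n * t * norm_l2 u * norm_l2 v) = real n * \<beta> + real n * \<beta>"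
    proof -
      have "s' * (norm_l2 u * norm_l2 v) = s' * (a * b) / \<tau>\<^sup>2"
        using tau by (simp add: a_def b_def power2_eq_square)
      also have "\<dots> = t / (16 * \<tau>^4)" by (simp add: sab flip: power_add)
      finally have "real n * t * (s' * (norm_l2 u * norm_l2 v)) = real n * t * (t / (16 * \<tau>^4))" by simp
      then show ?thesis by (simp add: \<beta> power2_eq_square mult_ac)
    qed
    show "{\<omega> \<in> space M. \<sigma> * ((\<Sum>i<n. (u \<bullet> X i \<omega>) * (v \<bullet> X i \<omega>)) - real n * m)
      > real n * t * norm_l2 u * norm_l2 v}
      \<subseteq> {\<omega> \<in> space M. (\<Sum>i<n. ?f (X i \<omega>, e i \<omega>)) \<ge> real n * \<beta> + real n * \<beta>}"
    proof clarify
      fix \<omega> assume "\<sigma> * ((\<Sum>i<n. (u \<bullet> X i \<omega>) * (v \<bullet> X i \<omega>)) - real n * m) > real n * t * norm_l2 u * norm_l2 v"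
      then have "s' * (real n * t * norm_l2 u * norm_l2 v)
          \<le> s' * (\<sigma> * ((\<Sum>i<n. (u \<bullet> X i \<omega>) * (v \<bullet> X i \<omega>)) - real n * m))"
        by (intro mult_left_mono s'0) simp
      then have "real n * \<beta> + real n * \<beta> \<le> s * ((\<Sum>i<n. (u \<bullet> X i \<omega>) * (v \<bullet> X i \<omega>)) - real n * m)"
        unfolding key s's by (simp only: mult_ac)
      then have "real n * \<beta> + real n * \<beta> \<le> (\<Sum>i<n. ?f (X i \<omega>, e i \<omega>))"
        unfolding sumf .
      then show "(\<Sum>i<n. ?f (X i \<omega>, e i \<omega>)) \<ge> real n * \<beta> + real n * \<beta>" by simp
    qed
    have "(\<lambda>\<omega>. \<Sum>i<n. ?f (X i \<omega>, e i \<omega>)) \<in> borel_measurable M"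
      unfolding sumf using sum_uX_measurable(1)[OF u(1) v(1)] by simp
    then show "{\<omega> \<in> space M. (\<Sum>i<n. ?f (X i \<omega>, e i \<omega>)) \<ge> real n * \<beta> + real n * \<beta>} \<in> events"
      by measurable
  qed
  ultimately show ?thesis by (simp add: \<beta> m_def)
qed

lemma two_sided_measurable:
  assumes "f \<in> borel_measurable M"
  shows "{\<omega> \<in> space M. f \<omega> > (c::real)} \<in> events" "{\<omega> \<in> space M. \<bar>f \<omega>\<bar> > c} \<in> events"
  using assms by measurable

lemma prob_two_sided:
  assumes [measurable]: "f \<in> borel_measurable M"
    and "prob {\<omega> \<in> space M. 1 * f \<omega> > c} \<le> q" "prob {\<omega> \<in> space M. (-1) * f \<omega> > (c::real)} \<le> q"
  shows "prob {\<omega> \<in> space M. \<bar>f \<omega>\<bar> > c} \<le> 2 * q"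
proof -
  have "prob {\<omega> \<in> space M. \<bar>f \<omega>\<bar> > c}
      \<le> prob ({\<omega> \<in> space M. 1 * f \<omega> > c} \<union> {\<omega> \<in> space M. (-1) * f \<omega> > c})"
    by (intro finite_measure_mono) auto
  also have "\<dots> \<le> prob {\<omega> \<in> space M. 1 * f \<omega> > c} + prob {\<omega> \<in> space M. (-1) * f \<omega> > c}"
    by (intro measure_Un_le) auto
  finally show ?thesis using assms by linarith
qed

lemma prob_cross_dev:
  assumes u: "u \<in> carrier_vec p" and v: "v \<in> carrier_vec p"
    and t: "0 \<le> t" "t \<le> 8 * \<tau>\<^sup>2"
  shows "prob {\<omega> \<in> space M. \<bar>(\<Sum>i<n. (u \<bullet> X i \<omega>) * (v \<bullet> X i \<omega>)) - real n * (u \<bullet> (S *\<^sub>v v))\<bar>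
      > real n * t * norm_l2 u * norm_l2 v} \<le> 2 * exp (- real n * t\<^sup>2 / (32 * \<tau>^4))"
proof (cases "norm_l2 u = 0 \<or> norm_l2 v = 0")
  case False
  then have pos: "norm_l2 u > 0" "norm_l2 v > 0"
    using norm_l2_nonneg[OF u] norm_l2_nonneg[OF v] by auto
  show ?thesis
    by (intro prob_two_sided prob_cross_dev_one_sided u v t pos)
       (use sum_uX_measurable(1)[OF u v] in auto)
next
  case True
  have z: "(\<Sum>i<n. (u \<bullet> X i \<omega>) * (v \<bullet> X i \<omega>)) = 0" if "\<omega> \<in> space M" for \<omega>
    using True norm_l2_eq_0[OF u _ _ that] norm_l2_eq_0[OF v _ _ that] by (intro sum.neutral) auto
  \<comment> \<open>The centring term is a mean of the product, so it vanishes with the product. For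
    \<open>n = 0\<close> there is no observation to read the covariance from, and the factor
    \<open>real n\<close> is zero.\<close>
  have "real n * (u \<bullet> (S *\<^sub>v v)) = 0"
  proof (cases "n = 0")
    case False
    then have "u \<bullet> (S *\<^sub>v v) = (\<integral>\<omega>. (u \<bullet> X 0 \<omega>) * (v \<bullet> X 0 \<omega>) \<partial>M)" using cov_uX[OF _ v u, of 0] by simp
    also have "\<dots> = (\<integral>\<omega>. 0 \<partial>M)"
      using True norm_l2_eq_0[OF u, of 0] norm_l2_eq_0[OF v, of 0] False
      by (intro Bochner_Integration.integral_cong) auto
    finally show ?thesis by simp
  qed simp
  then have "{\<omega> \<in> space M. \<bar>(\<Sum>i<n. (u \<bullet> X i \<omega>) * (v \<bullet> X i \<omega>)) - real n * (u \<bullet> (S *\<^sub>v v))\<bar>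
      > real n * t * norm_l2 u * norm_l2 v} = {}"
    using True by (auto simp: z)
  then show ?thesis by (simp only: measure_empty) simp
qed

text \<open>
  Subtracting the conditional log-moment-generating function of the noise makes the exponential
  moment at most one without any bound on the noise, so that no condition on \<open>ln p / n\<close> is needed.
\<close>

lemma noise_mgf:
  assumes i: "i < n" and u: "u \<in> carrier_vec p" "norm_l2 u > 0"
  shows "(\<integral>\<^sup>+\<omega>. exp (s * ((u \<bullet> X i \<omega>) * e i \<omega>) - 4 * s\<^sup>2 * (\<tau> * norm_l2 u)\<^sup>2 * (e i \<omega>)\<^sup>2) \<partial>M) \<le> 1"
proof -
  define a where "a = \<tau> * norm_l2 u"
  have a: "a > 0" using u tau by (simp add: a_def)
  have ind: "indep_rv M (borel_vec p) (X i) borel (e i)" using model i by (simp add: design_noise_def)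
  let ?f = "\<lambda>z :: rvec \<times> real. ennreal (exp (s * ((u \<bullet> fst z) * snd z) - 4 * s\<^sup>2 * a\<^sup>2 * (snd z)\<^sup>2))"
  have f: "?f \<in> borel_measurable (borel_vec p \<Otimes>\<^sub>M borel)"
    using ufst_measurable[OF u(1)] by simp
  have "(\<integral>\<^sup>+\<omega>. exp (s * ((u \<bullet> X i \<omega>) * e i \<omega>) - 4 * s\<^sup>2 * a\<^sup>2 * (e i \<omega>)\<^sup>2) \<partial>M)
      = (\<integral>\<^sup>+\<omega>. ?f (X i \<omega>, e i \<omega>) \<partial>M)" by simp
  also have "\<dots> = (\<integral>\<^sup>+\<omega>. (\<integral>\<^sup>+\<omega>'. ?f (X i \<omega>', e i \<omega>) \<partial>M) \<partial>M)"
    by (rule indep_rv_nn_integral(1)[OF prob_space_axioms ind f])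
  also have "\<dots> \<le> (\<integral>\<^sup>+\<omega>. 1 \<partial>M)"
  proof (rule nn_integral_mono)
    fix \<omega>
    define y where "y = e i \<omega>"
    have "(\<integral>\<^sup>+\<omega>'. ?f (X i \<omega>', e i \<omega>) \<partial>M)
        = (\<integral>\<^sup>+\<omega>'. ennreal (exp (- 4 * s\<^sup>2 * a\<^sup>2 * y\<^sup>2)) * ennreal (exp ((s * y) * (u \<bullet> X i \<omega>'))) \<partial>M)"
      by (intro nn_integral_cong) (simp add: y_def mult_ac flip: ennreal_mult exp_add)
    also have "\<dots> = exp (- 4 * s\<^sup>2 * a\<^sup>2 * y\<^sup>2) * (\<integral>\<^sup>+\<omega>'. exp ((s * y) * (u \<bullet> X i \<omega>')) \<partial>M)"
      using uX_measurable[OF i u(1)] by (intro nn_integral_cmult) simp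
    also have "\<dots> \<le> ennreal (exp (- 4 * s\<^sup>2 * a\<^sup>2 * y\<^sup>2)) * ennreal (exp (4 * (s * y)\<^sup>2 * a\<^sup>2))"
      using subX[OF i u(1)] u(2)
      by (intro mult_left_mono subgaussian_mgf uX_measurable i u(1) a mean_uX) (auto simp: a_def)
    also have "\<dots> = 1" by (simp add: power_mult_distrib mult_ac flip: ennreal_mult exp_add)
    finally show "(\<integral>\<^sup>+\<omega>'. ?f (X i \<omega>', e i \<omega>) \<partial>M) \<le> 1" .
  qed
  also have "\<dots> = 1" by (simp add: emeasure_space_1)
  finally show ?thesis by (simp add: a_def)
qed

text \<open>The compensator of \<open>noise_mgf\<close> is a multiple of the noise energy and thus
  bounded when the energy is. The energy bound is part of the event, so that its failure is paid for
  once and not in every union over directions.\<close>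

lemma prob_noise_one_sided:
  assumes u: "u \<in> carrier_vec p" "norm_l2 u > 0" and n: "n > 0" and t: "t \<ge> 0" and sg: "\<sigma> \<in> {1, -1 :: real}"
  shows "prob {\<omega> \<in> space M. \<sigma> * (\<Sum>i<n. (u \<bullet> X i \<omega>) * e i \<omega>) > t * norm_l2 u
      \<and> (\<Sum>i<n. (e i \<omega>)\<^sup>2) \<le> 2 * \<tau>\<^sup>2 * real n} \<le> exp (- t\<^sup>2 / (32 * \<tau>^4 * real n))"
proof -
  define r where "r = norm_l2 u"
  \<comment> \<open>Maximises s' t r - 8 \<tau>^4 n (s' r)^2; the maximum is t^2 / (32 \<tau>^4
    n).\<close>
  define s' where "s' = t / (16 * \<tau>^4 * real n * r)"
  define s where "s = \<sigma> * s'"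
  have r: "r > 0" using u by (simp add: r_def)
  have s'0: "s' \<ge> 0" using t r tau by (simp add: s'_def)
  have ss: "s\<^sup>2 = s'\<^sup>2" using sg by (auto simp: s_def power_mult_distrib)
  define T where "T = t\<^sup>2 / (32 * \<tau>^4 * real n)"
  let ?f = "\<lambda>z :: rvec \<times> real. s * ((u \<bullet> fst z) * snd z) - 4 * s\<^sup>2 * (\<tau> * r)\<^sup>2 * (snd z)\<^sup>2"
  have "prob {\<omega> \<in> space M. (\<Sum>i<n. ?f (X i \<omega>, e i \<omega>)) \<ge> real n * 0 + T} \<le> exp (- T)"
  proof (rule chernoff_Xe)
    show "?f \<in> borel_measurable (obs_space p)"
      using ufst_measurable[OF u(1)] by simp
    show "(\<integral>\<^sup>+\<omega>. exp (?f (X i \<omega>, e i \<omega>)) \<partial>M) \<le> ennreal (exp 0)" if "i < n" for i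
      using noise_mgf[OF that u] by (simp add: r_def)
  qed
  moreover have "prob {\<omega> \<in> space M. \<sigma> * (\<Sum>i<n. (u \<bullet> X i \<omega>) * e i \<omega>) > t * r
      \<and> (\<Sum>i<n. (e i \<omega>)\<^sup>2) \<le> 2 * \<tau>\<^sup>2 * real n}
    \<le> prob {\<omega> \<in> space M. (\<Sum>i<n. ?f (X i \<omega>, e i \<omega>)) \<ge> real n * 0 + T}"
  proof (rule finite_measure_mono)
    have sumf: "(\<Sum>i<n. ?f (X i \<omega>, e i \<omega>)) = s * (\<Sum>i<n. (u \<bullet> X i \<omega>) * e i \<omega>)
        - 4 * s\<^sup>2 * (\<tau> * r)\<^sup>2 * (\<Sum>i<n. (e i \<omega>)\<^sup>2)" for \<omega>
      by (simp add: sum_subtractf sum_distrib_left)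
    have key: "s' * (t * r) - 4 * s'\<^sup>2 * (\<tau> * r)\<^sup>2 * (2 * \<tau>\<^sup>2 * real n) = T"
    proof -
      have 1: "s' * r = t / (16 * \<tau>^4 * real n)" using r by (simp add: s'_def)
      have "s' * (t * r) - 4 * s'\<^sup>2 * (\<tau> * r)\<^sup>2 * (2 * \<tau>\<^sup>2 * real n)
          = t * (s' * r) - 8 * \<tau>^4 * real n * (s' * r)\<^sup>2"
        by (simp add: power_mult_distrib power2_eq_square power4_eq_xxxx algebra_simps)
      also have "\<dots> = T" unfolding 1 T_def using n tau by (simp add: power2_eq_square field_simps)
      finally show ?thesis .
    qed
    show "{\<omega> \<in> space M. \<sigma> * (\<Sum>i<n. (u \<bullet> X i \<omega>) * e i \<omega>) > t * r
      \<and> (\<Sum>i<n. (e i \<omega>)\<^sup>2) \<le> 2 * \<tau>\<^sup>2 * real n}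
      \<subseteq> {\<omega> \<in> space M. (\<Sum>i<n. ?f (X i \<omega>, e i \<omega>)) \<ge> real n * 0 + T}"
    proof clarify
      fix \<omega> assume 1: "\<sigma> * (\<Sum>i<n. (u \<bullet> X i \<omega>) * e i \<omega>) > t * r"
        and 2: "(\<Sum>i<n. (e i \<omega>)\<^sup>2) \<le> 2 * \<tau>\<^sup>2 * real n"
      have "s' * (t * r) \<le> s' * (\<sigma> * (\<Sum>i<n. (u \<bullet> X i \<omega>) * e i \<omega>))"
        using 1 by (intro mult_left_mono s'0) simp
      moreover have "4 * s'\<^sup>2 * (\<tau> * r)\<^sup>2 * (\<Sum>i<n. (e i \<omega>)\<^sup>2) \<le> 4 * s'\<^sup>2 * (\<tau> * r)\<^sup>2 * (2 * \<tau>\<^sup>2 * real n)"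
        by (intro mult_left_mono 2) simp
      ultimately have "T \<le> s' * (\<sigma> * (\<Sum>i<n. (u \<bullet> X i \<omega>) * e i \<omega>)) - 4 * s'\<^sup>2 * (\<tau> * r)\<^sup>2 * (\<Sum>i<n. (e i \<omega>)\<^sup>2)"
        using key by linarith
      then have "T \<le> s * (\<Sum>i<n. (u \<bullet> X i \<omega>) * e i \<omega>) - 4 * s\<^sup>2 * (\<tau> * r)\<^sup>2 * (\<Sum>i<n. (e i \<omega>)\<^sup>2)"
        unfolding ss by (simp only: s_def mult_ac)
      then have "real n * 0 + T \<le> (\<Sum>i<n. ?f (X i \<omega>, e i \<omega>))"
        unfolding sumf by simp
      then show "(\<Sum>i<n. ?f (X i \<omega>, e i \<omega>)) \<ge> real n * 0 + T" by simp
    qed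
    have "(\<lambda>\<omega>. \<Sum>i<n. ?f (X i \<omega>, e i \<omega>)) \<in> borel_measurable M"
      unfolding sumf using sum_uX_measurable(3)[OF u(1)] sum_uX_measurable(4) by simp
    then show "{\<omega> \<in> space M. (\<Sum>i<n. ?f (X i \<omega>, e i \<omega>)) \<ge> real n * 0 + T} \<in> events"
      by measurable
  qed
  ultimately show ?thesis by (simp add: T_def r_def)
qed

lemma prob_noise:
  assumes u: "u \<in> carrier_vec p" and n: "n > 0" and t: "t \<ge> 0"
  shows "prob {\<omega> \<in> space M. \<bar>\<Sum>i<n. (u \<bullet> X i \<omega>) * e i \<omega>\<bar> > t * norm_l2 u
      \<and> (\<Sum>i<n. (e i \<omega>)\<^sup>2) \<le> 2 * \<tau>\<^sup>2 * real n} \<le> 2 * exp (- t\<^sup>2 / (32 * \<tau>^4 * real n))"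
proof (cases "norm_l2 u = 0")
  case True
  then have "{\<omega> \<in> space M. \<bar>\<Sum>i<n. (u \<bullet> X i \<omega>) * e i \<omega>\<bar> > t * norm_l2 u
      \<and> (\<Sum>i<n. (e i \<omega>)\<^sup>2) \<le> 2 * \<tau>\<^sup>2 * real n} = {}"
    using norm_l2_eq_0[OF u True] by auto
  then show ?thesis by (simp only: measure_empty) simp
next
  case False
  then have r: "norm_l2 u > 0" using norm_l2_nonneg[OF u] by simp
  let ?A = "\<lambda>\<sigma>. {\<omega> \<in> space M. \<sigma> * (\<Sum>i<n. (u \<bullet> X i \<omega>) * e i \<omega>) > t * norm_l2 u
      \<and> (\<Sum>i<n. (e i \<omega>)\<^sup>2) \<le> 2 * \<tau>\<^sup>2 * real n}"
  note [measurable] = sum_uX_measurable(3)[OF u] sum_uX_measurable(4)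
  have "prob {\<omega> \<in> space M. \<bar>\<Sum>i<n. (u \<bullet> X i \<omega>) * e i \<omega>\<bar> > t * norm_l2 u
      \<and> (\<Sum>i<n. (e i \<omega>)\<^sup>2) \<le> 2 * \<tau>\<^sup>2 * real n} \<le> prob (?A 1 \<union> ?A (-1))"
    by (intro finite_measure_mono) auto
  also have "\<dots> \<le> prob (?A 1) + prob (?A (-1))"
    by (intro measure_Un_le) auto
  also have "\<dots> \<le> 2 * exp (- t\<^sup>2 / (32 * \<tau>^4 * real n))"
    using prob_noise_one_sided[OF u r n t, of 1] prob_noise_one_sided[OF u r n t, of "-1"] by simp
  finally show ?thesis .
qed

end

section \<open>Least squares and LASSO\<close>

text \<open>Young's inequality; with the weight 1/4, two uses in \<open>ols_prediction_bound\<close>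
  leave half of the energy on the left.\<close>

lemma mult_le_quarter_plus: "c > 0 \<Longrightarrow> a * t \<le> c / 4 * a\<^sup>2 + t\<^sup>2 / (c :: real)"
proof -
  assume c: "c > 0"
  have "0 \<le> (c * a / 2 - t)\<^sup>2 / c" using c by simp
  also have "\<dots> = c / 4 * a\<^sup>2 + t\<^sup>2 / c - a * t" using c by (simp add: power2_eq_square field_simps)
  finally show ?thesis by simp
qed

lemma square_sum_le: "(a + b)\<^sup>2 \<le> 2 * a\<^sup>2 + 2 * (b :: real)\<^sup>2"
  using sum_squares_bound[of a b] by (simp add: power2_sum)

text \<open>By the normal equations the energy Q of the fitted error is its product with the noise
  \<open>\<xi>\<close> minus its product with the bias \<open>u\<close>. Rewritten in coefficients,
  the noise part meets only the score of dimension \<open>K\<close>, and the Gram bound turns the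
  squared coefficients back into Q.\<close>

lemma ols_prediction_bound:
  fixes Z :: "nat \<Rightarrow> nat \<Rightarrow> real"
  assumes c: "c > 0"
    and gram: "c * (\<Sum>k<K. (a k)\<^sup>2) \<le> (\<Sum>i<n::nat. (\<Sum>k<K. a k * Z i k)\<^sup>2)"
    and normal: "(\<Sum>i<n. (\<Sum>k<K. a k * Z i k) * (\<xi> i - (\<Sum>k<K. a k * Z i k) - u i)) = 0"
  shows "(\<Sum>i<n. (\<Sum>k<K. a k * Z i k)\<^sup>2)
    \<le> 2 / c * (\<Sum>k<K. (\<Sum>i<n. Z i k * \<xi> i)\<^sup>2) + 2 * (\<Sum>i<n. (u i)\<^sup>2)"
proof -
  define q where "q i = (\<Sum>k<K. a k * Z i k)" for i
  define T where "T k = (\<Sum>i<n. Z i k * \<xi> i)" for k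
  define Q where "Q = (\<Sum>i<n. (q i)\<^sup>2)"
  have "0 = (\<Sum>i<n. q i * \<xi> i - (q i)\<^sup>2 - q i * u i)"
    using normal by (simp add: q_def[symmetric] right_diff_distrib power2_eq_square)
  then have "Q = (\<Sum>i<n. q i * \<xi> i) + (\<Sum>i<n. - q i * u i)"
    by (simp add: sum_subtractf Q_def sum_negf)
  also have "(\<Sum>i<n. q i * \<xi> i) = (\<Sum>k<K. a k * T k)"
  proof -
    have "(\<Sum>i<n. q i * \<xi> i) = (\<Sum>i<n. \<Sum>k<K. a k * (Z i k * \<xi> i))"
      by (simp add: q_def sum_distrib_right mult.assoc)
    also have "\<dots> = (\<Sum>k<K. a k * T k)"
      by (subst sum.swap) (simp add: T_def sum_distrib_left)
    finally show ?thesis .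
  qed
  also have "(\<Sum>k<K. a k * T k) \<le> (\<Sum>k<K. c / 4 * (a k)\<^sup>2 + (T k)\<^sup>2 / c)"
    by (intro sum_mono mult_le_quarter_plus c)
  also have "\<dots> = c * (\<Sum>k<K. (a k)\<^sup>2) / 4 + (\<Sum>k<K. (T k)\<^sup>2) / c"
    by (simp add: sum.distrib sum_divide_distrib sum_distrib_left)
  also have "(\<Sum>i<n. - q i * u i) \<le> (\<Sum>i<n. 1 / 4 * (- q i)\<^sup>2 + (u i)\<^sup>2 / 1)"
    by (intro sum_mono mult_le_quarter_plus) simp
  also have "\<dots> = Q / 4 + (\<Sum>i<n. (u i)\<^sup>2)"
    by (simp add: sum.distrib Q_def sum_divide_distrib)
  finally have "Q \<le> c * (\<Sum>k<K. (a k)\<^sup>2) / 4 + (\<Sum>k<K. (T k)\<^sup>2) / c + (Q / 4 + (\<Sum>i<n. (u i)\<^sup>2))"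
    by simp
  moreover have "c * (\<Sum>k<K. (a k)\<^sup>2) \<le> Q" using gram by (simp add: Q_def q_def)
  ultimately have "Q \<le> 2 * ((\<Sum>k<K. (T k)\<^sup>2) / c) + 2 * (\<Sum>i<n. (u i)\<^sup>2)" by linarith
  then show ?thesis by (simp add: Q_def q_def T_def)
qed

lemma clear_denominator: "c > 0 \<Longrightarrow> a / c + x \<le> b / c + y \<Longrightarrow> a + c * x \<le> b + c * (y :: real)"
proof -
  assume c: "c > 0" and le: "a / c + x \<le> b / c + y"
  have "c * (a / c + x) \<le> c * (b / c + y)" using c le by (intro mult_left_mono) auto
  then show ?thesis using c by (simp add: distrib_left)
qed

text \<open>The minimiser is compared with \<delta>. Noise at half of \<open>lam\<close> leaves the
  l1 error with coefficient one against penalties with coefficient two; this imbalance creates the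
  cone condition.\<close>

lemma lasso_basic_inequality:
  fixes x :: "nat \<Rightarrow> nat \<Rightarrow> real" and \<delta> d :: "nat \<Rightarrow> real"
  assumes n: "n > 0" and lam: "lam > 0"
    and opt: "(\<Sum>i<n. (\<eta> i - (\<Sum>j<p. (d j - \<delta> j) * x i j))\<^sup>2) / (2 * real n) + lam * (\<Sum>j<p. \<bar>d j\<bar>)
      \<le> (\<Sum>i<n. (\<eta> i)\<^sup>2) / (2 * real n) + lam * (\<Sum>j<p. \<bar>\<delta> j\<bar>)"
    and noise: "\<And>j. j < p \<Longrightarrow> \<bar>\<Sum>i<n. x i j * \<eta> i\<bar> \<le> real n * lam / 2"
  defines "\<Delta> \<equiv> \<lambda>j. d j - \<delta> j"
  shows "(\<Sum>i<n. (\<Sum>j<p. \<Delta> j * x i j)\<^sup>2) / real n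
    \<le> lam * ((\<Sum>j<p. \<bar>\<Delta> j\<bar>) + 2 * (\<Sum>j<p. \<bar>\<delta> j\<bar>) - 2 * (\<Sum>j<p. \<bar>d j\<bar>))"
proof -
  define q where "q i = (\<Sum>j<p. \<Delta> j * x i j)" for i
  have "(\<Sum>i<n. (\<eta> i - q i)\<^sup>2) + 2 * real n * lam * (\<Sum>j<p. \<bar>d j\<bar>)
      \<le> (\<Sum>i<n. (\<eta> i)\<^sup>2) + 2 * real n * lam * (\<Sum>j<p. \<bar>\<delta> j\<bar>)"
    using clear_denominator[OF _ opt] n by (simp add: q_def \<Delta>_def mult.assoc)
  moreover have "(\<Sum>i<n. (\<eta> i - q i)\<^sup>2) = (\<Sum>i<n. (\<eta> i)\<^sup>2) - 2 * (\<Sum>i<n. q i * \<eta> i) + (\<Sum>i<n. (q i)\<^sup>2)"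
    by (simp add: power2_diff sum.distrib sum_subtractf sum_distrib_left mult_ac)
  moreover have "(\<Sum>i<n. q i * \<eta> i) \<le> real n * lam / 2 * (\<Sum>j<p. \<bar>\<Delta> j\<bar>)"
  proof -
    have "(\<Sum>i<n. q i * \<eta> i) = (\<Sum>i<n. \<Sum>j<p. \<Delta> j * (x i j * \<eta> i))"
      by (simp add: q_def sum_distrib_right mult.assoc)
    also have "\<dots> = (\<Sum>j<p. \<Delta> j * (\<Sum>i<n. x i j * \<eta> i))"
      by (subst sum.swap) (simp add: sum_distrib_left)
    also have "\<dots> \<le> (\<Sum>j<p. real n * lam / 2 * \<bar>\<Delta> j\<bar>)"
    proof (rule sum_mono)
      fix j assume "j \<in> {..<p}"
      then have "\<bar>\<Delta> j\<bar> * \<bar>\<Sum>i<n. x i j * \<eta> i\<bar> \<le> \<bar>\<Delta> j\<bar> * (real n * lam / 2)"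
        by (intro mult_left_mono noise) auto
      then show "\<Delta> j * (\<Sum>i<n. x i j * \<eta> i) \<le> real n * lam / 2 * \<bar>\<Delta> j\<bar>"
        using abs_ge_self[of "\<Delta> j * (\<Sum>i<n. x i j * \<eta> i)"] by (simp add: abs_mult mult.commute)
    qed
    finally show ?thesis by (simp add: sum_distrib_left)
  qed
  ultimately have "(\<Sum>i<n. (q i)\<^sup>2) \<le> real n * (lam * ((\<Sum>j<p. \<bar>\<Delta> j\<bar>) + 2 * (\<Sum>j<p. \<bar>\<delta> j\<bar>) - 2 * (\<Sum>j<p. \<bar>d j\<bar>)))"
    by (simp add: algebra_simps)
  then show ?thesis using n by (simp add: q_def field_simps)
qed

text \<open>Three readings of the basic inequality. Nonnegativity of its right-hand side gives an l1
  error of at most four times the l1 norm of \<delta>, which alone yields the first bound. A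
  restricted eigenvalue converts the prediction error into the second. On the cone, the loss
  \<open>D\<close> of \<open>gram_lower_bound\<close> is absorbed, which yields the third.\<close>

lemma lasso_error_bound:
  fixes x :: "nat \<Rightarrow> nat \<Rightarrow> real" and \<delta> d :: "nat \<Rightarrow> real"
  assumes n: "n > 0" and lam: "lam > 0"
    and opt: "(\<Sum>i<n. (\<eta> i - (\<Sum>j<p. (d j - \<delta> j) * x i j))\<^sup>2) / (2 * real n) + lam * (\<Sum>j<p. \<bar>d j\<bar>)
      \<le> (\<Sum>i<n. (\<eta> i)\<^sup>2) / (2 * real n) + lam * (\<Sum>j<p. \<bar>\<delta> j\<bar>)"
    and noise: "\<And>j. j < p \<Longrightarrow> \<bar>\<Sum>i<n. x i j * \<eta> i\<bar> \<le> real n * lam / 2"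
  defines "\<Delta> \<equiv> \<lambda>j. d j - \<delta> j"
  shows "(\<Sum>j<p. (\<Delta> j)\<^sup>2) \<le> 16 * (\<Sum>j<p. \<bar>\<delta> j\<bar>)\<^sup>2"
    and "c > 0 \<Longrightarrow> D \<ge> 0 \<Longrightarrow> c * (\<Sum>j<p. (\<Delta> j)\<^sup>2) - D * (\<Sum>j<p. \<bar>\<Delta> j\<bar>)\<^sup>2
        \<le> (\<Sum>i<n. (\<Sum>j<p. \<Delta> j * x i j)\<^sup>2) / real n \<Longrightarrow>
      (\<Sum>j<p. (\<Delta> j)\<^sup>2) \<le> (3 * lam * (\<Sum>j<p. \<bar>\<delta> j\<bar>) + 16 * D * (\<Sum>j<p. \<bar>\<delta> j\<bar>)\<^sup>2) / c"
    and "c > 0 \<Longrightarrow> D \<ge> 0 \<Longrightarrow> c * (\<Sum>j<p. (\<Delta> j)\<^sup>2) - D * (\<Sum>j<p. \<bar>\<Delta> j\<bar>)\<^sup>2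
        \<le> (\<Sum>i<n. (\<Sum>j<p. \<Delta> j * x i j)\<^sup>2) / real n \<Longrightarrow>
      s \<ge> 1 \<Longrightarrow> real (card {j. j < p \<and> \<delta> j \<noteq> 0}) \<le> s \<Longrightarrow> 16 * s * D \<le> c / 2 \<Longrightarrow>
      (\<Sum>j<p. (\<Delta> j)\<^sup>2) \<le> 36 * lam\<^sup>2 * s / c\<^sup>2"
proof -
  define E where "E = (\<Sum>i<n. (\<Sum>j<p. \<Delta> j * x i j)\<^sup>2) / real n"
  define N where "N = (\<Sum>j<p. \<bar>\<Delta> j\<bar>)"
  define h where "h = (\<Sum>j<p. \<bar>\<delta> j\<bar>)"
  define S2 where "S2 = (\<Sum>j<p. (\<Delta> j)\<^sup>2)"
  have S20: "S2 \<ge> 0" by (simp add: S2_def sum_nonneg)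
  have E0: "E \<ge> 0" by (simp add: E_def sum_nonneg)
  have h0: "h \<ge> 0" by (simp add: h_def sum_nonneg)
  have N0: "N \<ge> 0" by (simp add: N_def sum_nonneg)
  have basic: "E \<le> lam * (N + 2 * h - 2 * (\<Sum>j<p. \<bar>d j\<bar>))"
    unfolding E_def N_def h_def \<Delta>_def by (rule lasso_basic_inequality[OF n lam opt noise])
  have tri: "N \<le> h + (\<Sum>j<p. \<bar>d j\<bar>)"
    unfolding N_def h_def \<Delta>_def sum.distrib[symmetric] by (intro sum_mono) simp
  have d0: "(\<Sum>j<p. \<bar>d j\<bar>) \<ge> 0" by (simp add: sum_nonneg)
  have E3: "E \<le> 3 * lam * h"
  proof -
    have "lam * (N + 2 * h - 2 * (\<Sum>j<p. \<bar>d j\<bar>)) \<le> lam * (3 * h)"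
      using tri d0 lam by (intro mult_left_mono) linarith+
    then show ?thesis using basic by simp
  qed
  have "0 \<le> N + 2 * h - 2 * (\<Sum>j<p. \<bar>d j\<bar>)"
    using order_trans[OF E0 basic] lam by (simp add: zero_le_mult_iff)
  then have N4: "N \<le> 4 * h" using tri by linarith
  have S2N: "S2 \<le> N\<^sup>2"
  proof -
    have "S2 = (\<Sum>j<p. \<bar>\<Delta> j\<bar> * \<bar>\<Delta> j\<bar>)" by (simp add: S2_def power2_eq_square)
    also have "\<dots> \<le> (\<Sum>j<p. \<bar>\<Delta> j\<bar> * N)"
      unfolding N_def by (intro sum_mono mult_left_mono member_le_sum) auto
    also have "\<dots> = N\<^sup>2" by (simp add: N_def sum_distrib_right power2_eq_square)
    finally show ?thesis .
  qed
  have NN: "N\<^sup>2 \<le> 16 * h\<^sup>2" using power_mono[OF N4 N0, of 2] by (simp add: power_mult_distrib)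
  then show "(\<Sum>j<p. (\<Delta> j)\<^sup>2) \<le> 16 * (\<Sum>j<p. \<bar>\<delta> j\<bar>)\<^sup>2"
    using S2N by (simp add: S2_def h_def)
  assume c: "c > 0" and D: "D \<ge> 0" and re: "c * (\<Sum>j<p. (\<Delta> j)\<^sup>2) - D * (\<Sum>j<p. \<bar>\<Delta> j\<bar>)\<^sup>2
        \<le> (\<Sum>i<n. (\<Sum>j<p. \<Delta> j * x i j)\<^sup>2) / real n"
  then have re': "c * S2 - D * N\<^sup>2 \<le> E" by (simp add: S2_def N_def E_def)
  have "D * N\<^sup>2 \<le> D * (16 * h\<^sup>2)" by (intro mult_left_mono NN D)
  then have "c * S2 \<le> 3 * lam * h + 16 * D * h\<^sup>2" using re' E3 by linarith
  then show "(\<Sum>j<p. (\<Delta> j)\<^sup>2) \<le> (3 * lam * (\<Sum>j<p. \<bar>\<delta> j\<bar>) + 16 * D * (\<Sum>j<p. \<bar>\<delta> j\<bar>)\<^sup>2) / c"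
    using c by (simp add: S2_def h_def pos_le_divide_eq mult.commute)
  assume s: "s \<ge> 1" and card: "real (card {j. j < p \<and> \<delta> j \<noteq> 0}) \<le> s" and sD: "16 * s * D \<le> c / 2"
  define I where "I = {j. j < p \<and> \<delta> j \<noteq> 0}"
  define NI where "NI = (\<Sum>j\<in>I. \<bar>\<Delta> j\<bar>)"
  have Isub: "I \<subseteq> {..<p}" by (auto simp: I_def)
  have split: "(\<Sum>j<p. f j) = (\<Sum>j\<in>I. f j) + (\<Sum>j\<in>{..<p} - I. f j)" for f :: "nat \<Rightarrow> real"
    using sum.subset_diff[OF Isub, of f] by simp
  \<comment> \<open>Off the support of \<delta> the entry of \<open>d\<close> is the error itself,
    so there the penalty counts twice against one copy of the l1 error.\<close>
  have cone: "N + 2 * h - 2 * (\<Sum>j<p. \<bar>d j\<bar>) \<le> 4 * NI - N"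
  proof -
    have "N + 2 * h - 2 * (\<Sum>j<p. \<bar>d j\<bar>) = (\<Sum>j<p. \<bar>\<Delta> j\<bar> + 2 * \<bar>\<delta> j\<bar> - 2 * \<bar>d j\<bar>)"
      by (simp add: N_def h_def sum.distrib sum_subtractf sum_distrib_left)
    also have "\<dots> = (\<Sum>j\<in>I. \<bar>\<Delta> j\<bar> + 2 * \<bar>\<delta> j\<bar> - 2 * \<bar>d j\<bar>) + (\<Sum>j\<in>{..<p} - I. \<bar>\<Delta> j\<bar> + 2 * \<bar>\<delta> j\<bar> - 2 * \<bar>d j\<bar>)"
      by (rule split)
    also have "\<dots> \<le> (\<Sum>j\<in>I. 3 * \<bar>\<Delta> j\<bar>) + (\<Sum>j\<in>{..<p} - I. - \<bar>\<Delta> j\<bar>)"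
    proof (intro add_mono sum_mono)
      fix j
      have "\<bar>\<delta> j\<bar> - \<bar>d j\<bar> \<le> \<bar>\<Delta> j\<bar>"
        using abs_triangle_ineq2[of "\<delta> j" "d j"] by (simp add: \<Delta>_def abs_minus_commute)
      then show "\<bar>\<Delta> j\<bar> + 2 * \<bar>\<delta> j\<bar> - 2 * \<bar>d j\<bar> \<le> 3 * \<bar>\<Delta> j\<bar>" by linarith
      assume "j \<in> {..<p} - I"
      then show "\<bar>\<Delta> j\<bar> + 2 * \<bar>\<delta> j\<bar> - 2 * \<bar>d j\<bar> \<le> - \<bar>\<Delta> j\<bar>"
        by (simp add: \<Delta>_def I_def)
    qed
    also have "\<dots> = 3 * NI - (N - NI)"
      using split[of "\<lambda>j. \<bar>\<Delta> j\<bar>"] by (simp add: NI_def N_def sum_distrib_left sum_negf)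
    finally show ?thesis by simp
  qed
  have NI0: "NI \<ge> 0" by (simp add: NI_def sum_nonneg)
  have "0 \<le> lam * (4 * NI - N)"
    using order_trans[OF E0 basic] mult_left_mono[OF cone, of lam] lam by linarith
  then have N4I: "N \<le> 4 * NI" using lam by (simp add: zero_le_mult_iff)
  have E3I: "E \<le> 4 * lam * NI - lam * N"
    using basic mult_left_mono[OF cone, of lam] lam by (simp add: algebra_simps)
  have NNI: "NI \<le> N" using split[of "\<lambda>j. \<bar>\<Delta> j\<bar>"] by (simp add: NI_def N_def sum_nonneg)
  have E3I': "E \<le> 3 * lam * NI"
    using E3I mult_left_mono[OF NNI less_imp_le[OF lam]] by linarith
  have NIsq: "NI\<^sup>2 \<le> s * S2"
  proof -
    have "NI\<^sup>2 \<le> (\<Sum>j\<in>I. 1\<^sup>2) * (\<Sum>j\<in>I. \<bar>\<Delta> j\<bar>\<^sup>2)"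
      using Cauchy_Schwarz_ineq_sum[of "\<lambda>_. 1" "\<lambda>j. \<bar>\<Delta> j\<bar>" I] by (simp add: NI_def)
    also have "\<dots> = real (card I) * (\<Sum>j\<in>I. (\<Delta> j)\<^sup>2)" by simp
    also have "\<dots> \<le> s * S2"
      using card s Isub unfolding S2_def I_def[symmetric]
      by (intro mult_mono sum_mono2) (auto simp: sum_nonneg)
    finally show ?thesis .
  qed
  have "D * N\<^sup>2 \<le> c / 2 * S2"
  proof -
    have "N\<^sup>2 \<le> (4 * NI)\<^sup>2" by (intro power_mono N4I N0)
    also have "\<dots> \<le> 16 * (s * S2)" using NIsq by (simp add: power_mult_distrib)
    finally have "D * N\<^sup>2 \<le> D * (16 * (s * S2))" by (intro mult_left_mono D)
    also have "\<dots> = (16 * s * D) * S2" by simp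
    also have "\<dots> \<le> c / 2 * S2" by (intro mult_right_mono sD S20)
    finally show ?thesis .
  qed
  moreover have "3 * lam * NI \<le> c / 4 * S2 + 9 * lam\<^sup>2 * s / c"
  proof -
    have cs: "c / s > 0" using c s by simp
    \<comment> \<open>The weight \<open>c / s\<close> matches \<open>NIsq\<close>, so only a quarter
      of \<open>c * S2\<close> is spent. One half went into the loss; the remaining quarter turns 9
      into 36.\<close>
    have "NI * (3 * lam) \<le> (c / s) / 4 * NI\<^sup>2 + (3 * lam)\<^sup>2 / (c / s)"
      by (rule mult_le_quarter_plus[OF cs])
    also have "(c / s) / 4 * NI\<^sup>2 \<le> (c / s) / 4 * (s * S2)"
      using cs by (intro mult_left_mono NIsq) simp
    finally show ?thesis using s by (simp add: power_mult_distrib mult_ac)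
  qed
  ultimately have "c / 4 * S2 \<le> 9 * lam\<^sup>2 * s / c" using re' E3I' by linarith
  then have "S2 \<le> 36 * lam\<^sup>2 * s / c\<^sup>2" using c by (simp add: field_simps power2_eq_square)
  then show "(\<Sum>j<p. (\<Delta> j)\<^sup>2) \<le> 36 * lam\<^sup>2 * s / c\<^sup>2" by (simp add: S2_def)
qed

section \<open>Matrix-vector inequalities and the normal equations\<close>

lemma mult_mat_vec_scalar_prod:
  assumes A: "(A :: rmat) \<in> carrier_mat p K" and a: "a \<in> carrier_vec K" and x: "x \<in> carrier_vec p"
  shows "(A *\<^sub>v a) \<bullet> x = (\<Sum>k<K. a $ k * (col A k \<bullet> x))"
proof -
  have Aa: "A *\<^sub>v a \<in> carrier_vec p" using A a by simp
  have tx: "transpose_mat A *\<^sub>v x \<in> carrier_vec K" using A x by simp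
  have "(A *\<^sub>v a) \<bullet> x = x \<bullet> (A *\<^sub>v a)" by (rule comm_scalar_prod[OF Aa x])
  also have "\<dots> = (transpose_mat A *\<^sub>v x) \<bullet> a" by (rule transpose_vec_mult_scalar[OF A a x, symmetric])
  also have "\<dots> = (\<Sum>k<K. (transpose_mat A *\<^sub>v x) $ k * a $ k)" by (rule scalar_prod_lessThan[OF a])
  also have "\<dots> = (\<Sum>k<K. a $ k * (col A k \<bullet> x))"
    using A by (intro sum.cong) (auto simp: mult.commute)
  finally show ?thesis .
qed

lemma scalar_prod_self_nonneg: "v \<in> carrier_vec d \<Longrightarrow> 0 \<le> v \<bullet> (v :: rvec)"
  by (simp add: scalar_prod_lessThan sum_nonneg)

lemma scalar_prod_self: "v \<in> carrier_vec d \<Longrightarrow> v \<bullet> (v :: rvec) = (\<Sum>j<d. (v $ j)\<^sup>2)"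
  by (simp add: scalar_prod_lessThan power2_eq_square)

lemma scalar_prod_add_self_le:
  assumes "u \<in> carrier_vec d" "v \<in> carrier_vec d"
  shows "(u + v) \<bullet> (u + v :: rvec) \<le> 2 * (u \<bullet> u) + 2 * (v \<bullet> v)"
proof -
  have "(u + v) \<bullet> (u + v) = (\<Sum>j<d. (u $ j + v $ j)\<^sup>2)"
    using assms by (simp add: scalar_prod_self[of _ d])
  also have "\<dots> \<le> (\<Sum>j<d. 2 * (u $ j)\<^sup>2 + 2 * (v $ j)\<^sup>2)" by (intro sum_mono square_sum_le)
  finally show ?thesis
    using assms by (simp add: scalar_prod_self[of _ d] sum.distrib sum_distrib_left)
qed

text \<open>The squared Frobenius norm is the sum of the squared column errors, which is what the
  source rate controls; no further factor \<open>K\<close> arises.\<close>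

lemma mult_mat_vec_frobenius:
  assumes A: "(A :: rmat) \<in> carrier_mat p K" and a: "a \<in> carrier_vec K"
  shows "(A *\<^sub>v a) \<bullet> (A *\<^sub>v a) \<le> (\<Sum>k<K. col A k \<bullet> col A k) * (a \<bullet> a)"
proof -
  have Aa: "A *\<^sub>v a \<in> carrier_vec p" using A a by simp
  have "(A *\<^sub>v a) \<bullet> (A *\<^sub>v a) = (\<Sum>j<p. (\<Sum>k<K. A $$ (j, k) * a $ k)\<^sup>2)"
    unfolding scalar_prod_self[OF Aa] using A a
    by (intro sum.cong refl) (simp add: scalar_prod_lessThan[of _ K])
  also have "\<dots> \<le> (\<Sum>j<p. (\<Sum>k<K. (A $$ (j, k))\<^sup>2) * (\<Sum>k<K. (a $ k)\<^sup>2))"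
    by (intro sum_mono Cauchy_Schwarz_ineq_sum)
  also have "\<dots> = (\<Sum>j<p. \<Sum>k<K. (A $$ (j, k))\<^sup>2) * (a \<bullet> a)"
    using a by (simp add: scalar_prod_self[of _ K] sum_distrib_right)
  also have "(\<Sum>j<p. \<Sum>k<K. (A $$ (j, k))\<^sup>2) = (\<Sum>k<K. col A k \<bullet> col A k)"
    using A by (subst sum.swap) (simp add: scalar_prod_self[of _ p])
  finally show ?thesis .
qed

text \<open>Discriminant argument for a semidefinite form. It serves the mean of the scores, where
  one argument is the source error applied to a direction and the other is \<delta>.\<close>

lemma psd_cauchy_schwarz:
  assumes S: "(S :: rmat) \<in> carrier_mat p p" and u: "u \<in> carrier_vec p" and v: "v \<in> carrier_vec p"
    and bd: "\<And>y. y \<in> carrier_vec p \<Longrightarrow> 0 \<le> y \<bullet> (S *\<^sub>v y) \<and> y \<bullet> (S *\<^sub>v y) \<le> C * (y \<bullet> y)"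
    and sym: "\<And>i j. i < p \<Longrightarrow> j < p \<Longrightarrow> S $$ (i, j) = S $$ (j, i)"
  shows "\<bar>u \<bullet> (S *\<^sub>v v)\<bar> \<le> C * norm_l2 u * norm_l2 v"
proof -
  let ?f = "bform p (\<lambda>j l. S $$ (j, l))"
  define f where "f a b = ?f (\<lambda>j. a $ j) (\<lambda>j. b $ j)" for a b :: rvec
  have q: "x \<bullet> (S *\<^sub>v y) = f x y" if "x \<in> carrier_vec p" "y \<in> carrier_vec p" for x y
    unfolding f_def by (rule quad_form_eq_bform[OF S that])
  have comm: "?f a b = ?f b a" for a b
    unfolding bform_def by (subst sum.swap) (intro sum.cong refl, simp add: sym mult_ac)
  define U where "U = u \<bullet> u"
  define V where "V = v \<bullet> v"
  have U0: "U \<ge> 0" "V \<ge> 0" using u v by (simp_all add: U_def V_def scalar_prod_self_nonneg)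
  have nU: "norm_l2 u = sqrt U" "norm_l2 v = sqrt V" by (simp_all add: norm_l2_def U_def V_def)
  have pos: "0 \<le> f u u + 2 * s * f u v + s\<^sup>2 * f v v" for s
  proof -
    have "0 \<le> (u + s \<cdot>\<^sub>v v) \<bullet> (S *\<^sub>v (u + s \<cdot>\<^sub>v v))" using bd[of "u + s \<cdot>\<^sub>v v"] u v by simp
    also have "\<dots> = f (u + s \<cdot>\<^sub>v v) (u + s \<cdot>\<^sub>v v)" using u v by (intro q) auto
    also have "\<dots> = ?f (\<lambda>j. u $ j + s * v $ j) (\<lambda>j. u $ j + s * v $ j)"
      using u v by (simp add: f_def bform_def)
    also have "\<dots> = f u u + 2 * s * f u v + s\<^sup>2 * f v v"
      unfolding bform_add_left bform_add_right comm[of "\<lambda>j. v $ j" "\<lambda>j. u $ j"] f_def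
      by (simp add: power2_eq_square algebra_simps)
    finally show ?thesis .
  qed
  have fu: "f u u \<le> C * U" and fv: "0 \<le> f v v" "f v v \<le> C * V" and fu0: "0 \<le> f u u"
    using bd[OF u] bd[OF v] by (simp_all add: q u v U_def V_def)
  have "(f u v)\<^sup>2 \<le> f u u * f v v"
  proof (cases "f v v = 0")
    case True
    have "f u v = 0"
    proof (rule ccontr)
      assume h: "f u v \<noteq> 0"
      have "0 \<le> f u u + 2 * (- (f u u + 1) / (2 * f u v)) * f u v"
        using pos[of "- (f u u + 1) / (2 * f u v)"] True by simp
      moreover have "2 * (- (f u u + 1) / (2 * f u v)) * f u v = - (f u u + 1)" using h by simp
      ultimately show False by linarith
    qed
    then show ?thesis using True by simp
  next
    case False
    then have p: "f v v > 0" using fv by simp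
    have "0 \<le> f u u + 2 * (- f u v / f v v) * f u v + (- f u v / f v v)\<^sup>2 * f v v" by (rule pos)
    also have "\<dots> = f u u - (f u v)\<^sup>2 / f v v" using p by (simp add: power2_eq_square field_simps)
    finally show ?thesis using p by (simp add: field_simps)
  qed
  also have "\<dots> \<le> (C * U) * (C * V)" using fu fv fu0 by (intro mult_mono) auto
  also have "\<dots> = (C * sqrt U * sqrt V)\<^sup>2" using U0 by (simp only: power_mult_distrib real_sqrt_pow2) (simp add: power2_eq_square)
  finally have sq: "(f u v)\<^sup>2 \<le> (C * sqrt U * sqrt V)\<^sup>2" .
  \<comment> \<open>The sign of \<open>C\<close> is read off the bounds on the form at
    \<open>u\<close>; if \<open>u\<close> has norm zero, so has the product.\<close>
  have nn: "0 \<le> C * sqrt U * sqrt V"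
  proof (cases "U = 0")
    case False
    then have "U > 0" using U0 by simp
    moreover have "0 \<le> C * U" using fu fu0 by linarith
    ultimately have "C \<ge> 0" by (simp add: zero_le_mult_iff)
    then show ?thesis using U0 by simp
  qed simp
  show ?thesis using abs_le_square_iff[THEN iffD2, OF sq] nn by (simp add: q u v nU)
qed

lemma mat_inv_right:
  assumes A: "A \<in> carrier_mat d d" and det: "Determinant.det A \<noteq> (0 :: real)"
  shows "mat_inv A \<in> carrier_mat d d" "A * mat_inv A = 1\<^sub>m d"
proof -
  have "mat_inverse A \<noteq> None"
  proof
    assume "mat_inverse A = None"
    from mat_inverse(1)[OF A this] have "A \<notin> Units (ring_mat TYPE(real) d ())" .
    then show False using det_non_zero_imp_unit[OF A det, of "()"] by blast
  qed
  then obtain C where C: "mat_inverse A = Some C" by auto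
  from mat_inverse(2)[OF A C] C show "mat_inv A \<in> carrier_mat d d" "A * mat_inv A = 1\<^sub>m d"
    by (simp_all add: mat_inv_def)
qed

lemma Z_hat_scalar_prod:
  assumes "Bh \<in> carrier_mat p K" "fst (D i) \<in> carrier_vec p" "a \<in> carrier_vec K"
  shows "Z_hat Bh D i \<bullet> a = (Bh *\<^sub>v a) \<bullet> fst (D i)"
  using assms transpose_vec_mult_scalar[OF assms(1,3,2)] comm_scalar_prod[of "fst (D i)" p "Bh *\<^sub>v a"]
  by (simp add: Z_hat_def)

text \<open>\<open>inj\<close> expresses full column rank of the fitted design. It makes the Gram
  matrix nonsingular, so \<open>mat_inv\<close> is the true inverse and not its default
  value.\<close>

lemma w_ptl_normal_equations:
  fixes D :: dataset
  assumes Bh: "Bh \<in> carrier_mat p K" and x: "\<And>i. i < n \<Longrightarrow> fst (D i) \<in> carrier_vec p"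
    and inj: "\<And>a. a \<in> carrier_vec K \<Longrightarrow> (\<Sum>i<n. ((Bh *\<^sub>v a) \<bullet> fst (D i))\<^sup>2) = 0 \<Longrightarrow> a = 0\<^sub>v K"
  shows "w_ptl n K Bh D \<in> carrier_vec K"
    and "a \<in> carrier_vec K \<Longrightarrow>
      (\<Sum>i<n. ((Bh *\<^sub>v a) \<bullet> fst (D i)) * (snd (D i) - Z_hat Bh D i \<bullet> w_ptl n K Bh D)) = 0"
proof -
  let ?Z = "Z_hat Bh D"
  define G where "G = Matrix.mat K K (\<lambda>(a, b). \<Sum>i<n. ?Z i $ a * ?Z i $ b)"
  define r where "r = Matrix.vec K (\<lambda>a. \<Sum>i<n. ?Z i $ a * snd (D i))"
  have G: "G \<in> carrier_mat K K" by (simp add: G_def)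
  have Gv: "(G *\<^sub>v a) $ j = (\<Sum>i<n. ?Z i $ j * (?Z i \<bullet> a))" if a: "a \<in> carrier_vec K" and j: "j < K" for a j
  proof -
    have "(G *\<^sub>v a) $ j = (\<Sum>l<K. (\<Sum>i<n. ?Z i $ j * ?Z i $ l) * a $ l)"
      using j a by (simp add: G_def scalar_prod_lessThan[OF a])
    also have "\<dots> = (\<Sum>l<K. \<Sum>i<n. ?Z i $ j * (?Z i $ l * a $ l))"
      by (simp add: sum_distrib_right mult.assoc)
    also have "\<dots> = (\<Sum>i<n. ?Z i $ j * (?Z i \<bullet> a))"
      by (subst sum.swap) (simp add: scalar_prod_lessThan[OF a] sum_distrib_left)
    finally show ?thesis .
  qed
  have dot: "(\<Sum>j<K. a $ j * (\<Sum>i<n. ?Z i $ j * f i)) = (\<Sum>i<n. ((Bh *\<^sub>v a) \<bullet> fst (D i)) * f i)"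
    if a: "a \<in> carrier_vec K" for a f
  proof -
    have "(\<Sum>j<K. a $ j * (\<Sum>i<n. ?Z i $ j * f i)) = (\<Sum>j<K. \<Sum>i<n. (?Z i $ j * a $ j) * f i)"
      by (simp add: sum_distrib_left mult_ac)
    also have "\<dots> = (\<Sum>i<n. (?Z i \<bullet> a) * f i)"
      by (subst sum.swap) (simp add: scalar_prod_lessThan[OF a] sum_distrib_right)
    also have "\<dots> = (\<Sum>i<n. ((Bh *\<^sub>v a) \<bullet> fst (D i)) * f i)"
      by (intro sum.cong refl) (simp add: Z_hat_scalar_prod[OF Bh x a])
    finally show ?thesis .
  qed
  have "Determinant.det G \<noteq> 0"
  proof
    assume "Determinant.det G = 0"
    then obtain a where a: "a \<in> carrier_vec K" "a \<noteq> 0\<^sub>v K" "G *\<^sub>v a = 0\<^sub>v K"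
      using det_0_iff_vec_prod_zero[OF G] by blast
    have "0 = (\<Sum>j<K. a $ j * (G *\<^sub>v a) $ j)" using a by simp
    also have "\<dots> = (\<Sum>j<K. a $ j * (\<Sum>i<n. ?Z i $ j * (?Z i \<bullet> a)))"
      by (intro sum.cong refl) (simp add: Gv[OF a(1)])
    also have "\<dots> = (\<Sum>i<n. ((Bh *\<^sub>v a) \<bullet> fst (D i)) * (?Z i \<bullet> a))" by (rule dot[OF a(1)])
    also have "\<dots> = (\<Sum>i<n. ((Bh *\<^sub>v a) \<bullet> fst (D i))\<^sup>2)"
      by (intro sum.cong refl) (simp add: Z_hat_scalar_prod[OF Bh x a(1)] power2_eq_square)
    finally show False using inj[OF a(1)] a(2) by simp
  qed
  note inv = mat_inv_right[OF G this]
  have r: "r \<in> carrier_vec K" by (simp add: r_def)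
  have w: "w_ptl n K Bh D = mat_inv G *\<^sub>v r" by (simp add: w_ptl_def G_def r_def)
  show wK: "w_ptl n K Bh D \<in> carrier_vec K" unfolding w using inv(1) r by simp
  have "G *\<^sub>v w_ptl n K Bh D = (G * mat_inv G) *\<^sub>v r"
    unfolding w by (rule assoc_mult_mat_vec[OF G inv(1) r, symmetric])
  also have "\<dots> = r" using inv(2) r by simp
  finally have Gw: "G *\<^sub>v w_ptl n K Bh D = r" .
  assume a: "a \<in> carrier_vec K"
  have "0 = (\<Sum>j<K. a $ j * (r $ j - (G *\<^sub>v w_ptl n K Bh D) $ j))" using Gw by simp
  also have "\<dots> = (\<Sum>j<K. a $ j * (\<Sum>i<n. ?Z i $ j * (snd (D i) - ?Z i \<bullet> w_ptl n K Bh D)))"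
    by (intro sum.cong refl) (simp add: Gv[OF wK] r_def right_diff_distrib sum_subtractf)
  also have "\<dots> = (\<Sum>i<n. ((Bh *\<^sub>v a) \<bullet> fst (D i)) * (snd (D i) - ?Z i \<bullet> w_ptl n K Bh D))"
    by (rule dot[OF a])
  finally show "(\<Sum>i<n. ((Bh *\<^sub>v a) \<bullet> fst (D i)) * (snd (D i) - ?Z i \<bullet> w_ptl n K Bh D)) = 0" by simp
qed

section \<open>The profiled fit\<close>

text \<open>
  The factor \<open>1/16\<close> is \<open>1/2 \<cdot> 1/4 \<cdot> 1/2\<close>: the losses from replacing the covariance by the sample Gram
  matrix, the source coefficients by their estimates, and lattice points by arbitrary vectors.
\<close>

definition gram_const :: "real \<Rightarrow> real" where
  "gram_const Cmin = Cmin\<^sup>2 / 16"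

text \<open>The first summand is the factor 2 / (n \<open>gram_const\<close>) of the least-squares
  bound times the score bound with its 4 n^2, per observation; the second is twice the bias energy 2
  \<tau>^2 Cw^2.\<close>

definition pred_const :: "real \<Rightarrow> real \<Rightarrow> real \<Rightarrow> real \<Rightarrow> real \<Rightarrow> real" where
  "pred_const Cmin Cmax Cw H \<tau> =
    8 * (3 * Cmax * (H + 1)\<^sup>2 + Cmax\<^sup>2 * H\<^sup>2) / gram_const Cmin + 4 * \<tau>\<^sup>2 * Cw\<^sup>2"

text \<open>The sum of the constants for the Euclidean error and for the prediction error of the
  first stage, so that one constant serves both.\<close>

definition profile_const :: "real \<Rightarrow> real \<Rightarrow> real \<Rightarrow> real \<Rightarrow> real \<Rightarrow> real" where
  "profile_const Cmin Cmax Cw H \<tau> =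
    6 * Cmax * pred_const Cmin Cmax Cw H \<tau> / gram_const Cmin + 2 * Cw\<^sup>2
    + 2 * pred_const Cmin Cmax Cw H \<tau> + 4 * \<tau>\<^sup>2 * Cw\<^sup>2"

lemma norm_l2_le_of_sq:
  assumes "v \<in> carrier_vec d" "v \<bullet> v \<le> c\<^sup>2 * y" "c \<ge> 0"
  shows "norm_l2 v \<le> c * sqrt y"
proof -
  have "norm_l2 v \<le> sqrt (c\<^sup>2 * y)" unfolding norm_l2_def using assms by simp
  then show ?thesis using assms by (simp add: real_sqrt_mult)
qed

text \<open>
  One realisation of the data: \<open>\<rho>\<close> bounds the Frobenius norm of the source error \<open>Bh - B\<close>, \<open>t\<close> is the
  deviation level of the scores, and \<open>m\<close> is the radius of the lattice points that control the Gram matrix.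
\<close>

locale profiled_fit =
  fixes p K n m :: nat and x :: "nat \<Rightarrow> rvec" and \<epsilon> :: "nat \<Rightarrow> real"
    and B Bh S :: rmat and w \<delta> :: rvec
    and Cmin Cmax Cw H \<tau> \<rho> t :: real
  assumes n: "n > 0" and K: "K \<ge> 1"
    and cst: "0 < Cmin" "Cmin \<le> Cmax" "0 < Cw" "0 \<le> H" "0 < \<tau>" "0 \<le> \<rho>" "0 \<le> t"
    and x: "\<And>i. i < n \<Longrightarrow> x i \<in> carrier_vec p"
    and B: "B \<in> carrier_mat p K" and Bh: "Bh \<in> carrier_mat p K" and S: "S \<in> carrier_mat p p"
    and w: "w \<in> carrier_vec K" and \<delta>: "\<delta> \<in> carrier_vec p"
    and wCw: "norm_l2 w \<le> Cw" and \<delta>H: "norm_l2 \<delta> \<le> H"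
    and orth: "\<And>k. k < K \<Longrightarrow> col B k \<bullet> (S *\<^sub>v \<delta>) = 0"
    and Ssym: "\<And>i j. i < p \<Longrightarrow> j < p \<Longrightarrow> S $$ (i, j) = S $$ (j, i)"
    and Sbd: "\<And>y. y \<in> carrier_vec p \<Longrightarrow> 0 \<le> y \<bullet> (S *\<^sub>v y) \<and> y \<bullet> (S *\<^sub>v y) \<le> Cmax * (y \<bullet> y)"
    and BB: "\<And>a. a \<in> carrier_vec K \<Longrightarrow>
      Cmin * (a \<bullet> a) \<le> (B *\<^sub>v a) \<bullet> (B *\<^sub>v a) \<and> (B *\<^sub>v a) \<bullet> (B *\<^sub>v a) \<le> Cmax * (a \<bullet> a)"
    and rho: "(\<Sum>k<K. (norm_l2 (col Bh k - col B k))\<^sup>2) \<le> \<rho>\<^sup>2" "\<rho>\<^sup>2 \<le> Cmin / 4"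
    and m: "m \<ge> 2" "real K * (6 * \<tau>\<^sup>2 * Cmax) \<le> gram_const Cmin * (real m - 1)"
    and ev_gram: "\<And>z. z \<in> lattice_pts K m \<Longrightarrow>
      real n * (Cmin / 2) * ((Bh *\<^sub>v Matrix.vec K z) \<bullet> (Bh *\<^sub>v Matrix.vec K z))
        \<le> (\<Sum>i<n. ((Bh *\<^sub>v Matrix.vec K z) \<bullet> x i)\<^sup>2)"
    and ev_diag: "\<And>k. k < K \<Longrightarrow>
      (\<Sum>i<n. (col Bh k \<bullet> x i)\<^sup>2) \<le> 2 * \<tau>\<^sup>2 * real n * (col Bh k \<bullet> col Bh k)"
    and ev_bias: "(\<Sum>i<n. (((Bh - B) *\<^sub>v w) \<bullet> x i)\<^sup>2)
      \<le> 2 * \<tau>\<^sup>2 * real n * (((Bh - B) *\<^sub>v w) \<bullet> ((Bh - B) *\<^sub>v w))"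
    and ev_cross: "\<And>z. z \<in> lattice_pts K (K + 1) \<Longrightarrow>
      \<bar>(\<Sum>i<n. ((Bh *\<^sub>v Matrix.vec K z) \<bullet> x i) * (\<delta> \<bullet> x i))
        - real n * ((Bh *\<^sub>v Matrix.vec K z) \<bullet> (S *\<^sub>v \<delta>))\<bar>
      \<le> real n * t * norm_l2 (Bh *\<^sub>v Matrix.vec K z) * norm_l2 \<delta>"
    and ev_noise: "\<And>z. z \<in> lattice_pts K (K + 1) \<Longrightarrow>
      \<bar>\<Sum>i<n. ((Bh *\<^sub>v Matrix.vec K z) \<bullet> x i) * \<epsilon> i\<bar> \<le> real n * t * norm_l2 (Bh *\<^sub>v Matrix.vec K z)"
begin

definition b where "b = B *\<^sub>v w + \<delta>"
definition D where "D = (\<lambda>i\<in>{..<n}. (x i, x i \<bullet> b + \<epsilon> i))"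
definition wh where "wh = w_ptl n K Bh D"
definition v where "v = Bh *\<^sub>v wh - B *\<^sub>v w"
definition E where "E = Bh - B"

lemma E: "E \<in> carrier_mat p K" unfolding E_def by (rule minus_carrier_mat[OF B])

lemma Ea_bound: "a \<in> carrier_vec K \<Longrightarrow> (E *\<^sub>v a) \<bullet> (E *\<^sub>v a) \<le> \<rho>\<^sup>2 * (a \<bullet> a)"
proof -
  assume a: "a \<in> carrier_vec K"
  have "(\<Sum>k<K. col E k \<bullet> col E k) = (\<Sum>k<K. (norm_l2 (col Bh k - col B k))\<^sup>2)"
  proof (intro sum.cong refl)
    fix k assume "k \<in> {..<K}"
    then have eq: "col E k = col Bh k - col B k" using B Bh by (auto simp: E_def)
    have "col Bh k \<in> carrier_vec p" "col B k \<in> carrier_vec p" using B Bh by auto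
    from norm_l2_sq[OF minus_carrier_vec[OF this]]
    show "col E k \<bullet> col E k = (norm_l2 (col Bh k - col B k))\<^sup>2" unfolding eq by simp
  qed
  then have "(\<Sum>k<K. col E k \<bullet> col E k) * (a \<bullet> a) \<le> \<rho>\<^sup>2 * (a \<bullet> a)"
    using rho scalar_prod_self_nonneg[OF a] by (intro mult_right_mono) auto
  then show ?thesis using mult_mat_vec_frobenius[OF E a] by linarith
qed

lemma Bh_split: "a \<in> carrier_vec K \<Longrightarrow> Bh *\<^sub>v a = B *\<^sub>v a + E *\<^sub>v a"
proof -
  assume a: "a \<in> carrier_vec K"
  have "Bh = B + E" using B Bh by (intro eq_matI) (auto simp: E_def)
  then show ?thesis using add_mult_distrib_mat_vec[OF B E a] by simp
qed

lemma Bha_upper: "a \<in> carrier_vec K \<Longrightarrow> (Bh *\<^sub>v a) \<bullet> (Bh *\<^sub>v a) \<le> 3 * Cmax * (a \<bullet> a)"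
proof -
  assume a: "a \<in> carrier_vec K"
  have "(Bh *\<^sub>v a) \<bullet> (Bh *\<^sub>v a) \<le> 2 * ((B *\<^sub>v a) \<bullet> (B *\<^sub>v a)) + 2 * ((E *\<^sub>v a) \<bullet> (E *\<^sub>v a))"
    unfolding Bh_split[OF a] using B E a by (intro scalar_prod_add_self_le[of _ p]) auto
  also have "\<dots> \<le> 2 * (Cmax * (a \<bullet> a)) + 2 * (Cmax / 4 * (a \<bullet> a))"
  proof -
    have "\<rho>\<^sup>2 * (a \<bullet> a) \<le> Cmax / 4 * (a \<bullet> a)"
      using rho cst scalar_prod_self_nonneg[OF a] by (intro mult_right_mono) auto
    then show ?thesis using BB[OF a] Ea_bound[OF a] by linarith
  qed
  also have "\<dots> \<le> 3 * Cmax * (a \<bullet> a)"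
    using mult_nonneg_nonneg[of Cmax "a \<bullet> a"] cst scalar_prod_self_nonneg[OF a] by simp
  finally show ?thesis .
qed

text \<open>Writing B a = Bh a - E a, the source error takes half of \<open>Cmin\<close> and the
  square of a sum another factor 2: (Cmin - Cmin / 2) / 2 = Cmin / 4.\<close>

lemma Bha_lower: "a \<in> carrier_vec K \<Longrightarrow> Cmin / 4 * (a \<bullet> a) \<le> (Bh *\<^sub>v a) \<bullet> (Bh *\<^sub>v a)"
proof -
  assume a: "a \<in> carrier_vec K"
  have Ba: "B *\<^sub>v a \<in> carrier_vec p" and Ea: "E *\<^sub>v a \<in> carrier_vec p" and Bha: "Bh *\<^sub>v a \<in> carrier_vec p"
    using B E Bh a by auto
  have "B *\<^sub>v a = Bh *\<^sub>v a + - (E *\<^sub>v a)"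
    unfolding Bh_split[OF a] using Ba Ea by (intro eq_vecI) auto
  then have "(B *\<^sub>v a) \<bullet> (B *\<^sub>v a) \<le> 2 * ((Bh *\<^sub>v a) \<bullet> (Bh *\<^sub>v a)) + 2 * (- (E *\<^sub>v a) \<bullet> - (E *\<^sub>v a))"
    using scalar_prod_add_self_le[OF Bha, of "- (E *\<^sub>v a)"] Ea by simp
  also have "- (E *\<^sub>v a) \<bullet> - (E *\<^sub>v a) = (E *\<^sub>v a) \<bullet> (E *\<^sub>v a)" using Ea by simp
  also have "\<dots> \<le> Cmin / 4 * (a \<bullet> a)"
    using rho(2) Ea_bound[OF a] scalar_prod_self_nonneg[OF a]
    by (meson mult_right_mono order_trans)
  finally show ?thesis using BB[OF a] by linarith
qed

lemma Bha_dot: "a \<in> carrier_vec K \<Longrightarrow> y \<in> carrier_vec p \<Longrightarrow> (Bh *\<^sub>v a) \<bullet> y = (\<Sum>k<K. a $ k * (col Bh k \<bullet> y))"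
  by (rule mult_mat_vec_scalar_prod[OF Bh])

lemma vec_dot: "Matrix.vec K z \<bullet> Matrix.vec K z = (\<Sum>k<K. (z k)\<^sup>2)" for z :: "nat \<Rightarrow> real"
  by (simp add: scalar_prod_self[of _ K])

lemma gram_const_pos: "gram_const Cmin > 0" using cst by (simp add: gram_const_def)

text \<open>Lattice points give the bound with \<open>2 * gram_const Cmin\<close>. The loss carries
  \<open>6 * \<tau>\<^sup>2 * Cmax\<close>, from the diagonal deviation 2 \<tau>^2 and squared
  columns of at most 3 Cmax, and by Cauchy-Schwarz a factor K; the condition linking
  \<open>m\<close> to \<open>K\<close> limits it to one \<open>gram_const Cmin\<close>.\<close>

lemma gram_bound:
  assumes a: "a \<in> carrier_vec K"
  shows "real n * gram_const Cmin * (a \<bullet> a) \<le> (\<Sum>i<n. ((Bh *\<^sub>v a) \<bullet> x i)\<^sup>2)"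
proof -
  let ?Z = "\<lambda>i k. col Bh k \<bullet> x i"
  let ?D = "6 * \<tau>\<^sup>2 * Cmax"
  have eq: "(\<Sum>i<n. ((Bh *\<^sub>v a) \<bullet> x i)\<^sup>2) = (\<Sum>i<n. (\<Sum>k<K. a $ k * ?Z i k)\<^sup>2)"
    if a: "a \<in> carrier_vec K" for a
    using x by (intro sum.cong refl) (simp add: Bha_dot[OF a])
  have unit: "col Bh k = Bh *\<^sub>v unit_vec K k" if "k < K" for k
    using Bh that by (intro eq_vecI) (auto simp: scalar_prod_right_unit)
  have "(\<Sum>i<n. (\<Sum>k<K. a $ k * ?Z i k)\<^sup>2) / real n
    \<ge> 2 * gram_const Cmin * (\<Sum>k<K. (a $ k)\<^sup>2) - ?D / (real m - 1) * (\<Sum>k<K. \<bar>a $ k\<bar>)\<^sup>2"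
  proof (rule gram_lower_bound[OF m(1) n])
    show "0 \<le> 2 * gram_const Cmin" using gram_const_pos by simp
  next
    fix z assume z: "z \<in> lattice_pts K m"
    let ?v = "Matrix.vec K z"
    have "2 * gram_const Cmin * (?v \<bullet> ?v) = Cmin / 2 * (Cmin / 4 * (?v \<bullet> ?v))"
      by (simp add: gram_const_def power2_eq_square)
    also have "\<dots> \<le> Cmin / 2 * ((Bh *\<^sub>v ?v) \<bullet> (Bh *\<^sub>v ?v))"
      using cst by (intro mult_left_mono Bha_lower) auto
    finally have "real n * (2 * gram_const Cmin * (?v \<bullet> ?v)) \<le> real n * (Cmin / 2 * ((Bh *\<^sub>v ?v) \<bullet> (Bh *\<^sub>v ?v)))"
      by (intro mult_left_mono) auto
    also have "\<dots> \<le> (\<Sum>i<n. ((Bh *\<^sub>v ?v) \<bullet> x i)\<^sup>2)" using ev_gram[OF z] by (simp add: mult.assoc)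
    also have "\<dots> = (\<Sum>i<n. (\<Sum>k<K. z k * ?Z i k)\<^sup>2)" by (subst eq) simp_all
    finally show "2 * gram_const Cmin * (\<Sum>k<K. (z k)\<^sup>2) \<le> (\<Sum>i<n. (\<Sum>k<K. z k * ?Z i k)\<^sup>2) / real n"
      using n by (simp add: vec_dot field_simps)
  next
    fix k assume k: "k < K"
    have "col Bh k \<bullet> col Bh k \<le> 3 * Cmax"
      using Bha_upper[of "unit_vec K k"] k by (simp add: unit)
    then have "2 * \<tau>\<^sup>2 * real n * (col Bh k \<bullet> col Bh k) \<le> 2 * \<tau>\<^sup>2 * real n * (3 * Cmax)"
      by (intro mult_left_mono) auto
    also have "\<dots> = ?D * real n" by simp
    finally have "(\<Sum>i<n. (?Z i k)\<^sup>2) \<le> ?D * real n" using ev_diag[OF k] by linarith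
    then show "(\<Sum>i<n. (?Z i k)\<^sup>2) / real n \<le> ?D" using n by (simp add: pos_divide_le_eq)
  qed
  moreover have "?D / (real m - 1) * (\<Sum>k<K. \<bar>a $ k\<bar>)\<^sup>2 \<le> gram_const Cmin * (\<Sum>k<K. (a $ k)\<^sup>2)"
  proof -
    have "?D / (real m - 1) * (\<Sum>k<K. \<bar>a $ k\<bar>)\<^sup>2 \<le> ?D / (real m - 1) * (real K * (\<Sum>k<K. (a $ k)\<^sup>2))"
      using m cst by (intro mult_left_mono sum_abs_sq_le) auto
    also have "\<dots> = real K * ?D / (real m - 1) * (\<Sum>k<K. (a $ k)\<^sup>2)" by simp
    also have "\<dots> \<le> gram_const Cmin * (\<Sum>k<K. (a $ k)\<^sup>2)"
      using m by (intro mult_right_mono sum_nonneg) (simp_all add: pos_divide_le_eq)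
    finally show ?thesis .
  qed
  ultimately have "gram_const Cmin * (\<Sum>k<K. (a $ k)\<^sup>2) \<le> (\<Sum>i<n. (\<Sum>k<K. a $ k * ?Z i k)\<^sup>2) / real n"
    by linarith
  then show ?thesis using n by (simp add: eq[OF a] scalar_prod_self[OF a] field_simps)
qed

lemma D_eq: "i < n \<Longrightarrow> D i = (x i, x i \<bullet> b + \<epsilon> i)" by (simp add: D_def)

lemma inj: "a \<in> carrier_vec K \<Longrightarrow> (\<Sum>i<n. ((Bh *\<^sub>v a) \<bullet> fst (D i))\<^sup>2) = 0 \<Longrightarrow> a = 0\<^sub>v K"
proof -
  assume a: "a \<in> carrier_vec K" and z: "(\<Sum>i<n. ((Bh *\<^sub>v a) \<bullet> fst (D i))\<^sup>2) = 0"
  have "real n * gram_const Cmin * (a \<bullet> a) \<le> 0" using gram_bound[OF a] z by (simp add: D_eq)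
  then have "a \<bullet> a \<le> 0" using n gram_const_pos by (simp add: mult_le_0_iff)
  then have "(\<Sum>k<K. (a $ k)\<^sup>2) = 0" using scalar_prod_self_nonneg[OF a] by (simp add: scalar_prod_self[OF a])
  then have "\<forall>k<K. a $ k = 0" by (simp add: sum_nonneg_eq_0_iff)
  then show ?thesis using a by (intro eq_vecI) auto
qed

lemma wh: "wh \<in> carrier_vec K"
  unfolding wh_def by (rule w_ptl_normal_equations(1)[OF Bh _ inj]) (simp_all add: D_eq x)

lemma normal: "a \<in> carrier_vec K \<Longrightarrow>
    (\<Sum>i<n. ((Bh *\<^sub>v a) \<bullet> x i) * (snd (D i) - Z_hat Bh D i \<bullet> wh)) = 0"
proof -
  assume a: "a \<in> carrier_vec K"
  have "fst (D i) \<in> carrier_vec p" if "i < n" for i using that by (simp add: D_eq x)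
  from w_ptl_normal_equations(2)[OF Bh this inj a]
  have "(\<Sum>i<n. ((Bh *\<^sub>v a) \<bullet> fst (D i)) * (snd (D i) - Z_hat Bh D i \<bullet> wh)) = 0"
    by (simp add: wh_def)
  then show ?thesis by (simp add: D_eq)
qed

lemma v: "v \<in> carrier_vec p" using B Bh w wh by (simp add: v_def)

text \<open>Subtracting the fit cancels B w up to \<open>v\<close>. The second stage is thus a
  linear model with coefficient \<delta> and noise \<epsilon> minus the linear form of
  \<open>v\<close>.\<close>

lemma resid: "i < n \<Longrightarrow> snd (D i) - Z_hat Bh D i \<bullet> wh = \<delta> \<bullet> x i + \<epsilon> i - v \<bullet> x i"
proof -
  assume i: "i < n"
  have Bw: "B *\<^sub>v w \<in> carrier_vec p" and Bhw: "Bh *\<^sub>v wh \<in> carrier_vec p" using B Bh w wh by auto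
  have "Z_hat Bh D i \<bullet> wh = (Bh *\<^sub>v wh) \<bullet> x i"
    using Z_hat_scalar_prod[OF Bh _ wh, of D i] i x by (simp add: D_eq)
  moreover have "x i \<bullet> b = (B *\<^sub>v w) \<bullet> x i + \<delta> \<bullet> x i"
    unfolding b_def using comm_scalar_prod[of "x i" p "B *\<^sub>v w + \<delta>"] add_scalar_prod_distrib[OF Bw \<delta>, of "x i"] x[OF i] Bw \<delta>
    by simp
  moreover have "v \<bullet> x i = (Bh *\<^sub>v wh) \<bullet> x i - (B *\<^sub>v w) \<bullet> x i"
    unfolding v_def by (rule minus_scalar_prod_distrib[OF Bhw Bw x[OF i]])
  ultimately show ?thesis using i by (simp add: D_eq)
qed

definition a where "a = wh - w"

lemma a: "a \<in> carrier_vec K" using wh w by (simp add: a_def)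

text \<open>The first part lies in the fitted column space, where the normal equations act; the
  second is the bias from replacing \<open>B\<close> by \<open>Bh\<close>, controlled by the source
  error alone.\<close>

lemma v_split: "v = Bh *\<^sub>v a + E *\<^sub>v w"
proof -
  have "Bh *\<^sub>v a = Bh *\<^sub>v wh - Bh *\<^sub>v w" unfolding a_def by (rule mult_minus_distrib_mat_vec[OF Bh wh w])
  then show ?thesis unfolding v_def Bh_split[OF w] using B E Bh w wh by (intro eq_vecI) auto
qed

lemma vx_split: "i < n \<Longrightarrow> v \<bullet> x i = (Bh *\<^sub>v a) \<bullet> x i + (E *\<^sub>v w) \<bullet> x i"
  unfolding v_split using Bh E a w x by (intro add_scalar_prod_distrib[of _ p]) auto

text \<open>Since the columns of \<open>B\<close> are orthogonal to S \<delta>, only the source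
  error \<open>E\<close> contributes to the mean of the score. This makes the mean of order \<rho>;
  otherwise it would have the order of the norm of \<delta>, which need not be small.\<close>

lemma score_bound:
  assumes z: "z \<in> lattice_pts K (K + 1)"
  shows "\<bar>\<Sum>i<n. ((Bh *\<^sub>v Matrix.vec K z) \<bullet> x i) * (\<delta> \<bullet> x i + \<epsilon> i)\<bar>
    \<le> real n * (t * sqrt (3 * Cmax) * (H + 1) + \<rho> * Cmax * H) * sqrt (\<Sum>k<K. (z k)\<^sup>2)"
proof -
  let ?v = "Matrix.vec K z"
  define N where "N = sqrt (\<Sum>k<K. (z k)\<^sup>2)"
  have N0: "N \<ge> 0" by (simp add: N_def sum_nonneg)
  have vK: "?v \<in> carrier_vec K" by simp
  have Bv: "B *\<^sub>v ?v \<in> carrier_vec p" and Ev: "E *\<^sub>v ?v \<in> carrier_vec p" and Bhv: "Bh *\<^sub>v ?v \<in> carrier_vec p"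
    using B E Bh by auto
  have S\<delta>: "S *\<^sub>v \<delta> \<in> carrier_vec p" using S \<delta> by simp
  have nBh: "norm_l2 (Bh *\<^sub>v ?v) \<le> sqrt (3 * Cmax) * N"
    unfolding N_def using Bha_upper[OF vK] cst Bhv by (intro norm_l2_le_of_sq[of _ p]) (auto simp: vec_dot)
  have nE: "norm_l2 (E *\<^sub>v ?v) \<le> \<rho> * N"
    unfolding N_def using Ea_bound[OF vK] cst Ev by (intro norm_l2_le_of_sq[of _ p]) (auto simp: vec_dot)
  have n\<delta>0: "norm_l2 \<delta> \<ge> 0" by (rule norm_l2_nonneg[OF \<delta>])
  have "(B *\<^sub>v ?v) \<bullet> (S *\<^sub>v \<delta>) = 0"
    unfolding mult_mat_vec_scalar_prod[OF B vK S\<delta>] by (simp add: orth)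
  then have "(Bh *\<^sub>v ?v) \<bullet> (S *\<^sub>v \<delta>) = (E *\<^sub>v ?v) \<bullet> (S *\<^sub>v \<delta>)"
    unfolding Bh_split[OF vK] by (simp add: add_scalar_prod_distrib[OF Bv Ev S\<delta>])
  also have "\<bar>\<dots>\<bar> \<le> Cmax * norm_l2 (E *\<^sub>v ?v) * norm_l2 \<delta>"
    by (rule psd_cauchy_schwarz[OF S Ev \<delta> Sbd Ssym])
  also have "\<dots> \<le> Cmax * (\<rho> * N) * H"
    using cst N0 n\<delta>0 \<delta>H nE norm_l2_nonneg[OF Ev] by (intro mult_mono mult_nonneg_nonneg) auto
  finally have bias: "real n * \<bar>(Bh *\<^sub>v ?v) \<bullet> (S *\<^sub>v \<delta>)\<bar> \<le> real n * (Cmax * (\<rho> * N) * H)"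
    by (intro mult_left_mono) auto
  have "real n * t * norm_l2 (Bh *\<^sub>v ?v) * norm_l2 \<delta> \<le> real n * t * (sqrt (3 * Cmax) * N) * H"
    using cst N0 n\<delta>0 \<delta>H nBh norm_l2_nonneg[OF Bhv] by (intro mult_mono mult_nonneg_nonneg) auto
  moreover have "real n * t * norm_l2 (Bh *\<^sub>v ?v) \<le> real n * t * (sqrt (3 * Cmax) * N)"
    using cst nBh by (intro mult_left_mono) auto
  moreover have "real n * \<bar>(Bh *\<^sub>v ?v) \<bullet> (S *\<^sub>v \<delta>)\<bar> = \<bar>real n * ((Bh *\<^sub>v ?v) \<bullet> (S *\<^sub>v \<delta>))\<bar>"
    by (simp add: abs_mult)
  moreover have "(\<Sum>i<n. ((Bh *\<^sub>v ?v) \<bullet> x i) * (\<delta> \<bullet> x i + \<epsilon> i))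
      = (\<Sum>i<n. ((Bh *\<^sub>v ?v) \<bullet> x i) * (\<delta> \<bullet> x i)) + (\<Sum>i<n. ((Bh *\<^sub>v ?v) \<bullet> x i) * \<epsilon> i)"
    by (simp add: distrib_left sum.distrib)
  ultimately have "\<bar>\<Sum>i<n. ((Bh *\<^sub>v ?v) \<bullet> x i) * (\<delta> \<bullet> x i + \<epsilon> i)\<bar>
      \<le> real n * t * (sqrt (3 * Cmax) * N) * H + real n * (Cmax * (\<rho> * N) * H) + real n * t * (sqrt (3 * Cmax) * N)"
    using ev_cross[OF z] ev_noise[OF z] bias by linarith
  also have "\<dots> = real n * (t * sqrt (3 * Cmax) * (H + 1) + \<rho> * Cmax * H) * N"
    by (simp add: algebra_simps)
  finally show ?thesis by (simp add: N_def)
qed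

abbreviation "R \<equiv> t\<^sup>2 + \<rho>\<^sup>2"

text \<open>The factor 4 is a 2 from \<open>dual_lattice_bound\<close> times a 2 from squaring a
  sum.\<close>

lemma score_norm_bound:
  "(\<Sum>k<K. (\<Sum>i<n. (col Bh k \<bullet> x i) * (\<delta> \<bullet> x i + \<epsilon> i))\<^sup>2)
    \<le> 4 * (real n)\<^sup>2 * (3 * Cmax * (H + 1)\<^sup>2 + Cmax\<^sup>2 * H\<^sup>2) * R"
proof -
  let ?T = "\<lambda>k. \<Sum>i<n. (col Bh k \<bullet> x i) * (\<delta> \<bullet> x i + \<epsilon> i)"
  define q where "q = real n * (t * sqrt (3 * Cmax) * (H + 1) + \<rho> * Cmax * H)"
  have T: "(\<Sum>k<K. (?T k)\<^sup>2) \<le> 2 * q\<^sup>2"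
  proof (rule dual_lattice_bound[OF K])
    fix z assume z: "z \<in> lattice_pts K (K + 1)"
    have "(\<Sum>k<K. z k * ?T k) = (\<Sum>i<n. (\<Sum>k<K. z k * (col Bh k \<bullet> x i)) * (\<delta> \<bullet> x i + \<epsilon> i))"
      by (simp add: sum_distrib_left sum_distrib_right mult.assoc) (rule sum.swap)
    also have "\<dots> = (\<Sum>i<n. ((Bh *\<^sub>v Matrix.vec K z) \<bullet> x i) * (\<delta> \<bullet> x i + \<epsilon> i))"
      using x by (intro sum.cong refl) (simp add: Bha_dot)
    finally have "\<bar>\<Sum>k<K. z k * ?T k\<bar> \<le> q * sqrt (\<Sum>k<K. (z k)\<^sup>2)"
      using score_bound[OF z] by (simp add: q_def)
    then have "\<bar>\<Sum>k<K. z k * ?T k\<bar>\<^sup>2 \<le> (q * sqrt (\<Sum>k<K. (z k)\<^sup>2))\<^sup>2"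
      by (intro power_mono) auto
    then show "(\<Sum>k<K. z k * ?T k)\<^sup>2 \<le> q\<^sup>2 * (\<Sum>k<K. (z k)\<^sup>2)"
      by (simp add: power_mult_distrib sum_nonneg)
  qed simp
  have "q\<^sup>2 \<le> (real n)\<^sup>2 * (2 * (t * sqrt (3 * Cmax) * (H + 1))\<^sup>2 + 2 * (\<rho> * Cmax * H)\<^sup>2)"
    unfolding q_def power_mult_distrib[of "real n"] by (intro mult_left_mono square_sum_le) simp
  moreover have "2 * (t * sqrt (3 * Cmax) * (H + 1))\<^sup>2 + 2 * (\<rho> * Cmax * H)\<^sup>2
      = 2 * (t\<^sup>2 * (3 * Cmax * (H + 1)\<^sup>2) + \<rho>\<^sup>2 * (Cmax\<^sup>2 * H\<^sup>2))"
    using cst by (simp add: power_mult_distrib)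
  \<comment> \<open>Each coefficient is enlarged to the sum of both, so that \<open>R\<close>
    factors out.\<close>
  moreover have "(real n)\<^sup>2 * (2 * (t\<^sup>2 * (3 * Cmax * (H + 1)\<^sup>2) + \<rho>\<^sup>2 * (Cmax\<^sup>2 * H\<^sup>2)))
      \<le> (real n)\<^sup>2 * (2 * (t\<^sup>2 * (3 * Cmax * (H + 1)\<^sup>2 + Cmax\<^sup>2 * H\<^sup>2) + \<rho>\<^sup>2 * (3 * Cmax * (H + 1)\<^sup>2 + Cmax\<^sup>2 * H\<^sup>2)))"
    using cst by (intro mult_left_mono add_mono) auto
  ultimately have "q\<^sup>2 \<le> (real n)\<^sup>2 * (2 * (t\<^sup>2 * (3 * Cmax * (H + 1)\<^sup>2 + Cmax\<^sup>2 * H\<^sup>2) + \<rho>\<^sup>2 * (3 * Cmax * (H + 1)\<^sup>2 + Cmax\<^sup>2 * H\<^sup>2)))"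
    by simp
  also have "\<dots> = 2 * ((real n)\<^sup>2 * (3 * Cmax * (H + 1)\<^sup>2 + Cmax\<^sup>2 * H\<^sup>2) * R)"
    by (simp only: distrib_left mult_ac)
  finally show ?thesis using T by simp
qed

abbreviation "q0 \<equiv> pred_const Cmin Cmax Cw H \<tau>"

lemma R0: "R \<ge> 0" by simp

lemma q0_nonneg: "q0 \<ge> 0"
  unfolding pred_const_def using cst gram_const_pos by (intro add_nonneg_nonneg divide_nonneg_nonneg mult_nonneg_nonneg) auto

lemma Ew_bound: "(E *\<^sub>v w) \<bullet> (E *\<^sub>v w) \<le> Cw\<^sup>2 * R"
proof -
  have "w \<bullet> w \<le> Cw\<^sup>2" using power_mono[OF wCw norm_l2_nonneg[OF w], of 2] norm_l2_sq[OF w] by simp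
  then have "\<rho>\<^sup>2 * (w \<bullet> w) \<le> R * Cw\<^sup>2"
    using scalar_prod_self_nonneg[OF w] by (intro mult_mono) auto
  then show ?thesis using Ea_bound[OF w] by (simp add: mult.commute)
qed

lemma Ewx_bound: "(\<Sum>i<n. ((E *\<^sub>v w) \<bullet> x i)\<^sup>2) \<le> real n * (2 * \<tau>\<^sup>2 * Cw\<^sup>2 * R)"
proof -
  have "2 * \<tau>\<^sup>2 * real n * ((E *\<^sub>v w) \<bullet> (E *\<^sub>v w)) \<le> 2 * \<tau>\<^sup>2 * real n * (Cw\<^sup>2 * R)"
    by (intro mult_left_mono Ew_bound) auto
  then show ?thesis using ev_bias by (simp add: E_def mult_ac)
qed

lemma pred_bound: "(\<Sum>i<n. ((Bh *\<^sub>v a) \<bullet> x i)\<^sup>2) \<le> real n * (q0 * R)"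
proof -
  let ?Z = "\<lambda>i k. col Bh k \<bullet> x i"
  let ?W = "3 * Cmax * (H + 1)\<^sup>2 + Cmax\<^sup>2 * H\<^sup>2"
  have c: "real n * gram_const Cmin > 0" using n gram_const_pos by simp
  have eq: "(\<Sum>k<K. a $ k * ?Z i k) = (Bh *\<^sub>v a) \<bullet> x i" if "i < n" for i
    using Bha_dot[OF a x[OF that]] by simp
  have "(\<Sum>i<n. (\<Sum>k<K. a $ k * ?Z i k)\<^sup>2)
    \<le> 2 / (real n * gram_const Cmin) * (\<Sum>k<K. (\<Sum>i<n. ?Z i k * (\<delta> \<bullet> x i + \<epsilon> i))\<^sup>2)
      + 2 * (\<Sum>i<n. ((E *\<^sub>v w) \<bullet> x i)\<^sup>2)"
  proof (rule ols_prediction_bound[OF c])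
    show "real n * gram_const Cmin * (\<Sum>k<K. (a $ k)\<^sup>2) \<le> (\<Sum>i<n. (\<Sum>k<K. a $ k * ?Z i k)\<^sup>2)"
      using gram_bound[OF a] by (simp add: eq scalar_prod_self[OF a])
    have "0 = (\<Sum>i<n. ((Bh *\<^sub>v a) \<bullet> x i) * (snd (D i) - Z_hat Bh D i \<bullet> wh))"
      using normal[OF a] by simp
    also have "\<dots> = (\<Sum>i<n. (\<Sum>k<K. a $ k * ?Z i k) * (\<delta> \<bullet> x i + \<epsilon> i - (\<Sum>k<K. a $ k * ?Z i k) - (E *\<^sub>v w) \<bullet> x i))"
      by (intro sum.cong refl) (simp add: eq resid vx_split)
    finally show "(\<Sum>i<n. (\<Sum>k<K. a $ k * ?Z i k) * (\<delta> \<bullet> x i + \<epsilon> i - (\<Sum>k<K. a $ k * ?Z i k) - (E *\<^sub>v w) \<bullet> x i)) = 0"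
      by simp
  qed
  also have "\<dots> \<le> 2 / (real n * gram_const Cmin) * (4 * (real n)\<^sup>2 * ?W * R) + 2 * (real n * (2 * \<tau>\<^sup>2 * Cw\<^sup>2 * R))"
    using c by (intro add_mono mult_left_mono score_norm_bound Ewx_bound) auto
  also have "\<dots> = real n * (q0 * R)"
    using n gram_const_pos by (simp add: pred_const_def power2_eq_square field_simps)
  finally show ?thesis by (simp add: eq)
qed

lemma profile_const_split:
  "6 * Cmax * q0 / gram_const Cmin + 2 * Cw\<^sup>2 \<le> profile_const Cmin Cmax Cw H \<tau>"
  "2 * q0 + 4 * \<tau>\<^sup>2 * Cw\<^sup>2 \<le> profile_const Cmin Cmax Cw H \<tau>"
  unfolding profile_const_def using q0_nonneg cst gram_const_pos by auto

lemma profile_error: "v \<bullet> v \<le> profile_const Cmin Cmax Cw H \<tau> * R"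
proof -
  have "real n * gram_const Cmin * (a \<bullet> a) \<le> real n * (q0 * R)"
    using gram_bound[OF a] pred_bound by linarith
  then have aa: "a \<bullet> a \<le> q0 * R / gram_const Cmin"
    using n gram_const_pos by (simp add: pos_le_divide_eq mult.assoc mult.left_commute mult.commute)
  have "v \<bullet> v \<le> 2 * ((Bh *\<^sub>v a) \<bullet> (Bh *\<^sub>v a)) + 2 * ((E *\<^sub>v w) \<bullet> (E *\<^sub>v w))"
    unfolding v_split using Bh E a w by (intro scalar_prod_add_self_le[of _ p]) auto
  also have "\<dots> \<le> 2 * (3 * Cmax * (q0 * R / gram_const Cmin)) + 2 * (Cw\<^sup>2 * R)"
  proof -
    have "3 * Cmax * (a \<bullet> a) \<le> 3 * Cmax * (q0 * R / gram_const Cmin)"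
      using cst by (intro mult_left_mono aa) auto
    then show ?thesis using Bha_upper[OF a] Ew_bound by linarith
  qed
  also have "\<dots> = (6 * Cmax * q0 / gram_const Cmin + 2 * Cw\<^sup>2) * R" by (simp add: algebra_simps)
  also have "\<dots> \<le> profile_const Cmin Cmax Cw H \<tau> * R"
    by (intro mult_right_mono profile_const_split) simp
  finally show ?thesis .
qed

text \<open>Obtained from the splitting of \<open>v\<close> and not from
  \<open>profile_error\<close>: \<open>v\<close> depends on the target sample, so deviation bounds
  for fixed vectors do not lead from \<open>v \<bullet> v\<close> to its prediction error.\<close>

lemma profile_prediction_error: "(\<Sum>i<n. (v \<bullet> x i)\<^sup>2) \<le> real n * (profile_const Cmin Cmax Cw H \<tau> * R)"
proof -
  have "(\<Sum>i<n. (v \<bullet> x i)\<^sup>2) \<le> (\<Sum>i<n. 2 * ((Bh *\<^sub>v a) \<bullet> x i)\<^sup>2 + 2 * ((E *\<^sub>v w) \<bullet> x i)\<^sup>2)"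
    by (intro sum_mono) (simp add: vx_split square_sum_le)
  also have "\<dots> \<le> 2 * (real n * (q0 * R)) + 2 * (real n * (2 * \<tau>\<^sup>2 * Cw\<^sup>2 * R))"
    using pred_bound Ewx_bound by (simp add: sum.distrib flip: sum_distrib_left)
  also have "\<dots> = real n * ((2 * q0 + 4 * \<tau>\<^sup>2 * Cw\<^sup>2) * R)" by (simp add: algebra_simps)
  also have "\<dots> \<le> real n * (profile_const Cmin Cmax Cw H \<tau> * R)"
    by (intro mult_left_mono mult_right_mono profile_const_split) auto
  finally show ?thesis .
qed

lemma beta_ptl_error:
  assumes L: "L (resid_data n K Bh D) \<in> carrier_vec p"
  shows "(norm_l2 (beta_ptl n K L Bh D - b))\<^sup>2
    \<le> 2 * (v \<bullet> v) + 2 * (\<Sum>j<p. (L (resid_data n K Bh D) $ j - \<delta> $ j)\<^sup>2)"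
proof -
  let ?d = "L (resid_data n K Bh D)"
  have Bw: "B *\<^sub>v w \<in> carrier_vec p" and Bhw: "Bh *\<^sub>v wh \<in> carrier_vec p" using B Bh w wh by auto
  have eq: "beta_ptl n K L Bh D - b = v + (?d - \<delta>)"
    unfolding beta_ptl_def b_def v_def wh_def[symmetric] using Bw Bhw L \<delta> B Bh by (intro eq_vecI) auto
  have "(norm_l2 (beta_ptl n K L Bh D - b))\<^sup>2 = (v + (?d - \<delta>)) \<bullet> (v + (?d - \<delta>))"
    unfolding eq using v L \<delta> by (intro norm_l2_sq[of _ p]) auto
  also have "\<dots> \<le> 2 * (v \<bullet> v) + 2 * ((?d - \<delta>) \<bullet> (?d - \<delta>))"
    using v L \<delta> by (intro scalar_prod_add_self_le[of _ p]) auto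
  also have "(?d - \<delta>) \<bullet> (?d - \<delta>) = (\<Sum>j<p. (?d $ j - \<delta> $ j)\<^sup>2)"
    using L \<delta> by (simp add: scalar_prod_self[of _ p])
  finally show ?thesis .
qed

text \<open>Centres the objective at \<delta>, the form in which \<open>lasso_error_bound\<close>
  compares its values at the minimiser and at \<delta>.\<close>

lemma lasso_obj_resid:
  assumes d: "d \<in> carrier_vec p"
  shows "lasso_obj n lam (resid_data n K Bh D) d
    = (\<Sum>i<n. (\<epsilon> i - v \<bullet> x i - (\<Sum>j<p. (d $ j - \<delta> $ j) * x i $ j))\<^sup>2) / (2 * real n) + lam * (\<Sum>j<p. \<bar>d $ j\<bar>)"
proof -
  have "snd (resid_data n K Bh D i) - fst (resid_data n K Bh D i) \<bullet> d
      = \<epsilon> i - v \<bullet> x i - (\<Sum>j<p. (d $ j - \<delta> $ j) * x i $ j)" if i: "i < n" for i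
  proof -
    have "snd (resid_data n K Bh D i) = \<delta> \<bullet> x i + \<epsilon> i - v \<bullet> x i"
      using i resid[OF i] by (simp add: resid_data_def wh_def)
    moreover have "fst (resid_data n K Bh D i) \<bullet> d = (\<Sum>j<p. d $ j * x i $ j)"
      using i by (simp add: resid_data_def D_eq scalar_prod_lessThan[OF d] mult.commute)
    moreover have "\<delta> \<bullet> x i = (\<Sum>j<p. \<delta> $ j * x i $ j)" by (rule scalar_prod_lessThan[OF x[OF i]])
    ultimately show ?thesis by (simp add: left_diff_distrib sum_subtractf)
  qed
  then show ?thesis using d by (simp add: lasso_obj_def norm_l1_def)
qed

end

section \<open>Measurability of the estimator\<close>

text \<open>By the Leibniz formula the determinant is a polynomial in the entries.\<close>

lemma det_measurable:
  fixes A :: "'a \<Rightarrow> rmat"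
  assumes A: "\<And>\<omega>. \<omega> \<in> space M \<Longrightarrow> A \<omega> \<in> carrier_mat d d"
    and m: "\<And>i j. i < d \<Longrightarrow> j < d \<Longrightarrow> (\<lambda>\<omega>. A \<omega> $$ (i, j)) \<in> borel_measurable M"
  shows "(\<lambda>\<omega>. Determinant.det (A \<omega>)) \<in> borel_measurable M"
proof -
  have "(\<lambda>\<omega>. \<Sum>q\<in>{q. q permutes {0..<d}}. signof q * (\<Prod>i = 0..<d. A \<omega> $$ (i, q i))) \<in> borel_measurable M"
  proof (intro borel_measurable_sum borel_measurable_times borel_measurable_prod)
    fix q i assume q: "q \<in> {q. q permutes {0..<d}}" and i: "i \<in> {0..<d}"
    then have "q i \<in> {0..<d}" using permutes_in_image[of q "{0..<d}" i] by simp
    then show "(\<lambda>\<omega>. A \<omega> $$ (i, q i)) \<in> borel_measurable M" using i by (intro m) auto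
  qed simp
  moreover have "Determinant.det (A \<omega>) = (\<Sum>q\<in>{q. q permutes {0..<d}}. signof q * (\<Prod>i = 0..<d. A \<omega> $$ (i, q i)))"
    if "\<omega> \<in> space M" for \<omega>
    using det_def'[OF A[OF that]] by simp
  ultimately show ?thesis by (simp cong: measurable_cong)
qed

lemma cofactor_measurable:
  fixes A :: "'a \<Rightarrow> rmat"
  assumes A: "\<And>\<omega>. \<omega> \<in> space M \<Longrightarrow> A \<omega> \<in> carrier_mat d d"
    and m: "\<And>i j. i < d \<Longrightarrow> j < d \<Longrightarrow> (\<lambda>\<omega>. A \<omega> $$ (i, j)) \<in> borel_measurable M"
  shows "(\<lambda>\<omega>. cofactor (A \<omega>) k l) \<in> borel_measurable M"
proof -
  have "(\<lambda>\<omega>. Determinant.det (mat_delete (A \<omega>) k l)) \<in> borel_measurable M"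
  proof (rule det_measurable[of _ _ "d - 1"])
    show "mat_delete (A \<omega>) k l \<in> carrier_mat (d - 1) (d - 1)" if "\<omega> \<in> space M" for \<omega>
      using A[OF that] by (rule mat_delete_carrier)
    fix i j assume ij: "i < d - 1" "j < d - 1"
    let ?i = "if i < k then i else Suc i" and ?j = "if j < l then j else Suc j"
    have "(\<lambda>\<omega>. A \<omega> $$ (?i, ?j)) \<in> borel_measurable M" using ij by (intro m) auto
    moreover have "mat_delete (A \<omega>) k l $$ (i, j) = A \<omega> $$ (?i, ?j)" if "\<omega> \<in> space M" for \<omega>
      using A[OF that] ij unfolding mat_delete_def by auto
    ultimately show "(\<lambda>\<omega>. mat_delete (A \<omega>) k l $$ (i, j)) \<in> borel_measurable M"
      by (simp cong: measurable_cong)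
  qed
  then show ?thesis unfolding cofactor_def by simp
qed

text \<open>Cramer's rule, with the default value zero in the singular case: one formula for all
  matrices, so measurability of the inverse needs no exclusion of singular outcomes.\<close>

lemma mat_inv_index:
  assumes A: "(A :: rmat) \<in> carrier_mat d d" and ij: "i < d" "j < d"
  shows "mat_inv A $$ (i, j) = (if Determinant.det A = 0 then 0 else cofactor A j i / Determinant.det A)"
proof (cases "Determinant.det A = 0")
  case True
  have "mat_inverse A = None"
  proof (rule ccontr)
    assume "mat_inverse A \<noteq> None"
    then obtain C where "mat_inverse A = Some C" by auto
    from mat_inverse(2)[OF A this] have C: "A * C = 1\<^sub>m d" "C \<in> carrier_mat d d" by auto
    have "Determinant.det A * Determinant.det C = 1"
      using det_mult[OF A C(2)] C(1) by simp
    with True show False by simp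
  qed
  then show ?thesis using A ij True by (simp add: mat_inv_def)
next
  case False
  note inv = mat_inv_right[OF A False]
  let ?C = "mat_inv A"
  have "?C * A = 1\<^sub>m d" by (rule mat_mult_left_right_inverse[OF A inv])
  then have "adj_mat A = (?C * A) * adj_mat A" using adj_mat(1)[OF A] by simp
  also have "\<dots> = ?C * (A * adj_mat A)"
    by (rule assoc_mult_mat[OF inv(1) A adj_mat(1)[OF A]])
  also have "\<dots> = ?C * (Determinant.det A \<cdot>\<^sub>m 1\<^sub>m d)" by (simp add: adj_mat(2)[OF A])
  also have "\<dots> = Determinant.det A \<cdot>\<^sub>m ?C"
    using inv(1) by (subst mult_smult_distrib[OF inv(1) one_carrier_mat]) simp
  finally have "adj_mat A $$ (i, j) = Determinant.det A * ?C $$ (i, j)"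
    using inv(1) ij by simp
  moreover have "adj_mat A $$ (i, j) = cofactor A j i" using A ij by (simp add: adj_mat_def)
  ultimately show ?thesis using False by simp
qed

lemma mat_inv_carrier: "A \<in> carrier_mat d d \<Longrightarrow> mat_inv A \<in> carrier_mat d d"
  using mat_inverse(2)[of A d] by (auto simp: mat_inv_def split: option.splits)

lemma mat_inv_measurable:
  fixes A :: "'a \<Rightarrow> rmat"
  assumes A: "\<And>\<omega>. \<omega> \<in> space M \<Longrightarrow> A \<omega> \<in> carrier_mat d d"
    and m: "\<And>i j. i < d \<Longrightarrow> j < d \<Longrightarrow> (\<lambda>\<omega>. A \<omega> $$ (i, j)) \<in> borel_measurable M"
    and ij: "i < d" "j < d"
  shows "(\<lambda>\<omega>. mat_inv (A \<omega>) $$ (i, j)) \<in> borel_measurable M"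
proof -
  note [measurable] = det_measurable[OF A m] cofactor_measurable[OF A m]
  have "(\<lambda>\<omega>. if Determinant.det (A \<omega>) = 0 then 0 else cofactor (A \<omega>) j i / Determinant.det (A \<omega>)) \<in> borel_measurable M"
    by measurable
  then show ?thesis using mat_inv_index[OF A ij] by (simp cong: measurable_cong)
qed

lemma borel_vecD: "f \<in> measurable N (borel_vec p) \<Longrightarrow> j < p \<Longrightarrow> (\<lambda>x. f x $ j) \<in> borel_measurable N"
  by (simp add: measurable_borel_vec_iff)

lemma borel_vec_carrier: "f \<in> measurable N (borel_vec p) \<Longrightarrow> x \<in> space N \<Longrightarrow> f x \<in> carrier_vec p"
  using measurable_space[of f N "borel_vec p" x] by simp

lemma borel_vecI:
  "(\<And>x. x \<in> space N \<Longrightarrow> f x \<in> carrier_vec p) \<Longrightarrow>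
    (\<And>j. j < p \<Longrightarrow> (\<lambda>x. f x $ j) \<in> borel_measurable N) \<Longrightarrow> f \<in> measurable N (borel_vec p)"
  by (auto simp: measurable_borel_vec_iff)

lemma mult_mat_vec_measurable:
  fixes A :: "'a \<Rightarrow> rmat"
  assumes A: "\<And>x. x \<in> space N \<Longrightarrow> A x \<in> carrier_mat p K"
    and m: "\<And>j k. j < p \<Longrightarrow> k < K \<Longrightarrow> (\<lambda>x. A x $$ (j, k)) \<in> borel_measurable N"
    and u: "u \<in> measurable N (borel_vec K)"
  shows "(\<lambda>x. A x *\<^sub>v u x) \<in> measurable N (borel_vec p)"
proof (rule borel_vecI)
  show "A x *\<^sub>v u x \<in> carrier_vec p" if "x \<in> space N" for x
    using A[OF that] borel_vec_carrier[OF u that] by simp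
  fix j assume j: "j < p"
  have "(\<lambda>x. \<Sum>k<K. A x $$ (j, k) * u x $ k) \<in> borel_measurable N"
    using j by (intro borel_measurable_sum borel_measurable_times m borel_vecD[OF u]) auto
  moreover have "(A x *\<^sub>v u x) $ j = (\<Sum>k<K. A x $$ (j, k) * u x $ k)" if "x \<in> space N" for x
    using A[OF that] borel_vec_carrier[OF u that] j by (simp add: scalar_prod_lessThan[of _ K])
  ultimately show "(\<lambda>x. (A x *\<^sub>v u x) $ j) \<in> borel_measurable N" by (simp cong: measurable_cong)
qed

lemma add_vec_measurable:
  assumes "u \<in> measurable N (borel_vec p)" "v \<in> measurable N (borel_vec p)"
  shows "(\<lambda>x. u x + v x) \<in> measurable N (borel_vec p)"
proof (rule borel_vecI)
  show "u x + v x \<in> carrier_vec p" if "x \<in> space N" for x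
    using borel_vec_carrier[OF assms(1) that] borel_vec_carrier[OF assms(2) that] by simp
  fix j assume j: "j < p"
  have "(\<lambda>x. u x $ j + v x $ j) \<in> borel_measurable N"
    using borel_vecD[OF assms(1) j] borel_vecD[OF assms(2) j] by simp
  moreover have "(u x + v x) $ j = u x $ j + v x $ j" if "x \<in> space N" for x
    using borel_vec_carrier[OF assms(2) that] j by simp
  ultimately show "(\<lambda>x. (u x + v x) $ j) \<in> borel_measurable N" by (simp cong: measurable_cong)
qed

lemma minus_vec_measurable:
  assumes "u \<in> measurable N (borel_vec p)" "v \<in> measurable N (borel_vec p)"
  shows "(\<lambda>x. u x - v x) \<in> measurable N (borel_vec p)"
proof (rule borel_vecI)
  show "u x - v x \<in> carrier_vec p" if "x \<in> space N" for x
    using borel_vec_carrier[OF assms(1) that] borel_vec_carrier[OF assms(2) that] by simp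
  fix j assume j: "j < p"
  have "(\<lambda>x. u x $ j - v x $ j) \<in> borel_measurable N"
    using borel_vecD[OF assms(1) j] borel_vecD[OF assms(2) j] by simp
  moreover have "(u x - v x) $ j = u x $ j - v x $ j" if "x \<in> space N" for x
    using borel_vec_carrier[OF assms(2) that] j by simp
  ultimately show "(\<lambda>x. (u x - v x) $ j) \<in> borel_measurable N" by (simp cong: measurable_cong)
qed

lemma norm_l2_measurable: "u \<in> measurable N (borel_vec p) \<Longrightarrow> (\<lambda>x. norm_l2 (u x)) \<in> borel_measurable N"
  unfolding norm_l2_def
  by (rule measurable_compose[OF borel_measurable_scalar_prod borel_measurable_sqrt])

text \<open>The first conclusion makes the error event an event. The second is needed because
  \<open>is_lasso\<close> promises a minimiser only for data in the data space.\<close>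

lemma beta_ptl_measurable:
  assumes Bh: "\<And>\<omega>. \<omega> \<in> space M \<Longrightarrow> Bh \<omega> \<in> carrier_mat p K"
    and mBh: "\<And>j k. j < p \<Longrightarrow> k < K \<Longrightarrow> (\<lambda>\<omega>. Bh \<omega> $$ (j, k)) \<in> borel_measurable M"
    and x: "\<And>i. i < n \<Longrightarrow> (\<lambda>\<omega>. fst (D \<omega> i)) \<in> measurable M (borel_vec p)"
    and y: "\<And>i. i < n \<Longrightarrow> (\<lambda>\<omega>. snd (D \<omega> i)) \<in> borel_measurable M"
    and L: "L \<in> measurable (data_space p n) (borel_vec p)"
  shows "(\<lambda>\<omega>. beta_ptl n K L (Bh \<omega>) (D \<omega>)) \<in> measurable M (borel_vec p)"
    and "\<And>\<omega>. \<omega> \<in> space M \<Longrightarrow> resid_data n K (Bh \<omega>) (D \<omega>) \<in> space (data_space p n)"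
proof -
  have Z: "(\<lambda>\<omega>. Z_hat (Bh \<omega>) (D \<omega>) i) \<in> measurable M (borel_vec K)" if i: "i < n" for i
    unfolding Z_hat_def
  proof (rule mult_mat_vec_measurable[OF _ _ x[OF i]])
    show "transpose_mat (Bh \<omega>) \<in> carrier_mat K p" if "\<omega> \<in> space M" for \<omega> using Bh[OF that] by simp
    fix k j assume kj: "k < K" "j < p"
    have "transpose_mat (Bh \<omega>) $$ (k, j) = Bh \<omega> $$ (j, k)" if "\<omega> \<in> space M" for \<omega> using Bh[OF that] kj by simp
    then show "(\<lambda>\<omega>. transpose_mat (Bh \<omega>) $$ (k, j)) \<in> borel_measurable M"
      using mBh[OF kj(2,1)] by (simp cong: measurable_cong)
  qed
  have w: "(\<lambda>\<omega>. w_ptl n K (Bh \<omega>) (D \<omega>)) \<in> measurable M (borel_vec K)"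
    unfolding w_ptl_def
  proof (rule mult_mat_vec_measurable)
    let ?G = "\<lambda>\<omega>. Matrix.mat K K (\<lambda>(a, b). \<Sum>i<n. Z_hat (Bh \<omega>) (D \<omega>) i $ a * Z_hat (Bh \<omega>) (D \<omega>) i $ b)"
    show "mat_inv (?G \<omega>) \<in> carrier_mat K K" for \<omega> by (rule mat_inv_carrier) simp
    have "(\<lambda>\<omega>. ?G \<omega> $$ (a, b)) \<in> borel_measurable M" if "a < K" "b < K" for a b
      using that by simp (intro borel_measurable_sum borel_measurable_times borel_vecD[OF Z]; simp)
    then show "(\<lambda>\<omega>. mat_inv (?G \<omega>) $$ (j, k)) \<in> borel_measurable M" if "j < K" "k < K" for j k
      using that by (intro mat_inv_measurable) auto
    show "(\<lambda>\<omega>. Matrix.vec K (\<lambda>a. \<Sum>i<n. Z_hat (Bh \<omega>) (D \<omega>) i $ a * snd (D \<omega> i))) \<in> measurable M (borel_vec K)"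
    proof (rule borel_vecI)
      fix j assume "j < K"
      then show "(\<lambda>\<omega>. Matrix.vec K (\<lambda>a. \<Sum>i<n. Z_hat (Bh \<omega>) (D \<omega>) i $ a * snd (D \<omega> i)) $ j) \<in> borel_measurable M"
        by simp (intro borel_measurable_sum borel_measurable_times borel_vecD[OF Z] y; simp)
    qed simp
  qed
  have r: "(\<lambda>\<omega>. resid_data n K (Bh \<omega>) (D \<omega>)) \<in> measurable M (data_space p n)"
    unfolding resid_data_def
    by (intro measurable_restrict measurable_Pair x borel_measurable_diff y
        borel_measurable_scalar_prod[OF Z w]) auto
  show "\<And>\<omega>. \<omega> \<in> space M \<Longrightarrow> resid_data n K (Bh \<omega>) (D \<omega>) \<in> space (data_space p n)"
    by (rule measurable_space[OF r])
  have "(\<lambda>\<omega>. L (resid_data n K (Bh \<omega>) (D \<omega>))) \<in> measurable M (borel_vec p)"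
    by (rule measurable_compose[OF r L])
  then show "(\<lambda>\<omega>. beta_ptl n K L (Bh \<omega>) (D \<omega>)) \<in> measurable M (borel_vec p)"
    unfolding beta_ptl_def by (intro add_vec_measurable mult_mat_vec_measurable[OF Bh mBh w])
qed

lemma B_hat_carrier: "B_hat p K est Ds \<in> carrier_mat p K"
  by (auto simp: B_hat_def carrier_matI)

lemma B_hat_index: "j < p \<Longrightarrow> k < K \<Longrightarrow> B_hat p K est Ds $$ (j, k) = est k (Ds k) $ j"
  by (simp add: B_hat_def mat_of_cols_index)

lemma col_B_hat: "k < K \<Longrightarrow> est k (Ds k) \<in> carrier_vec p \<Longrightarrow> col (B_hat p K est Ds) k = est k (Ds k)"
  by (intro eq_vecI) (auto simp: B_hat_def mat_of_cols_index)

lemma B_hat_cong: "(\<And>k. k < K \<Longrightarrow> Ds k = Ds' k) \<Longrightarrow> B_hat p K est Ds = B_hat p K est Ds'"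
  unfolding B_hat_def by (intro arg_cong[of _ _ "mat_of_cols p"] map_cong) auto

lemma (in prob_space) prob_UN_le:
  assumes "finite I" "\<And>i. i \<in> I \<Longrightarrow> A i \<in> events" "\<And>i. i \<in> I \<Longrightarrow> prob (A i) \<le> q"
  shows "prob (\<Union>i\<in>I. A i) \<le> real (card I) * q"
proof -
  have "prob (\<Union>i\<in>I. A i) \<le> (\<Sum>i\<in>I. prob (A i))"
    using assms by (intro measure_UNION_le) auto
  also have "\<dots> \<le> (\<Sum>i\<in>I. q)" using assms by (intro sum_mono) auto
  finally show ?thesis by simp
qed

section \<open>The good event\<close>

locale ptl_model = target_sample M p n X e S sd \<tau> for M :: "'a measure" and p n X e S sd \<tau> +
  fixes K :: nat and nk :: "nat \<Rightarrow> nat" and Xs :: "nat \<Rightarrow> nat \<Rightarrow> 'a \<Rightarrow> rvec"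
    and es :: "nat \<Rightarrow> nat \<Rightarrow> 'a \<Rightarrow> real" and est :: "nat \<Rightarrow> dataset \<Rightarrow> rvec"
    and B :: rmat and w \<delta> :: rvec and Cmin Cmax :: real
  assumes n: "n > 0" and p: "p > 0"
    and B: "B \<in> carrier_mat p K" and w: "w \<in> carrier_vec K" and \<delta>: "\<delta> \<in> carrier_vec p"
    and Xs: "\<And>k i. k < K \<Longrightarrow> i < nk k \<Longrightarrow> Xs k i \<in> measurable M (borel_vec p)"
    and es: "\<And>k i. k < K \<Longrightarrow> i < nk k \<Longrightarrow> es k i \<in> borel_measurable M"
    and est: "\<And>k. k < K \<Longrightarrow> est k \<in> measurable (data_space p (nk k)) (borel_vec p)"
    and indep: "sources_indep_target M p K nk n Xs es X e"
    and Cmin: "Cmin > 0"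
    and Sbd: "\<And>y. y \<in> carrier_vec p \<Longrightarrow> Cmin * (y \<bullet> y) \<le> y \<bullet> (S *\<^sub>v y) \<and> y \<bullet> (S *\<^sub>v y) \<le> Cmax * (y \<bullet> y)"
begin

abbreviation "src_space \<equiv> Pi\<^sub>M (SIGMA k:{..<K}. {..<nk k}) (\<lambda>_. obs_space p)"

text \<open>All sources are flattened into one random element indexed by pairs, the form in which
  they are jointly independent of the target sample.\<close>

definition src :: "'a \<Rightarrow> nat \<times> nat \<Rightarrow> rvec \<times> real" where
  "src \<omega> = restrict (\<lambda>(k, i). (Xs k i \<omega>, es k i \<omega>)) (SIGMA k:{..<K}. {..<nk k})"

definition tgt :: "'a \<Rightarrow> dataset" where
  "tgt \<omega> = restrict (\<lambda>i. (X i \<omega>, e i \<omega>)) {..<n}"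

lemma indep_src_tgt: "indep_rv M src_space src (data_space p n) tgt"
  using indep unfolding sources_indep_target_def src_def[abs_def] tgt_def[abs_def] .

lemma src_measurable: "src \<in> measurable M src_space"
  using indep_src_tgt by (simp add: indep_rv_def)

definition Bh :: "'a \<Rightarrow> rmat" where
  "Bh \<omega> = B_hat p K est (\<lambda>k. sample (nk k) (Xs k) (es k) (col B k) \<omega>)"

definition src_sample :: "nat \<Rightarrow> (nat \<times> nat \<Rightarrow> rvec \<times> real) \<Rightarrow> dataset" where
  "src_sample k s = (\<lambda>i\<in>{..<nk k}. (fst (s (k, i)), fst (s (k, i)) \<bullet> col B k + snd (s (k, i))))"

text \<open>The fitted matrix as a function of the source data alone. \<open>Bh\<close> is its
  composition with \<open>src\<close>, and this is what allows it to be frozen.\<close>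

definition Bs :: "(nat \<times> nat \<Rightarrow> rvec \<times> real) \<Rightarrow> rmat" where
  "Bs s = B_hat p K est (\<lambda>k. src_sample k s)"

lemma Bs_src: "Bs (src \<omega>) = Bh \<omega>"
  unfolding Bs_def Bh_def
  by (rule B_hat_cong) (auto simp: src_sample_def sample_def src_def restrict_def fun_eq_iff)

lemma col_B: "k < K \<Longrightarrow> col B k \<in> carrier_vec p" using B by auto

lemma src_sample_measurable:
  assumes k: "k < K"
  shows "src_sample k \<in> measurable src_space (data_space p (nk k))"
  unfolding src_sample_def
proof (rule measurable_restrict)
  fix i assume i: "i \<in> {..<nk k}"
  then have ki: "(k, i) \<in> (SIGMA k:{..<K}. {..<nk k})" using k by auto
  have c: "(\<lambda>s. s (k, i)) \<in> measurable src_space (obs_space p)"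
    by (rule measurable_component_singleton[OF ki])
  have f: "(\<lambda>s. fst (s (k, i))) \<in> measurable src_space (borel_vec p)"
    by (rule measurable_compose[OF c measurable_fst])
  have g: "(\<lambda>s. snd (s (k, i))) \<in> borel_measurable src_space"
    by (rule measurable_compose[OF c measurable_snd])
  have h: "(\<lambda>s. fst (s (k, i)) \<bullet> col B k) \<in> borel_measurable src_space"
    by (rule borel_measurable_scalar_prod[OF f]) (use col_B[OF k] in simp)
  show "(\<lambda>s. (fst (s (k, i)), fst (s (k, i)) \<bullet> col B k + snd (s (k, i)))) \<in> measurable src_space (obs_space p)"
    by (intro measurable_Pair f borel_measurable_add h g)
qed

lemma Bs_col_measurable: "k < K \<Longrightarrow> (\<lambda>s. est k (src_sample k s)) \<in> measurable src_space (borel_vec p)"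
  by (rule measurable_compose[OF src_sample_measurable est])

lemma Bs_measurable: "j < p \<Longrightarrow> k < K \<Longrightarrow> (\<lambda>s. Bs s $$ (j, k)) \<in> borel_measurable src_space"
  using borel_vecD[OF Bs_col_measurable, of k j] by (simp add: Bs_def B_hat_index)

lemma Bs_carrier: "Bs s \<in> carrier_mat p K" by (simp add: Bs_def B_hat_carrier)

lemma Bh_carrier: "Bh \<omega> \<in> carrier_mat p K" by (simp add: Bh_def B_hat_carrier)

lemma Bh_measurable: "j < p \<Longrightarrow> k < K \<Longrightarrow> (\<lambda>\<omega>. Bh \<omega> $$ (j, k)) \<in> borel_measurable M"
  using measurable_compose[OF src_measurable Bs_measurable, of j k] by (simp add: Bs_src)

lemma Bs_vec_measurable: "z \<in> carrier_vec K \<Longrightarrow> (\<lambda>s. Bs s *\<^sub>v z) \<in> measurable src_space (borel_vec p)"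
  by (rule mult_mat_vec_measurable[OF Bs_carrier Bs_measurable]) auto

lemma col_Bs_measurable: "k < K \<Longrightarrow> (\<lambda>s. col (Bs s) k) \<in> measurable src_space (borel_vec p)"
proof (rule borel_vecI)
  assume k: "k < K"
  show "col (Bs s) k \<in> carrier_vec p" for s
    using col_dim[of "Bs s" k] carrier_matD(1)[OF Bs_carrier[of s]] by simp
  fix j assume j: "j < p"
  have "col (Bs s) k $ j = Bs s $$ (j, k)" for s using Bs_carrier[of s] j k by auto
  then show "(\<lambda>s. col (Bs s) k $ j) \<in> borel_measurable src_space"
    using Bs_measurable[OF j k] by simp
qed

lemma diff_Bs_measurable: "(\<lambda>s. (Bs s - B) *\<^sub>v w) \<in> measurable src_space (borel_vec p)"
proof (rule mult_mat_vec_measurable)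
  show "Bs s - B \<in> carrier_mat p K" for s by (rule minus_carrier_mat[OF B])
  show "(\<lambda>s. (Bs s - B) $$ (j, k)) \<in> borel_measurable src_space" if "j < p" "k < K" for j k
    using B that Bs_measurable[OF that] by simp
  show "(\<lambda>x. w) \<in> measurable src_space (borel_vec K)" using w by simp
qed

abbreviation "pair_space \<equiv> borel_vec p \<Otimes>\<^sub>M data_space p n"

lemma pair_component: "i < n \<Longrightarrow> (\<lambda>z. snd z i) \<in> measurable pair_space (obs_space p)"
  by (rule measurable_compose[OF measurable_snd measurable_component_singleton]) simp

lemma pair_fst: "i < n \<Longrightarrow> (\<lambda>z. fst (snd z i)) \<in> measurable pair_space (borel_vec p)"
  by (rule measurable_compose[OF pair_component measurable_fst])

lemma pair_snd: "i < n \<Longrightarrow> (\<lambda>z. snd (snd z i)) \<in> borel_measurable pair_space"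
  by (rule measurable_compose[OF pair_component measurable_snd])

lemma pair_dot: "i < n \<Longrightarrow> (\<lambda>z. fst z \<bullet> fst (snd z i)) \<in> borel_measurable pair_space"
  by (rule borel_measurable_scalar_prod[OF measurable_fst pair_fst])

lemma pair_dot_const: "i < n \<Longrightarrow> v \<in> carrier_vec p \<Longrightarrow> (\<lambda>z. v \<bullet> fst (snd z i)) \<in> borel_measurable pair_space"
  by (rule borel_measurable_scalar_prod_const[OF _ pair_fst])

lemma pair_self: "(\<lambda>z. fst z \<bullet> fst z) \<in> borel_measurable pair_space"
  by (rule borel_measurable_scalar_prod[OF measurable_fst measurable_fst])

lemma pair_norm: "(\<lambda>z. norm_l2 (fst z)) \<in> borel_measurable pair_space"
  by (rule norm_l2_measurable[OF measurable_fst])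

lemma tgt_eq: "i < n \<Longrightarrow> tgt \<omega> i = (X i \<omega>, e i \<omega>)" by (simp add: tgt_def)

text \<open>
  Conditioning on the source samples: a bound for every fixed \<open>u\<close> carries over to vectors computed
  from the sources.
\<close>

lemma prob_source_target_le:
  assumes g: "g \<in> measurable src_space (borel_vec p)"
    and Q: "Measurable.pred pair_space (\<lambda>z. Q (fst z) (snd z))"
    and le: "\<And>u. u \<in> carrier_vec p \<Longrightarrow> prob {\<omega> \<in> space M. Q u (tgt \<omega>)} \<le> q"
  shows "prob {\<omega> \<in> space M. Q (g (src \<omega>)) (tgt \<omega>)} \<le> q"
    and "{\<omega> \<in> space M. Q (g (src \<omega>)) (tgt \<omega>)} \<in> events"
proof -
  have tgt: "tgt \<in> measurable M (data_space p n)" using indep_src_tgt by (simp add: indep_rv_def)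
  have "(\<lambda>z. (g (fst z), snd z)) \<in> measurable (src_space \<Otimes>\<^sub>M data_space p n) pair_space"
    by (rule measurable_Pair[OF measurable_compose[OF measurable_fst g] measurable_snd])
  from measurable_compose[OF this Q]
  have P: "Measurable.pred (src_space \<Otimes>\<^sub>M data_space p n) (\<lambda>z. Q (g (fst z)) (snd z))" by simp
  show "prob {\<omega> \<in> space M. Q (g (src \<omega>)) (tgt \<omega>)} \<le> q"
    by (rule indep_rv_prob_le[OF prob_space_axioms indep_src_tgt P])
       (use le borel_vec_carrier[OF g] in blast)
  have "(\<lambda>\<omega>. (g (src \<omega>), tgt \<omega>)) \<in> measurable M pair_space"
    by (rule measurable_Pair[OF measurable_compose[OF src_measurable g] tgt])
  from measurable_compose[OF this Q]
  show "{\<omega> \<in> space M. Q (g (src \<omega>)) (tgt \<omega>)} \<in> events" by (simp add: pred_def)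
qed

section \<open>Deviation bounds at vectors computed from the sources\<close>

lemma upper_dev:
  assumes g: "g \<in> measurable src_space (borel_vec p)"
  defines "A \<equiv> {\<omega> \<in> space M. (\<Sum>i<n. (g (src \<omega>) \<bullet> X i \<omega>)\<^sup>2) > 2 * \<tau>\<^sup>2 * real n * (g (src \<omega>) \<bullet> g (src \<omega>))}"
  shows "prob A \<le> exp (- real n)" "A \<in> events"
proof -
  define Q where "Q u D = ((\<Sum>i<n. (u \<bullet> fst (D i))\<^sup>2) > 2 * \<tau>\<^sup>2 * real n * (u \<bullet> u))" for u and D :: dataset
  have QA: "A = {\<omega> \<in> space M. Q (g (src \<omega>)) (tgt \<omega>)}" by (simp add: A_def Q_def tgt_eq)
  have "(\<lambda>z. \<Sum>i<n. (fst z \<bullet> fst (snd z i))\<^sup>2) \<in> borel_measurable pair_space"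
    by (intro borel_measurable_sum borel_measurable_power pair_dot) simp
  then have Q: "Measurable.pred pair_space (\<lambda>z. Q (fst z) (snd z))"
    using pair_self unfolding Q_def by measurable
  have "prob {\<omega> \<in> space M. Q u (tgt \<omega>)} \<le> exp (- real n)" if u: "u \<in> carrier_vec p" for u
    using prob_sum_uX_sq[OF u, of "real n"] by (simp add: Q_def tgt_eq mult_ac)
  from prob_source_target_le[OF g Q this] show "prob A \<le> exp (- real n)" "A \<in> events" by (simp_all only: QA)
qed

text \<open>The exponent of \<open>prob_cross_dev\<close> at level min (Cmin / 2) (8 \<tau>^2): a
  deviation of Cmin / 2 keeps half of the smallest eigenvalue, and the minimum stays within the
  range of Bernstein's inequality.\<close>

definition cg :: real where "cg = (min (Cmin / 2) (8 * \<tau>\<^sup>2))\<^sup>2 / (32 * \<tau>^4)"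

lemma lower_dev_fixed:
  assumes u: "u \<in> carrier_vec p"
  shows "prob {\<omega> \<in> space M. (\<Sum>i<n. (u \<bullet> X i \<omega>)\<^sup>2) < real n * (Cmin / 2) * (u \<bullet> u)} \<le> 2 * exp (- real n * cg)"
proof -
  define t where "t = min (Cmin / 2) (8 * \<tau>\<^sup>2)"
  have t: "0 \<le> t" "t \<le> 8 * \<tau>\<^sup>2" "t \<le> Cmin / 2" using Cmin by (auto simp: t_def)
  have uu: "0 \<le> u \<bullet> u" by (rule scalar_prod_self_nonneg[OF u])
  have "prob {\<omega> \<in> space M. (\<Sum>i<n. (u \<bullet> X i \<omega>)\<^sup>2) < real n * (Cmin / 2) * (u \<bullet> u)}
      \<le> prob {\<omega> \<in> space M. \<bar>(\<Sum>i<n. (u \<bullet> X i \<omega>) * (u \<bullet> X i \<omega>)) - real n * (u \<bullet> (S *\<^sub>v u))\<bar>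
      > real n * t * norm_l2 u * norm_l2 u}"
  proof (rule finite_measure_mono)
    show "{\<omega> \<in> space M. (\<Sum>i<n. (u \<bullet> X i \<omega>)\<^sup>2) < real n * (Cmin / 2) * (u \<bullet> u)} \<subseteq>
      {\<omega> \<in> space M. \<bar>(\<Sum>i<n. (u \<bullet> X i \<omega>) * (u \<bullet> X i \<omega>)) - real n * (u \<bullet> (S *\<^sub>v u))\<bar>
      > real n * t * norm_l2 u * norm_l2 u}"
    proof clarify
      fix \<omega> assume lt: "(\<Sum>i<n. (u \<bullet> X i \<omega>)\<^sup>2) < real n * (Cmin / 2) * (u \<bullet> u)"
      have "real n * (Cmin * (u \<bullet> u)) \<le> real n * (u \<bullet> (S *\<^sub>v u))"
        using Sbd[OF u] by (intro mult_left_mono) auto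
      moreover have "real n * t * (u \<bullet> u) \<le> real n * (Cmin / 2) * (u \<bullet> u)"
        using t uu by (intro mult_right_mono mult_left_mono) auto
      moreover have "real n * t * norm_l2 u * norm_l2 u = real n * t * (u \<bullet> u)"
        by (simp add: norm_l2_sq[OF u, symmetric] power2_eq_square)
      moreover have "(\<Sum>i<n. (u \<bullet> X i \<omega>) * (u \<bullet> X i \<omega>)) = (\<Sum>i<n. (u \<bullet> X i \<omega>)\<^sup>2)"
        by (simp add: power2_eq_square)
      moreover have "real n * (Cmin * (u \<bullet> u)) = real n * (Cmin / 2) * (u \<bullet> u) + real n * (Cmin / 2) * (u \<bullet> u)"
        by simp
      ultimately show "real n * t * norm_l2 u * norm_l2 u
        < \<bar>(\<Sum>i<n. (u \<bullet> X i \<omega>) * (u \<bullet> X i \<omega>)) - real n * (u \<bullet> (S *\<^sub>v u))\<bar>"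
        using lt by linarith
    qed
    show "{\<omega> \<in> space M. \<bar>(\<Sum>i<n. (u \<bullet> X i \<omega>) * (u \<bullet> X i \<omega>)) - real n * (u \<bullet> (S *\<^sub>v u))\<bar>
      > real n * t * norm_l2 u * norm_l2 u} \<in> events"
      by (intro two_sided_measurable borel_measurable_diff sum_uX_measurable(1)[OF u u]) simp
  qed
  also have "\<dots> \<le> 2 * exp (- real n * t\<^sup>2 / (32 * \<tau>^4))"
    by (rule prob_cross_dev[OF u u t(1,2)])
  finally show ?thesis by (simp add: cg_def t_def)
qed

lemma lower_dev:
  assumes g: "g \<in> measurable src_space (borel_vec p)"
  defines "A \<equiv> {\<omega> \<in> space M. (\<Sum>i<n. (g (src \<omega>) \<bullet> X i \<omega>)\<^sup>2) < real n * (Cmin / 2) * (g (src \<omega>) \<bullet> g (src \<omega>))}"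
  shows "prob A \<le> 2 * exp (- real n * cg)" "A \<in> events"
proof -
  define Q where "Q u D = ((\<Sum>i<n. (u \<bullet> fst (D i))\<^sup>2) < real n * (Cmin / 2) * (u \<bullet> u))" for u and D :: dataset
  have QA: "A = {\<omega> \<in> space M. Q (g (src \<omega>)) (tgt \<omega>)}" by (simp add: A_def Q_def tgt_eq)
  have "(\<lambda>z. \<Sum>i<n. (fst z \<bullet> fst (snd z i))\<^sup>2) \<in> borel_measurable pair_space"
    by (intro borel_measurable_sum borel_measurable_power pair_dot) simp
  then have Q: "Measurable.pred pair_space (\<lambda>z. Q (fst z) (snd z))"
    using pair_self unfolding Q_def by measurable
  have "prob {\<omega> \<in> space M. Q u (tgt \<omega>)} \<le> 2 * exp (- real n * cg)" if u: "u \<in> carrier_vec p" for u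
    using lower_dev_fixed[OF u] by (simp add: Q_def tgt_eq)
  from prob_source_target_le[OF g Q this] show "prob A \<le> 2 * exp (- real n * cg)" "A \<in> events" by (simp_all only: QA)
qed

lemma cross_dev:
  assumes g: "g \<in> measurable src_space (borel_vec p)" and t: "0 \<le> t" "t \<le> 8 * \<tau>\<^sup>2"
  defines "A \<equiv> {\<omega> \<in> space M. \<bar>(\<Sum>i<n. (g (src \<omega>) \<bullet> X i \<omega>) * (\<delta> \<bullet> X i \<omega>)) - real n * (g (src \<omega>) \<bullet> (S *\<^sub>v \<delta>))\<bar>
      > real n * t * norm_l2 (g (src \<omega>)) * norm_l2 \<delta>}"
  shows "prob A \<le> 2 * exp (- real n * t\<^sup>2 / (32 * \<tau>^4))" "A \<in> events"
proof -
  define Q where "Q u D = (\<bar>(\<Sum>i<n. (u \<bullet> fst (D i)) * (\<delta> \<bullet> fst (D i))) - real n * (u \<bullet> (S *\<^sub>v \<delta>))\<bar>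
      > real n * t * norm_l2 u * norm_l2 \<delta>)" for u and D :: dataset
  have QA: "A = {\<omega> \<in> space M. Q (g (src \<omega>)) (tgt \<omega>)}" by (simp add: A_def Q_def tgt_eq)
  have S\<delta>: "S *\<^sub>v \<delta> \<in> carrier_vec p" using S_carrier[OF n] \<delta> by simp
  have 1: "(\<lambda>z. \<Sum>i<n. (fst z \<bullet> fst (snd z i)) * (\<delta> \<bullet> fst (snd z i))) \<in> borel_measurable pair_space"
    by (intro borel_measurable_sum borel_measurable_times pair_dot pair_dot_const \<delta>) simp_all
  have 2: "(\<lambda>z. fst z \<bullet> (S *\<^sub>v \<delta>)) \<in> borel_measurable pair_space"
    by (rule borel_measurable_scalar_prod[OF measurable_fst]) (use S\<delta> in simp)
  have Q: "Measurable.pred pair_space (\<lambda>z. Q (fst z) (snd z))"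
    using 1 2 pair_norm unfolding Q_def by measurable
  have "prob {\<omega> \<in> space M. Q u (tgt \<omega>)} \<le> 2 * exp (- real n * t\<^sup>2 / (32 * \<tau>^4))" if u: "u \<in> carrier_vec p" for u
    using prob_cross_dev[OF u \<delta> t] by (simp add: Q_def tgt_eq)
  from prob_source_target_le[OF g Q this] show "prob A \<le> 2 * exp (- real n * t\<^sup>2 / (32 * \<tau>^4))" "A \<in> events" by (simp_all only: QA)
qed

lemma noise_dev:
  assumes g: "g \<in> measurable src_space (borel_vec p)" and t: "0 \<le> t"
  defines "A \<equiv> {\<omega> \<in> space M. \<bar>\<Sum>i<n. (g (src \<omega>) \<bullet> X i \<omega>) * e i \<omega>\<bar> > real n * t * norm_l2 (g (src \<omega>))
      \<and> (\<Sum>i<n. (e i \<omega>)\<^sup>2) \<le> 2 * \<tau>\<^sup>2 * real n}"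
  shows "prob A \<le> 2 * exp (- real n * t\<^sup>2 / (32 * \<tau>^4))" "A \<in> events"
proof -
  define Q where "Q u D = (\<bar>\<Sum>i<n. (u \<bullet> fst (D i)) * snd (D i)\<bar> > real n * t * norm_l2 u
      \<and> (\<Sum>i<n. (snd (D i))\<^sup>2) \<le> 2 * \<tau>\<^sup>2 * real n)" for u and D :: dataset
  have QA: "A = {\<omega> \<in> space M. Q (g (src \<omega>)) (tgt \<omega>)}" by (simp add: A_def Q_def tgt_eq)
  have 1: "(\<lambda>z. \<Sum>i<n. (fst z \<bullet> fst (snd z i)) * snd (snd z i)) \<in> borel_measurable pair_space"
    by (intro borel_measurable_sum borel_measurable_times pair_dot pair_snd) simp_all
  have 2: "(\<lambda>z. \<Sum>i<n. (snd (snd z i))\<^sup>2) \<in> borel_measurable pair_space"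
    by (intro borel_measurable_sum borel_measurable_power pair_snd) simp
  have Q: "Measurable.pred pair_space (\<lambda>z. Q (fst z) (snd z))"
    using 1 2 pair_norm unfolding Q_def by measurable
  have "prob {\<omega> \<in> space M. Q u (tgt \<omega>)} \<le> 2 * exp (- real n * t\<^sup>2 / (32 * \<tau>^4))" if u: "u \<in> carrier_vec p" for u
  proof -
    have "(real n * t)\<^sup>2 / (32 * \<tau>^4 * real n) = real n * t\<^sup>2 / (32 * \<tau>^4)"
      using n by (simp add: power2_eq_square)
    then show ?thesis using prob_noise[OF u n, of "real n * t"] t by (simp add: Q_def tgt_eq)
  qed
  from prob_source_target_le[OF g Q this] show "prob A \<le> 2 * exp (- real n * t\<^sup>2 / (32 * \<tau>^4))" "A \<in> events" by (simp_all only: QA)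
qed

lemma unit_dot: "j < p \<Longrightarrow> i < n \<Longrightarrow> \<omega> \<in> space M \<Longrightarrow> unit_vec p j \<bullet> X i \<omega> = X i \<omega> $ j"
  using X_carrier by (intro scalar_prod_left_unit) auto

lemma unit_norm: "j < p \<Longrightarrow> unit_vec p j \<bullet> unit_vec p j = (1 :: real)" "j < p \<Longrightarrow> norm_l2 (unit_vec p j) = 1"
  by (simp_all add: norm_l2_def)

text \<open>The deviation level n + 2 ln p pays for the union over the coordinates. Keeping ln p in
  the threshold makes the bound valid for every size of ln p / n.\<close>

lemma design_coords_dev:
  defines "A \<equiv> (\<Union>j\<in>{..<p}. {\<omega> \<in> space M. (\<Sum>i<n. (X i \<omega> $ j)\<^sup>2) > 2 * \<tau>\<^sup>2 * (real n + ln (real p))})"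
  shows "prob A \<le> exp (- real n)" "A \<in> events"
proof -
  let ?A = "\<lambda>j. {\<omega> \<in> space M. (\<Sum>i<n. (X i \<omega> $ j)\<^sup>2) > 2 * \<tau>\<^sup>2 * (real n + ln (real p))}"
  have ev: "?A j \<in> events" if "j \<in> {..<p}" for j
    using that by (intro two_sided_measurable borel_measurable_sum borel_measurable_power Xj_measurable) auto
  show "A \<in> events" unfolding A_def by (rule sets.finite_UN[OF finite_lessThan ev])
  have "prob A \<le> real (card {..<p}) * exp (- (real n + 2 * ln (real p)))"
    unfolding A_def
  proof (rule prob_UN_le[OF _ ev])
    fix j assume j: "j \<in> {..<p}"
    have "?A j = {\<omega> \<in> space M. (\<Sum>i<n. (unit_vec p j \<bullet> X i \<omega>)\<^sup>2)
        > \<tau>\<^sup>2 * (unit_vec p j \<bullet> unit_vec p j) * (real n + (real n + 2 * ln (real p)))}"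
      using j by (intro Collect_cong conj_cong refl) (simp add: unit_dot unit_norm algebra_simps)
    then show "prob (?A j) \<le> exp (- (real n + 2 * ln (real p)))"
      using prob_sum_uX_sq[of "unit_vec p j" "real n + 2 * ln (real p)"] by simp
  qed simp_all
  also have "\<dots> = exp (- real n) * (real p * exp (- 2 * ln (real p)))"
    by (simp add: exp_add[symmetric] algebra_simps)
  also have "\<dots> \<le> exp (- real n) * 1"
  proof (intro mult_left_mono)
    have "real p * exp (- 2 * ln (real p)) = exp (ln (real p)) * exp (- 2 * ln (real p))" using p by simp
    also have "\<dots> = exp (- ln (real p))" by (simp flip: exp_add)
    also have "\<dots> \<le> 1" using p by simp
    finally show "real p * exp (- 2 * ln (real p)) \<le> 1" .
  qed simp
  finally show "prob A \<le> exp (- real n)" by simp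
qed

text \<open>The constant 8 makes the exponent 64 \<tau>^4 n ln p / (32 \<tau>^4 n) = 2 ln p; one ln
  p pays for the union, and the other leaves 2 / p, one reason why the final exponent involves the
  minimum of p and n.\<close>

lemma noise_coords_dev:
  defines "A \<equiv> (\<Union>j\<in>{..<p}. {\<omega> \<in> space M. \<bar>\<Sum>i<n. X i \<omega> $ j * e i \<omega>\<bar> > 8 * \<tau>\<^sup>2 * sqrt (real n * ln (real p))
      \<and> (\<Sum>i<n. (e i \<omega>)\<^sup>2) \<le> 2 * \<tau>\<^sup>2 * real n})"
  shows "prob A \<le> 2 / real p" "A \<in> events"
proof -
  let ?A = "\<lambda>j. {\<omega> \<in> space M. \<bar>\<Sum>i<n. X i \<omega> $ j * e i \<omega>\<bar> > 8 * \<tau>\<^sup>2 * sqrt (real n * ln (real p))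
      \<and> (\<Sum>i<n. (e i \<omega>)\<^sup>2) \<le> 2 * \<tau>\<^sup>2 * real n}"
  have ev: "?A j \<in> events" if j: "j \<in> {..<p}" for j
  proof -
    have [measurable]: "(\<lambda>\<omega>. \<Sum>i<n. X i \<omega> $ j * e i \<omega>) \<in> borel_measurable M"
      using j by (intro borel_measurable_sum borel_measurable_times Xj_measurable e_measurable) auto
    note [measurable] = sum_uX_measurable(4)
    show ?thesis by measurable
  qed
  show "A \<in> events" unfolding A_def by (rule sets.finite_UN[OF finite_lessThan ev])
  have lnp: "ln (real p) \<ge> 0" using p by simp
  have "prob A \<le> real (card {..<p}) * (2 * exp (- 2 * ln (real p)))"
    unfolding A_def
  proof (rule prob_UN_le[OF _ ev])
    fix j assume j: "j \<in> {..<p}"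
    have eq: "?A j = {\<omega> \<in> space M. \<bar>\<Sum>i<n. (unit_vec p j \<bullet> X i \<omega>) * e i \<omega>\<bar> > 8 * \<tau>\<^sup>2 * sqrt (real n * ln (real p)) * norm_l2 (unit_vec p j)
      \<and> (\<Sum>i<n. (e i \<omega>)\<^sup>2) \<le> 2 * \<tau>\<^sup>2 * real n}"
      using j by (intro Collect_cong conj_cong refl) (simp add: unit_dot unit_norm)
    have "(8 * \<tau>\<^sup>2 * sqrt (real n * ln (real p)))\<^sup>2 / (32 * \<tau>^4 * real n) = 2 * ln (real p)"
    proof -
      have "(8 * \<tau>\<^sup>2 * sqrt (real n * ln (real p)))\<^sup>2 = 64 * \<tau>^4 * (real n * ln (real p))"
        using lnp by (simp add: power_mult_distrib flip: power_mult)
      then show ?thesis using n tau by simp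
    qed
    then show "prob (?A j) \<le> 2 * exp (- 2 * ln (real p))"
      using prob_noise[of "unit_vec p j" "8 * \<tau>\<^sup>2 * sqrt (real n * ln (real p))"] n lnp unfolding eq by simp
  qed simp_all
  also have "\<dots> = 2 * (exp (ln (real p)) * exp (- 2 * ln (real p)))" using p by simp
  also have "\<dots> = 2 * exp (- ln (real p))" by (simp flip: exp_add)
  also have "\<dots> = 2 / real p" using p by (simp add: exp_minus field_simps)
  finally show "prob A \<le> 2 / real p" .
qed

lemma noise_energy_dev:
  defines "A \<equiv> {\<omega> \<in> space M. (\<Sum>i<n. (e i \<omega>)\<^sup>2) > 2 * \<tau>\<^sup>2 * real n}"
  shows "prob A \<le> exp (- real n)" "A \<in> events"
  using prob_sum_e_sq[of "real n"] sum_uX_measurable(4)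
  by (simp_all add: A_def mult_ac two_sided_measurable)

text \<open>\<open>m1\<close> is the lattice radius for the restricted eigenvalue in dimension
  \<open>p\<close>, \<open>m2\<close> the one for the fitted Gram matrix in dimension
  \<open>K\<close>, and \<open>K + 1\<close> is the radius in \<open>dual_lattice_bound\<close>.
  \<open>rk\<close> holds the error levels of the source estimators.\<close>

definition good :: "nat \<Rightarrow> nat \<Rightarrow> real \<Rightarrow> (nat \<Rightarrow> real) \<Rightarrow> 'a \<Rightarrow> bool" where
  "good m1 m2 t rk \<omega> \<longleftrightarrow>
    (\<forall>j<p. (\<Sum>i<n. (X i \<omega> $ j)\<^sup>2) \<le> 2 * \<tau>\<^sup>2 * (real n + ln (real p))) \<and>
    (\<forall>j<p. \<bar>\<Sum>i<n. X i \<omega> $ j * e i \<omega>\<bar> \<le> 8 * \<tau>\<^sup>2 * sqrt (real n * ln (real p))) \<and>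
    (\<forall>z\<in>lattice_pts p m1. real n * (Cmin / 2) * (Matrix.vec p z \<bullet> Matrix.vec p z)
      \<le> (\<Sum>i<n. (Matrix.vec p z \<bullet> X i \<omega>)\<^sup>2)) \<and>
    (\<forall>z\<in>lattice_pts K m2. real n * (Cmin / 2) * ((Bh \<omega> *\<^sub>v Matrix.vec K z) \<bullet> (Bh \<omega> *\<^sub>v Matrix.vec K z))
      \<le> (\<Sum>i<n. ((Bh \<omega> *\<^sub>v Matrix.vec K z) \<bullet> X i \<omega>)\<^sup>2)) \<and>
    (\<forall>k<K. (\<Sum>i<n. (col (Bh \<omega>) k \<bullet> X i \<omega>)\<^sup>2) \<le> 2 * \<tau>\<^sup>2 * real n * (col (Bh \<omega>) k \<bullet> col (Bh \<omega>) k)) \<and>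
    (\<Sum>i<n. (((Bh \<omega> - B) *\<^sub>v w) \<bullet> X i \<omega>)\<^sup>2)
      \<le> 2 * \<tau>\<^sup>2 * real n * (((Bh \<omega> - B) *\<^sub>v w) \<bullet> ((Bh \<omega> - B) *\<^sub>v w)) \<and>
    (\<forall>z\<in>lattice_pts K (K + 1).
      \<bar>(\<Sum>i<n. ((Bh \<omega> *\<^sub>v Matrix.vec K z) \<bullet> X i \<omega>) * (\<delta> \<bullet> X i \<omega>))
        - real n * ((Bh \<omega> *\<^sub>v Matrix.vec K z) \<bullet> (S *\<^sub>v \<delta>))\<bar>
      \<le> real n * t * norm_l2 (Bh \<omega> *\<^sub>v Matrix.vec K z) * norm_l2 \<delta>) \<and>
    (\<forall>z\<in>lattice_pts K (K + 1).
      \<bar>\<Sum>i<n. ((Bh \<omega> *\<^sub>v Matrix.vec K z) \<bullet> X i \<omega>) * e i \<omega>\<bar> \<le> real n * t * norm_l2 (Bh \<omega> *\<^sub>v Matrix.vec K z)) \<and>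
    (\<forall>k<K. (norm_l2 (col (Bh \<omega>) k - col B k))\<^sup>2 \<le> rk k)"

lemma prob_Union_le_sum_list:
  assumes "\<And>A. A \<in> set As \<Longrightarrow> A \<in> events"
  shows "prob (\<Union>(set As)) \<le> sum_list (map prob As)"
  using assms
proof (induction As)
  case (Cons A As)
  have U: "\<Union>(set As) \<in> events" using Cons.prems by (intro sets.finite_Union) auto
  have "prob (A \<union> \<Union>(set As)) \<le> prob A + prob (\<Union>(set As))"
    using Cons.prems U by (intro measure_Un_le) auto
  then show ?case using Cons by fastforce
qed simp

text \<open>Phrased through a measurable exceptional set, so that only its ten pieces have to be
  events. The polynomial count serves dimension \<open>p\<close>, which may far exceed the radius;
  the exponential count serves dimension \<open>K\<close>, where the radii used are of order
  K.\<close>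

lemma good_event:
  assumes t: "0 \<le> t" "t \<le> 8 * \<tau>\<^sup>2"
    and rk: "\<And>k. k < K \<Longrightarrow> prob {\<omega> \<in> space M. (norm_l2 (col (Bh \<omega>) k - col B k))\<^sup>2 \<le> rk k} \<ge> 1 - qk k"
  shows "\<exists>N\<in>events. (\<forall>\<omega>\<in>space M - N. good m1 m2 t rk \<omega>) \<and>
    prob N \<le> 2 * exp (- real n) + 2 / real p + (2 * real p + 1) ^ m1 * (2 * exp (- real n * cg))
      + 2 ^ m2 * 3 ^ K * (2 * exp (- real n * cg)) + real (K + 1) * exp (- real n)
      + 2 * (2 ^ (K + 1) * 3 ^ K * (2 * exp (- real n * t\<^sup>2 / (32 * \<tau>^4)))) + (\<Sum>k<K. qk k)"
proof -
  define A1 where "A1 = {\<omega> \<in> space M. (\<Sum>i<n. (e i \<omega>)\<^sup>2) > 2 * \<tau>\<^sup>2 * real n}"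
  define A2 where "A2 = (\<Union>j\<in>{..<p}. {\<omega> \<in> space M. (\<Sum>i<n. (X i \<omega> $ j)\<^sup>2) > 2 * \<tau>\<^sup>2 * (real n + ln (real p))})"
  define A3 where "A3 = (\<Union>j\<in>{..<p}. {\<omega> \<in> space M. \<bar>\<Sum>i<n. X i \<omega> $ j * e i \<omega>\<bar> > 8 * \<tau>\<^sup>2 * sqrt (real n * ln (real p))
      \<and> (\<Sum>i<n. (e i \<omega>)\<^sup>2) \<le> 2 * \<tau>\<^sup>2 * real n})"
  define a4 where "a4 z = {\<omega> \<in> space M. (\<Sum>i<n. (Matrix.vec p z \<bullet> X i \<omega>)\<^sup>2) < real n * (Cmin / 2) * (Matrix.vec p z \<bullet> Matrix.vec p z)}" for z :: "nat \<Rightarrow> real"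
  define A4 where "A4 = (\<Union>z\<in>lattice_pts p m1. a4 z)"
  let ?u = "\<lambda>z \<omega>. Bh \<omega> *\<^sub>v Matrix.vec K z"
  define a5 where "a5 z = {\<omega> \<in> space M. (\<Sum>i<n. (?u z \<omega> \<bullet> X i \<omega>)\<^sup>2) < real n * (Cmin / 2) * (?u z \<omega> \<bullet> ?u z \<omega>)}" for z :: "nat \<Rightarrow> real"
  define A5 where "A5 = (\<Union>z\<in>lattice_pts K m2. a5 z)"
  define a6 where "a6 z = {\<omega> \<in> space M. \<bar>(\<Sum>i<n. (?u z \<omega> \<bullet> X i \<omega>) * (\<delta> \<bullet> X i \<omega>)) - real n * (?u z \<omega> \<bullet> (S *\<^sub>v \<delta>))\<bar>
      > real n * t * norm_l2 (?u z \<omega>) * norm_l2 \<delta>}" for z :: "nat \<Rightarrow> real"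
  define A6 where "A6 = (\<Union>z\<in>lattice_pts K (K + 1). a6 z)"
  define a7 where "a7 z = {\<omega> \<in> space M. \<bar>\<Sum>i<n. (?u z \<omega> \<bullet> X i \<omega>) * e i \<omega>\<bar> > real n * t * norm_l2 (?u z \<omega>)
      \<and> (\<Sum>i<n. (e i \<omega>)\<^sup>2) \<le> 2 * \<tau>\<^sup>2 * real n}" for z :: "nat \<Rightarrow> real"
  define A7 where "A7 = (\<Union>z\<in>lattice_pts K (K + 1). a7 z)"
  define a8 where "a8 k = {\<omega> \<in> space M. (\<Sum>i<n. (col (Bh \<omega>) k \<bullet> X i \<omega>)\<^sup>2) > 2 * \<tau>\<^sup>2 * real n * (col (Bh \<omega>) k \<bullet> col (Bh \<omega>) k)}" for k
  define A8 where "A8 = (\<Union>k\<in>{..<K}. a8 k)"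
  define A9 where "A9 = {\<omega> \<in> space M. (\<Sum>i<n. (((Bh \<omega> - B) *\<^sub>v w) \<bullet> X i \<omega>)\<^sup>2)
      > 2 * \<tau>\<^sup>2 * real n * (((Bh \<omega> - B) *\<^sub>v w) \<bullet> ((Bh \<omega> - B) *\<^sub>v w))}"
  define a10 where "a10 k = {\<omega> \<in> space M. \<not> (norm_l2 (col (Bh \<omega>) k - col B k))\<^sup>2 \<le> rk k}" for k
  define A10 where "A10 = (\<Union>k\<in>{..<K}. a10 k)"
  have e1: "prob A1 \<le> exp (- real n)" "A1 \<in> events" unfolding A1_def by (rule noise_energy_dev)+
  have e2: "prob A2 \<le> exp (- real n)" "A2 \<in> events" unfolding A2_def by (rule design_coords_dev)+
  have e3: "prob A3 \<le> 2 / real p" "A3 \<in> events" unfolding A3_def by (rule noise_coords_dev)+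
  have a4: "a4 z \<in> events" "prob (a4 z) \<le> 2 * exp (- real n * cg)" for z
  proof -
    have v: "Matrix.vec p z \<in> carrier_vec p" by simp
    show "prob (a4 z) \<le> 2 * exp (- real n * cg)" unfolding a4_def by (rule lower_dev_fixed[OF v])
    note [measurable] = sum_uX_measurable(2)[OF v]
    show "a4 z \<in> events" unfolding a4_def by measurable
  qed
  have e4: "prob A4 \<le> (2 * real p + 1) ^ m1 * (2 * exp (- real n * cg))" "A4 \<in> events"
  proof -
    have "prob A4 \<le> real (card (lattice_pts p m1)) * (2 * exp (- real n * cg))"
      unfolding A4_def by (rule prob_UN_le[OF finite_lattice_pts a4])
    also have "\<dots> \<le> (2 * real p + 1) ^ m1 * (2 * exp (- real n * cg))"
      by (intro mult_right_mono card_lattice_pts_le_poly) simp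
    finally show "prob A4 \<le> (2 * real p + 1) ^ m1 * (2 * exp (- real n * cg))" .
    show "A4 \<in> events" unfolding A4_def by (intro sets.finite_UN finite_lattice_pts a4)
  qed
  have vK: "Matrix.vec K z \<in> carrier_vec K" for z :: "nat \<Rightarrow> real" by simp
  have a5: "a5 z \<in> events" "prob (a5 z) \<le> 2 * exp (- real n * cg)" for z
    using lower_dev[OF Bs_vec_measurable[OF vK[of z]]] by (simp_all add: a5_def Bs_src)
  have e5: "prob A5 \<le> 2 ^ m2 * 3 ^ K * (2 * exp (- real n * cg))" "A5 \<in> events"
  proof -
    have "prob A5 \<le> real (card (lattice_pts K m2)) * (2 * exp (- real n * cg))"
      unfolding A5_def by (rule prob_UN_le[OF finite_lattice_pts a5])
    also have "\<dots> \<le> 2 ^ m2 * 3 ^ K * (2 * exp (- real n * cg))"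
      by (intro mult_right_mono card_lattice_pts_le_exp) simp
    finally show "prob A5 \<le> 2 ^ m2 * 3 ^ K * (2 * exp (- real n * cg))" .
    show "A5 \<in> events" unfolding A5_def by (intro sets.finite_UN finite_lattice_pts a5)
  qed
  let ?q = "2 * exp (- real n * t\<^sup>2 / (32 * \<tau>^4))"
  have a6: "a6 z \<in> events" "prob (a6 z) \<le> ?q" for z
    using cross_dev[OF Bs_vec_measurable[OF vK[of z]] t] by (simp_all add: a6_def Bs_src)
  have e6: "prob A6 \<le> 2 ^ (K + 1) * 3 ^ K * ?q" "A6 \<in> events"
  proof -
    have "prob A6 \<le> real (card (lattice_pts K (K + 1))) * ?q"
      unfolding A6_def by (rule prob_UN_le[OF finite_lattice_pts a6])
    also have "\<dots> \<le> 2 ^ (K + 1) * 3 ^ K * ?q"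
      by (intro mult_right_mono card_lattice_pts_le_exp) simp
    finally show "prob A6 \<le> 2 ^ (K + 1) * 3 ^ K * ?q" .
    show "A6 \<in> events" unfolding A6_def by (intro sets.finite_UN finite_lattice_pts a6)
  qed
  have a7: "a7 z \<in> events" "prob (a7 z) \<le> ?q" for z
    using noise_dev[OF Bs_vec_measurable[OF vK[of z]] t(1)] by (simp_all add: a7_def Bs_src)
  have e7: "prob A7 \<le> 2 ^ (K + 1) * 3 ^ K * ?q" "A7 \<in> events"
  proof -
    have "prob A7 \<le> real (card (lattice_pts K (K + 1))) * ?q"
      unfolding A7_def by (rule prob_UN_le[OF finite_lattice_pts a7])
    also have "\<dots> \<le> 2 ^ (K + 1) * 3 ^ K * ?q"
      by (intro mult_right_mono card_lattice_pts_le_exp) simp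
    finally show "prob A7 \<le> 2 ^ (K + 1) * 3 ^ K * ?q" .
    show "A7 \<in> events" unfolding A7_def by (intro sets.finite_UN finite_lattice_pts a7)
  qed
  have a8: "a8 k \<in> events" "prob (a8 k) \<le> exp (- real n)" if "k \<in> {..<K}" for k
    using upper_dev[OF col_Bs_measurable[of k]] that by (simp_all add: a8_def Bs_src)
  have e8: "prob A8 \<le> real K * exp (- real n)" "A8 \<in> events"
  proof -
    show "prob A8 \<le> real K * exp (- real n)"
      using prob_UN_le[of "{..<K}" a8, OF _ a8] by (simp add: A8_def)
    show "A8 \<in> events" unfolding A8_def by (intro sets.finite_UN a8) auto
  qed
  have e9: "prob A9 \<le> exp (- real n)" "A9 \<in> events"
    using upper_dev[OF diff_Bs_measurable] by (simp_all add: A9_def Bs_src)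
  have a10: "a10 k \<in> events" "prob (a10 k) \<le> qk k" if k: "k \<in> {..<K}" for k
  proof -
    let ?G = "{\<omega> \<in> space M. (norm_l2 (col (Bh \<omega>) k - col B k))\<^sup>2 \<le> rk k}"
    have "(\<lambda>s. norm_l2 (col (Bs s) k - col B k)) \<in> borel_measurable src_space"
      using k col_B by (intro norm_l2_measurable[of _ _ p] minus_vec_measurable col_Bs_measurable) auto
    from measurable_compose[OF src_measurable this]
    have [measurable]: "(\<lambda>\<omega>. norm_l2 (col (Bh \<omega>) k - col B k)) \<in> borel_measurable M" by (simp add: Bs_src)
    have G: "?G \<in> events" by measurable
    have eq: "a10 k = space M - ?G" by (auto simp: a10_def)
    show "a10 k \<in> events" unfolding eq using G by auto
    show "prob (a10 k) \<le> qk k" unfolding eq using prob_compl[OF G] rk[of k] k by simp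
  qed
  have e10: "prob A10 \<le> (\<Sum>k<K. qk k)" "A10 \<in> events"
  proof -
    have "prob A10 \<le> (\<Sum>k<K. prob (a10 k))" unfolding A10_def using a10 by (intro measure_UNION_le) auto
    also have "\<dots> \<le> (\<Sum>k<K. qk k)" using a10 by (intro sum_mono) auto
    finally show "prob A10 \<le> (\<Sum>k<K. qk k)" .
    show "A10 \<in> events" unfolding A10_def by (intro sets.finite_UN a10) auto
  qed
  let ?As = "[A1, A2, A3, A4, A5, A6, A7, A8, A9, A10]"
  define N where "N = \<Union>(set ?As)"
  have evs: "A \<in> events" if "A \<in> set ?As" for A
    using that e1 e2 e3 e4 e5 e6 e7 e8 e9 e10 by auto
  have "N \<in> events" unfolding N_def using evs by (intro sets.finite_Union) auto
  moreover have "prob N \<le> 2 * exp (- real n) + 2 / real p + (2 * real p + 1) ^ m1 * (2 * exp (- real n * cg))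
      + 2 ^ m2 * 3 ^ K * (2 * exp (- real n * cg)) + real (K + 1) * exp (- real n)
      + 2 * (2 ^ (K + 1) * 3 ^ K * ?q) + (\<Sum>k<K. qk k)"
  proof -
    have "prob N \<le> sum_list (map prob ?As)" unfolding N_def by (rule prob_Union_le_sum_list[OF evs])
    also have "\<dots> = prob A1 + prob A2 + prob A3 + prob A4 + prob A5 + prob A6 + prob A7 + prob A8 + prob A9 + prob A10"
      by simp
    also have "\<dots> \<le> exp (- real n) + exp (- real n) + 2 / real p + (2 * real p + 1) ^ m1 * (2 * exp (- real n * cg))
      + 2 ^ m2 * 3 ^ K * (2 * exp (- real n * cg)) + 2 ^ (K + 1) * 3 ^ K * ?q + 2 ^ (K + 1) * 3 ^ K * ?q
      + real K * exp (- real n) + exp (- real n) + (\<Sum>k<K. qk k)"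
      by (intro add_mono e1 e2 e3 e4 e5 e6 e7 e8 e9 e10)
    also have "\<dots> = 2 * exp (- real n) + 2 / real p + (2 * real p + 1) ^ m1 * (2 * exp (- real n * cg))
      + 2 ^ m2 * 3 ^ K * (2 * exp (- real n * cg)) + real (K + 1) * exp (- real n)
      + 2 * (2 ^ (K + 1) * 3 ^ K * ?q) + (\<Sum>k<K. qk k)"
      by (simp add: distrib_right)
    finally show ?thesis .
  qed
  moreover have "good m1 m2 t rk \<omega>" if w: "\<omega> \<in> space M - N" for \<omega>
  proof -
    have ws: "\<omega> \<in> space M" and nN: "\<omega> \<notin> A1" "\<omega> \<notin> A2" "\<omega> \<notin> A3" "\<omega> \<notin> A4" "\<omega> \<notin> A5" "\<omega> \<notin> A6" "\<omega> \<notin> A7" "\<omega> \<notin> A8" "\<omega> \<notin> A9" "\<omega> \<notin> A10"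
      using w by (simp_all add: N_def)
    \<comment> \<open>Outside \<open>A1\<close> the energy clause of \<open>A3\<close> and
      \<open>A7\<close> holds, so avoiding these two events bounds the noise terms
      themselves.\<close>
    have E: "(\<Sum>i<n. (e i \<omega>)\<^sup>2) \<le> 2 * \<tau>\<^sup>2 * real n" using nN(1) ws by (simp add: A1_def)
    show ?thesis unfolding good_def
    proof (intro conjI)
      show "\<forall>j<p. (\<Sum>i<n. (X i \<omega> $ j)\<^sup>2) \<le> 2 * \<tau>\<^sup>2 * (real n + ln (real p))"
        using nN(2) ws by (simp add: A2_def not_less)
      show "\<forall>j<p. \<bar>\<Sum>i<n. X i \<omega> $ j * e i \<omega>\<bar> \<le> 8 * \<tau>\<^sup>2 * sqrt (real n * ln (real p))"
        using nN(3) ws E by (simp add: A3_def not_less)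
      show "\<forall>z\<in>lattice_pts p m1. real n * (Cmin / 2) * (Matrix.vec p z \<bullet> Matrix.vec p z)
          \<le> (\<Sum>i<n. (Matrix.vec p z \<bullet> X i \<omega>)\<^sup>2)"
        using nN(4) ws by (simp add: A4_def a4_def not_less)
      show "\<forall>z\<in>lattice_pts K m2. real n * (Cmin / 2) * (?u z \<omega> \<bullet> ?u z \<omega>) \<le> (\<Sum>i<n. (?u z \<omega> \<bullet> X i \<omega>)\<^sup>2)"
        using nN(5) ws by (simp add: A5_def a5_def not_less)
      show "\<forall>k<K. (\<Sum>i<n. (col (Bh \<omega>) k \<bullet> X i \<omega>)\<^sup>2) \<le> 2 * \<tau>\<^sup>2 * real n * (col (Bh \<omega>) k \<bullet> col (Bh \<omega>) k)"
        using nN(8) ws by (simp add: A8_def a8_def not_less)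
      show "(\<Sum>i<n. (((Bh \<omega> - B) *\<^sub>v w) \<bullet> X i \<omega>)\<^sup>2)
          \<le> 2 * \<tau>\<^sup>2 * real n * (((Bh \<omega> - B) *\<^sub>v w) \<bullet> ((Bh \<omega> - B) *\<^sub>v w))"
        using nN(9) ws by (simp add: A9_def not_less)
      show "\<forall>z\<in>lattice_pts K (K + 1).
          \<bar>(\<Sum>i<n. (?u z \<omega> \<bullet> X i \<omega>) * (\<delta> \<bullet> X i \<omega>)) - real n * (?u z \<omega> \<bullet> (S *\<^sub>v \<delta>))\<bar>
          \<le> real n * t * norm_l2 (?u z \<omega>) * norm_l2 \<delta>"
        using nN(6) ws by (simp add: A6_def a6_def not_less)
      show "\<forall>z\<in>lattice_pts K (K + 1). \<bar>\<Sum>i<n. (?u z \<omega> \<bullet> X i \<omega>) * e i \<omega>\<bar> \<le> real n * t * norm_l2 (?u z \<omega>)"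
        using nN(7) ws E by (simp add: A7_def a7_def not_less)
      show "\<forall>k<K. (norm_l2 (col (Bh \<omega>) k - col B k))\<^sup>2 \<le> rk k"
        using nN(10) ws by (simp add: A10_def a10_def)
    qed
  qed
  ultimately show ?thesis by blast
qed

end

section \<open>Error bounds on the good event\<close>

lemma norm_l1_eq: "v \<in> carrier_vec d \<Longrightarrow> norm_l1 v = (\<Sum>j<d. \<bar>v $ j\<bar>)"
  by (simp add: norm_l1_def)

lemma norm_l2_le_norm_l1: "v \<in> carrier_vec d \<Longrightarrow> norm_l2 v \<le> norm_l1 v"
proof -
  assume v: "v \<in> carrier_vec d"
  have "v \<bullet> v = (\<Sum>j<d. \<bar>v $ j\<bar> * \<bar>v $ j\<bar>)" by (simp add: scalar_prod_lessThan[OF v])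
  also have "\<dots> \<le> (\<Sum>j<d. \<bar>v $ j\<bar> * norm_l1 v)"
    unfolding norm_l1_eq[OF v] by (intro sum_mono mult_left_mono member_le_sum) auto
  also have "\<dots> = (norm_l1 v)\<^sup>2" by (simp add: norm_l1_eq[OF v] sum_distrib_right power2_eq_square)
  finally have "norm_l2 v \<le> sqrt ((norm_l1 v)\<^sup>2)" unfolding norm_l2_def by (rule real_sqrt_le_mono)
  then show ?thesis by (simp add: norm_l1_eq[OF v] sum_nonneg)
qed

context ptl_model
begin

lemma col_Bh:
  assumes k: "k < K" and \<omega>: "\<omega> \<in> space M"
  shows "col (Bh \<omega>) k = est k (sample (nk k) (Xs k) (es k) (col B k) \<omega>)"
proof -
  have eq: "src_sample k (src \<omega>) = sample (nk k) (Xs k) (es k) (col B k) \<omega>"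
    using k by (auto simp: src_sample_def sample_def src_def restrict_def fun_eq_iff)
  have "src \<omega> \<in> space src_space" using measurable_space[OF src_measurable \<omega>] .
  from borel_vec_carrier[OF Bs_col_measurable[OF k] this]
  have "est k (sample (nk k) (Xs k) (es k) (col B k) \<omega>) \<in> carrier_vec p" by (simp add: eq)
  then show ?thesis unfolding Bh_def by (rule col_B_hat[OF k])
qed

lemma sample_fst_measurable: "i < n \<Longrightarrow> (\<lambda>\<omega>. fst (sample n X e b \<omega> i)) \<in> measurable M (borel_vec p)"
  using X_measurable[of i] by (simp add: sample_def)

lemma sample_snd_measurable:
  "b \<in> carrier_vec p \<Longrightarrow> i < n \<Longrightarrow> (\<lambda>\<omega>. snd (sample n X e b \<omega> i)) \<in> borel_measurable M"
  using borel_measurable_add[OF borel_measurable_scalar_prod[OF X_measurable] e_measurable, of i "\<lambda>_. b" i]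
  by (simp add: sample_def)

lemma error_event:
  assumes b: "b \<in> carrier_vec p" and L: "L \<in> measurable (data_space p n) (borel_vec p)"
  shows "{\<omega> \<in> space M. (norm_l2 (beta_ptl n K L (Bh \<omega>) (sample n X e b \<omega>) - b))\<^sup>2 \<le> c} \<in> events"
proof -
  have "(\<lambda>\<omega>. beta_ptl n K L (Bh \<omega>) (sample n X e b \<omega>)) \<in> measurable M (borel_vec p)"
    by (rule beta_ptl_measurable(1)[OF Bh_carrier Bh_measurable sample_fst_measurable sample_snd_measurable[OF b] L])
  then have [measurable]: "(\<lambda>\<omega>. norm_l2 (beta_ptl n K L (Bh \<omega>) (sample n X e b \<omega>) - b)) \<in> borel_measurable M"
    using b by (intro norm_l2_measurable[of _ _ p] minus_vec_measurable) auto
  show ?thesis by measurable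
qed

text \<open>The bounds on the LASSO error stay separate because the last two go through the
  restricted eigenvalue and hence a radius of at least 2, whereas the first holds for every
  \<open>m1\<close>.\<close>

lemma ptl_error_bound:
  assumes g: "good m1 m2 t rk \<omega>" and \<omega>: "\<omega> \<in> space M" and K: "K \<ge> 1"
    and cst: "Cmin \<le> Cmax" "0 < Cw" "0 \<le> H" "0 \<le> \<rho>" "0 \<le> t"
    and wCw: "norm_l2 w \<le> Cw" and dH: "norm_l1 \<delta> \<le> H"
    and orth: "\<And>k. k < K \<Longrightarrow> col B k \<bullet> (S *\<^sub>v \<delta>) = 0"
    and BB: "\<And>a. a \<in> carrier_vec K \<Longrightarrow>
      Cmin * (a \<bullet> a) \<le> (B *\<^sub>v a) \<bullet> (B *\<^sub>v a) \<and> (B *\<^sub>v a) \<bullet> (B *\<^sub>v a) \<le> Cmax * (a \<bullet> a)"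
    and rho: "(\<Sum>k<K. rk k) \<le> \<rho>\<^sup>2" "\<rho>\<^sup>2 \<le> Cmin / 4"
    and m2: "m2 \<ge> 2" "real K * (6 * \<tau>\<^sup>2 * Cmax) \<le> gram_const Cmin * (real m2 - 1)"
    and lam: "lam > 0" and L: "is_lasso p n lam L"
    and b: "b = B *\<^sub>v w + \<delta>"
  defines "R \<equiv> profile_const Cmin Cmax Cw H \<tau> * (t\<^sup>2 + \<rho>\<^sup>2)"
  assumes noise: "8 * \<tau>\<^sup>2 * sqrt (real n * ln (real p))
      + sqrt (2 * \<tau>\<^sup>2 * (real n + ln (real p)) * (real n * R)) \<le> real n * lam / 2"
  defines "D \<equiv> 2 * \<tau>\<^sup>2 * (real n + ln (real p)) / real n / (real m1 - 1)"
  shows "\<exists>\<Delta>. (norm_l2 (beta_ptl n K L (Bh \<omega>) (sample n X e b \<omega>) - b))\<^sup>2 \<le> 2 * R + 2 * \<Delta> \<and>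
    \<Delta> \<le> 16 * (norm_l1 \<delta>)\<^sup>2 \<and>
    (m1 \<ge> 2 \<longrightarrow> \<Delta> \<le> (3 * lam * norm_l1 \<delta> + 16 * D * (norm_l1 \<delta>)\<^sup>2) / (Cmin / 2)) \<and>
    (\<forall>s\<ge>1. m1 \<ge> 2 \<longrightarrow> real (norm_l0 \<delta>) \<le> s \<longrightarrow> 16 * s * D \<le> Cmin / 4 \<longrightarrow>
      \<Delta> \<le> 36 * lam\<^sup>2 * s / (Cmin / 2)\<^sup>2)"
proof -
  interpret F: profiled_fit p K n m2 "\<lambda>i. X i \<omega>" "\<lambda>i. e i \<omega>" B "Bh \<omega>" S w \<delta> Cmin Cmax Cw H \<tau> \<rho> t
  proof
    show "0 < n" by (rule n)
    show "1 \<le> K" by (rule K)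
    show "0 < Cmin" by (rule Cmin)
    show "Cmin \<le> Cmax" "0 < Cw" "0 \<le> H" "0 \<le> \<rho>" "0 \<le> t" by (rule cst)+
    show "0 < \<tau>" by (rule tau)
    show "X i \<omega> \<in> carrier_vec p" if "i < n" for i by (rule X_carrier[OF that \<omega>])
    show "B \<in> carrier_mat p K" by (rule B)
    show "Bh \<omega> \<in> carrier_mat p K" by (rule Bh_carrier)
    show "S \<in> carrier_mat p p" by (rule S_carrier[OF n])
    show "w \<in> carrier_vec K" by (rule w)
    show "\<delta> \<in> carrier_vec p" by (rule \<delta>)
    show "norm_l2 w \<le> Cw" by (rule wCw)
    show "norm_l2 \<delta> \<le> H" by (rule order_trans[OF norm_l2_le_norm_l1[OF \<delta>] dH])
    show "col B k \<bullet> (S *\<^sub>v \<delta>) = 0" if "k < K" for k by (rule orth[OF that])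
    show "S $$ (i, j) = S $$ (j, i)" if "i < p" "j < p" for i j by (rule S_sym[OF n that])
    show "0 \<le> y \<bullet> (S *\<^sub>v y) \<and> y \<bullet> (S *\<^sub>v y) \<le> Cmax * (y \<bullet> y)" if y: "y \<in> carrier_vec p" for y
    proof -
      have "0 \<le> Cmin * (y \<bullet> y)" using Cmin scalar_prod_self_nonneg[OF y] by simp
      then show ?thesis using Sbd[OF y] by linarith
    qed
    show "Cmin * (a \<bullet> a) \<le> (B *\<^sub>v a) \<bullet> (B *\<^sub>v a) \<and> (B *\<^sub>v a) \<bullet> (B *\<^sub>v a) \<le> Cmax * (a \<bullet> a)"
      if "a \<in> carrier_vec K" for a by (rule BB[OF that])
    have "(\<Sum>k<K. (norm_l2 (col (Bh \<omega>) k - col B k))\<^sup>2) \<le> (\<Sum>k<K. rk k)"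
      using g by (intro sum_mono) (simp add: good_def)
    then show "(\<Sum>k<K. (norm_l2 (col (Bh \<omega>) k - col B k))\<^sup>2) \<le> \<rho>\<^sup>2" using rho(1) by linarith
    show "\<rho>\<^sup>2 \<le> Cmin / 4" by (rule rho(2))
    show "2 \<le> m2" "real K * (6 * \<tau>\<^sup>2 * Cmax) \<le> gram_const Cmin * (real m2 - 1)" by (rule m2)+
  qed (use g in \<open>simp_all only: good_def\<close>)
  have bF: "F.b = b" by (simp add: F.b_def b)
  have DF: "F.D = sample n X e b \<omega>" by (simp add: F.D_def sample_def bF)
  have bc: "b \<in> carrier_vec p" using B w \<delta> by (simp add: b)
  define d where "d = L (resid_data n K (Bh \<omega>) F.D)"
  have Lm: "L \<in> measurable (data_space p n) (borel_vec p)" using L by (simp add: is_lasso_def)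
  have rs: "resid_data n K (Bh \<omega>) F.D \<in> space (data_space p n)"
    unfolding DF
    by (rule beta_ptl_measurable(2)[OF Bh_carrier Bh_measurable sample_fst_measurable sample_snd_measurable[OF bc] Lm \<omega>])
  have arg: "is_arg_min (lasso_obj n lam (resid_data n K (Bh \<omega>) F.D)) (\<lambda>d. d \<in> carrier_vec p) d"
    using L rs by (simp add: is_lasso_def d_def)
  then have d: "d \<in> carrier_vec p" by (simp add: is_arg_min_def)
  have "lasso_obj n lam (resid_data n K (Bh \<omega>) F.D) d \<le> lasso_obj n lam (resid_data n K (Bh \<omega>) F.D) \<delta>"
    using arg \<delta> by (auto simp: is_arg_min_def not_less)
  then have opt: "(\<Sum>i<n. (e i \<omega> - F.v \<bullet> X i \<omega> - (\<Sum>j<p. (d $ j - \<delta> $ j) * X i \<omega> $ j))\<^sup>2) / (2 * real n) + lam * (\<Sum>j<p. \<bar>d $ j\<bar>)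
      \<le> (\<Sum>i<n. (e i \<omega> - F.v \<bullet> X i \<omega>)\<^sup>2) / (2 * real n) + lam * (\<Sum>j<p. \<bar>\<delta> $ j\<bar>)"
    unfolding F.lasso_obj_resid[OF d] F.lasso_obj_resid[OF \<delta>] by simp
  have lnp: "ln (real p) \<ge> 0" using p by simp
  have noise_le: "\<bar>\<Sum>i<n. X i \<omega> $ j * (e i \<omega> - F.v \<bullet> X i \<omega>)\<bar> \<le> real n * lam / 2" if j: "j < p" for j
  proof -
    have g1: "(\<Sum>i<n. (X i \<omega> $ j)\<^sup>2) \<le> 2 * \<tau>\<^sup>2 * (real n + ln (real p))"
      and g2: "\<bar>\<Sum>i<n. X i \<omega> $ j * e i \<omega>\<bar> \<le> 8 * \<tau>\<^sup>2 * sqrt (real n * ln (real p))"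
      using g j by (simp_all only: good_def)
    have g3: "(\<Sum>i<n. (F.v \<bullet> X i \<omega>)\<^sup>2) \<le> real n * R"
      using F.profile_prediction_error by (simp add: R_def)
    \<comment> \<open>\<open>F.v\<close> depends on the target sample, so its correlation with a
      coordinate comes from the prediction error by Cauchy-Schwarz and not from concentration. This
      is how the first-stage rate enters the required size of \<open>lam\<close>.\<close>
    have "(\<Sum>i<n. X i \<omega> $ j * (F.v \<bullet> X i \<omega>))\<^sup>2 \<le> (\<Sum>i<n. (X i \<omega> $ j)\<^sup>2) * (\<Sum>i<n. (F.v \<bullet> X i \<omega>)\<^sup>2)"
      by (rule Cauchy_Schwarz_ineq_sum)
    also have "\<dots> \<le> 2 * \<tau>\<^sup>2 * (real n + ln (real p)) * (real n * R)"
      using lnp by (intro mult_mono g1 g3) (auto simp: sum_nonneg)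
    finally have "\<bar>\<Sum>i<n. X i \<omega> $ j * (F.v \<bullet> X i \<omega>)\<bar> \<le> sqrt (2 * \<tau>\<^sup>2 * (real n + ln (real p)) * (real n * R))"
      using real_le_rsqrt by (simp only: power2_abs real_le_rsqrt)
    moreover have "(\<Sum>i<n. X i \<omega> $ j * (e i \<omega> - F.v \<bullet> X i \<omega>))
        = (\<Sum>i<n. X i \<omega> $ j * e i \<omega>) - (\<Sum>i<n. X i \<omega> $ j * (F.v \<bullet> X i \<omega>))"
      by (simp add: right_diff_distrib sum_subtractf)
    ultimately show ?thesis using g2 noise by linarith
  qed
  define \<Delta> where "\<Delta> = (\<Sum>j<p. (d $ j - \<delta> $ j)\<^sup>2)"
  note err = lasso_error_bound[OF n lam opt noise_le]
  have l1: "norm_l1 \<delta> = (\<Sum>j<p. \<bar>\<delta> $ j\<bar>)" by (rule norm_l1_eq[OF \<delta>])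
  have l0: "norm_l0 \<delta> = card {j. j < p \<and> \<delta> $ j \<noteq> 0}" using \<delta> by (simp add: norm_l0_def)
  have "(norm_l2 (beta_ptl n K L (Bh \<omega>) (sample n X e b \<omega>) - b))\<^sup>2 \<le> 2 * R + 2 * \<Delta>"
    using F.beta_ptl_error[of L, folded d_def, OF d] F.profile_error
    unfolding bF DF[symmetric] R_def \<Delta>_def by linarith
  moreover have "\<Delta> \<le> 16 * (norm_l1 \<delta>)\<^sup>2" unfolding \<Delta>_def l1 by (rule err(1))
  moreover have RE: "Cmin / 2 * \<Delta> - D * (\<Sum>j<p. \<bar>d $ j - \<delta> $ j\<bar>)\<^sup>2
      \<le> (\<Sum>i<n. (\<Sum>j<p. (d $ j - \<delta> $ j) * X i \<omega> $ j)\<^sup>2) / real n" if m1: "m1 \<ge> 2"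
    unfolding \<Delta>_def D_def
  proof (rule gram_lower_bound[OF m1 n])
    show "0 \<le> Cmin / 2" using Cmin by simp
    fix z assume z: "z \<in> lattice_pts p m1"
    have 1: "Matrix.vec p z \<bullet> Matrix.vec p z = (\<Sum>j<p. (z j)\<^sup>2)" by (simp add: scalar_prod_self[of _ p])
    have 2: "Matrix.vec p z \<bullet> X i \<omega> = (\<Sum>j<p. z j * X i \<omega> $ j)" if "i < n" for i
      using uX_sum[OF that \<omega>, of "Matrix.vec p z"] by simp
    have "real n * (Cmin / 2) * (Matrix.vec p z \<bullet> Matrix.vec p z) \<le> (\<Sum>i<n. (Matrix.vec p z \<bullet> X i \<omega>)\<^sup>2)"
      using g z by (simp only: good_def)
    then show "Cmin / 2 * (\<Sum>j<p. (z j)\<^sup>2) \<le> (\<Sum>i<n. (\<Sum>j<p. z j * X i \<omega> $ j)\<^sup>2) / real n"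
      using n by (simp add: 1 2 pos_le_divide_eq mult_ac)
  next
    fix j assume "j < p"
    then have "(\<Sum>i<n. (X i \<omega> $ j)\<^sup>2) \<le> 2 * \<tau>\<^sup>2 * (real n + ln (real p))"
      using g by (simp only: good_def)
    then show "(\<Sum>i<n. (X i \<omega> $ j)\<^sup>2) / real n \<le> 2 * \<tau>\<^sup>2 * (real n + ln (real p)) / real n"
      by (rule divide_right_mono) simp
  qed
  have D0: "D \<ge> 0" if "m1 \<ge> 2" using that lnp by (simp add: D_def)
  have C2: "Cmin / 2 > 0" using Cmin by simp
  have "m1 \<ge> 2 \<longrightarrow> \<Delta> \<le> (3 * lam * norm_l1 \<delta> + 16 * D * (norm_l1 \<delta>)\<^sup>2) / (Cmin / 2)"
  proof
    assume m1: "m1 \<ge> 2"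
    show "\<Delta> \<le> (3 * lam * norm_l1 \<delta> + 16 * D * (norm_l1 \<delta>)\<^sup>2) / (Cmin / 2)"
      unfolding \<Delta>_def l1 by (rule err(2)[OF _ C2 D0[OF m1] RE[OF m1, unfolded \<Delta>_def]])
  qed
  moreover have "\<forall>s\<ge>1. m1 \<ge> 2 \<longrightarrow> real (norm_l0 \<delta>) \<le> s \<longrightarrow> 16 * s * D \<le> Cmin / 4 \<longrightarrow>
      \<Delta> \<le> 36 * lam\<^sup>2 * s / (Cmin / 2)\<^sup>2"
  proof (intro allI impI)
    fix s :: real assume s: "1 \<le> s" "2 \<le> m1" "real (norm_l0 \<delta>) \<le> s" "16 * s * D \<le> Cmin / 4"
    have sD: "16 * s * D \<le> Cmin / 2 / 2" using s(4) by simp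
    show "\<Delta> \<le> 36 * lam\<^sup>2 * s / (Cmin / 2)\<^sup>2"
      unfolding \<Delta>_def
      by (rule err(3)[OF _ C2 D0[OF s(2)] RE[OF s(2), unfolded \<Delta>_def] s(1) s(3)[unfolded l0] sD])
  qed
  ultimately show ?thesis by blast
qed

end

section \<open>Numerical estimates for the failure probability, the noise level and the lattice
  radius\<close>

lemma six_le_exp_2: "(6::real) \<le> exp 2"
proof -
  \<comment> \<open>The Taylor value 1 + 1 + 1/2 is enough because (5/2)^2 exceeds 6 = 2 * 3, the
    base of the exponential lattice count at radius K.\<close>
  have "(5/2::real) \<le> exp 1"
    using exp_lower_Taylor_quadratic[of 1] by simp
  then have "(5/2::real)\<^sup>2 \<le> (exp 1)\<^sup>2" by (intro power_mono) auto
  then show ?thesis by (simp add: power2_eq_square flip: exp_add)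
qed

text \<open>
  The exponent \<open>4 (K + ln \<mu>)\<close> comes from the choice \<open>t\<^sup>2 = 128 \<tau>\<^sup>4 (K + ln \<mu>) / n\<close>.
\<close>

lemma failure_probability_le:
  fixes n p K m1 \<kappa> :: nat and c :: real
  assumes n: "n \<ge> 1" and p: "p \<ge> 2" and Kn: "real K \<le> real n"
    and lnn: "2 * ln (real n) \<le> real n" "ln (real n) \<le> real n * c / 2"
    and m1: "(2 * real p + 1) ^ m1 \<le> exp (real n * c / 2)"
    and Kc: "real K * (real \<kappa> * ln 2 + ln 3) \<le> real n * c / 2"
  defines "\<mu> \<equiv> real (min p n)"
  shows "2 * exp (- real n) + 2 / real p + (2 * real p + 1) ^ m1 * (2 * exp (- real n * c))
      + 2 ^ (\<kappa> * K + 1) * 3 ^ K * (2 * exp (- real n * c)) + real (K + 1) * exp (- real n)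
      + 2 * (2 ^ (K + 1) * 3 ^ K * (2 * exp (- (4 * (real K + ln \<mu>))))) \<le> 20 * exp (- ln \<mu>)"
proof -
  have mu: "\<mu> \<ge> 1" "\<mu> \<le> real n" "\<mu> \<le> real p" using n p by (auto simp: \<mu>_def)
  define E where "E = exp (- ln \<mu>)"
  have nE: "exp (- ln (real n)) \<le> E" using mu n by (simp add: E_def)
  have ln0: "ln (real n) \<ge> 0" "ln \<mu> \<ge> 0" using mu n by auto
  have 1: "exp (- real n) \<le> E"
  proof -
    have "exp (- real n) \<le> exp (- ln (real n))" using lnn ln0 by simp
    then show ?thesis using nE by linarith
  qed
  have 2: "2 / real p \<le> 2 * E"
    using mu p by (simp add: E_def exp_minus inverse_eq_divide frac_le)
  have half: "exp (real n * c / 2) * (2 * exp (- real n * c)) \<le> 2 * E"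
  proof -
    have "exp (real n * c / 2) * (2 * exp (- real n * c)) = 2 * exp (- (real n * c / 2))"
      by (simp flip: exp_add)
    also have "\<dots> \<le> 2 * exp (- ln (real n))" using lnn by simp
    finally show ?thesis using nE by linarith
  qed
  have 3: "(2 * real p + 1) ^ m1 * (2 * exp (- real n * c)) \<le> 2 * E"
    by (rule order_trans[OF mult_right_mono[OF m1] half]) simp
  have 4: "2 ^ (\<kappa> * K + 1) * 3 ^ K * (2 * exp (- real n * c)) \<le> 4 * E"
  proof -
    have "(2::real) ^ (\<kappa> * K) * 3 ^ K = exp (real (\<kappa> * K) * ln 2) * exp (real K * ln 3)"
      by (simp only: exp_of_nat_mult) simp
    also have "\<dots> = exp (real K * (real \<kappa> * ln 2 + ln 3))"
      by (simp add: algebra_simps flip: exp_add)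
    also have "\<dots> \<le> exp (real n * c / 2)" using Kc by simp
    finally have "(2::real) ^ (\<kappa> * K) * 3 ^ K * (2 * exp (- real n * c)) \<le> exp (real n * c / 2) * (2 * exp (- real n * c))"
      by (intro mult_right_mono) auto
    moreover have "(2::real) ^ (\<kappa> * K + 1) * 3 ^ K * (2 * exp (- real n * c))
        = 2 * (2 ^ (\<kappa> * K) * 3 ^ K * (2 * exp (- real n * c)))" by simp
    ultimately show ?thesis using half by linarith
  qed
  have 5: "real (K + 1) * exp (- real n) \<le> 2 * E"
  proof -
    have "real (K + 1) \<le> 2 * real n" using Kn n by simp
    then have "real (K + 1) * exp (- real n) \<le> 2 * real n * exp (- real n)" by (intro mult_right_mono) auto
    also have "\<dots> = 2 * (exp (ln (real n)) * exp (- real n))" using n by simp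
    also have "\<dots> = 2 * exp (ln (real n) - real n)" by (simp add: exp_diff exp_minus field_simps)
    also have "\<dots> \<le> 2 * exp (- ln (real n))" using lnn by simp
    finally show ?thesis using nE by linarith
  qed
  have 6: "2 * (2 ^ (K + 1) * 3 ^ K * (2 * exp (- (4 * (real K + ln \<mu>))))) \<le> 8 * E"
  proof -
    have "(2::real) ^ K * 3 ^ K = 6 ^ K" by (simp flip: power_mult_distrib)
    also have "\<dots> \<le> exp 2 ^ K" by (intro power_mono six_le_exp_2) simp
    also have "\<dots> = exp (2 * real K)" by (simp add: exp_of_nat_mult[symmetric] mult.commute)
    finally have "(2::real) ^ K * 3 ^ K * exp (- (4 * (real K + ln \<mu>))) \<le> exp (2 * real K) * exp (- (4 * (real K + ln \<mu>)))"
      by (intro mult_right_mono) auto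
    also have "\<dots> = exp (- 2 * real K - 4 * ln \<mu>)" by (simp add: algebra_simps flip: exp_add)
    also have "\<dots> \<le> E" using ln0 by (simp add: E_def)
    finally show ?thesis by simp
  qed
  \<comment> \<open>The first bound is used twice: 20 = 2 + 2 + 2 + 4 + 2 + 8.\<close>
  show ?thesis unfolding E_def[symmetric] using 1 2 3 4 5 6 by linarith
qed

lemma sqrt_sum3_le:
  assumes "a \<ge> 0" "b \<ge> 0" "c \<ge> 0"
  shows "sqrt (a + b + c) \<le> sqrt a + sqrt b + sqrt c"
  using sqrt_add_le_add_sqrt[of "a + b" c] sqrt_add_le_add_sqrt[of a b] assms by simp

text \<open>With l = ln p / n, the contribution of the first stage is governed by (1 + l) R. As R
  \<le> 1, the product l R is at most l, which the rate already contains, so a large l does no harm;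
  this adds the one between \<open>G - 1\<close> and \<open>G\<close>.\<close>

lemma noise_level_le:
  fixes n p K :: nat and C1 G \<tau> R src :: real
  assumes n: "n > 0" and p: "p \<ge> 1" and src: "src \<ge> 0" and C1: "C1 \<ge> 0" and G: "G \<ge> 1"
    and R: "0 \<le> R" "R \<le> 1" "R \<le> (G - 1) * (src + real K / real n + ln (real p) / real n)"
  shows "8 * \<tau>\<^sup>2 * sqrt (real n * ln (real p)) + sqrt (2 * \<tau>\<^sup>2 * (real n + ln (real p)) * (real n * (C1 * R)))
    \<le> real n * ((8 * \<tau>\<^sup>2 + sqrt (2 * \<tau>\<^sup>2 * C1 * G)) * (sqrt src + sqrt (real K / real n) + sqrt (ln (real p) / real n)))"
proof -
  define l where "l = ln (real p) / real n"
  have l0: "l \<ge> 0" using p by (simp add: l_def)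
  have ln: "ln (real p) = real n * l" using n by (simp add: l_def)
  define r where "r = sqrt src + sqrt (real K / real n) + sqrt l"
  have Y0: "src + real K / real n + l \<ge> 0" using src l0 by simp
  have "sqrt (real n * ln (real p)) = real n * sqrt l"
    using n by (simp add: ln real_sqrt_mult flip: power2_eq_square mult.assoc)
  also have "\<dots> \<le> real n * r" using src by (intro mult_left_mono) (auto simp: r_def)
  finally have 1: "8 * \<tau>\<^sup>2 * sqrt (real n * ln (real p)) \<le> 8 * \<tau>\<^sup>2 * (real n * r)"
    by (intro mult_left_mono) auto
  have "(1 + l) * R \<le> G * (src + real K / real n + l)"
  proof -
    have "l * R \<le> l * 1" using l0 R by (intro mult_left_mono) auto
    then have "(1 + l) * R \<le> (G - 1) * (src + real K / real n + l) + l"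
      using R(3) by (simp add: l_def distrib_right)
    also have "\<dots> \<le> (G - 1) * (src + real K / real n + l) + (src + real K / real n + l)"
      using src by simp
    finally show ?thesis by (simp add: left_diff_distrib)
  qed
  then have "2 * \<tau>\<^sup>2 * (real n + ln (real p)) * (real n * (C1 * R)) \<le> (real n)\<^sup>2 * ((2 * \<tau>\<^sup>2 * C1 * G) * (src + real K / real n + l))"
  proof -
    assume h: "(1 + l) * R \<le> G * (src + real K / real n + l)"
    have "2 * \<tau>\<^sup>2 * (real n + ln (real p)) * (real n * (C1 * R)) = (real n)\<^sup>2 * (2 * \<tau>\<^sup>2 * C1) * ((1 + l) * R)"
      by (simp add: ln power2_eq_square algebra_simps)
    also have "\<dots> \<le> (real n)\<^sup>2 * (2 * \<tau>\<^sup>2 * C1) * (G * (src + real K / real n + l))"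
      using C1 by (intro mult_left_mono h) auto
    finally show ?thesis by (simp add: mult_ac)
  qed
  then have "sqrt (2 * \<tau>\<^sup>2 * (real n + ln (real p)) * (real n * (C1 * R)))
      \<le> sqrt ((real n)\<^sup>2 * ((2 * \<tau>\<^sup>2 * C1 * G) * (src + real K / real n + l)))"
    by (rule real_sqrt_le_mono)
  also have "\<dots> = real n * (sqrt (2 * \<tau>\<^sup>2 * C1 * G) * sqrt (src + real K / real n + l))"
    by (simp add: real_sqrt_mult)
  also have "\<dots> \<le> real n * (sqrt (2 * \<tau>\<^sup>2 * C1 * G) * r)"
    unfolding r_def using src l0 C1 G by (intro mult_left_mono sqrt_sum3_le) auto
  finally have 2: "sqrt (2 * \<tau>\<^sup>2 * (real n + ln (real p)) * (real n * (C1 * R))) \<le> real n * (sqrt (2 * \<tau>\<^sup>2 * C1 * G) * r)" .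
  have "real n * ((8 * \<tau>\<^sup>2 + sqrt (2 * \<tau>\<^sup>2 * C1 * G)) * r)
      = 8 * \<tau>\<^sup>2 * (real n * r) + real n * (sqrt (2 * \<tau>\<^sup>2 * C1 * G) * r)"
    by (simp add: algebra_simps)
  then show ?thesis using 1 2 by (simp add: r_def l_def)
qed

text \<open>\<open>m\<close> is the largest radius at which the polynomial count stays below exp (n
  c / 2), half of the exponent available at each lattice point. Since 2 p + 1 \<le> p^3, it is of
  order n / ln p. The bound c / 24 gives m \<ge> 2, and 3072 = 4 * 16 * 48 makes
  \<open>16 * s * D\<close> at most Cmin / 4; \<open>s \<ge> 1\<close> passes from s ln p / n to ln
  p / n.\<close>

lemma sparsity_level:
  fixes n p :: nat and c \<tau> Cmin s :: real
  assumes n: "n > 0" and p: "p \<ge> 2" and c: "c > 0" and s: "s \<ge> 1" and tau: "\<tau> > 0" and Cmin: "Cmin > 0"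
    and small: "s * ln (real p) / real n \<le> min 1 (min (c / 24) (Cmin * c / (3072 * \<tau>\<^sup>2)))"
  defines "m \<equiv> nat \<lfloor>real n * c / (2 * ln (2 * real p + 1))\<rfloor>"
  defines "D \<equiv> 2 * \<tau>\<^sup>2 * (real n + ln (real p)) / real n / (real m - 1)"
  shows "m \<ge> 2" "(2 * real p + 1) ^ m \<le> exp (real n * c / 2)"
    "D \<le> 48 * \<tau>\<^sup>2 / c * (ln (real p) / real n)" "16 * s * D \<le> Cmin / 4" "ln (real p) / real n \<le> 1"
proof -
  define l where "l = ln (real p) / real n"
  have lp: "ln (real p) > 0" using p by simp
  have l0: "l > 0" using lp n by (simp add: l_def)
  have lsl: "l \<le> s * l" using s l0 by simp
  have sl: "s * l \<le> 1" "s * l \<le> c / 24" "s * l \<le> Cmin * c / (3072 * \<tau>\<^sup>2)"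
    using small by (simp_all add: l_def)
  show l1: "ln (real p) / real n \<le> 1" using lsl sl by (simp add: l_def)
  \<comment> \<open>Half of the lower bound c / (6 l) for the radius before rounding. Rounding down
    and subtracting one costs at most 2, which the other half covers because y \<ge> 2.\<close>
  define y where "y = c / (12 * l)"
  have "l \<le> c / 24" using lsl sl by linarith
  then have y2: "y \<ge> 2" using l0 by (simp add: y_def field_simps)
  have l2: "ln (2 * real p + 1) > 0" using p by simp
  have l3: "ln (2 * real p + 1) \<le> 3 * ln (real p)"
  proof -
    have "2 * real p + 1 \<le> real p ^ 3"
    proof -
      have "real p \<ge> 2" using p by simp
      then have "2 * 2 * real p \<le> real p * real p * real p" by (intro mult_mono) auto
      then have "2 * real p + 1 \<le> real p * real p * real p" using \<open>real p \<ge> 2\<close> by linarith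
      then show ?thesis by (simp add: power3_eq_cube)
    qed
    then have "ln (2 * real p + 1) \<le> ln (real p ^ 3)" using p by simp
    also have "\<dots> = 3 * ln (real p)" using p by (simp add: ln_realpow)
    finally show ?thesis .
  qed
  define q where "q = real n * c / (2 * ln (2 * real p + 1))"
  have q0: "q \<ge> 0" using c l2 by (simp add: q_def)
  have "2 * y = real n * c / (2 * (3 * ln (real p)))" using n by (simp add: y_def l_def)
  also have "\<dots> \<le> q" unfolding q_def using l2 l3 c lp by (intro divide_left_mono mult_pos_pos) auto
  finally have q2y: "2 * y \<le> q" .
  have mq: "real m \<le> q" "q < real m + 1"
    using q0 by (simp_all add: m_def q_def[symmetric])
  have my: "real m - 1 \<ge> y" using mq q2y y2 by linarith
  show m2: "m \<ge> 2" using my y2 by linarith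
  have "(2 * real p + 1) ^ m = exp (real m * ln (2 * real p + 1))"
    using p by (simp add: exp_of_nat_mult)
  also have "\<dots> \<le> exp (q * ln (2 * real p + 1))"
    using mq l2 by (simp add: mult_right_mono)
  also have "q * ln (2 * real p + 1) = real n * c / 2" using l2 by (simp add: q_def)
  finally show "(2 * real p + 1) ^ m \<le> exp (real n * c / 2)" .
  have "2 * \<tau>\<^sup>2 * (real n + ln (real p)) / real n \<le> 4 * \<tau>\<^sup>2"
  proof -
    have "2 * \<tau>\<^sup>2 * (real n + ln (real p)) / real n = 2 * \<tau>\<^sup>2 * (1 + l)"
      using n by (simp add: l_def field_simps)
    also have "\<dots> \<le> 2 * \<tau>\<^sup>2 * 2" using l1 by (intro mult_left_mono) (auto simp: l_def)
    finally show ?thesis by simp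
  qed
  then have "D \<le> 4 * \<tau>\<^sup>2 / (real m - 1)" unfolding D_def using m2 by (intro divide_right_mono) auto
  also have "\<dots> \<le> 4 * \<tau>\<^sup>2 / y" using my y2 tau by (intro divide_left_mono) auto
  also have "\<dots> = 48 * \<tau>\<^sup>2 / c * l" using c l0 by (simp add: y_def)
  finally have D: "D \<le> 48 * \<tau>\<^sup>2 / c * l" .
  then show "D \<le> 48 * \<tau>\<^sup>2 / c * (ln (real p) / real n)" by (simp add: l_def)
  have "16 * s * D \<le> 16 * s * (48 * \<tau>\<^sup>2 / c * l)" using D s by (intro mult_left_mono) auto
  also have "\<dots> = 768 * \<tau>\<^sup>2 / c * (s * l)" by simp
  also have "\<dots> \<le> 768 * \<tau>\<^sup>2 / c * (Cmin * c / (3072 * \<tau>\<^sup>2))" using sl c by (intro mult_left_mono) auto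
  also have "\<dots> = Cmin / 4" using c tau by simp
  finally show "16 * s * D \<le> Cmin / 4" .
qed

section \<open>The rate\<close>

lemma profile_const_nonneg:
  assumes "Cmin > 0" "Cmax \<ge> 0" "H \<ge> 0"
  shows "profile_const Cmin Cmax Cw H \<tau> \<ge> 0"
proof -
  have g: "gram_const Cmin > 0" using assms by (simp add: gram_const_def)
  have "pred_const Cmin Cmax Cw H \<tau> \<ge> 0"
    unfolding pred_const_def using assms g
    by (intro add_nonneg_nonneg divide_nonneg_nonneg mult_nonneg_nonneg) auto
  then show ?thesis unfolding profile_const_def using assms g
    by (intro add_nonneg_nonneg divide_nonneg_nonneg mult_nonneg_nonneg) auto
qed

text \<open>Twice the coefficient of the rate in \<open>noise_level_le\<close>, because the LASSO
  bounds require noise at no more than half of \<open>lam\<close>.\<close>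

definition lasso_level_const :: "real \<Rightarrow> real \<Rightarrow> real \<Rightarrow> real \<Rightarrow> real \<Rightarrow> real \<Rightarrow> real" where
  "lasso_level_const Cmin Cmax Cw H \<tau> Cbar =
    2 * (8 * \<tau>\<^sup>2 + sqrt (2 * \<tau>\<^sup>2 * profile_const Cmin Cmax Cw H \<tau> * (128 * \<tau>^4 + Cbar + 1)))"

text \<open>
  The second bracket collects the constants of the three LASSO bounds, one for each member of the
  minimum in \<^const>\<open>ptl_rate\<close>.
\<close>

definition ptl_const :: "real \<Rightarrow> real \<Rightarrow> real \<Rightarrow> real \<Rightarrow> real \<Rightarrow> real \<Rightarrow> real \<Rightarrow> real \<Rightarrow> real" where
  "ptl_const Cmin Cmax Cw H \<tau> Cbar cL c =
    2 * (profile_const Cmin Cmax Cw H \<tau> * (128 * \<tau>^4 + Cbar))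
    + 2 * (144 * cL\<^sup>2 / Cmin\<^sup>2 + 2 / Cmin * (3 * cL + 768 * \<tau>\<^sup>2 * H / c) + 16)"

context ptl_model
begin

lemma cg_pos: "cg > 0"
  unfolding cg_def using Cmin tau by (intro divide_pos_pos) (auto simp: min_def)

text \<open>The result for a single sample size and parameter. Every smallness condition is
  explicit, so the asymptotic assumptions only have to make it hold eventually, and the conditions
  on the sizes do not involve the parameter, which yields uniformity.\<close>

lemma ptl_error_prob:
  fixes smax sdelta \<kappa> :: nat and Ce qk :: "nat \<Rightarrow> real" and Cbar H h lam cL :: real
  defines "\<mu> \<equiv> real (min p n)"
  defines "r \<equiv> r_rate p n K nk smax" and "s_rate \<equiv> source_rate p K nk smax"
  assumes K: "K \<ge> 1" and p2: "p \<ge> 2"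
    and cst: "Cmin \<le> Cmax" "0 < Cw" "0 < Cbar" "0 < cL"
    and wCw: "norm_l2 w \<le> Cw" and \<delta>h: "norm_l1 \<delta> \<le> h" and hH: "h \<le> H" and \<delta>s: "norm_l0 \<delta> \<le> sdelta"
    and orth: "\<And>k. k < K \<Longrightarrow> col B k \<bullet> (S *\<^sub>v \<delta>) = 0"
    and BB: "\<And>a. a \<in> carrier_vec K \<Longrightarrow>
      Cmin * (a \<bullet> a) \<le> (B *\<^sub>v a) \<bullet> (B *\<^sub>v a) \<and> (B *\<^sub>v a) \<bullet> (B *\<^sub>v a) \<le> Cmax * (a \<bullet> a)"
    and Ce: "\<And>k. Ce k \<le> Cbar"
    and src_prob: "\<And>k. k < K \<Longrightarrow> prob {\<omega> \<in> space M. (norm_l2 (col (Bh \<omega>) k - col B k))\<^sup>2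
        \<le> Ce k * real smax * ln (real p) / real (nk k)} \<ge> 1 - qk k"
    and s_small: "Cbar * s_rate \<le> Cmin / 4" "Cbar * s_rate \<le> 1 / 2"
    and K_small: "(real K + ln \<mu>) / real n \<le> 1 / 2" "128 * \<tau>^4 * ((real K + ln \<mu>) / real n) \<le> 1 / 2"
    and kap: "\<kappa> \<ge> 1" "6 * \<tau>\<^sup>2 * Cmax \<le> gram_const Cmin * real \<kappa>"
    and Kn: "real K \<le> real n" "real K * (real \<kappa> * ln 2 + ln 3) \<le> real n * cg / 2"
    and lnn: "2 * ln (real n) \<le> real n" "ln (real n) \<le> real n * cg / 2"
    and sd_small: "real sdelta * ln (real p) / real n \<le> min 1 (min (cg / 24) (Cmin * cg / (3072 * \<tau>\<^sup>2)))"
    and lam: "lasso_level_const Cmin Cmax Cw H \<tau> Cbar * r \<le> lam" "lam \<le> cL * r"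
    and L: "is_lasso p n lam L"
    and b: "b = B *\<^sub>v w + \<delta>"
  shows "prob {\<omega> \<in> space M. (norm_l2 (beta_ptl n K L (Bh \<omega>) (sample n X e b \<omega>) - b))\<^sup>2
      \<le> ptl_const Cmin Cmax Cw H \<tau> Cbar cL cg * ptl_rate p n K nk smax sdelta h}
    \<ge> 1 - (20 * exp (- ln \<mu>) + (\<Sum>k<K. qk k))"
proof -
  define C1 where "C1 = profile_const Cmin Cmax Cw H \<tau>"
  define G where "G = 128 * \<tau>^4 + Cbar + 1"
  define t where "t = sqrt (128 * \<tau>^4 * ((real K + ln \<mu>) / real n))"
  define \<rho> where "\<rho> = sqrt (Cbar * s_rate)"
  \<comment> \<open>If \<open>sdelta = 0\<close>, no restricted eigenvalue is needed, and \<open>ln p / n\<close> may be unbounded.\<close>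
  define m1 where "m1 = (if sdelta = 0 then 0 else nat \<lfloor>real n * cg / (2 * ln (2 * real p + 1))\<rfloor>)"
  define l where "l = ln (real p) / real n"
  have lp: "ln (real p) > 0" using p2 by simp
  have l0: "l > 0" using lp n by (simp add: l_def)
  have mu: "\<mu> \<ge> 1" "\<mu> \<le> real p" using n p2 by (auto simp: \<mu>_def)
  have lmu: "0 \<le> ln \<mu>" "ln \<mu> \<le> ln (real p)" using mu by auto
  have h0: "0 \<le> h" using \<delta>h norm_l1_eq[OF \<delta>] by (smt (verit) sum_nonneg abs_ge_zero)
  have H0: "0 \<le> H" using h0 hH by simp
  have C10: "C1 \<ge> 0" unfolding C1_def using Cmin cst H0 by (intro profile_const_nonneg) auto
  have s0: "s_rate \<ge> 0" unfolding s_rate_def source_rate_def using lp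
    by (intro sum_nonneg divide_nonneg_nonneg mult_nonneg_nonneg) auto
  have t2: "t\<^sup>2 = 128 * \<tau>^4 * ((real K + ln \<mu>) / real n)" unfolding t_def using lmu by simp
  have \<rho>2: "\<rho>\<^sup>2 = Cbar * s_rate" unfolding \<rho>_def using s0 cst by simp
  have t0: "0 \<le> t" "0 \<le> \<rho>" using lmu s0 cst by (simp_all add: t_def \<rho>_def)
  have t8: "t \<le> 8 * \<tau>\<^sup>2"
  proof -
    have "t\<^sup>2 \<le> 128 * \<tau>^4 * (1 / 2)" unfolding t2 by (intro mult_left_mono K_small) simp
    also have "\<dots> = (8 * \<tau>\<^sup>2)\<^sup>2" by (simp add: power_mult_distrib flip: power_mult)
    finally show ?thesis by (rule power2_le_imp_le) simp
  qed
  have r_eq: "r = sqrt s_rate + sqrt (real K / real n) + sqrt l"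
    by (simp add: r_def r_rate_def s_rate_def l_def)
  have r0: "r > 0"
  proof -
    have "sqrt l > 0" using l0 by simp
    moreover have "sqrt s_rate \<ge> 0" "sqrt (real K / real n) \<ge> 0" using s0 by simp_all
    ultimately show ?thesis unfolding r_eq by linarith
  qed
  have rl: "sqrt l \<le> r" unfolding r_eq using s0 by simp
  have R1: "t\<^sup>2 + \<rho>\<^sup>2 \<le> 1" unfolding t2 \<rho>2 using K_small s_small by linarith
  have RG: "t\<^sup>2 + \<rho>\<^sup>2 \<le> (G - 1) * (s_rate + real K / real n + ln (real p) / real n)"
  proof -
    have "t\<^sup>2 \<le> 128 * \<tau>^4 * (s_rate + real K / real n + ln (real p) / real n)"
      unfolding t2 using lmu s0 by (intro mult_left_mono) (auto simp: add_divide_distrib divide_right_mono intro!: add_increasing add_mono)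
    moreover have "\<rho>\<^sup>2 \<le> Cbar * (s_rate + real K / real n + ln (real p) / real n)"
      unfolding \<rho>2 using cst lp by (intro mult_left_mono) auto
    ultimately show ?thesis unfolding G_def by (simp add: distrib_right)
  qed
  have Lc: "lasso_level_const Cmin Cmax Cw H \<tau> Cbar = 2 * (8 * \<tau>\<^sup>2 + sqrt (2 * \<tau>\<^sup>2 * C1 * G))"
    by (simp add: lasso_level_const_def C1_def G_def)
  have Lc0: "8 * \<tau>\<^sup>2 + sqrt (2 * \<tau>\<^sup>2 * C1 * G) > 0"
    using tau C10 cst by (intro add_pos_nonneg) (auto simp: G_def)
  have lam0: "lam > 0"
    using lam(1) mult_pos_pos[OF Lc0 r0] unfolding Lc by linarith
  have noise: "8 * \<tau>\<^sup>2 * sqrt (real n * ln (real p))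
      + sqrt (2 * \<tau>\<^sup>2 * (real n + ln (real p)) * (real n * (C1 * (t\<^sup>2 + \<rho>\<^sup>2)))) \<le> real n * lam / 2"
  proof -
    have "8 * \<tau>\<^sup>2 * sqrt (real n * ln (real p)) + sqrt (2 * \<tau>\<^sup>2 * (real n + ln (real p)) * (real n * (C1 * (t\<^sup>2 + \<rho>\<^sup>2))))
      \<le> real n * ((8 * \<tau>\<^sup>2 + sqrt (2 * \<tau>\<^sup>2 * C1 * G)) * (sqrt s_rate + sqrt (real K / real n) + sqrt (ln (real p) / real n)))"
      using n p2 s0 C10 R1 RG cst by (intro noise_level_le) (auto simp: G_def)
    also have "\<dots> = real n * ((8 * \<tau>\<^sup>2 + sqrt (2 * \<tau>\<^sup>2 * C1 * G)) * r)" by (simp add: r_eq l_def)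
    also have "\<dots> \<le> real n * (lam / 2)"
    proof (intro mult_left_mono)
      have "2 * ((8 * \<tau>\<^sup>2 + sqrt (2 * \<tau>\<^sup>2 * C1 * G)) * r) \<le> lam"
        using lam(1) unfolding Lc by (simp only: mult.assoc)
      then show "(8 * \<tau>\<^sup>2 + sqrt (2 * \<tau>\<^sup>2 * C1 * G)) * r \<le> lam / 2" by linarith
    qed simp
    finally show ?thesis by simp
  qed
  \<comment> \<open>\<open>m2 - 1 = \<kappa> * K\<close> repays the factor \<open>K\<close> in the
    loss of the lattice transfer; \<kappa> repays the ratio of the diagonal bound to
    \<open>gram_const Cmin\<close>.\<close>
  define m2 where "m2 = \<kappa> * K + 1"
  have m2: "m2 \<ge> 2" "real K * (6 * \<tau>\<^sup>2 * Cmax) \<le> gram_const Cmin * (real m2 - 1)"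
  proof -
    have "1 * 1 \<le> \<kappa> * K" using kap K by (intro mult_le_mono) auto
    then show "m2 \<ge> 2" by (simp add: m2_def)
    have "real K * (6 * \<tau>\<^sup>2 * Cmax) \<le> real K * (gram_const Cmin * real \<kappa>)" by (intro mult_left_mono kap) simp
    then show "real K * (6 * \<tau>\<^sup>2 * Cmax) \<le> gram_const Cmin * (real m2 - 1)" by (simp add: m2_def mult_ac)
  qed
  define D where "D = 2 * \<tau>\<^sup>2 * (real n + ln (real p)) / real n / (real m1 - 1)"
  have sp: "m1 \<ge> 2" "(2 * real p + 1) ^ m1 \<le> exp (real n * cg / 2)" "D \<le> 48 * \<tau>\<^sup>2 / cg * l"
      "16 * real sdelta * D \<le> Cmin / 4" "l \<le> 1" if "sdelta \<noteq> 0"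
  proof -
    have s1: "1 \<le> real sdelta" using that by simp
    note sp = sparsity_level[OF n p2 cg_pos s1 tau Cmin sd_small]
    show "m1 \<ge> 2" "(2 * real p + 1) ^ m1 \<le> exp (real n * cg / 2)" "D \<le> 48 * \<tau>\<^sup>2 / cg * l"
      "16 * real sdelta * D \<le> Cmin / 4" "l \<le> 1"
      using sp that by (simp_all add: m1_def D_def l_def)
  qed
  have m1e: "(2 * real p + 1) ^ m1 \<le> exp (real n * cg / 2)"
    using sp(2) cg_pos by (cases "sdelta = 0") (simp_all add: m1_def)
  define rk where "rk k = Ce k * real smax * ln (real p) / real (nk k)" for k
  have rho: "(\<Sum>k<K. rk k) \<le> \<rho>\<^sup>2" "\<rho>\<^sup>2 \<le> Cmin / 4"
  proof -
    have "(\<Sum>k<K. rk k) \<le> (\<Sum>k<K. Cbar * (real smax * ln (real p) / real (nk k)))"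
    proof (rule sum_mono)
      fix k
      have "Ce k * (real smax * ln (real p) / real (nk k)) \<le> Cbar * (real smax * ln (real p) / real (nk k))"
        using lp by (intro mult_right_mono Ce) auto
      then show "rk k \<le> Cbar * (real smax * ln (real p) / real (nk k))" by (simp add: rk_def)
    qed
    then show "(\<Sum>k<K. rk k) \<le> \<rho>\<^sup>2" by (simp add: \<rho>2 s_rate_def source_rate_def sum_distrib_left)
    show "\<rho>\<^sup>2 \<le> Cmin / 4" using s_small by (simp add: \<rho>2)
  qed
  define tail where "tail = 2 * exp (- real n) + 2 / real p + (2 * real p + 1) ^ m1 * (2 * exp (- real n * cg))
      + 2 ^ m2 * 3 ^ K * (2 * exp (- real n * cg)) + real (K + 1) * exp (- real n)
      + 2 * (2 ^ (K + 1) * 3 ^ K * (2 * exp (- real n * t\<^sup>2 / (32 * \<tau>^4)))) + (\<Sum>k<K. qk k)"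
  have "\<exists>N\<in>events. (\<forall>\<omega>\<in>space M - N. good m1 m2 t rk \<omega>) \<and> prob N \<le> tail"
    unfolding tail_def
  proof (rule good_event[OF t0(1) t8])
    show "1 - qk k \<le> prob {\<omega> \<in> space M. (norm_l2 (col (Bh \<omega>) k - col B k))\<^sup>2 \<le> rk k}" if "k < K" for k
      unfolding rk_def by (rule src_prob[OF that])
  qed
  then obtain N where N: "N \<in> events" "\<forall>\<omega>\<in>space M - N. good m1 m2 t rk \<omega>" and PN: "prob N \<le> tail"
    by (elim bexE conjE)
  have nt: "- real n * t\<^sup>2 / (32 * \<tau>^4) = - (4 * (real K + ln \<mu>))"
    unfolding t2 using n tau by (simp add: field_simps)
  have "2 * exp (- real n) + 2 / real p + (2 * real p + 1) ^ m1 * (2 * exp (- real n * cg))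
      + 2 ^ m2 * 3 ^ K * (2 * exp (- real n * cg)) + real (K + 1) * exp (- real n)
      + 2 * (2 ^ (K + 1) * 3 ^ K * (2 * exp (- (4 * (real K + ln \<mu>))))) \<le> 20 * exp (- ln \<mu>)"
    unfolding m2_def \<mu>_def using n p2 Kn lnn m1e by (intro failure_probability_le) auto
  with PN[unfolded tail_def] have PN': "prob N \<le> 20 * exp (- ln \<mu>) + (\<Sum>k<K. qk k)" unfolding nt by linarith
  let ?C = "ptl_const Cmin Cmax Cw H \<tau> Cbar cL cg"
  let ?E = "{\<omega> \<in> space M. (norm_l2 (beta_ptl n K L (Bh \<omega>) (sample n X e b \<omega>) - b))\<^sup>2
      \<le> ?C * ptl_rate p n K nk smax sdelta h}"
  define CD where "CD = 144 * cL\<^sup>2 / Cmin\<^sup>2 + 2 / Cmin * (3 * cL + 768 * \<tau>\<^sup>2 * H / cg) + 16"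
  define mn where "mn = min (real sdelta * r\<^sup>2) (min (h * r) (h\<^sup>2))"
  define A where "A = s_rate + (real K + ln \<mu>) / real n"
  have rate: "ptl_rate p n K nk smax sdelta h = A + mn"
    by (simp add: ptl_rate_def A_def mn_def s_rate_def r_def \<mu>_def)
  have C: "?C = 2 * (C1 * (128 * \<tau>^4 + Cbar)) + 2 * CD"
    by (simp add: ptl_const_def C1_def CD_def)
  have A0: "A \<ge> 0" using s0 lmu by (simp add: A_def)
  have mn0: "mn \<ge> 0" using h0 r0 by (simp add: mn_def)
  have CD1: "CD \<ge> 144 * cL\<^sup>2 / Cmin\<^sup>2" "CD \<ge> 2 / Cmin * (3 * cL + 768 * \<tau>\<^sup>2 * H / cg)" "CD \<ge> 16" "CD \<ge> 0"
  proof -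
    have "144 * cL\<^sup>2 / Cmin\<^sup>2 \<ge> 0" "2 / Cmin * (3 * cL + 768 * \<tau>\<^sup>2 * H / cg) \<ge> 0"
      using cst Cmin H0 cg_pos by auto
    then show "CD \<ge> 144 * cL\<^sup>2 / Cmin\<^sup>2" "CD \<ge> 2 / Cmin * (3 * cL + 768 * \<tau>\<^sup>2 * H / cg)" "CD \<ge> 16" "CD \<ge> 0"
      by (simp_all add: CD_def)
  qed
  have "space M - N \<subseteq> ?E"
  proof
    fix \<omega> assume w: "\<omega> \<in> space M - N"
    then have ws: "\<omega> \<in> space M" by simp
    obtain \<Delta> where err: "(norm_l2 (beta_ptl n K L (Bh \<omega>) (sample n X e b \<omega>) - b))\<^sup>2 \<le> 2 * (C1 * (t\<^sup>2 + \<rho>\<^sup>2)) + 2 * \<Delta>"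
      and D1: "\<Delta> \<le> 16 * (norm_l1 \<delta>)\<^sup>2"
      and D2: "m1 \<ge> 2 \<Longrightarrow> \<Delta> \<le> (3 * lam * norm_l1 \<delta> + 16 * D * (norm_l1 \<delta>)\<^sup>2) / (Cmin / 2)"
      and D3: "\<And>s. s \<ge> 1 \<Longrightarrow> m1 \<ge> 2 \<Longrightarrow> real (norm_l0 \<delta>) \<le> s \<Longrightarrow> 16 * s * D \<le> Cmin / 4 \<Longrightarrow>
        \<Delta> \<le> 36 * lam\<^sup>2 * s / (Cmin / 2)\<^sup>2"
      using ptl_error_bound[OF bspec[OF N(2) w] ws K cst(1,2) H0 t0(2,1) wCw order_trans[OF \<delta>h hH] orth BB rho m2 lam0 L b noise[unfolded C1_def]]
      unfolding C1_def D_def by blast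
    have n1: "norm_l1 \<delta> \<ge> 0" unfolding norm_l1_eq[OF \<delta>] by (simp add: sum_nonneg)
    have hh: "(norm_l1 \<delta>)\<^sup>2 \<le> h\<^sup>2" using n1 \<delta>h by (intro power_mono)
    have \<Delta>: "\<Delta> \<le> CD * mn"
    proof (cases "sdelta = 0")
      \<comment> \<open>Here \<delta> vanishes, and the bound through its l1 norm closes the case
        without a restricted eigenvalue.\<close>
      case True
      then have "card {j. j < p \<and> \<delta> $ j \<noteq> 0} = 0" using \<delta>s \<delta> by (simp add: norm_l0_def)
      then have "\<forall>j<p. \<delta> $ j = 0" by auto
      then have "norm_l1 \<delta> = 0" unfolding norm_l1_eq[OF \<delta>] by simp
      then have "\<Delta> \<le> 0" using D1 by simp
      moreover have "CD * mn \<ge> 0" using CD1 mn0 by simp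
      ultimately show ?thesis by linarith
    next
      case False
      note sp = sp[OF False]
      have D0: "D \<ge> 0" using sp(1) lp by (simp add: D_def)
      have a1: "\<Delta> \<le> CD * (real sdelta * r\<^sup>2)"
      proof -
        have "\<Delta> \<le> 36 * lam\<^sup>2 * real sdelta / (Cmin / 2)\<^sup>2"
          using False \<delta>s by (intro D3 sp) auto
        also have "\<dots> \<le> 36 * (cL * r)\<^sup>2 * real sdelta / (Cmin / 2)\<^sup>2"
          using lam0 lam(2) by (intro divide_right_mono mult_right_mono mult_left_mono power_mono) auto
        also have "\<dots> = 144 * cL\<^sup>2 / Cmin\<^sup>2 * (real sdelta * r\<^sup>2)"
          by (simp add: power_mult_distrib power_divide)
        also have "\<dots> \<le> CD * (real sdelta * r\<^sup>2)" by (intro mult_right_mono CD1) simp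
        finally show ?thesis .
      qed
      have a2: "\<Delta> \<le> CD * (h * r)"
      proof -
        have "3 * lam * norm_l1 \<delta> \<le> 3 * (cL * r) * h"
          using lam0 lam(2) n1 \<delta>h by (intro mult_mono mult_left_mono) auto
        moreover have "16 * D * (norm_l1 \<delta>)\<^sup>2 \<le> 16 * (48 * \<tau>\<^sup>2 / cg * r) * (H * h)"
        proof (intro mult_mono)
          \<comment> \<open>As l \<le> 1, the loss \<open>D\<close> of order l is at most of order
            sqrt l and hence of order r. Together with trading one factor \<open>h\<close> for the
            constant \<open>H\<close>, this turns the loss into a multiple of h r.\<close>
          have "l \<le> sqrt l"
          proof -
            have "sqrt l * sqrt l \<le> sqrt l * 1" using sp(5) l0 by (intro mult_left_mono) auto
            then show ?thesis using l0 by simp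
          qed
          then have "48 * \<tau>\<^sup>2 / cg * l \<le> 48 * \<tau>\<^sup>2 / cg * r" using rl cg_pos by (intro mult_left_mono) auto
          then show "D \<le> 48 * \<tau>\<^sup>2 / cg * r" using sp(3) by linarith
          have "h\<^sup>2 \<le> H * h" using hH h0 by (simp add: power2_eq_square mult_right_mono)
          then show "(norm_l1 \<delta>)\<^sup>2 \<le> H * h" using hh by linarith
        qed (use D0 r0 cg_pos in auto)
        ultimately have "3 * lam * norm_l1 \<delta> + 16 * D * (norm_l1 \<delta>)\<^sup>2 \<le> (3 * cL + 768 * \<tau>\<^sup>2 * H / cg) * (h * r)"
          by (simp add: algebra_simps)
        then have "(3 * lam * norm_l1 \<delta> + 16 * D * (norm_l1 \<delta>)\<^sup>2) / (Cmin / 2) \<le> (3 * cL + 768 * \<tau>\<^sup>2 * H / cg) * (h * r) / (Cmin / 2)"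
          using Cmin by (intro divide_right_mono) auto
        also have "\<dots> = 2 / Cmin * (3 * cL + 768 * \<tau>\<^sup>2 * H / cg) * (h * r)" by simp
        also have "\<dots> \<le> CD * (h * r)" using h0 r0 by (intro mult_right_mono CD1) auto
        finally show ?thesis using D2[OF sp(1)] by linarith
      qed
      have a3: "\<Delta> \<le> CD * h\<^sup>2"
      proof -
        have "16 * h\<^sup>2 \<le> CD * h\<^sup>2" by (intro mult_right_mono CD1) simp
        then show ?thesis using D1 hh by linarith
      qed
      show ?thesis using a1 a2 a3 unfolding mn_def by (auto simp: min_def)
    qed
    have "t\<^sup>2 + \<rho>\<^sup>2 \<le> (128 * \<tau>^4 + Cbar) * A"
    proof -
      have "128 * \<tau>^4 * ((real K + ln \<mu>) / real n) \<le> 128 * \<tau>^4 * A"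
        using s0 by (intro mult_left_mono) (auto simp: A_def)
      moreover have "Cbar * s_rate \<le> Cbar * A"
        using cst lmu by (intro mult_left_mono) (auto simp: A_def)
      ultimately show ?thesis unfolding t2 \<rho>2 by (simp add: distrib_right)
    qed
    then have "C1 * (t\<^sup>2 + \<rho>\<^sup>2) \<le> C1 * ((128 * \<tau>^4 + Cbar) * A)" by (rule mult_left_mono[OF _ C10])
    with err \<Delta> have "(norm_l2 (beta_ptl n K L (Bh \<omega>) (sample n X e b \<omega>) - b))\<^sup>2
        \<le> 2 * (C1 * (128 * \<tau>^4 + Cbar)) * A + 2 * CD * mn" by simp
    also have "\<dots> \<le> ?C * A + ?C * mn"
      unfolding C using A0 mn0 C10 CD1 cst by (intro add_mono mult_right_mono) auto
    finally show "\<omega> \<in> ?E" using ws by (simp add: rate distrib_left)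
  qed
  moreover have "?E \<in> events"
  proof (rule error_event)
    show "b \<in> carrier_vec p" using B w \<delta> by (simp add: b)
    show "L \<in> measurable (data_space p n) (borel_vec p)" using L by (simp add: is_lasso_def)
  qed
  ultimately have "prob (space M - N) \<le> prob ?E" by (intro finite_measure_mono)
  then show ?thesis using prob_compl[OF N(1)] PN' by linarith
qed

end

section \<open>From one sample size to the asymptotic statement\<close>

lemma eigen_bounded_gram:
  assumes B: "B \<in> carrier_mat p K" and K: "K \<ge> 1"
    and bd: "eigen_bounded Cmin Cmax (transpose_mat B * B)" and a: "a \<in> carrier_vec K"
  shows "Cmin * (a \<bullet> a) \<le> (B *\<^sub>v a) \<bullet> (B *\<^sub>v a) \<and> (B *\<^sub>v a) \<bullet> (B *\<^sub>v a) \<le> Cmax * (a \<bullet> a)"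
proof -
  let ?G = "transpose_mat B * B"
  have G: "?G \<in> carrier_mat K K" using B by simp
  have Bt: "transpose_mat B \<in> carrier_mat K p" using B by simp
  have Ba: "B *\<^sub>v a \<in> carrier_vec p" using B a by simp
  have TBa: "transpose_mat B *\<^sub>v (B *\<^sub>v a) \<in> carrier_vec K" using Bt Ba by simp
  have sym: "?G $$ (i, j) = ?G $$ (j, i)" if "i < K" "j < K" for i j
  proof -
    have "col B i \<in> carrier_vec p" "col B j \<in> carrier_vec p" using B by auto
    then show ?thesis using B that comm_scalar_prod[of "col B i" p "col B j"] by simp
  qed
  have "a \<bullet> (?G *\<^sub>v a) = a \<bullet> (transpose_mat B *\<^sub>v (B *\<^sub>v a))"
    by (simp only: assoc_mult_mat_vec[OF Bt B a])
  also have "\<dots> = (transpose_mat B *\<^sub>v (B *\<^sub>v a)) \<bullet> a" by (rule comm_scalar_prod[OF a TBa])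
  also have "\<dots> = (B *\<^sub>v a) \<bullet> (B *\<^sub>v a)" by (rule transpose_vec_mult_scalar[OF B a Ba])
  finally have "a \<bullet> (?G *\<^sub>v a) = (B *\<^sub>v a) \<bullet> (B *\<^sub>v a)" .
  then show ?thesis
    using eigen_bounded_quad_form[OF G K sym bd a] by simp
qed

theorem theorem1:
  fixes M :: "nat \<Rightarrow> 'a measure"
    and p K smax sdelta :: "nat \<Rightarrow> nat"
    and nk :: "nat \<Rightarrow> nat \<Rightarrow> nat"
    and h :: "nat \<Rightarrow> real"
    and X :: "nat \<Rightarrow> nat \<Rightarrow> 'a \<Rightarrow> rvec"
    and e :: "nat \<Rightarrow> nat \<Rightarrow> 'a \<Rightarrow> real"
    and Xs :: "nat \<Rightarrow> nat \<Rightarrow> nat \<Rightarrow> 'a \<Rightarrow> rvec"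
    and es :: "nat \<Rightarrow> nat \<Rightarrow> nat \<Rightarrow> 'a \<Rightarrow> real"
    and Sig :: "nat \<Rightarrow> rmat"
    and Sigs :: "nat \<Rightarrow> nat \<Rightarrow> rmat"
    and sd :: "nat \<Rightarrow> real"
    and sds :: "nat \<Rightarrow> nat \<Rightarrow> real"
    and est :: "nat \<Rightarrow> nat \<Rightarrow> dataset \<Rightarrow> rvec"
    and Cest Cest' :: "nat \<Rightarrow> real"
    and Cw Cpsi Cmin Cmax :: real
  assumes constants: "Cw > 0" "Cpsi > 0" "0 < Cmin" "Cmin < Cmax"
    and sizes: "\<And>n. n \<ge> 1 \<Longrightarrow> p n \<ge> 1" "\<And>n. n \<ge> 1 \<Longrightarrow> K n \<ge> 1"
      "\<And>n k. n \<ge> 1 \<Longrightarrow> k < K n \<Longrightarrow> nk n k \<ge> 1"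
    and prob: "\<And>n. n \<ge> 1 \<Longrightarrow> prob_space (M n)"
    and target: "\<And>n. n \<ge> 1 \<Longrightarrow> design_noise (M n) (p n) n (X n) (e n) (Sig n) (sd n)"
    and sources: "\<And>n k. n \<ge> 1 \<Longrightarrow> k < K n \<Longrightarrow>
      design_noise (M n) (p n) (nk n k) (Xs n k) (es n k) (Sigs n k) (sds n k)"
    and indep: "\<And>n. n \<ge> 1 \<Longrightarrow>
      sources_indep_target (M n) (p n) (K n) (nk n) n (Xs n) (es n) (X n) (e n)"
    and estimators: "\<And>n k. n \<ge> 1 \<Longrightarrow> k < K n \<Longrightarrow>
      est n k \<in> measurable (data_space (p n) (nk n k)) (borel_vec (p n))"
    and a_constants: "\<And>k. Cest k > 0" "\<And>k. Cest' k > 0"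
    and a: "\<And>n k B b. n \<ge> 1 \<Longrightarrow> k < K n \<Longrightarrow>
      (B, b) \<in> Theta_reg (p n) (K n) (Sig n) Cw Cmin Cmax (smax n) (sdelta n) (h n) \<Longrightarrow>
      measure (M n) {\<omega> \<in> space (M n).
        (norm_l2 (est n k (sample (nk n k) (Xs n k) (es n k) (col B k) \<omega>) - col B k))\<^sup>2
          \<le> Cest k * real (smax n) * ln (real (p n)) / real (nk n k)}
      \<ge> 1 - 2 * exp (- Cest' k * ln (real (p n)))"
    and a_uniform: "bdd_above (range Cest)"
      "\<exists>c>0. \<forall>\<^sub>F n in sequentially.
        (\<Sum>k<K n. 2 * exp (- Cest' k * ln (real (p n)))) \<le> exp (- c * ln (real (min (p n) n)))"
    and b: "(\<lambda>n. source_rate (p n) (K n) (nk n) (smax n)) \<in> o(\<lambda>_. 1)"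
      "(\<lambda>n. real (sdelta n) * ln (real (p n)) / real n) \<in> o(\<lambda>_. 1)"
      "(\<lambda>n. real (K n)) \<in> o(\<lambda>n. real (min n (p n)))"
      "h \<in> O(\<lambda>_. 1)"
    and c: "\<And>n i. n \<ge> 1 \<Longrightarrow> i < n \<Longrightarrow> psi2_norm_vec (M n) (p n) (X n i) \<le> ennreal Cpsi"
      "\<And>n i. n \<ge> 1 \<Longrightarrow> i < n \<Longrightarrow> psi2_norm (M n) (e n i) \<le> ennreal Cpsi"
    and d: "\<And>n. n \<ge> 1 \<Longrightarrow> eigen_bounded Cmin Cmax (Sig n)"
  shows "\<exists>Clam>0. \<forall>lam L.
    (\<forall>n\<ge>1. lam n \<ge> Clam * r_rate (p n) n (K n) (nk n) (smax n)) \<and>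
    lam \<in> O(\<lambda>n. r_rate (p n) n (K n) (nk n) (smax n)) \<and>
    (\<forall>n\<ge>1. is_lasso (p n) n (lam n) (L n)) \<longrightarrow>
    (\<exists>C>0. \<exists>C1>0. \<forall>\<^sub>F n in sequentially.
      (INF (B, b) \<in> Theta_reg (p n) (K n) (Sig n) Cw Cmin Cmax (smax n) (sdelta n) (h n).
        ereal (measure (M n) {\<omega> \<in> space (M n).
        (norm_l2 (beta_ptl n (K n) (L n)
            (B_hat (p n) (K n) (est n) (\<lambda>k. sample (nk n k) (Xs n k) (es n k) (col B k) \<omega>))
            (sample n (X n) (e n) b \<omega>) - b))\<^sup>2
          \<le> C * ptl_rate (p n) n (K n) (nk n) (smax n) (sdelta n) (h n)}))
      \<ge> ereal (1 - exp (- C1 * ln (real (min (p n) n)))))"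
proof -
  \<comment> \<open>The factor 2 is the doubling in \<open>psi2_norm_le_imp\<close>.\<close>
  define \<tau> where "\<tau> = 2 * Cpsi"
  have \<tau>: "\<tau> > 0" using constants by (simp add: \<tau>_def)
  obtain U where U: "\<And>k. Cest k \<le> U" using a_uniform(1) by (auto simp: bdd_above_def)
  \<comment> \<open>One constant for all sources at all sample sizes; the maximum with 1 makes it
    positive.\<close>
  define Cbar where "Cbar = max U 1"
  have Cbar: "Cbar > 0" "\<And>k. Cest k \<le> Cbar" using U by (auto simp: Cbar_def le_max_iff_disj)
  obtain H where H: "H > 0" "\<forall>\<^sub>F n in sequentially. norm (h n) \<le> H * norm (1 :: real)"
    using landau_o.bigE[OF b(4)] by blast
  \<comment> \<open>The value of \<open>cg\<close>. It depends on no sample size and is named here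
    because the smallness thresholds are chosen before the locale is interpreted.\<close>
  define g where "g = (min (Cmin / 2) (8 * \<tau>\<^sup>2))\<^sup>2 / (32 * \<tau>^4)"
  have g: "g > 0" unfolding g_def using constants \<tau> by (intro divide_pos_pos) (auto simp: min_def)
  have gc: "gram_const Cmin > 0" using constants by (simp add: gram_const_def)
  define \<kappa> where "\<kappa> = nat \<lceil>6 * \<tau>\<^sup>2 * Cmax / gram_const Cmin\<rceil> + 1"
  have \<kappa>: "\<kappa> \<ge> 1" "6 * \<tau>\<^sup>2 * Cmax \<le> gram_const Cmin * real \<kappa>"
  proof -
    show "\<kappa> \<ge> 1" by (simp add: \<kappa>_def)
    have "6 * \<tau>\<^sup>2 * Cmax / gram_const Cmin \<le> real \<kappa>" unfolding \<kappa>_def by linarith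
    then show "6 * \<tau>\<^sup>2 * Cmax \<le> gram_const Cmin * real \<kappa>" using gc by (simp add: pos_divide_le_eq mult.commute)
  qed
  define k0 where "k0 = real \<kappa> * ln 2 + ln 3"
  have k0: "k0 > 0" unfolding k0_def by (intro add_nonneg_pos mult_nonneg_nonneg) auto
  let ?Clam = "lasso_level_const Cmin Cmax Cw H \<tau> Cbar"
  have pc: "profile_const Cmin Cmax Cw H \<tau> \<ge> 0" using constants H by (intro profile_const_nonneg) auto
  have Clam: "?Clam > 0"
  proof -
    have sq: "0 \<le> sqrt (2 * \<tau>\<^sup>2 * profile_const Cmin Cmax Cw H \<tau> * (128 * \<tau>^4 + Cbar + 1))"
      using pc Cbar(1) by (intro real_sqrt_ge_zero mult_nonneg_nonneg) auto
    have "0 < 8 * \<tau>\<^sup>2" using \<tau> by simp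
    from add_pos_nonneg[OF this sq] show ?thesis
      unfolding lasso_level_const_def by (rule mult_pos_pos[rotated]) simp
  qed
  show ?thesis
  proof (rule exI[of _ ?Clam], intro conjI allI impI)
    show "?Clam > 0" by (rule Clam)
  next
    fix lam :: "nat \<Rightarrow> real" and L :: "nat \<Rightarrow> dataset \<Rightarrow> rvec"
    assume "(\<forall>n\<ge>1. lam n \<ge> ?Clam * r_rate (p n) n (K n) (nk n) (smax n)) \<and>
      lam \<in> O(\<lambda>n. r_rate (p n) n (K n) (nk n) (smax n)) \<and>
      (\<forall>n\<ge>1. is_lasso (p n) n (lam n) (L n))"
    then have lam: "\<And>n. n \<ge> 1 \<Longrightarrow> ?Clam * r_rate (p n) n (K n) (nk n) (smax n) \<le> lam n"
      and lamO: "lam \<in> O(\<lambda>n. r_rate (p n) n (K n) (nk n) (smax n))"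
      and L: "\<And>n. n \<ge> 1 \<Longrightarrow> is_lasso (p n) n (lam n) (L n)" by auto
    obtain cL where cL: "cL > 0"
      "\<forall>\<^sub>F n in sequentially. norm (lam n) \<le> cL * norm (r_rate (p n) n (K n) (nk n) (smax n))"
      using landau_o.bigE[OF lamO] by blast
    obtain c0 where c0: "c0 > 0" "\<forall>\<^sub>F n in sequentially.
        (\<Sum>k<K n. 2 * exp (- Cest' k * ln (real (p n)))) \<le> exp (- c0 * ln (real (min (p n) n)))"
      using a_uniform(2) by blast
    \<comment> \<open>Half of the smaller exponent: the other half absorbs the factor 21 = 20 + 1
      once \<mu> is large.\<close>
    define C1 where "C1 = min c0 1 / 2"
    have C1: "C1 > 0" "2 * C1 \<le> c0" "2 * C1 \<le> 1" using c0(1) by (auto simp: C1_def)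
    let ?C = "ptl_const Cmin Cmax Cw H \<tau> Cbar cL g"
    have C: "?C > 0"
      unfolding ptl_const_def using constants pc Cbar(1) cL(1) H(1) g
      by (intro add_nonneg_pos mult_nonneg_nonneg mult_pos_pos add_nonneg_nonneg) auto
    \<comment> \<open>\<epsilon>1 bounds K / n and \<epsilon>2 bounds ln n / n. Twice 1/4 gives 1/2,
      and 128 \<tau>^4 times 2 / (512 \<tau>^4) gives 1/2 again; g / (2 k0) and g / 2 pay for the
      Gram lattice count and for ln n out of half of the exponent n g. \<epsilon>3 serves the source
      rate and \<epsilon>4 is the condition of \<open>sparsity_level\<close>.\<close>
    define \<epsilon>1 where "\<epsilon>1 = min (1 / 4) (min (1 / (512 * \<tau>^4)) (g / (2 * k0)))"
    define \<epsilon>2 where "\<epsilon>2 = min (1 / 4) (min (1 / (512 * \<tau>^4)) (g / 2))"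
    define \<epsilon>3 where "\<epsilon>3 = min (Cmin / (4 * Cbar)) (1 / (2 * Cbar))"
    define \<epsilon>4 where "\<epsilon>4 = min 1 (min (g / 24) (Cmin * g / (3072 * \<tau>\<^sup>2)))"
    \<comment> \<open>From exp (ln 21 / C1) on, exp (C1 ln \<mu>) is at least 21; the 2 forces p
      \<ge> 2 and thereby ln p > 0.\<close>
    define \<mu>0 where "\<mu>0 = max 2 (exp (ln 21 / C1))"
    have \<epsilon>1: "\<epsilon>1 > 0" using \<tau> g k0 by (simp add: \<epsilon>1_def)
    have \<epsilon>2: "\<epsilon>2 > 0" using \<tau> g by (simp add: \<epsilon>2_def)
    have \<epsilon>3: "\<epsilon>3 > 0" using constants Cbar by (simp add: \<epsilon>3_def)
    have \<epsilon>4: "\<epsilon>4 > 0" using constants g \<tau> by (simp add: \<epsilon>4_def)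
    have \<mu>0: "\<mu>0 > 0" by (simp add: \<mu>0_def)
    have ev_ln: "\<forall>\<^sub>F n in sequentially. ln (real n) / real n < \<epsilon>2"
      using order_tendstoD(2)[OF lim_ln_over_n \<epsilon>2] by simp
    note ev_K = landau_o.smallD[OF b(3) \<epsilon>1]
    \<comment> \<open>The growth of min p n comes from here: K \<ge> 1 and K \<le> \<mu> / \<mu>0
      together give \<mu> \<ge> \<mu>0.\<close>
    have "1 / \<mu>0 > 0" using \<mu>0 by simp
    note ev_mu = landau_o.smallD[OF b(3) this]
    note ev_s = landau_o.smallD[OF b(1) \<epsilon>3]
    note ev_sd = landau_o.smallD[OF b(2) \<epsilon>4]
    have "\<forall>\<^sub>F n in sequentially.
      (INF (B, b) \<in> Theta_reg (p n) (K n) (Sig n) Cw Cmin Cmax (smax n) (sdelta n) (h n).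
        ereal (measure (M n) {\<omega> \<in> space (M n).
        (norm_l2 (beta_ptl n (K n) (L n)
            (B_hat (p n) (K n) (est n) (\<lambda>k. sample (nk n k) (Xs n k) (es n k) (col B k) \<omega>))
            (sample n (X n) (e n) b \<omega>) - b))\<^sup>2
          \<le> ?C * ptl_rate (p n) n (K n) (nk n) (smax n) (sdelta n) (h n)}))
      \<ge> ereal (1 - exp (- C1 * ln (real (min (p n) n))))"
      using eventually_ge_at_top[of "1::nat"] H(2) cL(2) c0(2) ev_ln ev_K ev_mu ev_s ev_sd
    proof eventually_elim
      case (elim n)
      define \<mu> where "\<mu> = real (min (p n) n)"
      have n: "n \<ge> 1" "real n > 0" using elim by auto
      have pn: "p n \<ge> 1" and Kn: "K n \<ge> 1" using sizes n by auto
      have lp: "ln (real (p n)) \<ge> 0" using pn by simp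
      have minmu: "real (min n (p n)) = \<mu>" by (simp add: \<mu>_def min.commute)
      have absmu: "\<bar>\<mu>\<bar> = \<mu>" by (simp add: \<mu>_def)
      have K1: "real (K n) \<le> \<epsilon>1 * \<mu>" using elim(6) by (simp add: minmu absmu)
      have "real (K n) \<le> 1 / \<mu>0 * \<mu>" using elim(7) by (simp add: minmu absmu)
      then have "1 \<le> 1 / \<mu>0 * \<mu>" using Kn by linarith
      then have mu0: "\<mu>0 \<le> \<mu>" using \<mu>0 by (simp add: field_simps)
      then have mu2: "\<mu> \<ge> 2" and mu21: "exp (ln 21 / C1) \<le> \<mu>" by (simp_all add: \<mu>0_def)
      have mun: "\<mu> \<le> real n" "\<mu> \<le> real (p n)" by (auto simp: \<mu>_def)
      have p2: "p n \<ge> 2" using mu2 mun by linarith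
      have lmu: "0 \<le> ln \<mu>" "ln \<mu> \<le> ln (real n)" using mu2 mun by auto
      have KE: "real (K n) \<le> \<epsilon>1 * real n"
        using order_trans[OF K1 mult_left_mono[OF mun(1)]] \<epsilon>1 by simp
      have lnE: "ln (real n) \<le> \<epsilon>2 * real n" using elim(5) n by (simp add: pos_divide_less_eq)
      have Kdiv: "(real (K n) + ln \<mu>) / real n \<le> \<epsilon>1 + \<epsilon>2"
        using KE lnE lmu n by (simp add: pos_divide_le_eq distrib_right)
      have e12: "\<epsilon>1 \<le> 1 / 4" "\<epsilon>1 \<le> 1 / (512 * \<tau>^4)" "\<epsilon>1 \<le> g / (2 * k0)"
        "\<epsilon>2 \<le> 1 / 4" "\<epsilon>2 \<le> 1 / (512 * \<tau>^4)" "\<epsilon>2 \<le> g / 2"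
        by (simp_all add: \<epsilon>1_def \<epsilon>2_def)
      have s0: "source_rate (p n) (K n) (nk n) (smax n) \<ge> 0"
        unfolding source_rate_def using lp by (intro sum_nonneg) simp
      have sE: "source_rate (p n) (K n) (nk n) (smax n) \<le> \<epsilon>3" using elim(8) s0 by simp
      have hH: "h n \<le> H" using elim(2) by simp
      have sdE: "real (sdelta n) * ln (real (p n)) / real n \<le> \<epsilon>4"
        using elim(9) lp by simp
      have r0: "r_rate (p n) n (K n) (nk n) (smax n) \<ge> 0"
        unfolding r_rate_def using s0 lp by simp
      have lam_le: "lam n \<le> cL * r_rate (p n) n (K n) (nk n) (smax n)" using elim(3) r0 by simp
      have cond1: "(real (K n) + ln \<mu>) / real n \<le> 1 / 2" using Kdiv e12 by linarith
      have cond2: "128 * \<tau>^4 * ((real (K n) + ln \<mu>) / real n) \<le> 1 / 2"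
      proof -
        have "(real (K n) + ln \<mu>) / real n \<le> 1 / (512 * \<tau>^4) + 1 / (512 * \<tau>^4)" using Kdiv e12 by linarith
        then have "128 * \<tau>^4 * ((real (K n) + ln \<mu>) / real n) \<le> 128 * \<tau>^4 * (1 / (512 * \<tau>^4) + 1 / (512 * \<tau>^4))"
          by (intro mult_left_mono) auto
        then show ?thesis using \<tau> by simp
      qed
      have cond3: "real (K n) \<le> real n"
        using KE mult_right_mono[OF e12(1), of "real n"] n by linarith
      have cond4: "real (K n) * (real \<kappa> * ln 2 + ln 3) \<le> real n * g / 2"
      proof -
        have "real (K n) * k0 \<le> (\<epsilon>1 * real n) * k0" using KE k0 by (intro mult_right_mono) auto
        also have "\<dots> \<le> (g / (2 * k0) * real n) * k0" using e12 k0 by (intro mult_right_mono) auto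
        also have "\<dots> = real n * g / 2" using k0 by simp
        finally show ?thesis by (simp add: k0_def)
      qed
      have cond5: "2 * ln (real n) \<le> real n" using lnE mult_right_mono[OF e12(4), of "real n"] n by linarith
      have cond6: "ln (real n) \<le> real n * g / 2"
      proof -
        have "\<epsilon>2 * real n \<le> g / 2 * real n" using e12 by (intro mult_right_mono) auto
        then show ?thesis using lnE by (simp add: mult.commute)
      qed
      have cond7: "Cbar * source_rate (p n) (K n) (nk n) (smax n) \<le> Cmin / 4"
        "Cbar * source_rate (p n) (K n) (nk n) (smax n) \<le> 1 / 2"
      proof -
        have "Cbar * source_rate (p n) (K n) (nk n) (smax n) \<le> Cbar * \<epsilon>3" using sE Cbar by (intro mult_left_mono) auto
        moreover have "Cbar * \<epsilon>3 \<le> Cbar * (Cmin / (4 * Cbar))" "Cbar * \<epsilon>3 \<le> Cbar * (1 / (2 * Cbar))"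
          using Cbar(1) by (intro mult_left_mono; simp add: \<epsilon>3_def)+
        moreover have "Cbar * (Cmin / (4 * Cbar)) = Cmin / 4" "Cbar * (1 / (2 * Cbar)) = 1 / 2" using Cbar(1) by simp_all
        ultimately show "Cbar * source_rate (p n) (K n) (nk n) (smax n) \<le> Cmin / 4"
          "Cbar * source_rate (p n) (K n) (nk n) (smax n) \<le> 1 / 2" by linarith+
      qed
      have tail: "20 * exp (- ln \<mu>) + exp (- c0 * ln \<mu>) \<le> exp (- C1 * ln \<mu>)"
      proof -
        have "ln 21 / C1 \<le> ln \<mu>" using mu21 mu2 by (subst ln_ge_iff) auto
        then have "ln 21 \<le> C1 * ln \<mu>" using C1 by (simp add: pos_divide_le_eq mult.commute)
        then have "exp (ln 21) \<le> exp (C1 * ln \<mu>)" by (simp only: exp_le_cancel_iff)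
        then have 21: "21 \<le> exp (C1 * ln \<mu>)" by simp
        have "2 * C1 * ln \<mu> \<le> c0 * ln \<mu>" "2 * C1 * ln \<mu> \<le> 1 * ln \<mu>"
          using C1 lmu by (intro mult_right_mono; simp)+
        then have "exp (- c0 * ln \<mu>) \<le> exp (- 2 * C1 * ln \<mu>)" "exp (- ln \<mu>) \<le> exp (- 2 * C1 * ln \<mu>)" by simp_all
        then have "20 * exp (- ln \<mu>) + exp (- c0 * ln \<mu>) \<le> 21 * exp (- 2 * C1 * ln \<mu>)" by linarith
        also have "\<dots> \<le> exp (C1 * ln \<mu>) * exp (- 2 * C1 * ln \<mu>)" using 21 by (intro mult_right_mono) auto
        also have "\<dots> = exp (- C1 * ln \<mu>)" by (simp flip: exp_add)
        finally show ?thesis .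
      qed
      interpret PM: prob_space "M n" by (rule prob[OF n(1)])
      have model: "design_noise (M n) (p n) n (X n) (e n) (Sig n) (sd n)" by (rule target[OF n(1)])
      interpret T: target_sample "M n" "p n" n "X n" "e n" "Sig n" "sd n" \<tau>
      proof
        show "design_noise (M n) (p n) n (X n) (e n) (Sig n) (sd n)" by (rule model)
        show "0 < \<tau>" by (rule \<tau>)
        fix i assume i: "i < n"
        have Xi: "X n i \<in> measurable (M n) (borel_vec (p n))" using model i by (simp add: design_noise_def indep_rv_def)
        show "(\<integral>\<^sup>+\<omega>. exp ((u \<bullet> X n i \<omega>)\<^sup>2 / (\<tau> * norm_l2 u)\<^sup>2) \<partial>M n) \<le> ennreal 2"
          if u: "u \<in> carrier_vec (p n)" "norm_l2 u \<noteq> 0" for u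
          unfolding \<tau>_def
          by (rule psi2_norm_vec_le_imp[OF c(1)[OF n(1) i] constants(2) u borel_vec_carrier[OF Xi]])
        show "(\<integral>\<^sup>+\<omega>. exp ((e n i \<omega>)\<^sup>2 / \<tau>\<^sup>2) \<partial>M n) \<le> ennreal 2"
          unfolding \<tau>_def by (rule psi2_norm_le_imp[OF c(2)[OF n(1) i] constants(2)])
      qed
      have n0: "0 < n" using n by simp
      \<comment> \<open>The threshold on \<open>n\<close> is fixed before the parameter, so the
        bound is uniform in it; the decomposition into \<open>w\<close> and \<delta> is chosen for
        each parameter afterwards. Over an empty parameter set the infimum of extended reals is
        infinite and the claim holds.\<close>
      show ?case
      proof (rule INF_greatest)
        fix \<theta> assume \<theta>: "\<theta> \<in> Theta_reg (p n) (K n) (Sig n) Cw Cmin Cmax (smax n) (sdelta n) (h n)"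
        obtain B b where Bb: "\<theta> = (B, b)" by (cases \<theta>)
        have BT: "(B, b) \<in> Theta_reg (p n) (K n) (Sig n) Cw Cmin Cmax (smax n) (sdelta n) (h n)" using \<theta> Bb by simp
        then have B: "B \<in> carrier_mat (p n) (K n)" and eb: "eigen_bounded Cmin Cmax (transpose_mat B * B)"
          by (auto simp: Theta_reg_def Theta_def)
        obtain w \<delta> where w: "w \<in> carrier_vec (K n)" "norm_l2 w \<le> Cw" and \<delta>: "\<delta> \<in> carrier_vec (p n)"
          "norm_l1 \<delta> \<le> h n" "norm_l0 \<delta> \<le> sdelta n" and b: "b = B *\<^sub>v w + \<delta>"
          and orth: "\<And>k. k < K n \<Longrightarrow> col B k \<bullet> (Sig n *\<^sub>v \<delta>) = 0"
          using BT by (auto simp: Theta_reg_def Theta_def)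
        interpret I: ptl_model "M n" "p n" n "X n" "e n" "Sig n" "sd n" \<tau> "K n" "nk n" "Xs n" "es n" "est n" B w \<delta> Cmin Cmax
        proof
          show "0 < n" by (rule n0)
          show "0 < p n" using pn by simp
          show "B \<in> carrier_mat (p n) (K n)" "w \<in> carrier_vec (K n)" "\<delta> \<in> carrier_vec (p n)" by fact+
          show "Xs n k i \<in> measurable (M n) (borel_vec (p n))" "es n k i \<in> borel_measurable (M n)"
            if "k < K n" "i < nk n k" for k i
            using sources[OF n(1) that(1)] that(2) by (simp_all add: design_noise_def indep_rv_def)
          show "est n k \<in> measurable (data_space (p n) (nk n k)) (borel_vec (p n))" if "k < K n" for k
            by (rule estimators[OF n(1) that])
          show "sources_indep_target (M n) (p n) (K n) (nk n) n (Xs n) (es n) (X n) (e n)" by (rule indep[OF n(1)])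
          show "0 < Cmin" by (rule constants)
          show "Cmin * (y \<bullet> y) \<le> y \<bullet> (Sig n *\<^sub>v y) \<and> y \<bullet> (Sig n *\<^sub>v y) \<le> Cmax * (y \<bullet> y)"
            if y: "y \<in> carrier_vec (p n)" for y
            using eigen_bounded_quad_form[OF T.S_carrier[OF n0] pn T.S_sym[OF n0] d[OF n(1)] y] by blast
        qed
        have cg: "I.cg = g" by (simp add: I.cg_def g_def)
        define qk where "qk k = 2 * exp (- Cest' k * ln (real (p n)))" for k
        let ?E = "{\<omega> \<in> space (M n). (norm_l2 (beta_ptl n (K n) (L n) (I.Bh \<omega>) (sample n (X n) (e n) b \<omega>) - b))\<^sup>2
          \<le> ?C * ptl_rate (p n) n (K n) (nk n) (smax n) (sdelta n) (h n)}"
        have "measure (M n) ?E \<ge> 1 - (20 * exp (- ln (real (min (p n) n))) + (\<Sum>k<K n. qk k))"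
          unfolding cg[symmetric]
        proof (rule I.ptl_error_prob[where Ce = Cest and \<kappa> = \<kappa> and H = H and lam = "lam n"])
          show "1 - qk k \<le> measure (M n) {\<omega> \<in> space (M n). (norm_l2 (col (I.Bh \<omega>) k - col B k))\<^sup>2
              \<le> Cest k * real (smax n) * ln (real (p n)) / real (nk n k)}" if k: "k < K n" for k
          proof -
            have "{\<omega> \<in> space (M n). (norm_l2 (col (I.Bh \<omega>) k - col B k))\<^sup>2
                \<le> Cest k * real (smax n) * ln (real (p n)) / real (nk n k)}
              = {\<omega> \<in> space (M n). (norm_l2 (est n k (sample (nk n k) (Xs n k) (es n k) (col B k) \<omega>) - col B k))\<^sup>2
                \<le> Cest k * real (smax n) * ln (real (p n)) / real (nk n k)}"
              by (intro Collect_cong conj_cong refl) (simp add: I.col_Bh[OF k])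
            then show ?thesis using a[OF n(1) k BT] by (simp add: qk_def)
          qed
          show "Cmin * (v \<bullet> v) \<le> (B *\<^sub>v v) \<bullet> (B *\<^sub>v v) \<and> (B *\<^sub>v v) \<bullet> (B *\<^sub>v v) \<le> Cmax * (v \<bullet> v)"
            if "v \<in> carrier_vec (K n)" for v
            by (rule eigen_bounded_gram[OF B Kn eb that])
          show "?Clam * r_rate (p n) n (K n) (nk n) (smax n) \<le> lam n" by (rule lam[OF n(1)])
          show "is_lasso (p n) n (lam n) (L n)" by (rule L[OF n(1)])
          show "real (sdelta n) * ln (real (p n)) / real n \<le> min 1 (min (I.cg / 24) (Cmin * I.cg / (3072 * \<tau>\<^sup>2)))"
            using sdE by (simp add: cg \<epsilon>4_def)
        qed (use Kn p2 constants Cbar cL(1) w \<delta> hH orth cond1 cond2 cond3 cond4 cond5 cond6 cond7 \<kappa> lam_le b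
              in \<open>simp_all add: cg \<mu>_def\<close>)
        moreover have "(\<Sum>k<K n. qk k) \<le> exp (- c0 * ln \<mu>)" using elim(4) by (simp add: qk_def \<mu>_def)
        ultimately have "measure (M n) ?E \<ge> 1 - exp (- C1 * ln (real (min (p n) n)))"
          using tail by (simp add: \<mu>_def)
        then show "ereal (1 - exp (- C1 * ln (real (min (p n) n)))) \<le> (case \<theta> of (B, b) \<Rightarrow>
          ereal (measure (M n) {\<omega> \<in> space (M n).
          (norm_l2 (beta_ptl n (K n) (L n)
            (B_hat (p n) (K n) (est n) (\<lambda>k. sample (nk n k) (Xs n k) (es n k) (col B k) \<omega>))
            (sample n (X n) (e n) b \<omega>) - b))\<^sup>2
          \<le> ?C * ptl_rate (p n) n (K n) (nk n) (smax n) (sdelta n) (h n)}))"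
          by (simp add: Bb I.Bh_def)
      qed
    qed
    then show "\<exists>C>0. \<exists>C1>0. \<forall>\<^sub>F n in sequentially.
      (INF (B, b) \<in> Theta_reg (p n) (K n) (Sig n) Cw Cmin Cmax (smax n) (sdelta n) (h n).
        ereal (measure (M n) {\<omega> \<in> space (M n).
        (norm_l2 (beta_ptl n (K n) (L n)
            (B_hat (p n) (K n) (est n) (\<lambda>k. sample (nk n k) (Xs n k) (es n k) (col B k) \<omega>))
            (sample n (X n) (e n) b \<omega>) - b))\<^sup>2
          \<le> C * ptl_rate (p n) n (K n) (nk n) (smax n) (sdelta n) (h n)}))
      \<ge> ereal (1 - exp (- C1 * ln (real (min (p n) n))))"
      using C C1(1) by blast
  qed
qed

end
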